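(* Let $n,d$ be positive integers. Let $Y\in\mathbb{R}^d$ be a random vector with i.i.d. entries from a probability distribution $\nu$ on $\mathbb{R}$ (having a density) with zero mean, unit variance, and spectral gap $c\in(0,1]$. Let $A\in\mathbb{R}^{n\times d}$ be a matrix such that $AA^{\top}=\mathrm{I}_n$. Let $$\epsilon=\max_{i\in[d]}(A^{\top}A)_{i,i}\qquad\text{and}\qquad \zeta=\max_{i,j\in[d],\,i\neq j}|(A^{\top}A)_{i,j}| .$$ Then $$\mathrm{Ent}(AY\,\Vert\,\gamma_n)\le n\,\min\!\left(\frac{2(\epsilon+\zeta^2 d)}{c},\,1\right)\mathrm{Ent}(\nu\,\Vert\,\gamma_1).$$
   Context: $[d]=\{1,\dots,d\}$, $\mathrm{I}_n$ is the $n\times n$ identity matrix, and $\gamma_n$ is the standard Gaussian measure on $\mathbb{R}^n$. (If $d=1$, the maximum over the empty set defining $\zeta$ is $0$.) The relative entropy of a probability measure $\lambda$ with density $f$ with respect to a probability measure $\rho$ with density $g$ (densities with respect to Lebesgue measure) is $\mathrm{Ent}(\lambda\Vert\rho)=\int f(x)\log\frac{f(x)}{g(x)}\,dx$ (possibly $+\infty$). For a random variable $Z$ with law $\lambda$, $\mathrm{Ent}(Z\Vert\rho)$ means $\mathrm{Ent}(\lambda\Vert\rho)$. A probability measure $\nu$ on $\mathbb{R}$ is said to have spectral gap $c$ if for all smooth functions $g$ with $\mathbb{E}_{\nu}(g)=0$ one has $\mathbb{E}_{\nu}(g^2)\le\frac1c\,\mathbb{E}_{\nu}\big((g')^2\big)$.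 *)

theory Defs
  imports "HOL-Probability.Probability"
begin

definition has_lebesgue_density :: "'a::euclidean_space measure \<Rightarrow> bool" where
  "has_lebesgue_density \<nu> \<longleftrightarrow> (\<exists>f \<in> borel_measurable borel. \<nu> = density lborel f)"

text \<open>
  The standard Gaussian measure on an arbitrary Euclidean space; it serves both for
  \<^typ>\<open>real\<close> and for \<^typ>\<open>real ^ 'n\<close>.
\<close>

definition std_gaussian :: "'a::euclidean_space measure" where
  "std_gaussian = density lborel
     (\<lambda>x. ennreal (exp (- (norm x)\<^sup>2 / 2) / sqrt ((2 * pi) ^ DIM('a))))"

lemma std_gaussian_real: "(std_gaussian :: real measure) = density lborel std_normal_density"
  by (simp add: std_gaussian_def std_normal_density_def)

text \<open>
  Integrals with values in \<^typ>\<open>ereal\<close>: positive part minus negative part. Since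
  \<^term>\<open>\<infinity> - \<infinity> = (\<infinity> :: ereal)\<close>, this is the usual integral only if one of the two parts
  has a finite integral. For the relative entropy of probability measures the negative part
  always does, because \<open>t ln t \<ge> - 1 / e\<close>.
\<close>

definition ereal_integral :: "'a measure \<Rightarrow> ('a \<Rightarrow> ereal) \<Rightarrow> ereal" where
  "ereal_integral M h =
     enn2ereal (\<integral>\<^sup>+ x. e2ennreal (h x) \<partial>M) - enn2ereal (\<integral>\<^sup>+ x. e2ennreal (- h x) \<partial>M)"

text \<open>The function \<open>a ln (a / b)\<close>, with the conventions \<open>0 ln (0 / b) = 0\<close> and
  \<open>a ln (a / 0) = \<infinity>\<close> for \<open>a > 0\<close>.\<close>

definition entropy_integrand :: "real \<Rightarrow> real \<Rightarrow> ereal" where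
  "entropy_integrand a b =
     (if a = 0 then 0 else if b = 0 then \<infinity> else ereal (a * ln (a / b)))"

text \<open>
  The relative entropy can be \<open>\<infinity>\<close>, so the real-valued \<^const>\<open>KL_divergence\<close>, which is \<open>0\<close>
  for a non-integrable integrand, is not usable. Measures without a
  Lebesgue density are assigned the value \<open>\<infinity>\<close>, so that an upper bound on the relative
  entropy is never satisfied vacuously.
\<close>

definition relative_entropy :: "'a::euclidean_space measure \<Rightarrow> 'a measure \<Rightarrow> ereal" where
  "relative_entropy \<mu> \<rho> =
     (if has_lebesgue_density \<mu> \<and> has_lebesgue_density \<rho>
      then ereal_integral lborel
        (\<lambda>x. entropy_integrand (enn2real (RN_deriv lborel \<mu> x)) (enn2real (RN_deriv lborel \<rho> x)))
      else \<infinity>)"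

lemma relative_entropy_density:
  fixes f g :: "'a::euclidean_space \<Rightarrow> real"
  assumes [measurable]: "f \<in> borel_measurable borel" "g \<in> borel_measurable borel"
    and nonneg: "\<And>x. 0 \<le> f x" "\<And>x. 0 \<le> g x"
  shows "relative_entropy (density lborel f) (density lborel g) =
    ereal_integral lborel (\<lambda>x. entropy_integrand (f x) (g x))"
proof -
  let ?f = "\<lambda>x. enn2real (RN_deriv lborel (density lborel f) x)"
  let ?g = "\<lambda>x. enn2real (RN_deriv lborel (density lborel g) x)"
  have dens: "has_lebesgue_density (density lborel f)" "has_lebesgue_density (density lborel g)"
    unfolding has_lebesgue_density_def
    by (rule bexI[where x = "\<lambda>x. ennreal (f x)"] bexI[where x = "\<lambda>x. ennreal (g x)"]; simp)+
  have "AE x in lborel. ennreal (f x) = RN_deriv lborel (density lborel f) x"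
    by (rule sigma_finite_measure.RN_deriv_unique[OF sigma_finite_lborel]) auto
  then have f: "AE x in lborel. ?f x = f x"
    by eventually_elim (metis enn2real_ennreal nonneg(1))
  have "AE x in lborel. ennreal (g x) = RN_deriv lborel (density lborel g) x"
    by (rule sigma_finite_measure.RN_deriv_unique[OF sigma_finite_lborel]) auto
  then have g: "AE x in lborel. ?g x = g x"
    by eventually_elim (metis enn2real_ennreal nonneg(2))
  from f g have fg: "AE x in lborel. ?f x = f x \<and> ?g x = g x"
    by eventually_elim simp
  have "(\<integral>\<^sup>+ x. e2ennreal (entropy_integrand (?f x) (?g x)) \<partial>lborel) =
      (\<integral>\<^sup>+ x. e2ennreal (entropy_integrand (f x) (g x)) \<partial>lborel)"
    by (rule nn_integral_cong_AE, rule eventually_mono[OF fg]) simp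
  moreover have "(\<integral>\<^sup>+ x. e2ennreal (- entropy_integrand (?f x) (?g x)) \<partial>lborel) =
      (\<integral>\<^sup>+ x. e2ennreal (- entropy_integrand (f x) (g x)) \<partial>lborel)"
    by (rule nn_integral_cong_AE, rule eventually_mono[OF fg]) simp
  ultimately show ?thesis
    using dens by (simp add: relative_entropy_def ereal_integral_def)
qed

definition smooth :: "(real \<Rightarrow> real) \<Rightarrow> bool" where
  "smooth g \<longleftrightarrow> (\<forall>k x. (deriv ^^ k) g field_differentiable at x)"

text \<open>The two sides of the inequality are nonnegative and may be infinite.\<close>

definition has_spectral_gap :: "real measure \<Rightarrow> real \<Rightarrow> bool" where
  "has_spectral_gap \<nu> c \<longleftrightarrow>
     (\<forall>g. smooth g \<and> integrable \<nu> g \<and> (\<integral>x. g x \<partial>\<nu>) = 0 \<longrightarrow>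
        (\<integral>\<^sup>+ x. ennreal ((g x)\<^sup>2) \<partial>\<nu>) \<le> ennreal (1 / c) * (\<integral>\<^sup>+ x. ennreal ((deriv g x)\<^sup>2) \<partial>\<nu>))"

definition max_diagonal :: "real ^ 'd ^ 'd \<Rightarrow> real" where
  "max_diagonal B = Max (range (\<lambda>i. B $ i $ i))"

text \<open>Inserting \<open>0\<close> only matters for \<open>1 \<times> 1\<close> matrices, which have no off-diagonal entries.\<close>

definition max_off_diagonal :: "real ^ 'd ^ 'd \<Rightarrow> real" where
  "max_off_diagonal B = Max (insert 0 {\<bar>B $ i $ j\<bar> | i j. i \<noteq> j})"

end

(*
The law nu of the entries and the law of A Y are both run along the heat flow.  By de Bruijn's
identity the time derivative of the relative entropy to the Gaussian with the same covariance is
minus one half of the excess Fisher information, so it suffices to compare, at every positive time,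
the excess Fisher information of A X with that of one coordinate of X = Y + sqrt t G.

The score of A X is the conditional expectation of sum_j (score of X_j) (j-th column of A).  Conditionally
on A X, the density of X may be differentiated along any vector field with values in the kernel of A;
the fields s(x_j) (1 - A^T A) e_j, where s + 1 is the Stein kernel of X_j, replace the j-th score r(x_j) by
(A^T A)_jj r(x_j) and off-diagonal terms (A^T A)_ij s(x_j) rho(x_i), all pairwise nearly orthogonal.
The spectral gap, which survives the heat flow, bounds E s^2 both by I / c and by 1 / c - 1, where I is the excess
Fisher information; since the full Fisher information is at most 1 + I, the product with E s^2 is linear in I.

At time 0 the entropy of A Y is recovered from positive times by the Donsker-Varadhan formula.
*)
theory Submission
  imports Defs "HOL-Real_Asymp.Real_Asymp"
begin

section \<open>Differentiation and integration over Euclidean space\<close>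

text \<open>Transporting the coordinate scores by A unchanged yields only the factor 1 of the
  minimum; a gain must shrink the weight of each score. The Stein kernel achieves this because the
  derivative of \<open>s * p1\<close> is \<open>r * p1\<close>: a divergence along the kernel of A,
  which vanishes against functions of A x, cancels part of the score \<open>r\<close>. With B = A^T
  A, the squared norm of what remains, summed over the rows of A, is at most I times the sum of the
  B_jj^3, plus (2/c - 1) I times the off-diagonal sum of B_jj B_ij^2 + |B_ij|^3. The identity B^2 =
  B and the trace n of B reduce this to n (2/c) (\<epsilon> + \<zeta>^2 d) I; the 2 is there because
  each of the two bounds on E s^2 is used once.

  The initial law has an arbitrary density, and its gap speaks of smooth functions only. At positive
  times the density is positive and its logarithm grows at most quadratically, which justifies every
  integration by parts. Continuity of the entropies at time 0 is avoided: for one coordinate an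
  upper bound by the initial entropy suffices (data processing), for A Y lower
  semicontinuity.\<close>

lemma has_real_derivative_integral:
  fixes F F' :: "real \<Rightarrow> 'y \<Rightarrow> real"
  assumes \<delta>: "0 < \<delta>"
    and int: "\<And>u. \<bar>u - t\<bar> < \<delta> \<Longrightarrow> integrable M (F u)"
    and deriv: "\<And>u y. \<bar>u - t\<bar> < \<delta> \<Longrightarrow> y \<in> space M \<Longrightarrow>
      ((\<lambda>u. F u y) has_real_derivative F' u y) (at u)"
    and bound: "\<And>u y. \<bar>u - t\<bar> < \<delta> \<Longrightarrow> y \<in> space M \<Longrightarrow> \<bar>F' u y\<bar> \<le> h y"
    and h: "integrable M h"
    and meas: "F' t \<in> borel_measurable M"
  shows "((\<lambda>u. \<integral>y. F u y \<partial>M) has_real_derivative (\<integral>y. F' t y \<partial>M)) (at t)"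
  unfolding has_field_derivative_iff tendsto_at_iff_sequentially comp_def
proof (intro allI impI)
  fix X :: "nat \<Rightarrow> real"
  assume X0: "\<forall>i. X i \<in> UNIV - {t}" and X: "X \<longlonglongrightarrow> t"
  have "\<forall>\<^sub>F n in sequentially. \<bar>X n - t\<bar> < \<delta>"
    using X \<delta> by (metis (no_types, lifting) dist_real_def eventually_mono tendsto_iff)
  then obtain N where N: "\<And>n. n \<ge> N \<Longrightarrow> \<bar>X n - t\<bar> < \<delta>"
    by (auto simp: eventually_sequentially)
  define Y where "Y n = X (n + N)" for n
  have Y: "Y \<longlonglongrightarrow> t" unfolding Y_def using X by (rule LIMSEQ_ignore_initial_segment)
  have Yd: "\<bar>Y n - t\<bar> < \<delta>" and Y0: "Y n \<noteq> t" for n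
    using N X0 by (auto simp: Y_def)
  have iY: "integrable M (F (Y n))" for n using int Yd by blast
  have it: "integrable M (F t)" using int \<delta> by simp
  have "(\<lambda>n. \<integral>y. (F (Y n) y - F t y) / (Y n - t) \<partial>M) \<longlonglongrightarrow> (\<integral>y. F' t y \<partial>M)"
  proof (rule integral_dominated_convergence[where w = h])
    show "integrable M h" by fact
    show "F' t \<in> borel_measurable M" by fact
    show "(\<lambda>y. (F (Y n) y - F t y) / (Y n - t)) \<in> borel_measurable M" for n
      using iY it by (intro borel_measurable_divide borel_measurable_diff) auto
    show "AE y in M. (\<lambda>n. (F (Y n) y - F t y) / (Y n - t)) \<longlonglongrightarrow> F' t y"
    proof (rule AE_I2)
      fix y assume y: "y \<in> space M"
      have "((\<lambda>u. F u y) has_real_derivative F' t y) (at t)"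
        using deriv y \<delta> by simp
      then show "(\<lambda>n. (F (Y n) y - F t y) / (Y n - t)) \<longlonglongrightarrow> F' t y"
        unfolding has_field_derivative_iff tendsto_at_iff_sequentially comp_def
        using Y Y0 by auto
    qed
    show "AE y in M. norm ((F (Y n) y - F t y) / (Y n - t)) \<le> h y" for n
    proof (rule AE_I2)
      fix y assume y: "y \<in> space M"
      have "\<bar>F (Y n) y - F t y\<bar> \<le> h y * \<bar>Y n - t\<bar>"
      proof -
        \<comment> \<open>Mean value inequality on a symmetric interval around \<open>t\<close>,
          which contains both points and stays within \<open>\<delta>\<close> of \<open>t\<close>;
          it turns the bound on \<open>F'\<close> into one on the difference quotients.\<close>
        have "norm (F (Y n) y - F t y) \<le> h y * norm (Y n - t)"
        proof (rule field_differentiable_bound[where S = "{t - \<bar>Y n - t\<bar>..t + \<bar>Y n - t\<bar>}" and f' = "\<lambda>u. F' u y"])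
          fix u assume "u \<in> {t - \<bar>Y n - t\<bar>..t + \<bar>Y n - t\<bar>}"
          then have u: "\<bar>u - t\<bar> < \<delta>" using Yd[of n] by auto
          show "((\<lambda>u. F u y) has_field_derivative F' u y) (at u within {t - \<bar>Y n - t\<bar>..t + \<bar>Y n - t\<bar>})"
            using deriv[OF u y] by (rule has_field_derivative_at_within)
          show "norm (F' u y) \<le> h y" using bound[OF u y] by simp
        qed auto
        then show ?thesis by simp
      qed
      then show "norm ((F (Y n) y - F t y) / (Y n - t)) \<le> h y"
        using Y0[of n] by (simp add: divide_le_eq)
    qed
  qed
  moreover have "(\<integral>y. (F (Y n) y - F t y) / (Y n - t) \<partial>M) =
      ((\<integral>y. F (Y n) y \<partial>M) - (\<integral>y. F t y \<partial>M)) / (Y n - t)" for n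
    using iY it by simp
  ultimately have "(\<lambda>n. ((\<integral>y. F (Y n) y \<partial>M) - (\<integral>y. F t y \<partial>M)) / (Y n - t))
      \<longlonglongrightarrow> (\<integral>y. F' t y \<partial>M)"
    by (simp only:)
  then have "(\<lambda>n. ((\<integral>y. F (X (n + N)) y \<partial>M) - (\<integral>y. F t y \<partial>M)) / (X (n + N) - t))
      \<longlonglongrightarrow> (\<integral>y. F' t y \<partial>M)"
    unfolding Y_def .
  then show "(\<lambda>n. ((\<integral>y. F (X n) y \<partial>M) - (\<integral>y. F t y \<partial>M)) / (X n - t)) \<longlonglongrightarrow> (\<integral>y. F' t y \<partial>M)"
    by (rule LIMSEQ_offset)
qed

section \<open>Translation invariance and integrals of directional derivatives\<close>

lemma nn_integral_lborel_translate:
  fixes f :: "'a::euclidean_space \<Rightarrow> ennreal"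
  assumes [measurable]: "f \<in> borel_measurable borel"
  shows "(\<integral>\<^sup>+x. f (x + c) \<partial>lborel) = (\<integral>\<^sup>+x. f x \<partial>lborel)"
proof -
  have "(\<integral>\<^sup>+x. f x \<partial>lborel) = (\<integral>\<^sup>+x. f x \<partial>distr lborel borel ((+) c))"
    by (simp add: lborel_distr_plus)
  then show ?thesis by (simp add: nn_integral_distr add.commute)
qed

lemma integrable_lborel_translate:
  fixes f :: "'a::euclidean_space \<Rightarrow> real"
  assumes "integrable lborel f"
  shows "integrable lborel (\<lambda>x. f (x + c))"
proof -
  have "integrable (distr lborel borel ((+) c)) f"
    using assms by (simp add: lborel_distr_plus)
  then show ?thesis
    by (subst (asm) integrable_distr_eq) (use assms in \<open>auto simp: add.commute\<close>)
qed

lemma integral_lborel_translate: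
  fixes f :: "'a::euclidean_space \<Rightarrow> real"
  assumes [measurable]: "f \<in> borel_measurable borel"
  shows "(\<integral>x. f (x + c) \<partial>lborel) = (\<integral>x. f x \<partial>lborel)"
proof -
  have "(\<integral>x. f x \<partial>lborel) = (\<integral>x. f x \<partial>distr lborel borel ((+) c))"
    by (simp add: lborel_distr_plus)
  then show ?thesis by (simp add: integral_distr add.commute)
qed

text \<open>Averaging \<open>\<Phi>'\<close> over a unit segment in direction \<open>v\<close>
  leaves its integral unchanged, while the fundamental theorem turns the average into a difference
  of two translates of \<open>\<Phi>\<close>. Integrability thus replaces decay at infinity, and the
  weight \<open>g\<close>, constant along \<open>v\<close>, is never differentiated. With
  \<open>g = 1\<close> this is integration by parts; with \<open>g\<close> a function of
  \<open>A x\<close> and \<open>v\<close> in the kernel of \<open>A\<close> it discards a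
  divergence.\<close>

lemma integral_directional_derivative_eq_0:
  fixes \<Phi> \<Phi>' g :: "'a::euclidean_space \<Rightarrow> real" and v :: 'a
  assumes deriv: "\<And>x. ((\<lambda>h. \<Phi> (x + h *\<^sub>R v)) has_real_derivative \<Phi>' x) (at 0)"
    and cont: "\<And>x. continuous_on UNIV (\<lambda>h. \<Phi>' (x + h *\<^sub>R v))"
    and int: "integrable lborel \<Phi>" "integrable lborel \<Phi>'"
    and g [measurable]: "g \<in> borel_measurable borel"
    and bnd: "\<And>x. \<bar>g x\<bar> \<le> B"
    and inv: "\<And>x h. g (x + h *\<^sub>R v) = g x"
  shows "(\<integral>x. g x * \<Phi>' x \<partial>lborel) = 0"
proof -
  have [measurable]: "\<Phi> \<in> borel_measurable borel" "\<Phi>' \<in> borel_measurable borel"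
    using int by (auto dest: borel_measurable_integrable)
  have deriv': "((\<lambda>h. \<Phi> (x + h *\<^sub>R v)) has_real_derivative \<Phi>' (x + h *\<^sub>R v)) (at h)" for x h
  proof -
    have "((\<lambda>k. \<Phi> ((x + h *\<^sub>R v) + k *\<^sub>R v)) has_real_derivative \<Phi>' (x + h *\<^sub>R v)) (at 0)"
      by (rule deriv)
    then have "((\<lambda>k. (\<lambda>h. \<Phi> (x + h *\<^sub>R v)) (k + h)) has_real_derivative \<Phi>' (x + h *\<^sub>R v)) (at 0)"
      by (simp add: algebra_simps)
    then show ?thesis using DERIV_shift[of "\<lambda>h. \<Phi> (x + h *\<^sub>R v)" "\<Phi>' (x + h *\<^sub>R v)" 0 h] by simp
  qed
  have ig: "integrable lborel (\<lambda>x. g x * \<Phi> x)" if "integrable lborel \<Phi>" for \<Phi>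
  proof (rule Bochner_Integration.integrable_bound[where f = "\<lambda>x. B * \<Phi> x"])
    have "\<bar>g x * \<Phi> x\<bar> \<le> \<bar>B * \<Phi> x\<bar>" for x
      using bnd[of x] by (simp add: abs_mult mult_right_mono)
    then show "AE x in lborel. norm (g x * \<Phi> x) \<le> norm (B * \<Phi> x)" by simp
  qed (use that in \<open>auto dest: borel_measurable_integrable\<close>)
  note i1 = ig[OF int(1)] and i2 = ig[OF int(2)]
  have ftc: "(\<integral>h. (g x * \<Phi>' (x + h *\<^sub>R v)) * indicator {0..1} h \<partial>lborel) = g x * (\<Phi> (x + v) - \<Phi> x)" for x
  proof -
    have "(\<integral>h. \<Phi>' (x + h *\<^sub>R v) * indicator {0..1} h \<partial>lborel) = \<Phi> (x + 1 *\<^sub>R v) - \<Phi> (x + 0 *\<^sub>R v)"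
    proof (rule integral_FTC_Icc_real)
      show "isCont (\<lambda>h. \<Phi>' (x + h *\<^sub>R v)) y" for y
        using cont[of x] by (simp add: continuous_on_eq_continuous_at)
    qed (auto intro: deriv')
    then show ?thesis by (simp add: mult.assoc)
  qed
  have tr: "integrable lborel (\<lambda>x. g x * \<Phi>' (x + h *\<^sub>R v))"
    "(\<integral>x. g x * \<Phi>' (x + h *\<^sub>R v) \<partial>lborel) = (\<integral>x. g x * \<Phi>' x \<partial>lborel)"
    "(\<integral>x. norm (g x * \<Phi>' (x + h *\<^sub>R v)) \<partial>lborel) = (\<integral>x. norm (g x * \<Phi>' x) \<partial>lborel)" for h
    using integrable_lborel_translate[OF i2, of "h *\<^sub>R v"]
      integral_lborel_translate[of "\<lambda>x. g x * \<Phi>' x" "h *\<^sub>R v"]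
      integral_lborel_translate[of "\<lambda>x. norm (g x * \<Phi>' x)" "h *\<^sub>R v"]
    by (simp_all add: inv)
  have pair: "integrable (lborel \<Otimes>\<^sub>M lborel)
      (\<lambda>(h, x). (g x * \<Phi>' (x + h *\<^sub>R v)) * indicator {0..1::real} h)"
  proof (rule lborel_pair.Fubini_integrable)
    show "integrable lborel (\<lambda>h. \<integral>x. norm (case (h, x) of (h, x) \<Rightarrow>
        g x * \<Phi>' (x + h *\<^sub>R v) * indicator {0..1} h) \<partial>lborel)"
    proof -
      have "(\<integral>x. norm (case (h, x) of (h, x) \<Rightarrow> g x * \<Phi>' (x + h *\<^sub>R v) * indicator {0..1} h) \<partial>lborel)
          = indicator {0..1} h *\<^sub>R (\<integral>x. norm (g x * \<Phi>' x) \<partial>lborel)" for h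
        using tr(3)[of h] by (cases "h \<in> {0..1}") simp_all
      then show ?thesis by (simp add: integrable_indicator_iff)
    qed
    show "AE h in lborel. integrable lborel (\<lambda>x. case (h, x) of (h, x) \<Rightarrow>
        g x * \<Phi>' (x + h *\<^sub>R v) * indicator {0..1} h)"
      using tr(1) by (auto intro!: AE_I2)
  qed measurable
  \<comment> \<open>The integral is inserted as a constant over the unit interval of shifts;
    \<open>tr\<close> replaces it by equal translates, and Fubini then exposes
    \<open>ftc\<close>.\<close>
  have "(\<integral>x. g x * \<Phi>' x \<partial>lborel) = (\<integral>h. indicator {0..1::real} h *\<^sub>R (\<integral>x. g x * \<Phi>' x \<partial>lborel) \<partial>lborel)"
    by simp
  also have "\<dots> = (\<integral>h. (\<integral>x. (g x * \<Phi>' (x + h *\<^sub>R v)) * indicator {0..1::real} h \<partial>lborel) \<partial>lborel)"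
    by (rule Bochner_Integration.integral_cong) (simp_all add: tr(2) mult.commute)
  also have "\<dots> = (\<integral>x. (\<integral>h. (g x * \<Phi>' (x + h *\<^sub>R v)) * indicator {0..1::real} h \<partial>lborel) \<partial>lborel)"
    using lborel_pair.Fubini_integral[OF pair] by simp
  also have "\<dots> = (\<integral>x. g x * (\<Phi> (x + v) - \<Phi> x) \<partial>lborel)"
    by (simp add: ftc)
  also have "\<dots> = (\<integral>x. g (x + v) * \<Phi> (x + v) - g x * \<Phi> x \<partial>lborel)"
    using inv[of _ 1] by (simp add: right_diff_distrib)
  also have "\<dots> = (\<integral>x. g (x + v) * \<Phi> (x + v) \<partial>lborel) - (\<integral>x. g x * \<Phi> x \<partial>lborel)"
    by (rule Bochner_Integration.integral_diff[OF integrable_lborel_translate[OF i1] i1])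
  also have "\<dots> = 0"
    using integral_lborel_translate[of "\<lambda>x. g x * \<Phi> x" v] by simp
  finally show ?thesis .
qed

section \<open>Integrals of products of one-variable functions\<close>

lemma
  fixes h :: "'a::euclidean_space \<Rightarrow> real \<Rightarrow> real"
  assumes h: "\<And>b. b \<in> Basis \<Longrightarrow> integrable lborel (h b)"
  shows integrable_lborel_prod_Basis: "integrable lborel (\<lambda>x::'a. \<Prod>b\<in>Basis. h b (x \<bullet> b))" (is ?int)
    and integral_lborel_prod_Basis:
      "integral\<^sup>L lborel (\<lambda>x::'a. \<Prod>b\<in>Basis. h b (x \<bullet> b)) = (\<Prod>b\<in>Basis. \<integral>x. h b x \<partial>lborel)" (is ?eq)
proof -
  interpret product_sigma_finite "\<lambda>_::'a. lborel :: real measure" ..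
  let ?T = "\<lambda>f. (\<Sum>b\<in>Basis. f b *\<^sub>R b) :: 'a"
  have [measurable]: "h b \<in> borel_measurable borel" if "b \<in> Basis" for b
    using borel_measurable_integrable[OF h[OF that]] by simp
  have m: "(\<lambda>x::'a. \<Prod>b\<in>Basis. h b (x \<bullet> b)) \<in> borel_measurable borel"
    by (intro borel_measurable_prod) measurable
  have T: "?T \<in> measurable (Pi\<^sub>M Basis (\<lambda>_::'a. lborel)) borel" by simp
  have eq: "(\<Prod>b\<in>Basis. h b (?T f \<bullet> b)) = (\<Prod>b\<in>Basis. h b (f b))" for f
    by (rule prod.cong) (auto simp: inner_sum_left inner_Basis if_distrib cong: if_cong)
  have "integrable (Pi\<^sub>M Basis (\<lambda>_. lborel)) (\<lambda>f. \<Prod>b\<in>Basis. h b (f b))"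
    by (rule product_integrable_prod) (auto intro: h)
  then show ?int
    unfolding lborel_eq[where 'a = 'a] by (subst integrable_distr_eq[OF T m]) (simp only: eq)
  have "(\<integral>f. (\<Prod>b\<in>Basis. h b (f b)) \<partial>Pi\<^sub>M Basis (\<lambda>_. lborel)) = (\<Prod>b\<in>Basis. \<integral>x. h b x \<partial>lborel)"
    by (rule product_integral_prod) (auto intro: h)
  then show ?eq
    unfolding lborel_eq[where 'a = 'a] by (subst integral_distr[OF T m]) (simp only: eq)
qed

lemma Basis_vec_eq_range_axis: "(Basis :: (real ^ 'd::finite) set) = range (\<lambda>i. axis i 1)"
  by (auto simp: Basis_vec_def)

lemma inj_axis_1: "inj (\<lambda>i. axis i (1::real) :: real ^ 'd::finite)"
  by (auto simp: inj_def axis_eq_axis)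

lemma
  fixes h :: "'d::finite \<Rightarrow> real \<Rightarrow> real"
  assumes h: "\<And>i. integrable lborel (h i)"
  shows integrable_lborel_prod_vec: "integrable lborel (\<lambda>x::real ^ 'd. \<Prod>i\<in>UNIV. h i (x $ i))" (is ?int)
    and integral_lborel_prod_vec:
      "integral\<^sup>L lborel (\<lambda>x::real ^ 'd. \<Prod>i\<in>UNIV. h i (x $ i)) = (\<Prod>i\<in>UNIV. \<integral>x. h i x \<partial>lborel)" (is ?eq)
proof -
  define e :: "'d \<Rightarrow> real ^ 'd" where "e = (\<lambda>i. axis i 1)"
  have inj: "inj e" unfolding e_def by (rule inj_axis_1)
  have B: "(Basis :: (real ^ 'd) set) = range e" unfolding e_def by (rule Basis_vec_eq_range_axis)
  define k where "k b = h (inv e b)" for b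
  have ke: "k (e i) = h i" for i by (simp add: k_def inv_f_f[OF inj])
  have eq: "(\<Prod>b\<in>Basis. k b (x \<bullet> b)) = (\<Prod>i\<in>UNIV. h i (x $ i))" for x :: "real ^ 'd"
    unfolding B by (subst prod.reindex[OF inj]) (simp add: ke, simp add: e_def cart_eq_inner_axis)
  have eq2: "(\<Prod>b\<in>Basis. \<integral>x. k b x \<partial>lborel) = (\<Prod>i\<in>UNIV. \<integral>x. h i x \<partial>lborel)"
    unfolding B by (subst prod.reindex[OF inj]) (simp add: ke)
  have k: "integrable lborel (k b)" for b unfolding k_def by (rule h)
  show ?int using integrable_lborel_prod_Basis[of k] k by (simp add: eq)
  show ?eq using integral_lborel_prod_Basis[of k] k by (simp add: eq eq2)
qed

section \<open>The Gaussian kernel\<close>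

text \<open>The Gaussian density with covariance \<open>t\<close> times the identity, so that the
  heat flow is generated by half the Laplacian; hence the 1/2 in \<open>de_Bruijn\<close>. At
  \<open>t = 0\<close> division by zero makes the function constant, and continuity holds for every
  \<open>t\<close>.\<close>

definition gk :: "real \<Rightarrow> 'a::euclidean_space \<Rightarrow> real" where
  "gk t z = exp (- (norm z)\<^sup>2 / (2 * t)) / sqrt ((2 * pi * t) ^ DIM('a))"

lemma gk_pos: "0 < t \<Longrightarrow> 0 < gk t z"
  by (simp add: gk_def)

lemma gk_nonneg: "0 < t \<Longrightarrow> 0 \<le> gk t z"
  by (simp add: gk_def)

lemma continuous_on_gk [continuous_intros]: "continuous_on S (gk t)"
  unfolding gk_def by (cases "t = 0") (auto intro!: continuous_intros)

lemma borel_measurable_gk [measurable]: "gk t \<in> borel_measurable borel"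
  by (intro borel_measurable_continuous_onI continuous_on_gk)

lemma gk_le: "0 < t \<Longrightarrow> gk t (z::'a::euclidean_space) \<le> gk t (0::'a)"
  by (auto simp: gk_def intro!: divide_right_mono)

lemma gk_eq_prod:
  assumes "0 < t"
  shows "gk t (z::'a::euclidean_space) = (\<Prod>b\<in>Basis. normal_density 0 (sqrt t) (z \<bullet> b))"
proof -
  have n: "(norm z)\<^sup>2 = (\<Sum>b\<in>Basis. (z \<bullet> b)\<^sup>2)"
    unfolding power2_norm_eq_inner by (subst euclidean_inner) (simp add: power2_eq_square)
  have "(\<Prod>b\<in>Basis. normal_density 0 (sqrt t) (z \<bullet> b))
      = (\<Prod>b\<in>(Basis::'a set). (1 / sqrt (2 * pi * t)) * exp (- (z \<bullet> b)\<^sup>2 / (2 * t)))"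
    using assms by (simp add: normal_density_def)
  also have "\<dots> = (1 / sqrt (2 * pi * t)) ^ DIM('a) * exp (\<Sum>b\<in>Basis. - (z \<bullet> b)\<^sup>2 / (2 * t))"
    by (simp only: prod.distrib prod_constant exp_sum[OF finite_Basis])
  also have "(\<Sum>b\<in>Basis. - (z \<bullet> b)\<^sup>2 / (2 * t)) = - (norm z)\<^sup>2 / (2 * t)"
    by (simp add: n sum_divide_distrib sum_negf)
  also have "(1 / sqrt (2 * pi * t)) ^ DIM('a) = 1 / sqrt ((2 * pi * t) ^ DIM('a))"
    by (simp add: power_one_over real_sqrt_power)
  finally show ?thesis by (simp add: gk_def)
qed

lemma gk_real: "0 < t \<Longrightarrow> gk t (x::real) = normal_density 0 (sqrt t) x"
  by (simp add: gk_eq_prod)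

text \<open>The weight sits on a single coordinate, and all other factors of the product are normal
  densities of mass 1. Moments in any dimension thus come from those of one normal variable.\<close>

lemma has_bochner_integral_gk_Basis:
  fixes e :: "'a::euclidean_space"
  assumes t: "0 < t" and e: "e \<in> Basis"
    and h: "has_bochner_integral lborel (\<lambda>x. normal_density 0 (sqrt t) x * h x) c"
  shows "has_bochner_integral lborel (\<lambda>z::'a. gk t z * h (z \<bullet> e)) c"
proof -
  define k where "k b = (if b = e then \<lambda>x. normal_density 0 (sqrt t) x * h x else normal_density 0 (sqrt t))" for b :: 'a
  have eq: "gk t z * h (z \<bullet> e) = (\<Prod>b\<in>Basis. k b (z \<bullet> b))" for z
  proof -
    have "(\<Prod>b\<in>Basis. k b (z \<bullet> b)) = k e (z \<bullet> e) * (\<Prod>b\<in>Basis - {e}. k b (z \<bullet> b))"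
      using e by (simp add: prod.remove)
    also have "(\<Prod>b\<in>Basis - {e}. k b (z \<bullet> b)) = (\<Prod>b\<in>Basis - {e}. normal_density 0 (sqrt t) (z \<bullet> b))"
      by (rule prod.cong) (auto simp: k_def)
    also have "k e (z \<bullet> e) * \<dots> = h (z \<bullet> e) * (\<Prod>b\<in>Basis. normal_density 0 (sqrt t) (z \<bullet> b))"
      using e by (simp add: prod.remove k_def)
    finally show ?thesis using t by (simp add: gk_eq_prod)
  qed
  have k: "integrable lborel (k b)" for b
    using h t by (auto simp: k_def has_bochner_integral_iff)
  have "(\<Prod>b\<in>Basis. \<integral>x. k b x \<partial>lborel) = (\<integral>x. k e x \<partial>lborel) * (\<Prod>b\<in>Basis - {e}. \<integral>x. k b x \<partial>lborel)"
    using e by (simp add: prod.remove)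
  also have "(\<Prod>b\<in>Basis - {e}. \<integral>x. k b x \<partial>lborel) = 1"
    using t by (intro prod.neutral) (auto simp: k_def)
  also have "(\<integral>x. k e x \<partial>lborel) * 1 = c"
    using h by (simp add: k_def has_bochner_integral_iff)
  finally show ?thesis
    unfolding has_bochner_integral_iff eq
    using integrable_lborel_prod_Basis[of k] integral_lborel_prod_Basis[of k] k by simp
qed

section \<open>Mass and moments of the Gaussian kernel\<close>

lemma
  assumes t: "0 < t"
  shows integrable_gk: "integrable lborel (gk t :: 'a::euclidean_space \<Rightarrow> real)"
    and integral_gk: "integral\<^sup>L lborel (gk t :: 'a::euclidean_space \<Rightarrow> real) = 1"
proof -
  obtain e :: 'a where e: "e \<in> Basis" using nonempty_Basis by blast
  have "has_bochner_integral lborel (\<lambda>z::'a. gk t z * (\<lambda>_. 1) (z \<bullet> e)) 1"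
    by (rule has_bochner_integral_gk_Basis[OF t e]) (use t in \<open>auto simp: has_bochner_integral_iff\<close>)
  then show "integrable lborel (gk t :: 'a \<Rightarrow> real)" "integral\<^sup>L lborel (gk t :: 'a \<Rightarrow> real) = 1"
    by (simp_all add: has_bochner_integral_iff)
qed

lemma gk_first_moment_Basis:
  fixes e :: "'a::euclidean_space"
  assumes t: "0 < t" and e: "e \<in> Basis"
  shows "has_bochner_integral lborel (\<lambda>z::'a. gk t z * (z \<bullet> e)) 0"
proof -
  have "has_bochner_integral lborel (\<lambda>x. normal_density 0 (sqrt t) x * x) 0"
    using normal_moment_nz_1[of "sqrt t" 0] t by simp
  from has_bochner_integral_gk_Basis[OF t e this] show ?thesis .
qed

lemma gk_second_moment_Basis:
  fixes e :: "'a::euclidean_space"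
  assumes t: "0 < t" and e: "e \<in> Basis"
  shows "has_bochner_integral lborel (\<lambda>z::'a. gk t z * (z \<bullet> e)\<^sup>2) t"
proof -
  have "has_bochner_integral lborel (\<lambda>x. normal_density 0 (sqrt t) x * x\<^sup>2) t"
    using normal_moment_even[of "sqrt t" 0 1] t by (simp add: power2_eq_square)
  from has_bochner_integral_gk_Basis[OF t e this] show ?thesis .
qed

lemma gk_first_moment:
  fixes v :: "'a::euclidean_space"
  assumes t: "0 < t"
  shows "has_bochner_integral lborel (\<lambda>z::'a. gk t z * (z \<bullet> v)) 0"
proof -
  have "has_bochner_integral lborel (\<lambda>z::'a. \<Sum>b\<in>Basis. (v \<bullet> b) * (gk t z * (z \<bullet> b))) (\<Sum>b\<in>(Basis::'a set). (v \<bullet> b) * 0)"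
    using gk_first_moment_Basis[OF t]
    by (intro has_bochner_integral_sum has_bochner_integral_mult_right) auto
  moreover have "(\<Sum>b\<in>Basis. (v \<bullet> b) * (gk t z * (z \<bullet> b))) = gk t z * (z \<bullet> v)" for z
    by (subst (2) euclidean_inner) (simp add: sum_distrib_left mult_ac)
  ultimately show ?thesis by simp
qed

lemma gk_norm_moment:
  assumes t: "0 < t"
  shows "has_bochner_integral lborel (\<lambda>z::'a::euclidean_space. gk t z * (norm z)\<^sup>2) (t * DIM('a))"
proof -
  have "has_bochner_integral lborel (\<lambda>z::'a. \<Sum>b\<in>Basis. gk t z * (z \<bullet> b)\<^sup>2) (\<Sum>b\<in>(Basis::'a set). t)"
    using gk_second_moment_Basis[OF t] by (intro has_bochner_integral_sum) auto
  moreover have "(\<Sum>b\<in>Basis. gk t z * (z \<bullet> b)\<^sup>2) = gk t z * (norm z)\<^sup>2" for z :: 'a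
    unfolding power2_norm_eq_inner euclidean_inner[of z z]
    by (simp add: sum_distrib_left power2_eq_square)
  ultimately show ?thesis by (simp add: mult.commute)
qed

text \<open>The factor \<open>1 + 4 * b\<close> pays for the quadratic polynomial in
  \<open>gk_dominated\<close>; the quotient of roots exchanges the largest prefactor of
  \<open>gk u\<close> for \<open>u\<close> in \<open>[a, b]\<close> against that of
  \<open>gk (2 * b)\<close>.\<close>

definition gk_const :: "'a::euclidean_space itself \<Rightarrow> real \<Rightarrow> real \<Rightarrow> real" where
  "gk_const _ a b = (1 + 4 * b) * sqrt ((4 * pi * b) ^ DIM('a)) / sqrt ((2 * pi * a) ^ DIM('a))"

lemma gk_const_nonneg: "0 < a \<Longrightarrow> 0 < b \<Longrightarrow> 0 \<le> gk_const T a b"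
  by (simp add: gk_const_def)

text \<open>Half of the exponent is given up: \<open>exp (- r / (2 * b))\<close> is the square of
  \<open>exp (- r / (4 * b))\<close>; one factor absorbs \<open>1 + r\<close> through
  \<open>1 + x \<le> exp x\<close>, the other is a Gaussian of time \<open>2 * b\<close>. Uniformity
  in \<open>u\<close> serves differentiation in time.\<close>

lemma gk_dominated:
  fixes z :: "'a::euclidean_space"
  assumes "0 < a" "a \<le> u" "u \<le> b"
  shows "(1 + (norm z)\<^sup>2) * gk u z \<le> gk_const TYPE('a) a b * gk (2 * b) z"
proof -
  let ?r = "(norm z)\<^sup>2" and ?n = "DIM('a)"
  have b: "0 < b" and u: "0 < u" using assms by auto
  have 1: "exp (- ?r / (2 * u)) \<le> exp (- ?r / (2 * b))"
    using assms by (simp add: frac_le)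
  have 2: "1 / sqrt ((2 * pi * u) ^ ?n) \<le> 1 / sqrt ((2 * pi * a) ^ ?n)"
    using assms by (intro divide_left_mono) (auto intro!: power_mono mult_pos_pos)
  have "gk u z = exp (- ?r / (2 * u)) * (1 / sqrt ((2 * pi * u) ^ ?n))"
    by (simp add: gk_def)
  also have "\<dots> \<le> exp (- ?r / (2 * b)) * (1 / sqrt ((2 * pi * a) ^ ?n))"
    using 1 2 u by (intro mult_mono) auto
  finally have g: "gk u z \<le> exp (- ?r / (2 * b)) / sqrt ((2 * pi * a) ^ ?n)" by simp
  have "1 + ?r / (4 * b) \<le> exp (?r / (4 * b))" by (rule exp_ge_add_one_self)
  then have "?r \<le> 4 * b * exp (?r / (4 * b))"
    using b by (simp add: field_simps)
  moreover have "1 \<le> exp (?r / (4 * b))" using b by simp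
  ultimately have "1 + ?r \<le> (1 + 4 * b) * exp (?r / (4 * b))"
    unfolding distrib_right by linarith
  then have "(1 + ?r) * exp (- ?r / (2 * b)) \<le> (1 + 4 * b) * exp (?r / (4 * b)) * exp (- ?r / (2 * b))"
    by (rule mult_right_mono) simp
  also have "\<dots> = (1 + 4 * b) * exp (- ?r / (2 * (2 * b)))"
  proof -
    have "?r / (4 * b) + (- ?r / (2 * b)) = - ?r / (2 * (2 * b))"
      using b by (simp add: field_simps)
    then show ?thesis by (simp add: mult.assoc exp_add[symmetric])
  qed
  finally have 3: "(1 + ?r) * exp (- ?r / (2 * b)) \<le> (1 + 4 * b) * exp (- ?r / (2 * (2 * b)))" .
  have "(1 + ?r) * gk u z \<le> (1 + ?r) * (exp (- ?r / (2 * b)) / sqrt ((2 * pi * a) ^ ?n))"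
    using g by (intro mult_left_mono) auto
  also have "\<dots> = ((1 + ?r) * exp (- ?r / (2 * b))) / sqrt ((2 * pi * a) ^ ?n)" by simp
  also have "\<dots> \<le> ((1 + 4 * b) * exp (- ?r / (2 * (2 * b)))) / sqrt ((2 * pi * a) ^ ?n)"
    using 3 assms by (intro divide_right_mono) auto
  also have "\<dots> = gk_const TYPE('a) a b * gk (2 * b) z"
  proof -
    define K where "K = sqrt ((4 * pi * b) ^ ?n)"
    have K: "K \<noteq> 0" using b by (simp add: K_def)
    have e: "2 * pi * (2 * b) = 4 * pi * b" by simp
    show ?thesis unfolding gk_const_def gk_def e K_def[symmetric] using K by simp
  qed
  finally show ?thesis .
qed

text \<open>\<open>gk1\<close>, \<open>gk2\<close> and \<open>gkt\<close> are the first and second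
  derivatives of the kernel in direction \<open>v\<close> and its time derivative; as explicit
  polynomials times \<open>gk t\<close> they fall under \<open>gk_dominated\<close>.\<close>

definition gk1 :: "'a::euclidean_space \<Rightarrow> real \<Rightarrow> 'a \<Rightarrow> real" where
  "gk1 v t z = - (z \<bullet> v) / t * gk t z"

definition gk2 :: "'a::euclidean_space \<Rightarrow> real \<Rightarrow> 'a \<Rightarrow> real" where
  "gk2 v t z = ((z \<bullet> v)\<^sup>2 / t\<^sup>2 - (v \<bullet> v) / t) * gk t z"

definition gkt :: "real \<Rightarrow> 'a::euclidean_space \<Rightarrow> real" where
  "gkt t z = ((norm z)\<^sup>2 / (2 * t\<^sup>2) - DIM('a) / (2 * t)) * gk t z"

lemma continuous_on_gk1: "continuous_on S (gk1 v t)"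
  unfolding gk1_def by (cases "t = 0") (auto intro!: continuous_intros)

lemma continuous_on_gk2: "continuous_on S (gk2 v t)"
  unfolding gk2_def by (cases "t = 0") (auto intro!: continuous_intros)

lemma continuous_on_gkt: "continuous_on S (gkt t)"
  unfolding gkt_def by (cases "t = 0") (auto intro!: continuous_intros)

lemma borel_measurable_gk1 [measurable]: "gk1 v t \<in> borel_measurable borel"
  and borel_measurable_gk2 [measurable]: "gk2 v t \<in> borel_measurable borel"
  and borel_measurable_gkt [measurable]: "gkt t \<in> borel_measurable borel"
  by (intro borel_measurable_continuous_onI continuous_on_gk1 continuous_on_gk2 continuous_on_gkt)+

text \<open>This is the heat equation for the kernel.\<close>

lemma sum_gk2_Basis: "(\<Sum>e\<in>Basis. gk2 e t z) = 2 * gkt t z"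
proof -
  have "(\<Sum>e\<in>Basis. gk2 e t z) = ((\<Sum>e\<in>Basis. (z \<bullet> e)\<^sup>2) / t\<^sup>2 - (\<Sum>e\<in>(Basis::'a set). 1 / t)) * gk t z"
    unfolding gk2_def sum_distrib_right[symmetric] sum_subtractf sum_divide_distrib
    by (simp add: inner_Basis)
  also have "(\<Sum>e\<in>Basis. (z \<bullet> e)\<^sup>2) = (norm z)\<^sup>2"
    unfolding power2_norm_eq_inner by (subst euclidean_inner) (simp add: power2_eq_square)
  finally show ?thesis by (simp add: gkt_def algebra_simps)
qed

lemma norm_line: "(norm (z + h *\<^sub>R v))\<^sup>2 = (norm z)\<^sup>2 + 2 * h * (z \<bullet> v) + h\<^sup>2 * (v \<bullet> v)"
  unfolding power2_norm_eq_inner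
  by (simp add: inner_add_left inner_add_right inner_commute power2_eq_square algebra_simps)

lemma gk_deriv:
  fixes z v :: "'a::euclidean_space"
  assumes "0 < t"
  shows "((\<lambda>h. gk t (z + h *\<^sub>R v)) has_real_derivative gk1 v t (z + h *\<^sub>R v)) (at h)"
proof -
  define N c d K where "N = (norm z)\<^sup>2" and "c = z \<bullet> v" and "d = v \<bullet> v"
    and "K = sqrt ((2 * pi * t) ^ DIM('a))"
  have "((\<lambda>h. exp (- (N + 2 * h * c + h\<^sup>2 * d) / (2 * t)) / K) has_real_derivative
      (exp (- (N + 2 * h * c + h\<^sup>2 * d) / (2 * t)) * (- (2 * c + 2 * h * d) / (2 * t))) / K) (at h)"
    by (intro DERIV_cdivide DERIV_fun_exp) (use assms in \<open>auto intro!: derivative_eq_intros simp: field_simps\<close>)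
  moreover have "(exp (- (N + 2 * h * c + h\<^sup>2 * d) / (2 * t)) * (- (2 * c + 2 * h * d) / (2 * t))) / K
      = - (c + h * d) / t * (exp (- (N + 2 * h * c + h\<^sup>2 * d) / (2 * t)) / K)"
  proof -
    have e: "- (2 * c + 2 * h * d) / (2 * t) = - (c + h * d) / t"
      using assms by (simp add: field_simps)
    show ?thesis unfolding e by simp
  qed
  ultimately show ?thesis
    unfolding gk_def norm_line gk1_def inner_add_left inner_scaleR_left
    unfolding N_def[symmetric] c_def[symmetric] d_def[symmetric] K_def[symmetric] by simp
qed

lemma gk1_deriv:
  fixes z v :: "'a::euclidean_space"
  assumes "0 < t"
  shows "((\<lambda>h. gk1 v t (z + h *\<^sub>R v)) has_real_derivative gk2 v t (z + h *\<^sub>R v)) (at h)"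
proof -
  have "((\<lambda>h. - ((z + h *\<^sub>R v) \<bullet> v) / t * gk t (z + h *\<^sub>R v)) has_real_derivative
      (- (v \<bullet> v) / t) * gk t (z + h *\<^sub>R v) + gk1 v t (z + h *\<^sub>R v) * (- ((z + h *\<^sub>R v) \<bullet> v) / t)) (at h)"
    by (rule DERIV_mult[OF _ gk_deriv[OF assms]], unfold inner_add_left inner_scaleR_left)
      (use assms in \<open>auto intro!: derivative_eq_intros\<close>)
  moreover have "(- (v \<bullet> v) / t) * gk t (z + h *\<^sub>R v) + gk1 v t (z + h *\<^sub>R v) * (- ((z + h *\<^sub>R v) \<bullet> v) / t)
      = gk2 v t (z + h *\<^sub>R v)"
    using assms by (simp add: gk2_def gk1_def power2_eq_square field_simps)
  ultimately show ?thesis by (simp add: gk1_def[abs_def])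
qed

lemma gk_time_deriv:
  fixes z :: "'a::euclidean_space"
  assumes "0 < t"
  shows "((\<lambda>u. gk u z) has_real_derivative gkt t z) (at t)"
proof -
  let ?n = "DIM('a)"
  \<comment> \<open>The normalising power moves into the exponent, so that a single exponential is
    differentiated. The rewriting holds for positive \<open>u\<close> only, hence the final transfer
    through the open set \<open>{0<..}\<close>.\<close>
  have eq: "gk u z = exp (- (norm z)\<^sup>2 / (2 * u) - ?n / 2 * ln (2 * pi * u))" if "0 < u" for u
  proof -
    have "exp (ln (2 * pi * u) / 2) = sqrt (2 * pi * u)"
      using that by (simp add: ln_sqrt[symmetric])
    then have "exp (real ?n * (ln (2 * pi * u) / 2)) = sqrt (2 * pi * u) ^ ?n"
      by (simp only: exp_of_nat_mult)
    then have "sqrt ((2 * pi * u) ^ ?n) = exp (?n / 2 * ln (2 * pi * u))"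
      by (simp add: real_sqrt_power)
    then show ?thesis by (simp add: gk_def exp_diff)
  qed
  have "((\<lambda>u. exp (- (norm z)\<^sup>2 / (2 * u) - ?n / 2 * ln (2 * pi * u))) has_real_derivative
      exp (- (norm z)\<^sup>2 / (2 * t) - ?n / 2 * ln (2 * pi * t)) * ((norm z)\<^sup>2 / (2 * t\<^sup>2) - ?n / (2 * t))) (at t)"
    using assms by (auto intro!: derivative_eq_intros simp: power2_eq_square)
  then have "((\<lambda>u. exp (- (norm z)\<^sup>2 / (2 * u) - ?n / 2 * ln (2 * pi * u))) has_real_derivative gkt t z) (at t)"
    using assms by (simp add: gkt_def eq mult.commute)
  then show ?thesis
    by (rule has_field_derivative_transform_within_open[where S = "{0<..}"]) (use assms eq in auto)
qed

lemma inner_abs_le: "\<bar>z \<bullet> v\<bar> \<le> norm v * (1 + (norm z)\<^sup>2)"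
proof -
  have "norm z \<le> 1 + (norm z)\<^sup>2"
    using sum_squares_ge_zero[of "norm z - 1/2" 0] by (simp add: power2_eq_square algebra_simps)
  then have "norm z * norm v \<le> (1 + (norm z)\<^sup>2) * norm v" by (rule mult_right_mono) simp
  with Cauchy_Schwarz_ineq2[of z v] show ?thesis by (simp add: mult.commute)
qed

lemma gk1_bound:
  fixes z :: "'a::euclidean_space"
  assumes "0 < t"
  shows "\<bar>gk1 v t z\<bar> \<le> norm v / t * gk_const TYPE('a) t t * gk (2 * t) z"
proof -
  have "\<bar>gk1 v t z\<bar> = \<bar>z \<bullet> v\<bar> / t * gk t z"
    using assms by (simp add: gk1_def abs_mult gk_nonneg)
  also have "\<dots> \<le> norm v * (1 + (norm z)\<^sup>2) / t * gk t z"
    using assms by (intro mult_right_mono divide_right_mono inner_abs_le) (auto simp: gk_nonneg)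
  also have "\<dots> = norm v / t * ((1 + (norm z)\<^sup>2) * gk t z)" by simp
  also have "\<dots> \<le> norm v / t * (gk_const TYPE('a) t t * gk (2 * t) z)"
    using assms by (intro mult_left_mono gk_dominated) auto
  finally show ?thesis by (simp add: mult.assoc)
qed

lemma gk2_bound:
  fixes z :: "'a::euclidean_space"
  assumes "0 < t"
  shows "\<bar>gk2 v t z\<bar> \<le> (v \<bullet> v) * (1 / t\<^sup>2 + 1 / t) * gk_const TYPE('a) t t * gk (2 * t) z"
proof -
  have "(z \<bullet> v)\<^sup>2 \<le> (z \<bullet> z) * (v \<bullet> v)" by (rule Cauchy_Schwarz_ineq)
  then have "(z \<bullet> v)\<^sup>2 / t\<^sup>2 \<le> (norm z)\<^sup>2 * (v \<bullet> v) / t\<^sup>2"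
    using assms by (intro divide_right_mono) (auto simp: power2_norm_eq_inner)
  moreover have "\<bar>(z \<bullet> v)\<^sup>2 / t\<^sup>2 - (v \<bullet> v) / t\<bar> \<le> (z \<bullet> v)\<^sup>2 / t\<^sup>2 + (v \<bullet> v) / t"
    using assms by (intro order_trans[OF abs_triangle_ineq4]) auto
  ultimately have "\<bar>(z \<bullet> v)\<^sup>2 / t\<^sup>2 - (v \<bullet> v) / t\<bar> \<le> (norm z)\<^sup>2 * (v \<bullet> v) / t\<^sup>2 + (v \<bullet> v) / t" by simp
  also have "\<dots> = (v \<bullet> v) * ((norm z)\<^sup>2 / t\<^sup>2 + 1 / t)"
    by (simp add: algebra_simps)
  also have "\<dots> \<le> (v \<bullet> v) * ((1 / t\<^sup>2 + 1 / t) * (1 + (norm z)\<^sup>2))"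
  proof (rule mult_left_mono)
    have "0 \<le> 1 / t\<^sup>2 + (norm z)\<^sup>2 / t" using assms by simp
    then show "(norm z)\<^sup>2 / t\<^sup>2 + 1 / t \<le> (1 / t\<^sup>2 + 1 / t) * (1 + (norm z)\<^sup>2)"
      by (simp add: algebra_simps)
  qed simp
  finally have "\<bar>gk2 v t z\<bar> \<le> (v \<bullet> v) * (1 / t\<^sup>2 + 1 / t) * (1 + (norm z)\<^sup>2) * gk t z"
    using assms unfolding gk2_def abs_mult mult.assoc[symmetric]
    by (intro mult_mono) (auto simp: gk_nonneg mult.assoc)
  also have "\<dots> = (v \<bullet> v) * (1 / t\<^sup>2 + 1 / t) * ((1 + (norm z)\<^sup>2) * gk t z)" by simp
  also have "\<dots> \<le> (v \<bullet> v) * (1 / t\<^sup>2 + 1 / t) * (gk_const TYPE('a) t t * gk (2 * t) z)"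
    using assms by (intro mult_left_mono gk_dominated) auto
  finally show ?thesis by (simp add: mult.assoc)
qed

lemma gkt_bound:
  fixes z :: "'a::euclidean_space"
  assumes "0 < a" "a \<le> t" "t \<le> b"
  shows "\<bar>gkt t z\<bar> \<le> (1 / a\<^sup>2 + DIM('a) / a) * gk_const TYPE('a) a b * gk (2 * b) z"
proof -
  have t: "0 < t" using assms by simp
  have 1: "(norm z)\<^sup>2 / (2 * t\<^sup>2) \<le> (norm z)\<^sup>2 / a\<^sup>2"
    using assms by (intro divide_left_mono) (auto intro: order_trans[OF power_mono])
  have 2: "DIM('a) / (2 * t) \<le> DIM('a) / a"
    using assms by (intro divide_left_mono) auto
  have "\<bar>(norm z)\<^sup>2 / (2 * t\<^sup>2) - DIM('a) / (2 * t)\<bar> \<le> (norm z)\<^sup>2 / (2 * t\<^sup>2) + DIM('a) / (2 * t)"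
    using t by (intro order_trans[OF abs_triangle_ineq4]) auto
  also have "\<dots> \<le> (norm z)\<^sup>2 / a\<^sup>2 + DIM('a) / a" using 1 2 by (rule add_mono)
  also have "\<dots> \<le> (1 / a\<^sup>2 + DIM('a) / a) * (1 + (norm z)\<^sup>2)"
    using assms by (simp add: algebra_simps)
  finally have "\<bar>gkt t z\<bar> \<le> (1 / a\<^sup>2 + DIM('a) / a) * (1 + (norm z)\<^sup>2) * gk t z"
    using t by (auto simp: gkt_def abs_mult gk_nonneg intro!: mult_right_mono)
  also have "\<dots> = (1 / a\<^sup>2 + DIM('a) / a) * ((1 + (norm z)\<^sup>2) * gk t z)" by simp
  also have "\<dots> \<le> (1 / a\<^sup>2 + DIM('a) / a) * (gk_const TYPE('a) a b * gk (2 * b) z)"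
    using assms by (intro mult_left_mono gk_dominated) auto
  finally show ?thesis by (simp add: mult.assoc)
qed

section \<open>The heat flow and de Bruijn's identity\<close>

text \<open>The class of kernels whose convolutions with a law are continuous and integrable against
  quadratic weights. The time \<open>s\<close> of the dominating Gaussian is existential because a
  polynomial prefactor of the kernel doubles it.\<close>

definition gdom :: "('a::euclidean_space \<Rightarrow> real) \<Rightarrow> bool" where
  "gdom k \<longleftrightarrow> continuous_on UNIV k \<and> (\<exists>C s. 0 < s \<and> 0 \<le> C \<and> (\<forall>z. \<bar>k z\<bar> \<le> C * gk s z))"

lemma gdomI:
  assumes "continuous_on UNIV k" "0 < s" "0 \<le> C" "\<And>z. \<bar>k z\<bar> \<le> C * gk s z"
  shows "gdom k"
  using assms unfolding gdom_def by blast

lemma gdom_gk: "0 < t \<Longrightarrow> gdom (gk t)"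
  by (rule gdomI[of _ t 1]) (auto simp: gk_nonneg continuous_on_gk)

lemma gdom_gk1: "0 < t \<Longrightarrow> gdom (gk1 v t :: 'a::euclidean_space \<Rightarrow> real)"
  by (rule gdomI[OF continuous_on_gk1 _ _ gk1_bound]) (auto intro!: mult_nonneg_nonneg divide_nonneg_nonneg add_nonneg_nonneg gk_const_nonneg)

lemma gdom_gk2: "0 < t \<Longrightarrow> gdom (gk2 v t :: 'a::euclidean_space \<Rightarrow> real)"
  by (rule gdomI[OF continuous_on_gk2 _ _ gk2_bound]) (auto intro!: mult_nonneg_nonneg divide_nonneg_nonneg add_nonneg_nonneg gk_const_nonneg)

lemma gdom_gkt: "0 < t \<Longrightarrow> gdom (gkt t :: 'a::euclidean_space \<Rightarrow> real)"
  by (rule gdomI[OF continuous_on_gkt _ _ gkt_bound[of t t t]]) (auto intro!: mult_nonneg_nonneg divide_nonneg_nonneg add_nonneg_nonneg gk_const_nonneg)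

lemma gdom_measurable: "gdom k \<Longrightarrow> k \<in> borel_measurable borel"
  by (auto simp: gdom_def intro: borel_measurable_continuous_onI)

lemma gdom_bounded:
  fixes k :: "'a::euclidean_space \<Rightarrow> real"
  assumes "gdom k"
  obtains B where "\<And>z. \<bar>k z\<bar> \<le> B"
proof -
  from assms obtain C s where "0 < s" "0 \<le> C" "\<And>z. \<bar>k z\<bar> \<le> C * gk s z"
    unfolding gdom_def by blast
  then have "\<bar>k z\<bar> \<le> C * gk s (0::'a)" for z
    by (meson gk_le mult_left_mono order_trans)
  then show ?thesis by (rule that)
qed

lemma gdom_integrable:
  fixes k :: "'a::euclidean_space \<Rightarrow> real"
  assumes "gdom k"
  shows "integrable lborel (\<lambda>z. (1 + (norm z)\<^sup>2) * \<bar>k z\<bar>)"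
proof -
  from assms obtain C s where s: "0 < s" and C: "0 \<le> C" and k: "\<And>z. \<bar>k z\<bar> \<le> C * gk s z"
    unfolding gdom_def by blast
  have [measurable]: "k \<in> borel_measurable borel" using assms by (rule gdom_measurable)
  show ?thesis
  proof (rule Bochner_Integration.integrable_bound[where f = "\<lambda>z. C * (gk_const TYPE('a) s s * gk (2 * s) z)"])
    show "integrable lborel (\<lambda>z::'a. C * (gk_const TYPE('a) s s * gk (2 * s) z))"
      using s by (intro integrable_mult_right integrable_gk) simp
    have "\<bar>(1 + (norm z)\<^sup>2) * \<bar>k z\<bar>\<bar> \<le> \<bar>C * (gk_const TYPE('a) s s * gk (2 * s) z)\<bar>" for z
    proof -
      have "\<bar>(1 + (norm z)\<^sup>2) * \<bar>k z\<bar>\<bar> = (1 + (norm z)\<^sup>2) * \<bar>k z\<bar>" by simp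
      also have "\<dots> \<le> (1 + (norm z)\<^sup>2) * (C * gk s z)"
        using k by (intro mult_left_mono) auto
      also have "\<dots> = C * ((1 + (norm z)\<^sup>2) * gk s z)" by simp
      also have "\<dots> \<le> C * (gk_const TYPE('a) s s * gk (2 * s) z)"
        using s C by (intro mult_left_mono gk_dominated) auto
      finally show ?thesis by simp
    qed
    then show "AE z in lborel. norm ((1 + (norm z)\<^sup>2) * \<bar>k z\<bar>) \<le> norm (C * (gk_const TYPE('a) s s * gk (2 * s) z))"
      by simp
  qed simp
qed

lemma norm_add_sq_le: "1 + (norm (y + z))\<^sup>2 \<le> 2 * (1 + (norm y)\<^sup>2) * (1 + (norm (z::'a::real_normed_vector))\<^sup>2)"
proof -
  have "(norm (y + z))\<^sup>2 \<le> (norm y + norm z)\<^sup>2"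
    by (intro power_mono norm_triangle_ineq) simp
  also have "\<dots> \<le> 2 * (norm y)\<^sup>2 + 2 * (norm z)\<^sup>2"
    using zero_le_power2[of "norm y - norm z"] by (simp add: power2_eq_square algebra_simps)
  finally have "1 + (norm (y + z))\<^sup>2 \<le> 1 + (2 * (norm y)\<^sup>2 + 2 * (norm z)\<^sup>2)" by simp
  also have "\<dots> \<le> 2 * (1 + (norm y)\<^sup>2) * (1 + (norm z)\<^sup>2)"
    by (simp add: algebra_simps)
  finally show ?thesis .
qed

section \<open>Convolution of a law of finite second moment with Gaussian kernels\<close>

locale heat_flow = prob_space \<mu> for \<mu> :: "'a::euclidean_space measure" +
  assumes sets_\<mu> [measurable_cong, simp]: "sets \<mu> = sets borel"
    and second_moment: "integrable \<mu> (\<lambda>y. (norm y)\<^sup>2)"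
begin

lemma space_\<mu> [simp]: "space \<mu> = UNIV"
  using sets_eq_imp_space_eq[OF sets_\<mu>] by simp

lemma prob_UNIV [simp]: "prob UNIV = 1"
  using prob_space by simp

text \<open>For \<open>k = gk t\<close> this is the density of \<open>Y + sqrt t * G\<close>, with
  \<open>Y\<close> of law \<open>\<mu>\<close> and \<open>G\<close> an independent standard
  Gaussian; for \<open>gk1\<close>, \<open>gk2\<close> and \<open>gkt\<close> it is the
  corresponding derivative of that density.\<close>

definition conv :: "('a \<Rightarrow> real) \<Rightarrow> 'a \<Rightarrow> real" where
  "conv k x = (\<integral>y. k (x - y) \<partial>\<mu>)"

lemma integrable_conv:
  assumes "gdom k" shows "integrable \<mu> (\<lambda>y. k (x - y))"
proof -
  have [measurable]: "k \<in> borel_measurable borel" using assms by (rule gdom_measurable)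
  obtain B where "\<And>z. \<bar>k z\<bar> \<le> B" using gdom_bounded[OF assms] by blast
  then show ?thesis by (intro integrable_const_bound[where B = B]) auto
qed

lemma isCont_conv:
  assumes "gdom k" shows "isCont (conv k) x"
  unfolding continuous_at_sequentially
proof (intro allI impI)
  fix X assume X: "X \<longlonglongrightarrow> x"
  have [measurable]: "k \<in> borel_measurable borel" using assms by (rule gdom_measurable)
  have k: "isCont k z" for z
    using assms by (auto simp: gdom_def continuous_on_eq_continuous_at)
  obtain B where B: "\<And>z. \<bar>k z\<bar> \<le> B" using gdom_bounded[OF assms] by blast
  show "(conv k \<circ> X) \<longlonglongrightarrow> conv k x"
    unfolding comp_def conv_def
  proof (rule integral_dominated_convergence[where w = "\<lambda>_. B"])
    show "AE y in \<mu>. (\<lambda>n. k (X n - y)) \<longlonglongrightarrow> k (x - y)"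
      by (intro AE_I2 isCont_tendsto_compose[OF k] tendsto_intros X)
  qed (use B in auto)
qed

lemma continuous_on_conv: "gdom k \<Longrightarrow> continuous_on S (conv k)"
  using isCont_conv by (meson continuous_at_imp_continuous_on)

lemma borel_measurable_conv: "gdom k \<Longrightarrow> conv k \<in> borel_measurable borel"
  by (intro borel_measurable_continuous_onI continuous_on_conv)

lemma conv_abs_le:
  assumes k: "gdom k" and s: "0 < s" and le: "\<And>z. \<bar>k z\<bar> \<le> C * gk s z"
  shows "\<bar>conv k x\<bar> \<le> C * conv (gk s) x"
proof -
  have "\<bar>conv k x\<bar> \<le> (\<integral>y. \<bar>k (x - y)\<bar> \<partial>\<mu>)"
    unfolding conv_def by (rule integral_abs_bound)
  also have "\<dots> \<le> (\<integral>y. C * gk s (x - y) \<partial>\<mu>)"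
    using integrable_conv[OF k] integrable_conv[OF gdom_gk[OF s]] le
    by (intro integral_mono) auto
  finally show ?thesis by (simp add: conv_def)
qed

lemma conv_deriv:
  assumes k: "gdom k" and k': "gdom k'"
    and d: "\<And>z h. ((\<lambda>h. k (z + h *\<^sub>R v)) has_real_derivative k' (z + h *\<^sub>R v)) (at h)"
  shows "((\<lambda>h. conv k (x + h *\<^sub>R v)) has_real_derivative conv k' (x + h *\<^sub>R v)) (at h)"
proof -
  have [measurable]: "k' \<in> borel_measurable borel" using k' by (rule gdom_measurable)
  obtain B where B: "\<And>z. \<bar>k' z\<bar> \<le> B" using gdom_bounded[OF k'] by blast
  show ?thesis unfolding conv_def
  proof (rule has_real_derivative_integral[where \<delta> = 1 and h = "\<lambda>_. B"])
    show "((\<lambda>u. k (x + u *\<^sub>R v - y)) has_real_derivative k' (x + u *\<^sub>R v - y)) (at u)" for u y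
      using d[of "x - y"] by (simp add: algebra_simps)
  qed (use B integrable_conv[OF k] in auto)
qed

lemmas conv_gk_deriv = conv_deriv[OF gdom_gk gdom_gk1 gk_deriv]
lemmas conv_gk1_deriv = conv_deriv[OF gdom_gk1 gdom_gk2 gk1_deriv]

lemma conv_time_deriv:
  assumes t: "0 < t"
  shows "((\<lambda>u. conv (gk u) x) has_real_derivative conv (gkt t) x) (at t)"
  unfolding conv_def
\<comment> \<open>All times closer to \<open>t\<close> than \<open>t / 2\<close> lie in
  \<open>[t / 2, 2 * t]\<close>; \<open>gkt_bound\<close> on that window, at the peak of the
  dominating kernel, gives a constant bound.\<close>
proof (rule has_real_derivative_integral[where \<delta> = "t / 2" and
    h = "\<lambda>_. (1 / (t/2)\<^sup>2 + DIM('a) / (t/2)) * gk_const TYPE('a) (t/2) (2*t) * gk (2 * (2*t)) (0::'a)"])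
  fix u assume u: "\<bar>u - t\<bar> < t / 2"
  then have u': "0 < u" "t / 2 \<le> u" "u \<le> 2 * t" using t by linarith+
  show "integrable \<mu> (\<lambda>y. gk u (x - y))"
    by (rule integrable_conv[OF gdom_gk[OF u'(1)]])
  show "((\<lambda>u. gk u (x - y)) has_real_derivative gkt u (x - y)) (at u)" for y
    by (rule gk_time_deriv[OF u'(1)])
  fix y
  have "\<bar>gkt u (x - y)\<bar> \<le> (1 / (t/2)\<^sup>2 + DIM('a) / (t/2)) * gk_const TYPE('a) (t/2) (2*t) * gk (2 * (2*t)) (x - y)"
    using t u' by (intro gkt_bound) auto
  also have "\<dots> \<le> (1 / (t/2)\<^sup>2 + DIM('a) / (t/2)) * gk_const TYPE('a) (t/2) (2*t) * gk (2 * (2*t)) (0::'a)"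
    using t by (intro mult_left_mono gk_le mult_nonneg_nonneg gk_const_nonneg) auto
  finally show "\<bar>gkt u (x - y)\<bar> \<le> (1 / (t/2)\<^sup>2 + DIM('a) / (t/2)) * gk_const TYPE('a) (t/2) (2*t) * gk (2 * (2*t)) (0::'a)" .
qed (use t in auto)

text \<open>\<open>norm_add_sq_le\<close> splits the weight at \<open>y + z\<close> into a factor in
  \<open>y\<close>, paid for by the second moment of the law, and a factor in \<open>z\<close>, paid
  for by the decay of the kernel; then Fubini applies. Quadratic growth covers squared norms and
  logarithms of the flow density.\<close>

lemma
  fixes k w :: "'a \<Rightarrow> real"
  assumes [measurable]: "k \<in> borel_measurable borel" "w \<in> borel_measurable borel"
    and k: "integrable lborel (\<lambda>z. (1 + (norm z)\<^sup>2) * \<bar>k z\<bar>)"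
    and w: "\<And>x. \<bar>w x\<bar> \<le> C * (1 + (norm x)\<^sup>2)"
  shows conv_weighted_integrable: "integrable lborel (\<lambda>x. w x * conv k x)" (is ?A)
    and conv_weighted_integral: "(\<integral>x. w x * conv k x \<partial>lborel) = (\<integral>y. (\<integral>z. w (y + z) * k z \<partial>lborel) \<partial>\<mu>)" (is ?B)
    and conv_inner_integrable: "integrable lborel (\<lambda>z. w (y + z) * k z)" (is ?C)
    and conv_outer_integrable: "integrable \<mu> (\<lambda>y. \<integral>z. w (y + z) * k z \<partial>lborel)" (is ?D)
proof -
  interpret pair_sigma_finite \<mu> "lborel :: 'a measure" ..
  let ?K = "\<integral>z. (1 + (norm z)\<^sup>2) * \<bar>k z\<bar> \<partial>lborel"
  have C: "0 \<le> C" using w[of 0] by simp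
  have le: "\<bar>w (y + z) * k z\<bar> \<le> (2 * C * (1 + (norm y)\<^sup>2)) * ((1 + (norm z)\<^sup>2) * \<bar>k z\<bar>)" for y z
  proof -
    have "\<bar>w (y + z)\<bar> \<le> C * (2 * (1 + (norm y)\<^sup>2) * (1 + (norm z)\<^sup>2))"
      using w[of "y + z"] mult_left_mono[OF norm_add_sq_le C, of y z] by (rule order_trans)
    then have "\<bar>w (y + z)\<bar> * \<bar>k z\<bar> \<le> C * (2 * (1 + (norm y)\<^sup>2) * (1 + (norm z)\<^sup>2)) * \<bar>k z\<bar>"
      by (rule mult_right_mono) simp
    then show ?thesis by (simp add: abs_mult mult_ac)
  qed
  have i1: "integrable lborel (\<lambda>z. w (y + z) * k z)" for y
  proof (rule Bochner_Integration.integrable_bound[where f = "\<lambda>z. (2 * C * (1 + (norm y)\<^sup>2)) * ((1 + (norm z)\<^sup>2) * \<bar>k z\<bar>)"])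
    show "AE z in lborel. norm (w (y + z) * k z) \<le> norm ((2 * C * (1 + (norm y)\<^sup>2)) * ((1 + (norm z)\<^sup>2) * \<bar>k z\<bar>))"
      using le by (intro AE_I2) (simp add: order_trans[OF _ abs_ge_self])
  qed (use k in auto)
  then show ?C by simp
  have i2: "integrable lborel (\<lambda>x. w x * k (x - y))" for y
    using integrable_lborel_translate[OF i1[of y], of "- y"] by simp
  have s2: "(\<integral>x. w x * k (x - y) \<partial>lborel) = (\<integral>z. w (y + z) * k z \<partial>lborel)" for y
    using integral_lborel_translate[of "\<lambda>z. w (y + z) * k z" "- y"] by simp
  have n2: "(\<integral>x. \<bar>w x * k (x - y)\<bar> \<partial>lborel) = (\<integral>z. \<bar>w (y + z) * k z\<bar> \<partial>lborel)" for y
    using integral_lborel_translate[of "\<lambda>z. \<bar>w (y + z) * k z\<bar>" "- y"] by simp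
  have pair: "integrable (\<mu> \<Otimes>\<^sub>M lborel) (\<lambda>(y, x). w x * k (x - y))"
  proof (rule Fubini_integrable)
    show "integrable \<mu> (\<lambda>y. \<integral>x. norm (case (y, x) of (y, x) \<Rightarrow> w x * k (x - y)) \<partial>lborel)"
    proof (rule Bochner_Integration.integrable_bound[where f = "\<lambda>y. 2 * C * ?K * (1 + (norm y)\<^sup>2)"])
      show "integrable \<mu> (\<lambda>y. 2 * C * ?K * (1 + (norm y)\<^sup>2))"
        using second_moment by simp
      have "(\<integral>x. \<bar>w x * k (x - y)\<bar> \<partial>lborel) \<le> 2 * C * ?K * (1 + (norm y)\<^sup>2)" for y
      proof -
        have "(\<integral>x. \<bar>w x * k (x - y)\<bar> \<partial>lborel) \<le> (\<integral>z. (2 * C * (1 + (norm y)\<^sup>2)) * ((1 + (norm z)\<^sup>2) * \<bar>k z\<bar>) \<partial>lborel)"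
          unfolding n2 using i1 k le by (intro integral_mono) auto
        then show ?thesis unfolding integral_mult_right_zero by (simp only: mult_ac)
      qed
      then show "AE y in \<mu>. norm (\<integral>x. norm (case (y, x) of (y, x) \<Rightarrow> w x * k (x - y)) \<partial>lborel)
          \<le> norm (2 * C * ?K * (1 + (norm y)\<^sup>2))"
        by (intro AE_I2) (simp add: order_trans[OF _ abs_ge_self])
    qed measurable
    show "AE y in \<mu>. integrable lborel (\<lambda>x. case (y, x) of (y, x) \<Rightarrow> w x * k (x - y))"
      using i2 by simp
  qed measurable
  show ?A
    using integrable_snd[OF pair] by (simp add: conv_def)
  show ?B
    using Fubini_integral[OF pair] by (simp add: conv_def s2)
  show ?D
    using integrable_fst[OF pair] by (simp add: s2)
qed

lemma
  fixes w :: "'a \<Rightarrow> real"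
  assumes k: "gdom k" and [measurable]: "w \<in> borel_measurable borel"
    and w: "\<And>x. \<bar>w x\<bar> \<le> C * (1 + (norm x)\<^sup>2)"
  shows gdom_weighted_integrable: "integrable lborel (\<lambda>x. w x * conv k x)"
    and gdom_weighted_integral: "(\<integral>x. w x * conv k x \<partial>lborel) = (\<integral>y. (\<integral>z. w (y + z) * k z \<partial>lborel) \<partial>\<mu>)"
  using conv_weighted_integrable[OF gdom_measurable[OF k] assms(2) gdom_integrable[OF k] w]
    conv_weighted_integral[OF gdom_measurable[OF k] assms(2) gdom_integrable[OF k] w] by auto

section \<open>Moments and pointwise bounds of the flow density\<close>

lemma
  assumes t: "0 < t"
  shows integrable_conv_gk: "integrable lborel (conv (gk t))"
    and integral_conv_gk: "(\<integral>x. conv (gk t) x \<partial>lborel) = 1"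
    and integrable_norm_conv_gk: "integrable lborel (\<lambda>x. (norm x)\<^sup>2 * conv (gk t) x)"
    and integral_norm_conv_gk: "(\<integral>x. (norm x)\<^sup>2 * conv (gk t) x \<partial>lborel) = t * DIM('a) + (\<integral>y. (norm y)\<^sup>2 \<partial>\<mu>)"
proof -
  note g = gdom_gk[OF t, where 'a = 'a]
  show "integrable lborel (conv (gk t))"
    using gdom_weighted_integrable[OF g, of "\<lambda>_. 1" 1] by simp
  show "(\<integral>x. conv (gk t) x \<partial>lborel) = 1"
    using gdom_weighted_integral[OF g, of "\<lambda>_. 1" 1] by (simp add: integral_gk[OF t] prob_space)
  show "integrable lborel (\<lambda>x. (norm x)\<^sup>2 * conv (gk t) x)"
    by (rule gdom_weighted_integrable[OF g, where C = 1]) auto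
  have "(\<integral>x. (norm x)\<^sup>2 * conv (gk t) x \<partial>lborel) = (\<integral>y. (\<integral>z. (norm (y + z))\<^sup>2 * gk t z \<partial>lborel) \<partial>\<mu>)"
    by (rule gdom_weighted_integral[OF g, where C = 1]) auto
  also have "(\<lambda>y::'a. (\<integral>z. (norm (y + z))\<^sup>2 * gk t z \<partial>lborel)) = (\<lambda>y. (norm y)\<^sup>2 + t * DIM('a))"
  proof
    fix y :: 'a
    have "has_bochner_integral lborel (\<lambda>z. (norm y)\<^sup>2 * gk t z + 2 * (gk t z * (z \<bullet> y)) + gk t z * (norm z)\<^sup>2)
        ((norm y)\<^sup>2 * 1 + 2 * 0 + t * DIM('a))"
      using integral_gk[OF t, where 'a = 'a] integrable_gk[OF t, where 'a = 'a]
      by (intro has_bochner_integral_add has_bochner_integral_mult_right gk_first_moment gk_norm_moment t)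
        (auto simp: has_bochner_integral_iff)
    moreover have "(norm y)\<^sup>2 * gk t z + 2 * (gk t z * (z \<bullet> y)) + gk t z * (norm z)\<^sup>2 = (norm (y + z))\<^sup>2 * gk t z" for z
      using norm_line[of y 1 z] by (simp add: power2_norm_eq_inner inner_commute algebra_simps)
    ultimately show "(\<integral>z. (norm (y + z))\<^sup>2 * gk t z \<partial>lborel) = (norm y)\<^sup>2 + t * DIM('a)"
      by (simp add: has_bochner_integral_iff)
  qed
  also have "(\<integral>y. (norm y)\<^sup>2 + t * DIM('a) \<partial>\<mu>) = t * DIM('a) + (\<integral>y. (norm y)\<^sup>2 \<partial>\<mu>)"
    using second_moment by (simp add: prob_space)
  finally show "(\<integral>x. (norm x)\<^sup>2 * conv (gk t) x \<partial>lborel) = t * DIM('a) + (\<integral>y. (norm y)\<^sup>2 \<partial>\<mu>)" .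
qed

lemma conv_gk_le: "0 < t \<Longrightarrow> conv (gk t) x \<le> gk t (0::'a)"
proof -
  assume t: "0 < t"
  have "conv (gk t) x \<le> (\<integral>y. gk t (0::'a) \<partial>\<mu>)"
    unfolding conv_def using integrable_conv[OF gdom_gk[OF t]] t
    by (intro integral_mono) (auto simp: gk_le)
  then show ?thesis by (simp add: prob_space)
qed

text \<open>Since |x - y|^2 is at most 2 |x|^2 + 2 |y|^2, the kernel at \<open>x - y\<close>
  dominates a product in \<open>x\<close> and \<open>y\<close>, and Jensen's inequality for the
  exponential moves the expectation over \<open>y\<close> into the exponent. This Gaussian lower
  bound is what tames the logarithm of the density.\<close>

lemma conv_gk_ge:
  assumes t: "0 < t"
  shows "exp (- ((norm x)\<^sup>2 + (\<integral>y. (norm y)\<^sup>2 \<partial>\<mu>)) / t) * gk t (0::'a) \<le> conv (gk t) x"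
proof -
  have le: "(norm (x - y))\<^sup>2 \<le> 2 * ((norm x)\<^sup>2 + (norm y)\<^sup>2)" for y
  proof -
    have "(norm (x - y))\<^sup>2 \<le> (norm x + norm y)\<^sup>2"
      by (intro power_mono norm_triangle_ineq4) simp
    also have "\<dots> \<le> 2 * ((norm x)\<^sup>2 + (norm y)\<^sup>2)"
      using zero_le_power2[of "norm x - norm y"] by (simp add: power2_eq_square algebra_simps)
    finally show ?thesis .
  qed
  have i: "integrable \<mu> (\<lambda>y. - ((norm x)\<^sup>2 + (norm y)\<^sup>2) / t)"
    using second_moment by simp
  have ie: "integrable \<mu> (\<lambda>y. exp (- ((norm x)\<^sup>2 + (norm y)\<^sup>2) / t))"
  proof (intro integrable_const_bound[where B = 1] AE_I2)
    fix y
    have "- ((norm x)\<^sup>2 + (norm y)\<^sup>2) / t \<le> 0" using t by (intro divide_nonpos_pos) auto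
    then show "norm (exp (- ((norm x)\<^sup>2 + (norm y)\<^sup>2) / t)) \<le> 1"
      by (simp only: norm_exp exp_le_one_iff real_norm_def abs_exp_cancel)
  qed measurable
  have "exp (\<integral>y. - ((norm x)\<^sup>2 + (norm y)\<^sup>2) / t \<partial>\<mu>) \<le> (\<integral>y. exp (- ((norm x)\<^sup>2 + (norm y)\<^sup>2) / t) \<partial>\<mu>)"
    by (rule jensens_inequality[OF i, where I = UNIV])
      (use ie exp_convex in auto)
  also have "(\<integral>y. - ((norm x)\<^sup>2 + (norm y)\<^sup>2) / t \<partial>\<mu>) = - ((norm x)\<^sup>2 + (\<integral>y. (norm y)\<^sup>2 \<partial>\<mu>)) / t"
    using second_moment by (simp add: prob_space)
  finally have "exp (- ((norm x)\<^sup>2 + (\<integral>y. (norm y)\<^sup>2 \<partial>\<mu>)) / t) * gk t (0::'a)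
      \<le> (\<integral>y. exp (- ((norm x)\<^sup>2 + (norm y)\<^sup>2) / t) * gk t (0::'a) \<partial>\<mu>)"
    using t by (simp add: mult_right_mono gk_nonneg)
  also have "\<dots> \<le> conv (gk t) x"
    unfolding conv_def
  proof (rule integral_mono)
    show "integrable \<mu> (\<lambda>y. exp (- ((norm x)\<^sup>2 + (norm y)\<^sup>2) / t) * gk t (0::'a))"
      using ie by simp
    show "integrable \<mu> (\<lambda>y. gk t (x - y))" by (rule integrable_conv[OF gdom_gk[OF t]])
    fix y
    have "- ((norm x)\<^sup>2 + (norm y)\<^sup>2) / t \<le> - (norm (x - y))\<^sup>2 / (2 * t)"
    proof -
      have "(norm (x - y))\<^sup>2 / (2 * t) \<le> 2 * ((norm x)\<^sup>2 + (norm y)\<^sup>2) / (2 * t)"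
        using le[of y] t by (intro divide_right_mono) auto
      moreover have "2 * ((norm x)\<^sup>2 + (norm y)\<^sup>2) / (2 * t) = ((norm x)\<^sup>2 + (norm y)\<^sup>2) / t"
        by (subst mult_divide_mult_cancel_left) auto
      ultimately show ?thesis unfolding minus_divide_left[symmetric] neg_le_iff_le by (simp only:)
    qed
    then have "exp (- ((norm x)\<^sup>2 + (norm y)\<^sup>2) / t) \<le> exp (- (norm (x - y))\<^sup>2 / (2 * t))" by simp
    then have "exp (- ((norm x)\<^sup>2 + (norm y)\<^sup>2) / t) / sqrt ((2 * pi * t) ^ DIM('a))
        \<le> exp (- (norm (x - y))\<^sup>2 / (2 * t)) / sqrt ((2 * pi * t) ^ DIM('a))"
      using t by (intro divide_right_mono) auto
    then show "exp (- ((norm x)\<^sup>2 + (norm y)\<^sup>2) / t) * gk t (0::'a) \<le> gk t (x - y)"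
      by (simp add: gk_def)
  qed
  finally show ?thesis .
qed

lemma conv_gk_pos: "0 < t \<Longrightarrow> 0 < conv (gk t) x"
  using conv_gk_ge[of t x] gk_pos[of t "0::'a"] by (meson exp_gt_zero less_le_trans mult_pos_pos)

lemma ln_gk_0: "0 < t \<Longrightarrow> ln (gk t (0::'a)) = - (DIM('a) / 2 * ln (2 * pi * t))"
  by (simp add: gk_def ln_div ln_sqrt ln_realpow)

text \<open>From above the density is at most the peak of the kernel, from below
  \<open>conv_gk_ge\<close> applies. One constant for all times in \<open>[a, b]\<close> is needed
  to dominate the time derivative in \<open>de_Bruijn\<close>.\<close>

lemma ln_conv_gk_bound:
  assumes a: "0 < a"
  obtains L where "0 \<le> L" "\<And>u x. a \<le> u \<Longrightarrow> u \<le> b \<Longrightarrow> \<bar>ln (conv (gk u) x)\<bar> \<le> L * (1 + (norm x)\<^sup>2)"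
proof -
  define m where "m = (\<integral>y. (norm y)\<^sup>2 \<partial>\<mu>)"
  define c where "c = DIM('a) / 2 * (\<bar>ln (2 * pi * a)\<bar> + \<bar>ln (2 * pi * b)\<bar>)"
  have m: "0 \<le> m" unfolding m_def by simp
  have c: "0 \<le> c" unfolding c_def by simp
  show ?thesis
  proof (rule that)
    show "0 \<le> 1 / a + m / a + c" using a m c by simp
    fix u x assume u: "a \<le> u" "u \<le> b"
    with a have u0: "0 < u" by simp
    have "ln (2 * pi * a) \<le> ln (2 * pi * u)" "ln (2 * pi * u) \<le> ln (2 * pi * b)"
      using a u by auto
    then have "\<bar>ln (2 * pi * u)\<bar> \<le> \<bar>ln (2 * pi * a)\<bar> + \<bar>ln (2 * pi * b)\<bar>" by linarith
    then have "DIM('a) / 2 * \<bar>ln (2 * pi * u)\<bar> \<le> c"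
      unfolding c_def by (intro mult_left_mono) auto
    then have g: "\<bar>ln (gk u (0::'a))\<bar> \<le> c"
      using u0 by (simp add: ln_gk_0 abs_mult)
    have up: "ln (conv (gk u) x) \<le> ln (gk u (0::'a))"
      using conv_gk_le[OF u0, of x] conv_gk_pos[OF u0, of x] gk_pos[OF u0, of "0::'a"]
      by (subst ln_le_cancel_iff) auto
    have "ln (exp (- ((norm x)\<^sup>2 + m) / u) * gk u (0::'a)) \<le> ln (conv (gk u) x)"
      using conv_gk_ge[OF u0, of x] gk_pos[OF u0, of "0::'a"] conv_gk_pos[OF u0, of x]
      unfolding m_def by (subst ln_le_cancel_iff) auto
    then have lo: "- ((norm x)\<^sup>2 + m) / u + ln (gk u (0::'a)) \<le> ln (conv (gk u) x)"
      using gk_pos[OF u0, of "0::'a"] by (simp add: ln_mult)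
    have "((norm x)\<^sup>2 + m) / u \<le> ((norm x)\<^sup>2 + m) / a"
      using a u m by (intro divide_left_mono) auto
    moreover have "0 \<le> ((norm x)\<^sup>2 + m) / a" using a m by simp
    ultimately have "\<bar>ln (conv (gk u) x)\<bar> \<le> ((norm x)\<^sup>2 + m) / a + c"
      using up lo g unfolding minus_divide_left[symmetric] abs_le_iff by linarith
    also have "\<dots> \<le> (1 / a + m / a + c) * (1 + (norm x)\<^sup>2)"
      using a m c by (simp add: algebra_simps add_divide_distrib)
    finally show "\<bar>ln (conv (gk u) x)\<bar> \<le> (1 / a + m / a + c) * (1 + (norm x)\<^sup>2)" .
  qed
qed

lemma integrable_ln_conv_gk:
  assumes t: "0 < t" and k: "gdom k"
  shows "integrable lborel (\<lambda>x. ln (conv (gk t) x) * conv k x)"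
proof -
  obtain L where L: "\<And>x. \<bar>ln (conv (gk t) x)\<bar> \<le> L * (1 + (norm x)\<^sup>2)"
    by (rule ln_conv_gk_bound[OF t, of t]) auto
  have [measurable]: "conv (gk t) \<in> borel_measurable borel"
    by (rule borel_measurable_conv[OF gdom_gk[OF t]])
  show ?thesis by (rule gdom_weighted_integrable[OF k _ L]) measurable
qed

text \<open>Given the value \<open>x\<close> of the flow, the score in direction \<open>v\<close> is
  the conditional mean of \<open>- (z \<bullet> v) / t\<close> with \<open>z = x - y\<close>, and
  the right-hand side is the conditional second moment times the density. The inequality is
  nonnegativity of the conditional variance; it makes the Fisher information finite at positive
  times.\<close>

lemma score_sq_le:
  assumes t: "0 < t"
  shows "(conv (gk1 v t) x)\<^sup>2 / conv (gk t) x \<le> conv (gk2 v t) x + (v \<bullet> v) / t * conv (gk t) x"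
proof -
  define c where "c = conv (gk1 v t) x / conv (gk t) x"
  note i = integrable_conv[OF gdom_gk[OF t], of x] integrable_conv[OF gdom_gk1[OF t], of v x]
    integrable_conv[OF gdom_gk2[OF t], of v x]
  have eq: "(- (z \<bullet> v) / t - c)\<^sup>2 * gk t z = gk2 v t z + (v \<bullet> v) / t * gk t z - 2 * c * gk1 v t z + c\<^sup>2 * gk t z" for z
    by (simp add: gk1_def gk2_def power2_eq_square algebra_simps)
  have "0 \<le> (\<integral>y. (- ((x - y) \<bullet> v) / t - c)\<^sup>2 * gk t (x - y) \<partial>\<mu>)"
    using t by (intro integral_nonneg_AE AE_I2) (auto simp: gk_nonneg)
  also have "\<dots> = conv (gk2 v t) x + (v \<bullet> v) / t * conv (gk t) x - 2 * c * conv (gk1 v t) x + c\<^sup>2 * conv (gk t) x"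
    unfolding eq conv_def using i by simp
  finally have "0 \<le> conv (gk2 v t) x + (v \<bullet> v) / t * conv (gk t) x - (conv (gk1 v t) x)\<^sup>2 / conv (gk t) x"
    using conv_gk_pos[OF t, of x] by (simp add: c_def power2_eq_square)
  then show ?thesis by simp
qed

lemma integrable_score_sq:
  assumes t: "0 < t"
  shows "integrable lborel (\<lambda>x. (conv (gk1 v t) x)\<^sup>2 / conv (gk t) x)"
proof (rule Bochner_Integration.integrable_bound[where f = "\<lambda>x. conv (gk2 v t) x + (v \<bullet> v) / t * conv (gk t) x"])
  have [measurable]: "conv (gk t) \<in> borel_measurable borel" "conv (gk1 v t) \<in> borel_measurable borel"
    using t by (auto intro!: borel_measurable_conv gdom_gk gdom_gk1)
  show "integrable lborel (\<lambda>x. conv (gk2 v t) x + (v \<bullet> v) / t * conv (gk t) x)"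
    using integrable_conv_gk[OF t] gdom_weighted_integrable[OF gdom_gk2[OF t], of "\<lambda>_. 1" 1 v] by simp
  show "(\<lambda>x. (conv (gk1 v t) x)\<^sup>2 / conv (gk t) x) \<in> borel_measurable lborel" by measurable
  have n: "\<bar>(conv (gk1 v t) x)\<^sup>2 / conv (gk t) x\<bar> = (conv (gk1 v t) x)\<^sup>2 / conv (gk t) x" for x
    using conv_gk_pos[OF t, of x] by simp
  show "AE x in lborel. norm ((conv (gk1 v t) x)\<^sup>2 / conv (gk t) x) \<le> norm (conv (gk2 v t) x + (v \<bullet> v) / t * conv (gk t) x)"
    unfolding real_norm_def n
    by (intro AE_I2 order_trans[OF score_sq_le[OF t] abs_ge_self])
qed

section \<open>Fisher information, entropy and de Bruijn's identity\<close>

definition fisher :: "real \<Rightarrow> real" where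
  "fisher t = (\<Sum>e\<in>Basis. \<integral>x. (conv (gk1 e t) x)\<^sup>2 / conv (gk t) x \<partial>lborel)"

definition neg_entropy :: "real \<Rightarrow> real" where
  "neg_entropy t = (\<integral>x. conv (gk t) x * ln (conv (gk t) x) \<partial>lborel)"

text \<open>The derivative of \<open>(ln p + 1) * q1\<close> along \<open>v\<close> is
  \<open>(ln p + 1) * q2 + q1\<^sup>2 / p\<close>, and its integral vanishes. The constant 1 is the
  one in the derivative of \<open>p * ln p\<close>.\<close>

lemma ln_conv_gk_by_parts:
  assumes t: "0 < t"
  shows "(\<integral>x. (ln (conv (gk t) x) + 1) * conv (gk2 v t) x \<partial>lborel) = - (\<integral>x. (conv (gk1 v t) x)\<^sup>2 / conv (gk t) x \<partial>lborel)"
proof -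
  let ?p = "conv (gk t)" and ?q1 = "conv (gk1 v t)" and ?q2 = "conv (gk2 v t)"
  note pos = conv_gk_pos[OF t]
  have i2: "integrable lborel (\<lambda>x. (ln (?p x) + 1) * ?q2 x)"
    using integrable_ln_conv_gk[OF t gdom_gk2[OF t]] gdom_weighted_integrable[OF gdom_gk2[OF t], of "\<lambda>_. 1" 1 v]
    by (simp add: distrib_right)
  have "(\<integral>x. 1 * ((ln (?p x) + 1) * ?q2 x + (?q1 x)\<^sup>2 / ?p x) \<partial>lborel) = 0"
  proof (rule integral_directional_derivative_eq_0[where \<Phi> = "\<lambda>x. (ln (?p x) + 1) * ?q1 x" and v = v and B = 1])
    fix x
    note d1 = conv_gk_deriv[OF t t, where h = 0 and x = x and v = v, simplified]
      and d2 = conv_gk1_deriv[OF t t, where h = 0 and x = x and v = v, simplified]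
    have "((\<lambda>h. (ln (?p (x + h *\<^sub>R v)) + 1) * ?q1 (x + h *\<^sub>R v)) has_real_derivative
        (?q1 (x + 0 *\<^sub>R v) / ?p (x + 0 *\<^sub>R v)) * ?q1 (x + 0 *\<^sub>R v) + ?q2 (x + 0 *\<^sub>R v) * (ln (?p (x + 0 *\<^sub>R v)) + 1)) (at 0)"
      using pos[of "x + 0 *\<^sub>R v"]
      using t by (auto intro!: derivative_eq_intros d1 d2)
    then show "((\<lambda>h. (ln (?p (x + h *\<^sub>R v)) + 1) * ?q1 (x + h *\<^sub>R v)) has_real_derivative
        (ln (?p x) + 1) * ?q2 x + (?q1 x)\<^sup>2 / ?p x) (at 0)"
      by (simp add: power2_eq_square algebra_simps)
    have c: "continuous_on UNIV (\<lambda>h. conv k (x + h *\<^sub>R v))" if "gdom k" for k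
      by (rule continuous_on_compose2[OF continuous_on_conv[OF that, of UNIV]]) (auto intro!: continuous_intros)
    show "continuous_on UNIV (\<lambda>h. (ln (?p (x + h *\<^sub>R v)) + 1) * ?q2 (x + h *\<^sub>R v) + (?q1 (x + h *\<^sub>R v))\<^sup>2 / ?p (x + h *\<^sub>R v))"
      using pos by (intro continuous_intros c gdom_gk gdom_gk1 gdom_gk2 t) (simp_all add: less_imp_neq[THEN not_sym])
  next
    show "integrable lborel (\<lambda>x. (ln (?p x) + 1) * ?q1 x)"
      using integrable_ln_conv_gk[OF t gdom_gk1[OF t]] gdom_weighted_integrable[OF gdom_gk1[OF t], of "\<lambda>_. 1" 1 v]
      by (simp add: distrib_right)
    show "integrable lborel (\<lambda>x. (ln (?p x) + 1) * ?q2 x + (?q1 x)\<^sup>2 / ?p x)"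
      using i2 integrable_score_sq[OF t] by (rule Bochner_Integration.integrable_add)
  qed auto
  then show ?thesis
    using Bochner_Integration.integral_add[OF i2 integrable_score_sq[OF t, of v]] by simp
qed

text \<open>The time derivative of \<open>p * ln p\<close> is \<open>ln p + 1\<close> times
  \<open>conv (gkt t)\<close>; the heat equation turns the latter into half the sum of second
  derivatives, and each direction is integrated by parts.\<close>

lemma de_Bruijn:
  assumes t: "0 < t"
  shows "(neg_entropy has_real_derivative - (1 / 2) * fisher t) (at t)"
proof -
  let ?a = "t / 2" and ?b = "2 * t"
  obtain L where L: "0 \<le> L" "\<And>u x. ?a \<le> u \<Longrightarrow> u \<le> ?b \<Longrightarrow> \<bar>ln (conv (gk u) x)\<bar> \<le> L * (1 + (norm x)\<^sup>2)"
    using ln_conv_gk_bound[of ?a ?b] t by auto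
  define C where "C = (1 / ?a\<^sup>2 + DIM('a) / ?a) * gk_const TYPE('a) ?a ?b"
  have C: "0 \<le> C" using t unfolding C_def by (intro mult_nonneg_nonneg gk_const_nonneg) auto
  have [measurable]: "conv (gk t) \<in> borel_measurable borel" "conv (gkt t) \<in> borel_measurable borel"
    using t by (auto intro!: borel_measurable_conv gdom_gk gdom_gkt)
  have "((\<lambda>u. \<integral>x. conv (gk u) x * ln (conv (gk u) x) \<partial>lborel) has_real_derivative
      (\<integral>x. (ln (conv (gk t) x) + 1) * conv (gkt t) x \<partial>lborel)) (at t)"
  \<comment> \<open>On the window \<open>[t / 2, 2 * t]\<close> the logarithm grows quadratically
    and the time derivative is below a multiple of the flow at time \<open>2 * ?b\<close>; the
    product is integrable because that flow has a second moment.\<close>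
  proof (rule has_real_derivative_integral[where \<delta> = "t / 2" and
        h = "\<lambda>x. ((L + 1) * C) * (conv (gk (2 * ?b)) x + (norm x)\<^sup>2 * conv (gk (2 * ?b)) x)"])
    fix u assume u: "\<bar>u - t\<bar> < t / 2"
    then have u': "0 < u" "?a \<le> u" "u \<le> ?b" using t by linarith+
    show "integrable lborel (\<lambda>x. conv (gk u) x * ln (conv (gk u) x))"
      using integrable_ln_conv_gk[OF u'(1) gdom_gk[OF u'(1)]] by (simp add: mult.commute)
    show "((\<lambda>u. conv (gk u) x * ln (conv (gk u) x)) has_real_derivative (ln (conv (gk u) x) + 1) * conv (gkt u) x) (at u)" for x
      using conv_gk_pos[OF u'(1), of x]
      by (auto intro!: derivative_eq_intros conv_time_deriv u' simp: algebra_simps)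
    fix x
    have "\<bar>conv (gkt u) x\<bar> \<le> C * conv (gk (2 * ?b)) x"
      unfolding C_def using t u' by (intro conv_abs_le gdom_gkt gkt_bound) auto
    moreover have "\<bar>ln (conv (gk u) x) + 1\<bar> \<le> (L + 1) * (1 + (norm x)\<^sup>2)"
    proof -
      have "\<bar>ln (conv (gk u) x) + 1\<bar> \<le> L * (1 + (norm x)\<^sup>2) + 1" using L(2)[OF u'(2,3), of x] by linarith
      also have "\<dots> \<le> (L + 1) * (1 + (norm x)\<^sup>2)" by (simp add: algebra_simps)
      finally show ?thesis .
    qed
    ultimately have "\<bar>ln (conv (gk u) x) + 1\<bar> * \<bar>conv (gkt u) x\<bar> \<le> ((L + 1) * (1 + (norm x)\<^sup>2)) * (C * conv (gk (2 * ?b)) x)"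
      using L(1) by (intro mult_mono) auto
    then show "\<bar>(ln (conv (gk u) x) + 1) * conv (gkt u) x\<bar> \<le> ((L + 1) * C) * (conv (gk (2 * ?b)) x + (norm x)\<^sup>2 * conv (gk (2 * ?b)) x)"
      unfolding abs_mult by (rule order_trans) (simp add: algebra_simps)
  next
    show "integrable lborel (\<lambda>x. ((L + 1) * C) * (conv (gk (2 * ?b)) x + (norm x)\<^sup>2 * conv (gk (2 * ?b)) x))"
      using t by (intro integrable_mult_right Bochner_Integration.integrable_add integrable_conv_gk integrable_norm_conv_gk) auto
  qed (use t in auto)
  moreover have "(\<integral>x. (ln (conv (gk t) x) + 1) * conv (gkt t) x \<partial>lborel) = - (1 / 2) * fisher t"
  proof -
    have i: "integrable lborel (\<lambda>x. (ln (conv (gk t) x) + 1) * conv (gk2 e t) x)" for e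
      using integrable_ln_conv_gk[OF t gdom_gk2[OF t]] gdom_weighted_integrable[OF gdom_gk2[OF t], of "\<lambda>_. 1" 1 e]
      by (simp add: distrib_right)
    have s: "conv (gkt t) x = (1 / 2) * (\<Sum>e\<in>Basis. conv (gk2 e t) x)" for x
    proof -
      have "(\<Sum>e\<in>Basis. conv (gk2 e t) x) = (\<integral>y. (\<Sum>e\<in>Basis. gk2 e t (x - y)) \<partial>\<mu>)"
        unfolding conv_def by (rule Bochner_Integration.integral_sum[symmetric]) (rule integrable_conv[OF gdom_gk2[OF t]])
      then show ?thesis by (simp add: sum_gk2_Basis conv_def)
    qed
    have "(\<integral>x. (ln (conv (gk t) x) + 1) * conv (gkt t) x \<partial>lborel)
        = (\<integral>x. (1 / 2) * (\<Sum>e\<in>Basis. (ln (conv (gk t) x) + 1) * conv (gk2 e t) x) \<partial>lborel)"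
      by (simp add: s sum_distrib_left)
    also have "\<dots> = (1 / 2) * (\<Sum>e\<in>Basis. \<integral>x. (ln (conv (gk t) x) + 1) * conv (gk2 e t) x \<partial>lborel)"
      using i by (subst integral_mult_right_zero, subst Bochner_Integration.integral_sum) auto
    finally show ?thesis
      by (simp add: ln_conv_gk_by_parts[OF t] fisher_def sum_negf)
  qed
  ultimately show ?thesis
    unfolding neg_entropy_def[abs_def] by simp
qed

end

section \<open>Poincare inequalities\<close>

lemma DERIV_imp_continuous_on:
  fixes F f :: "real \<Rightarrow> real"
  shows "(\<And>x. (F has_real_derivative f x) (at x)) \<Longrightarrow> continuous_on S F"
  by (rule DERIV_continuous_on, rule has_field_derivative_at_within)

lemma integral_derivative_eq_0_real:
  fixes F f :: "real \<Rightarrow> real"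
  assumes d: "\<And>x. (F has_real_derivative f x) (at x)" and c: "continuous_on UNIV f"
    and i: "integrable lborel F" "integrable lborel f"
  shows "(\<integral>x. f x \<partial>lborel) = 0"
proof -
  have "(\<integral>x. 1 * f x \<partial>lborel) = 0"
  proof (rule integral_directional_derivative_eq_0[where \<Phi> = F and v = 1 and B = 1])
    show "((\<lambda>h. F (x + h *\<^sub>R 1)) has_real_derivative f x) (at 0)" for x
      using DERIV_shift[of F "f x" 0 x] d[of x] by (simp add: add.commute)
    show "continuous_on UNIV (\<lambda>h. f (x + h *\<^sub>R 1))" for x
      by (rule continuous_on_compose2[OF c]) (auto intro!: continuous_intros)
  qed (use i in auto)
  then show ?thesis by simp
qed

definition left_tail :: "(real \<Rightarrow> real) \<Rightarrow> real \<Rightarrow> real" where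
  "left_tail h x = (\<integral>y. h y * indicator {..x} y \<partial>lborel)"

lemma left_tail_add:
  assumes h: "integrable lborel h" and "a \<le> x"
  shows "left_tail h x = left_tail h a + (\<integral>y. h y * indicator {a..x} y \<partial>lborel)"
proof -
  have i: "integrable lborel (\<lambda>y. h y * indicator A y)" if "A \<in> sets borel" for A
    using integrable_mult_indicator[of A lborel h] h that by (simp add: mult.commute)
  have "left_tail h x = (\<integral>y. h y * indicator {..a} y + h y * indicator {a..x} y \<partial>lborel)"
    unfolding left_tail_def
  proof (rule integral_cong_AE)
    \<comment> \<open>Both intervals contain \<open>a\<close>, so the splitting can fail at this one
      point, a null set.\<close>
    have "AE y in lborel. y \<noteq> a" by (rule AE_lborel_singleton)
    then show "AE y in lborel. h y * indicator {..x} y = h y * indicator {..a} y + h y * indicator {a..x} y"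
      by eventually_elim (use \<open>a \<le> x\<close> in \<open>auto simp: indicator_def\<close>)
  qed (use h in auto)
  also have "\<dots> = left_tail h a + (\<integral>y. h y * indicator {a..x} y \<partial>lborel)"
    unfolding left_tail_def by (rule Bochner_Integration.integral_add) (auto intro: i)
  finally show ?thesis .
qed

lemma left_tail_deriv:
  assumes h: "integrable lborel h" and c: "continuous_on UNIV h"
  shows "(left_tail h has_real_derivative h x) (at x)"
proof -
  let ?a = "x - 1" and ?b = "x + 1"
  have eq: "left_tail h y = left_tail h ?a + integral {?a..y} h" if "y \<in> {?a<..<?b}" for y
  proof -
    have "set_integrable lborel {?a..y} h"
      by (rule borel_integrable_atLeastAtMost') (rule continuous_on_subset[OF c], simp)
    then have "(LINT z:{?a..y}|lborel. h z) = integral {?a..y} h"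
      by (rule set_borel_integral_eq_integral)
    then have "(\<integral>z. h z * indicator {?a..y} z \<partial>lborel) = integral {?a..y} h"
      by (simp add: set_lebesgue_integral_def mult.commute)
    then show ?thesis using left_tail_add[OF h, of ?a y] that by simp
  qed
  have "((\<lambda>y. integral {?a..y} h) has_real_derivative h x) (at x within {?a..?b})"
    by (rule integral_has_real_derivative) (auto intro: continuous_on_subset[OF c])
  then have "((\<lambda>y. integral {?a..y} h) has_real_derivative h x) (at x)"
    by (simp add: at_within_Icc_at)
  then have "((\<lambda>y. left_tail h ?a + integral {?a..y} h) has_real_derivative h x) (at x)"
    by (auto intro!: derivative_eq_intros)
  then show ?thesis
    by (rule has_field_derivative_transform_within_open[where S = "{?a<..<?b}"]) (use eq in auto)
qed

text \<open>If \<open>x\<close> and \<open>s\<close> have the same sign, (x + s)^2 is at least x^2 +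
  s^2. A tail that starts at \<open>x\<close> and leads away from the origin is thereby at most a
  multiple of the kernel at \<open>x\<close>.\<close>

lemma gk_shift_le:
  fixes x s :: real
  assumes t: "0 < t" and x: "0 \<le> x * s"
  shows "gk t (x + s) \<le> gk t x * gk t s / gk t (0::real)"
proof -
  have "(x + s)\<^sup>2 \<ge> x\<^sup>2 + s\<^sup>2" using x by (simp add: power2_sum mult.commute)
  then have "- (x + s)\<^sup>2 / (2 * t) \<le> - x\<^sup>2 / (2 * t) + - s\<^sup>2 / (2 * t)"
    using t unfolding add_divide_distrib[symmetric] by (intro divide_right_mono) auto
  then have "exp (- (x + s)\<^sup>2 / (2 * t)) \<le> exp (- x\<^sup>2 / (2 * t)) * exp (- s\<^sup>2 / (2 * t))"
    by (simp only: exp_add[symmetric] exp_le_cancel_iff)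
  moreover define S where "S = sqrt (2 * pi * t)"
  moreover have S: "0 < S" using t by (simp add: S_def)
  ultimately have "exp (- (x + s)\<^sup>2 / (2 * t)) / S \<le> exp (- x\<^sup>2 / (2 * t)) * exp (- s\<^sup>2 / (2 * t)) / S"
    by (intro divide_right_mono) auto
  also have "\<dots> = (exp (- x\<^sup>2 / (2 * t)) / S) * (exp (- s\<^sup>2 / (2 * t)) / S) / (1 / S)"
    using S by simp
  finally show ?thesis
    unfolding gk_def DIM_real power_one_right S_def[symmetric] by simp
qed

text \<open>Away from the origin \<open>gk_shift_le\<close> factors out \<open>gk t x\<close>. For
  positive \<open>x\<close> the left tail runs across the origin, and the zero mean exchanges it for
  minus the right tail.\<close>

lemma left_tail_gk_bound:
  fixes g :: "real \<Rightarrow> real"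
  assumes t: "0 < t" and [measurable]: "g \<in> borel_measurable borel" and G: "\<And>x. \<bar>g x\<bar> \<le> G"
    and mean: "(\<integral>x. g x * gk t x \<partial>lborel) = 0"
  shows "\<bar>left_tail (\<lambda>x. g x * gk t x) x\<bar> \<le> G / gk t (0::real) * gk t x"
proof -
  let ?h = "\<lambda>x. g x * gk t x"
  have G0: "0 \<le> G" using G[of 0] by simp
  have ig: "integrable lborel (\<lambda>x. G * gk t (x::real))" using t by (simp add: integrable_gk)
  have ih: "integrable lborel ?h"
  proof (rule Bochner_Integration.integrable_bound[OF ig])
    show "AE x in lborel. norm (?h x) \<le> norm (G * gk t x)"
      using G G0 t by (intro AE_I2) (simp add: abs_mult gk_nonneg mult_right_mono)
  qed simp
  have hs: "\<bar>?h y\<bar> \<le> G / gk t (0::real) * gk t x * gk t (y - x)" if "0 \<le> x * (y - x)" for y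
  proof -
    have "\<bar>?h y\<bar> \<le> G * gk t y" using G[of y] t by (simp add: abs_mult gk_nonneg mult_right_mono)
    also have "\<dots> \<le> G * (gk t x * gk t (y - x) / gk t (0::real))"
      using gk_shift_le[OF t that] G0 by (intro mult_left_mono) auto
    finally show ?thesis by (simp add: mult_ac)
  qed
  have key: "\<bar>\<integral>y. ?h y * indicator A y \<partial>lborel\<bar> \<le> G / gk t (0::real) * gk t x"
    if A: "A \<in> sets borel" "\<And>y. y \<in> A \<Longrightarrow> 0 \<le> x * (y - x)" for A
  proof -
    have [measurable]: "A \<in> sets borel" by fact
    have i1: "integrable lborel (\<lambda>y. G / gk t (0::real) * gk t x * gk t (y - x))"
      using integrable_lborel_translate[OF integrable_gk[OF t, where 'a = real], of "- x"] by simp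
    have "\<bar>\<integral>y. ?h y * indicator A y \<partial>lborel\<bar> \<le> (\<integral>y. \<bar>?h y * indicator A y\<bar> \<partial>lborel)"
      by (rule integral_abs_bound)
    also have "\<dots> \<le> (\<integral>y. G / gk t (0::real) * gk t x * gk t (y - x) \<partial>lborel)"
    proof (rule integral_mono)
      show "integrable lborel (\<lambda>y. \<bar>?h y * indicator A y\<bar>)"
        using integrable_mult_indicator[of A lborel ?h] ih by (simp add: mult.commute)
      show "\<bar>?h y * indicator A y\<bar> \<le> G / gk t (0::real) * gk t x * gk t (y - x)" for y
        using hs[OF A(2)] G0 t by (cases "y \<in> A") (auto simp: gk_nonneg)
    qed (rule i1)
    also have "\<dots> = G / gk t (0::real) * gk t x"
      using integral_lborel_translate[of "gk t" "- x"] integral_gk[OF t, where 'a = real] by simp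
    finally show ?thesis .
  qed
  show ?thesis
  proof (cases "x \<le> 0")
    case True
    then show ?thesis unfolding left_tail_def
      by (intro key) (auto simp: mult_nonpos_nonpos)
  next
    case False
    have i: "integrable lborel (\<lambda>y. ?h y * indicator A y)" if "A \<in> sets borel" for A
      using integrable_mult_indicator[of A lborel ?h] ih that by (simp add: mult.commute)
    have "0 = (\<integral>y. ?h y * indicator {..x} y + ?h y * indicator {x<..} y \<partial>lborel)"
      unfolding mean[symmetric] by (rule Bochner_Integration.integral_cong) (auto simp: indicator_def)
    also have "\<dots> = left_tail ?h x + (\<integral>y. ?h y * indicator {x<..} y \<partial>lborel)"
      unfolding left_tail_def by (rule Bochner_Integration.integral_add) (auto intro: i)
    finally have "\<bar>left_tail ?h x\<bar> = \<bar>\<integral>y. ?h y * indicator {x<..} y \<partial>lborel\<bar>" by linarith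
    also have "\<dots> \<le> G / gk t (0::real) * gk t x"
      using False by (intro key) auto
    finally show ?thesis .
  qed
qed

section \<open>The Gaussian Poincare inequality\<close>

lemma bounded_gk_integrable:
  fixes g :: "'a::euclidean_space \<Rightarrow> real"
  assumes t: "0 < t" and [measurable]: "g \<in> borel_measurable borel" and G: "\<And>x. \<bar>g x\<bar> \<le> G * (1 + (norm x)\<^sup>2)"
  shows "integrable lborel (\<lambda>x. g x * gk t x)"
proof (rule Bochner_Integration.integrable_bound[where f = "\<lambda>x. G * ((1 + (norm x)\<^sup>2) * \<bar>gk t x\<bar>)"])
  show "integrable lborel (\<lambda>x::'a. G * ((1 + (norm x)\<^sup>2) * \<bar>gk t x\<bar>))"
    by (intro integrable_mult_right gdom_integrable gdom_gk t)
  have "\<bar>g x * gk t x\<bar> \<le> G * ((1 + (norm x)\<^sup>2) * \<bar>gk t x\<bar>)" for x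
    using mult_right_mono[OF G, of "\<bar>gk t x\<bar>" x] by (simp add: abs_mult mult_ac)
  then show "AE x in lborel. norm (g x * gk t x) \<le> norm (G * ((1 + (norm x)\<^sup>2) * \<bar>gk t x\<bar>))"
    by (intro AE_I2) (simp add: order_trans[OF _ abs_ge_self])
qed simp

lemma gk_real_deriv: "0 < t \<Longrightarrow> (gk t has_real_derivative - (x / t) * gk t x) (at (x::real))"
  using gk_deriv[of t x 1 0] DERIV_shift[of "gk t" "- (x / t) * gk t x" 0 x]
  by (simp add: gk1_def add.commute)

text \<open>Dividing the antiderivative \<open>K\<close> of \<open>g * gk t\<close> by the kernel
  gives a solution \<open>k\<close> of \<open>k' = g + x * k / t\<close>, bounded by
  \<open>left_tail_gk_bound\<close>. Integration by parts writes the variance of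
  \<open>\<psi>\<close> as the integral of \<open>- u * k\<close>, a second identity bounds the norm
  of \<open>k\<close> by that of \<open>g\<close>, and Young's inequality closes the
  estimate.\<close>

lemma gaussian_poincare:
  fixes \<psi> u :: "real \<Rightarrow> real"
  assumes t: "0 < t"
    and d: "\<And>x. (\<psi> has_real_derivative u x) (at x)" and cu: "continuous_on UNIV u"
    and B: "\<And>x. \<bar>\<psi> x\<bar> \<le> B" and B': "\<And>x. \<bar>u x\<bar> \<le> B'"
    and m: "m = (\<integral>x. \<psi> x * gk t x \<partial>lborel)"
  shows "(\<integral>x. (\<psi> x - m)\<^sup>2 * gk t x \<partial>lborel) \<le> t * (\<integral>x. (u x)\<^sup>2 * gk t x \<partial>lborel)"
proof -
  define g where "g x = \<psi> x - m" for x
  define G where "G = B + \<bar>m\<bar>"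
  define K where "K = left_tail (\<lambda>x. g x * gk t x)"
  define k where "k x = K x / gk t x" for x
  define C where "C = G / gk t (0::real)"
  have pos: "0 < gk t x" for x :: real using t by (rule gk_pos)
  have c\<psi>: "continuous_on UNIV \<psi>"
    by (rule DERIV_imp_continuous_on[OF d])
  then have cg: "continuous_on UNIV g" unfolding g_def by (intro continuous_intros)
  have [measurable]: "\<psi> \<in> borel_measurable borel" "u \<in> borel_measurable borel" "g \<in> borel_measurable borel"
    using c\<psi> cu cg by (auto intro: borel_measurable_continuous_onI)
  have gG: "\<bar>g x\<bar> \<le> G" for x using B[of x] by (simp add: g_def G_def)
  have G0: "0 \<le> G" using gG[of 0] by simp
  have B'0: "0 \<le> B'" using B'[of 0] by simp
  have C0: "0 \<le> C" using G0 pos by (simp add: C_def less_imp_le)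
  have grow: "a \<le> a * (1 + (norm x)\<^sup>2)" if "0 \<le> a" for a and x :: real
    using that by (simp add: algebra_simps)
  have ibd: "integrable lborel (\<lambda>x. h x * gk t x)" if "h \<in> borel_measurable borel" "\<And>x. \<bar>h x\<bar> \<le> a * (1 + x\<^sup>2)" for h :: "real \<Rightarrow> real" and a
    using bounded_gk_integrable[OF t that(1), of a] that(2) by simp
  have ibd0: "integrable lborel (\<lambda>x. h x * gk t x)" if "h \<in> borel_measurable borel" "\<And>x. \<bar>h x\<bar> \<le> a" for h :: "real \<Rightarrow> real" and a
  proof (rule ibd[OF that(1), of a])
    fix x
    have "0 \<le> a" using that(2)[of 0] by simp
    then show "\<bar>h x\<bar> \<le> a * (1 + x\<^sup>2)"
      using that(2)[of x] grow[of a x] by simp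
  qed
  have i\<psi>: "integrable lborel (\<lambda>x. \<psi> x * gk t x)"
    by (rule ibd0[OF _ B]) measurable
  have ig: "integrable lborel (\<lambda>x. g x * gk t x)"
    by (rule ibd0[OF _ gG]) measurable
  have mean: "(\<integral>x. g x * gk t x \<partial>lborel) = 0"
    using i\<psi> integrable_gk[OF t, where 'a = real] integral_gk[OF t, where 'a = real]
    by (simp add: g_def left_diff_distrib m)
  have K': "(K has_real_derivative g x * gk t x) (at x)" for x
    unfolding K_def by (rule left_tail_deriv[OF ig]) (intro continuous_intros cg continuous_on_gk)
  have kC: "\<bar>k x\<bar> \<le> C" for x
  proof -
    have "\<bar>K x\<bar> \<le> C * gk t x"
      unfolding K_def C_def by (rule left_tail_gk_bound[OF t _ gG mean]) measurable
    then show ?thesis using pos[of x] by (simp add: k_def divide_le_eq)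
  qed
  have Kk: "K x = k x * gk t x" for x using pos[of x] by (simp add: k_def)
  have k': "(k has_real_derivative g x + x * k x / t) (at x)" for x
  proof -
    have "((\<lambda>x. K x / gk t x) has_real_derivative
        (g x * gk t x * gk t x - K x * (- (x / t) * gk t x)) / (gk t x * gk t x)) (at x)"
      by (rule DERIV_divide[OF K' gk_real_deriv[OF t]]) (use pos[of x] in simp)
    moreover have "(g x * gk t x * gk t x - K x * (- (x / t) * gk t x)) / (gk t x * gk t x) = g x + x * k x / t"
      using pos[of x] by (simp add: Kk field_simps)
    ultimately show ?thesis unfolding k_def[abs_def, symmetric] by simp
  qed
  have ck: "continuous_on UNIV k"
    by (rule DERIV_imp_continuous_on[OF k'])
  then have [measurable]: "k \<in> borel_measurable borel" by (rule borel_measurable_continuous_onI)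
  have abs2: "\<bar>a * b\<bar> \<le> A * D" if "\<bar>a\<bar> \<le> A" "\<bar>b\<bar> \<le> D" for a b A D :: real
    using that by (auto simp: abs_mult intro!: mult_mono)
  have x1: "\<bar>x\<bar> \<le> 1 + x\<^sup>2" for x :: real
    using sum_squares_ge_zero[of "\<bar>x\<bar> - 1/2" 0] by (simp add: power2_eq_square algebra_simps)
  have iuk: "integrable lborel (\<lambda>x. (u x * k x) * gk t x)"
  proof (rule ibd0[where a = "B' * C"])
    show "\<bar>u x * k x\<bar> \<le> B' * C" for x by (rule abs2[OF B' kC])
    show "(\<lambda>x. u x * k x) \<in> borel_measurable borel" by (intro borel_measurable_times) measurable
  qed
  have igk: "integrable lborel (\<lambda>x. (g x * k x) * gk t x)"
    by (rule ibd0[OF _ abs2[OF gG kC]]) measurable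
  have igg: "integrable lborel (\<lambda>x. (g x)\<^sup>2 * gk t x)"
    unfolding power2_eq_square
    by (rule ibd0[OF _ abs2[OF gG gG]]) measurable
  have ikk: "integrable lborel (\<lambda>x. (k x)\<^sup>2 * gk t x)"
    unfolding power2_eq_square
    by (rule ibd0[OF _ abs2[OF kC kC]]) measurable
  have iuu: "integrable lborel (\<lambda>x. (u x)\<^sup>2 * gk t x)"
    unfolding power2_eq_square
    by (rule ibd0[OF _ abs2[OF B' B']]) measurable
  have ixkk: "integrable lborel (\<lambda>x. (k x * k x * x) * gk t x)"
    by (rule ibd[of _ "C * C"]) (use abs2[OF abs2[OF kC kC] x1] in auto)
  have ixkg: "integrable lborel (\<lambda>x. (k x * g x * x) * gk t x)"
    by (rule ibd[of _ "C * G"]) (use abs2[OF abs2[OF kC gG] x1] in auto)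
  have ixxkk: "integrable lborel (\<lambda>x. (k x * k x * x\<^sup>2) * gk t x)"
    by (rule ibd[OF _ abs2[OF abs2[OF kC kC]]]) auto
  have k'sq: "(g x + x * k x / t)\<^sup>2 * gk t x
      = (g x)\<^sup>2 * gk t x + (2 / t) * ((k x * g x * x) * gk t x) + (1 / t\<^sup>2) * ((k x * k x * x\<^sup>2) * gk t x)" for x
    using t by (simp add: power2_eq_square field_simps)
  have ik': "integrable lborel (\<lambda>x. (g x + x * k x / t)\<^sup>2 * gk t x)"
    unfolding k'sq using igg ixkg ixxkk by simp
  have e1: "(\<integral>x. (u x * k x) * gk t x + (g x)\<^sup>2 * gk t x \<partial>lborel) = 0"
  proof (rule integral_derivative_eq_0_real[where F = "\<lambda>x. g x * K x"])
    show "((\<lambda>x. g x * K x) has_real_derivative (u x * k x) * gk t x + (g x)\<^sup>2 * gk t x) (at x)" for x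
    proof -
      have "((\<lambda>x. \<psi> x - m) has_real_derivative u x) (at x)" using d[of x] by (auto intro!: derivative_eq_intros)
      then have "(g has_real_derivative u x) (at x)" by (simp add: g_def[abs_def])
      from DERIV_mult[OF this K'[of x]] show ?thesis by (simp add: Kk power2_eq_square algebra_simps)
    qed
    show "continuous_on UNIV (\<lambda>x. (u x * k x) * gk t x + (g x)\<^sup>2 * gk t x)"
      by (intro continuous_intros cu ck cg continuous_on_gk)
    show "integrable lborel (\<lambda>x. g x * K x)" using igk by (simp add: Kk mult.assoc)
  qed (use iuk igg in simp)
  \<comment> \<open>Differentiating \<open>k\<^sup>2 * x * gk t\<close> and inserting the equation
    for \<open>k'\<close> yields \<open>k\<^sup>2 + t * k'\<^sup>2 - t * g\<^sup>2\<close> times the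
    kernel; dropping the nonnegative middle term leaves \<open>k2\<close>.\<close>
  have e2: "(\<integral>x. (k x)\<^sup>2 * gk t x + t * ((g x + x * k x / t)\<^sup>2 * gk t x) - t * ((g x)\<^sup>2 * gk t x) \<partial>lborel) = 0"
  proof (rule integral_derivative_eq_0_real[where F = "\<lambda>x. (k x * k x * x) * gk t x"])
    fix x
    have "((\<lambda>x. (k x * k x * x) * gk t x) has_real_derivative
       (((g x + x * k x / t) * k x + (g x + x * k x / t) * k x) * x + 1 * (k x * k x)) * gk t x
        + (- (x / t) * gk t x) * (k x * k x * x)) (at x)"
      by (intro DERIV_mult k' gk_real_deriv[OF t] DERIV_ident)
    moreover have "(((g x + x * k x / t) * k x + (g x + x * k x / t) * k x) * x + 1 * (k x * k x)) * gk t x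
        + (- (x / t) * gk t x) * (k x * k x * x)
        = (k x)\<^sup>2 * gk t x + t * ((g x + x * k x / t)\<^sup>2 * gk t x) - t * ((g x)\<^sup>2 * gk t x)"
      using t by (simp add: power2_eq_square field_simps)
    ultimately show "((\<lambda>x. (k x * k x * x) * gk t x) has_real_derivative
        (k x)\<^sup>2 * gk t x + t * ((g x + x * k x / t)\<^sup>2 * gk t x) - t * ((g x)\<^sup>2 * gk t x)) (at x)" by simp
  next
    show "continuous_on UNIV (\<lambda>x. (k x)\<^sup>2 * gk t x + t * ((g x + x * k x / t)\<^sup>2 * gk t x) - t * ((g x)\<^sup>2 * gk t x))"
      using t by (intro continuous_intros ck cg continuous_on_gk) auto
  qed (use ixkk ikk ik' igg in auto)
  let ?g2 = "\<integral>x. (g x)\<^sup>2 * gk t x \<partial>lborel" and ?k2 = "\<integral>x. (k x)\<^sup>2 * gk t x \<partial>lborel"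
    and ?u2 = "\<integral>x. (u x)\<^sup>2 * gk t x \<partial>lborel"
  have "t * ?g2 = ?k2 + t * (\<integral>x. (g x + x * k x / t)\<^sup>2 * gk t x \<partial>lborel)"
    using e2 ikk ik' igg by simp
  moreover have "0 \<le> (\<integral>x. (g x + x * k x / t)\<^sup>2 * gk t x \<partial>lborel)"
    using pos by (intro integral_nonneg_AE AE_I2) (simp add: less_imp_le)
  ultimately have k2: "?k2 \<le> t * ?g2" using t by simp
  have "?g2 = (\<integral>x. - ((u x * k x) * gk t x) \<partial>lborel)"
    using e1 iuk igg by simp
  \<comment> \<open>The weights are balanced so that, by \<open>k2\<close>, the second term is at
    most half of the left-hand side and can be absorbed.\<close>
  also have "\<dots> \<le> (\<integral>x. (t / 2) * ((u x)\<^sup>2 * gk t x) + (1 / (2 * t)) * ((k x)\<^sup>2 * gk t x) \<partial>lborel)"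
  proof (rule integral_mono)
    fix x
    have "- (u x * k x) \<le> (t / 2) * (u x)\<^sup>2 + (1 / (2 * t)) * (k x)\<^sup>2"
    proof -
      have "0 \<le> (t * u x + k x)\<^sup>2 / (2 * t)" using t by simp
      also have "\<dots> = (t / 2) * (u x)\<^sup>2 + (1 / (2 * t)) * (k x)\<^sup>2 + u x * k x"
        using t by (simp add: power2_eq_square field_simps)
      finally show ?thesis by simp
    qed
    from mult_right_mono[OF this, of "gk t x"] show "- ((u x * k x) * gk t x) \<le> (t / 2) * ((u x)\<^sup>2 * gk t x) + (1 / (2 * t)) * ((k x)\<^sup>2 * gk t x)"
      using pos[of x] by (simp add: algebra_simps)
  qed (use iuk iuu ikk in auto)
  also have "\<dots> = (t / 2) * ?u2 + (1 / (2 * t)) * ?k2"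
    using iuu ikk by simp
  also have "\<dots> \<le> (t / 2) * ?u2 + (1 / (2 * t)) * (t * ?g2)"
    using k2 t by (intro add_left_mono mult_left_mono) auto
  also have "\<dots> = (t / 2) * ?u2 + ?g2 / 2" using t by simp
  finally have "?g2 \<le> t * ?u2" by simp
  then show ?thesis by (simp add: g_def)
qed

text \<open>Induction on the coefficients: each factor \<open>z\<close> is absorbed by half of the
  exponent, so the induction hypothesis is used at \<open>2 * s\<close>.\<close>

lemma poly_exp_bounded:
  fixes Q :: "real poly"
  assumes "0 < s" shows "\<exists>C. \<forall>z. \<bar>poly Q z\<bar> * exp (- z\<^sup>2 / s) \<le> C"
  using assms
proof (induction Q arbitrary: s)
  case 0
  then show ?case by (intro exI[of _ 0]) simp
next
  case (pCons a q)
  from pCons.IH[of "2 * s"] pCons.prems obtain C where C: "\<And>z. \<bar>poly q z\<bar> * exp (- z\<^sup>2 / (2 * s)) \<le> C" by auto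
  have z: "\<bar>z\<bar> * exp (- z\<^sup>2 / (2 * s)) \<le> 1 + 2 * s" for z :: real
  proof -
    have "\<bar>z\<bar> \<le> 1 + z\<^sup>2"
      using sum_squares_ge_zero[of "\<bar>z\<bar> - 1/2" 0] by (simp add: power2_eq_square algebra_simps)
    also have "\<dots> \<le> (1 + 2 * s) * (1 + z\<^sup>2 / (2 * s))"
      using pCons.prems by (simp add: field_simps)
    also have "\<dots> \<le> (1 + 2 * s) * exp (z\<^sup>2 / (2 * s))"
      using pCons.prems by (intro mult_left_mono exp_ge_add_one_self) auto
    finally have "\<bar>z\<bar> * exp (- z\<^sup>2 / (2 * s)) \<le> (1 + 2 * s) * exp (z\<^sup>2 / (2 * s)) * exp (- z\<^sup>2 / (2 * s))"
      by (rule mult_right_mono) simp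
    then show ?thesis by (simp add: mult.assoc exp_add[symmetric])
  qed
  show ?case
  proof (intro exI[of _ "\<bar>a\<bar> + (1 + 2 * s) * C"] allI)
    fix z :: real
    have e: "exp (- z\<^sup>2 / s) = exp (- z\<^sup>2 / (2 * s)) * exp (- z\<^sup>2 / (2 * s))"
      using pCons.prems by (simp add: exp_add[symmetric] field_simps)
    have "\<bar>poly (pCons a q) z\<bar> * exp (- z\<^sup>2 / s) \<le> (\<bar>a\<bar> + \<bar>z\<bar> * \<bar>poly q z\<bar>) * exp (- z\<^sup>2 / s)"
      by (intro mult_right_mono) (auto simp: abs_mult[symmetric])
    also have "\<dots> = \<bar>a\<bar> * exp (- z\<^sup>2 / s) + (\<bar>z\<bar> * exp (- z\<^sup>2 / (2 * s))) * (\<bar>poly q z\<bar> * exp (- z\<^sup>2 / (2 * s)))"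
      unfolding e by (simp add: algebra_simps)
    also have "\<dots> \<le> \<bar>a\<bar> * 1 + (1 + 2 * s) * C"
    proof (intro add_mono mult_mono)
      have "- z\<^sup>2 / s \<le> 0" using pCons.prems by (intro divide_nonpos_pos) auto
      then show "exp (- z\<^sup>2 / s) \<le> 1" by (simp only: exp_le_one_iff)
    qed (use z C pCons.prems in auto)
    finally show "\<bar>poly (pCons a q) z\<bar> * exp (- z\<^sup>2 / s) \<le> \<bar>a\<bar> + (1 + 2 * s) * C" by simp
  qed
qed

text \<open>Derivatives of a Gaussian mollification keep this form: differentiating in
  \<open>y\<close> sends \<open>P\<close> to \<open>z * P / t - P'\<close>. One induction over this
  closed family yields all iterated derivatives.\<close>

definition gauss_smooth :: "(real \<Rightarrow> real) \<Rightarrow> real \<Rightarrow> real poly \<Rightarrow> real \<Rightarrow> real" where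
  "gauss_smooth \<psi> t P y = (\<integral>w. \<psi> w * (poly P (w - y) * gk t (w - y)) \<partial>lborel)"

lemma gauss_smooth_deriv:
  assumes t: "0 < t" and [measurable]: "\<psi> \<in> borel_measurable borel" and B: "\<And>x. \<bar>\<psi> x\<bar> \<le> B"
  shows "(gauss_smooth \<psi> t P has_real_derivative
    gauss_smooth \<psi> t (smult (1 / t) (pCons 0 P) - pderiv P) y) (at y)"
proof -
  have [measurable]: "poly Q \<in> borel_measurable borel" for Q :: "real poly"
    by (intro borel_measurable_continuous_onI continuous_intros)
  have B0: "0 \<le> B" using B[of 0] by simp
  \<comment> \<open>Half of the exponent at \<open>w - y'\<close> absorbs the polynomial into
    \<open>C\<close>; the other half is compared with the exponent at \<open>w - y\<close> by (w -
    y)^2 \<le> 2 (w - y')^2 + 2, at the price of \<open>exp (1 / (4 * t))\<close> and of a kernel at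
    time \<open>4 * t\<close>.\<close>
  define bnd where "bnd C w = B * (C * exp (1 / (4 * t)) * sqrt (8 * pi * t) / sqrt (2 * pi * t) * gk (4 * t) (w - y))" for C and w :: real
  have i: "integrable lborel (bnd C)" for C
    unfolding bnd_def using integrable_lborel_translate[OF integrable_gk[of "4 * t", where 'a = real], of "- y"] t
    by (intro integrable_mult_right) auto
  have dom: "\<exists>C. \<forall>w y'. \<bar>y' - y\<bar> < 1 \<longrightarrow> \<bar>\<psi> w * (poly Q (w - y') * gk t (w - y'))\<bar> \<le> bnd C w" for Q
  proof -
    obtain C where C: "\<And>z. \<bar>poly Q z\<bar> * exp (- z\<^sup>2 / (4 * t)) \<le> C"
      using poly_exp_bounded[of "4 * t" Q] t by auto
    have C0: "0 \<le> C" using C[of 0] by (meson abs_ge_zero exp_ge_zero mult_nonneg_nonneg order_trans)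
    have "\<bar>\<psi> w * (poly Q (w - y') * gk t (w - y'))\<bar> \<le> bnd C w" if y': "\<bar>y' - y\<bar> < 1" for w y'
    proof -
      let ?z = "w - y'"
      have "(w - y)\<^sup>2 \<le> 2 * ?z\<^sup>2 + 2 * (y' - y)\<^sup>2"
        using zero_le_power2[of "?z - (y' - y)"] by (simp add: power2_eq_square algebra_simps)
      moreover have "(y' - y)\<^sup>2 \<le> 1" using y' by (simp add: abs_square_le_1)
      ultimately have "(w - y)\<^sup>2 - 2 \<le> 2 * ?z\<^sup>2" by simp
      then have "((w - y)\<^sup>2 - 2) / (8 * t) \<le> 2 * ?z\<^sup>2 / (8 * t)"
        using t by (intro divide_right_mono) auto
      then have "- ?z\<^sup>2 / (4 * t) \<le> 1 / (4 * t) + - (w - y)\<^sup>2 / (8 * t)"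
        by (simp add: diff_divide_distrib)
      then have e1: "exp (- ?z\<^sup>2 / (4 * t)) \<le> exp (1 / (4 * t)) * exp (- (w - y)\<^sup>2 / (8 * t))"
        by (simp only: exp_add[symmetric] exp_le_cancel_iff)
      have e2: "exp (- ?z\<^sup>2 / (2 * t)) = exp (- ?z\<^sup>2 / (4 * t)) * exp (- ?z\<^sup>2 / (4 * t))"
        using t by (simp add: exp_add[symmetric] field_simps)
      have "\<bar>poly Q ?z * gk t ?z\<bar> = (\<bar>poly Q ?z\<bar> * exp (- ?z\<^sup>2 / (4 * t))) * exp (- ?z\<^sup>2 / (4 * t)) / sqrt (2 * pi * t)"
        using t e2 by (simp add: gk_def abs_mult)
      also have "\<dots> \<le> C * (exp (1 / (4 * t)) * exp (- (w - y)\<^sup>2 / (8 * t))) / sqrt (2 * pi * t)"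
        using t C e1 C0 by (intro divide_right_mono mult_mono) auto
      also have "\<dots> = C * exp (1 / (4 * t)) * sqrt (8 * pi * t) / sqrt (2 * pi * t) * gk (4 * t) (w - y)"
      proof -
        define K where "K = sqrt (8 * pi * t)"
        have K: "K \<noteq> 0" using t by (simp add: K_def)
        have e: "2 * pi * (4 * t) = 8 * pi * t" "2 * (4 * t) = 8 * t" by simp_all
        have "K * gk (4 * t) (w - y) = exp (- (w - y)\<^sup>2 / (8 * t))"
          unfolding gk_def e DIM_real power_one_right K_def[symmetric] using K by simp
        then show ?thesis unfolding K_def by (simp add: mult.assoc)
      qed
      finally have "\<bar>\<psi> w\<bar> * \<bar>poly Q ?z * gk t ?z\<bar> \<le> bnd C w"
        unfolding bnd_def using B[of w] B0 by (intro mult_mono) auto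
      then show ?thesis by (simp add: abs_mult)
    qed
    then show ?thesis by blast
  qed
  let ?Q = "smult (1 / t) (pCons 0 P) - pderiv P"
  obtain C1 where C1: "\<And>w y'. \<bar>y' - y\<bar> < 1 \<Longrightarrow> \<bar>\<psi> w * (poly P (w - y') * gk t (w - y'))\<bar> \<le> bnd C1 w"
    using dom[of P] by blast
  obtain C2 where C2: "\<And>w y'. \<bar>y' - y\<bar> < 1 \<Longrightarrow> \<bar>\<psi> w * (poly ?Q (w - y') * gk t (w - y'))\<bar> \<le> bnd C2 w"
    using dom[of ?Q] by blast
  show ?thesis
    unfolding gauss_smooth_def[abs_def]
  proof (rule has_real_derivative_integral[where \<delta> = 1 and h = "bnd C2"])
    fix u :: real assume u: "\<bar>u - y\<bar> < 1"
    show "integrable lborel (\<lambda>w. \<psi> w * (poly P (w - u) * gk t (w - u)))"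
      by (rule Bochner_Integration.integrable_bound[OF i[of C1]])
        (use C1[OF u] in \<open>auto intro!: AE_I2 simp: order_trans[OF _ abs_ge_self]\<close>)
    fix w
    show "\<bar>\<psi> w * (poly ?Q (w - u) * gk t (w - u))\<bar> \<le> bnd C2 w" by (rule C2[OF u])
    have "((\<lambda>u. w - u) has_real_derivative - 1) (at u)" by (auto intro!: derivative_eq_intros)
    from DERIV_chain2[OF poly_DERIV this] DERIV_chain2[OF gk_real_deriv[OF t] this]
    have "((\<lambda>u. poly P (w - u) * gk t (w - u)) has_real_derivative
        poly (pderiv P) (w - u) * - 1 * gk t (w - u) + - ((w - u) / t) * gk t (w - u) * - 1 * poly P (w - u)) (at u)"
      by (rule DERIV_mult)
    from DERIV_cmult[OF this, of "\<psi> w"]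
    show "((\<lambda>u. \<psi> w * (poly P (w - u) * gk t (w - u))) has_real_derivative \<psi> w * (poly ?Q (w - u) * gk t (w - u))) (at u)"
      by (rule DERIV_cong) (simp add: algebra_simps diff_divide_distrib)
  qed (use i in auto)
qed

lemma smooth_gauss_smooth:
  assumes t: "0 < t" and m: "\<psi> \<in> borel_measurable borel" and B: "\<And>x. \<bar>\<psi> x\<bar> \<le> B"
  shows "smooth (gauss_smooth \<psi> t P)"
proof -
  note d = gauss_smooth_deriv[OF t m B]
  have "\<exists>Q. (deriv ^^ k) (gauss_smooth \<psi> t P) = gauss_smooth \<psi> t Q" for k
  proof (induction k)
    case (Suc k)
    then obtain Q where Q: "(deriv ^^ k) (gauss_smooth \<psi> t P) = gauss_smooth \<psi> t Q" by blast
    have "deriv (gauss_smooth \<psi> t Q) = gauss_smooth \<psi> t (smult (1 / t) (pCons 0 Q) - pderiv Q)"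
      by (intro ext DERIV_imp_deriv d)
    with Q show ?case by auto
  qed auto
  then show ?thesis unfolding smooth_def
    by (metis d field_differentiable_def)
qed

section \<open>The spectral gap along the heat flow\<close>

locale gap_flow = heat_flow \<nu> for \<nu> :: "real measure" +
  fixes c :: real
  assumes c_pos: "0 < c" and gap: "has_spectral_gap \<nu> c"
begin

lemma spectral_gap_bounded:
  assumes g: "smooth g" and d: "\<And>x. (g has_real_derivative g' x) (at x)"
    and [measurable]: "g' \<in> borel_measurable borel"
    and B: "\<And>x. \<bar>g x\<bar> \<le> B" "\<And>x. \<bar>g' x\<bar> \<le> B'" and mean: "(\<integral>x. g x \<partial>\<nu>) = 0"
  shows "(\<integral>x. (g x)\<^sup>2 \<partial>\<nu>) \<le> 1 / c * (\<integral>x. (g' x)\<^sup>2 \<partial>\<nu>)"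
proof -
  have "continuous_on UNIV g"
    by (rule DERIV_imp_continuous_on[OF d])
  then have [measurable]: "g \<in> borel_measurable borel" by (rule borel_measurable_continuous_onI)
  have dg: "deriv g x = g' x" for x by (rule DERIV_imp_deriv[OF d])
  have i: "integrable \<nu> g" by (rule integrable_const_bound[where B = B]) (use B in auto)
  have B0: "0 \<le> B" "0 \<le> B'" using B(1)[of 0] B(2)[of 0] by linarith+
  have i2: "integrable \<nu> (\<lambda>x. (g x)\<^sup>2)"
    by (rule integrable_const_bound[where B = "B\<^sup>2"]) (use B B0 in \<open>auto simp: abs_le_square_iff[symmetric]\<close>)
  have i2': "integrable \<nu> (\<lambda>x. (g' x)\<^sup>2)"
    by (rule integrable_const_bound[where B = "B'\<^sup>2"]) (use B B0 in \<open>auto simp: abs_le_square_iff[symmetric]\<close>)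
  have "(\<integral>\<^sup>+x. ennreal ((g x)\<^sup>2) \<partial>\<nu>) \<le> ennreal (1 / c) * (\<integral>\<^sup>+x. ennreal ((g' x)\<^sup>2) \<partial>\<nu>)"
    using gap g i mean unfolding has_spectral_gap_def dg[symmetric] by blast
  moreover have "(\<integral>\<^sup>+x. ennreal ((g x)\<^sup>2) \<partial>\<nu>) = ennreal (\<integral>x. (g x)\<^sup>2 \<partial>\<nu>)"
    by (rule nn_integral_eq_integral[OF i2]) simp
  moreover have "(\<integral>\<^sup>+x. ennreal ((g' x)\<^sup>2) \<partial>\<nu>) = ennreal (\<integral>x. (g' x)\<^sup>2 \<partial>\<nu>)"
    by (rule nn_integral_eq_integral[OF i2']) simp
  moreover have "ennreal (1 / c) * ennreal (\<integral>x. (g' x)\<^sup>2 \<partial>\<nu>) = ennreal (1 / c * (\<integral>x. (g' x)\<^sup>2 \<partial>\<nu>))"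
    using c_pos by (intro ennreal_mult[symmetric]) (auto intro!: integral_nonneg_AE)
  ultimately have "ennreal (\<integral>x. (g x)\<^sup>2 \<partial>\<nu>) \<le> ennreal (1 / c * (\<integral>x. (g' x)\<^sup>2 \<partial>\<nu>))"
    by (simp only:)
  then show ?thesis
    using c_pos by (subst (asm) ennreal_le_iff) (auto intro!: mult_nonneg_nonneg integral_nonneg_AE)
qed

text \<open>Conditioning on the initial point splits the variance: \<open>gaussian_poincare\<close>
  bounds the part of the Gaussian increment with constant \<open>t\<close>, and the conditional mean
  \<open>\<psi>b\<close> is smooth, so that the gap of \<open>\<nu>\<close> applies with constant
  \<open>1 / c\<close>. The mollification thereby also extends the gap to bounded functions with
  merely continuous bounded derivative.\<close>

lemma poincare_heat:
  assumes t: "0 < t"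
    and d: "\<And>x. (\<psi> has_real_derivative u x) (at x)" and cu: "continuous_on UNIV u"
    and B: "\<And>x. \<bar>\<psi> x\<bar> \<le> B" and B': "\<And>x. \<bar>u x\<bar> \<le> B'"
    and m: "m = (\<integral>x. \<psi> x * conv (gk t) x \<partial>lborel)"
  shows "(\<integral>x. (\<psi> x - m)\<^sup>2 * conv (gk t) x \<partial>lborel) \<le> (1 / c + t) * (\<integral>x. (u x)\<^sup>2 * conv (gk t) x \<partial>lborel)"
proof -
  have c\<psi>: "continuous_on UNIV \<psi>"
    by (rule DERIV_imp_continuous_on[OF d])
  have [measurable]: "\<psi> \<in> borel_measurable borel" "u \<in> borel_measurable borel"
    using c\<psi> cu by (auto intro: borel_measurable_continuous_onI)
  have igk: "integrable lborel (gk t :: real \<Rightarrow> real)" and gk1: "(\<integral>z. gk t (z::real) \<partial>lborel) = 1"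
    using integrable_gk[OF t] integral_gk[OF t] by auto
  have bi: "integrable lborel (\<lambda>z. h z * gk t z)" if "h \<in> borel_measurable borel" "\<And>x. \<bar>h x\<bar> \<le> D" for h :: "real \<Rightarrow> real" and D
  proof (rule Bochner_Integration.integrable_bound[where f = "\<lambda>z. D * gk t z"])
    show "AE z in lborel. norm (h z * gk t z) \<le> norm (D * gk t z)"
      using that(2) t by (intro AE_I2) (simp add: abs_mult gk_nonneg mult_right_mono order_trans[OF _ abs_ge_self])
  qed (use that igk in auto)
  have le1: "\<bar>\<integral>z. h z * gk t z \<partial>lborel\<bar> \<le> D" if "h \<in> borel_measurable borel" "\<And>x. \<bar>h x\<bar> \<le> D" for h :: "real \<Rightarrow> real" and D
  proof -
    have "\<bar>\<integral>z. h z * gk t z \<partial>lborel\<bar> \<le> (\<integral>z. \<bar>h z * gk t z\<bar> \<partial>lborel)" by (rule integral_abs_bound)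
    also have "\<dots> \<le> (\<integral>z. D * gk t (z::real) \<partial>lborel)"
    proof (rule integral_mono)
      show "integrable lborel (\<lambda>z. \<bar>h z * gk t z\<bar>)" using bi[OF that] by (rule integrable_abs)
    qed (use igk that(2) t in \<open>auto simp: abs_mult gk_nonneg mult_right_mono\<close>)
    finally show ?thesis using gk1 by simp
  qed
  have wi: "(\<integral>x. h x * conv (gk t) x \<partial>lborel) = (\<integral>y. (\<integral>z. h (y + z) * gk t z \<partial>lborel) \<partial>\<nu>)"
    and wo: "integrable \<nu> (\<lambda>y. \<integral>z. h (y + z) * gk t z \<partial>lborel)"
    if "h \<in> borel_measurable borel" "\<And>x. \<bar>h x\<bar> \<le> D" for h D
  proof -
    have "0 \<le> D" using that(2)[of 0] by simp
    then have g: "\<bar>h x\<bar> \<le> D * (1 + (norm x)\<^sup>2)" for x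
    proof -
      have "0 \<le> D * x\<^sup>2" using \<open>0 \<le> D\<close> by (intro mult_nonneg_nonneg) auto
      then show ?thesis using that(2)[of x] unfolding distrib_left real_norm_def power2_abs by linarith
    qed
    show "(\<integral>x. h x * conv (gk t) x \<partial>lborel) = (\<integral>y. (\<integral>z. h (y + z) * gk t z \<partial>lborel) \<partial>\<nu>)"
      by (rule gdom_weighted_integral[OF gdom_gk[OF t] that(1) g])
    show "integrable \<nu> (\<lambda>y. \<integral>z. h (y + z) * gk t z \<partial>lborel)"
      by (rule conv_outer_integrable[OF _ that(1) gdom_integrable[OF gdom_gk[OF t]] g]) measurable
  qed
  define \<psi>b where "\<psi>b y = (\<integral>z. \<psi> (y + z) * gk t z \<partial>lborel)" for y
  define ub where "ub y = (\<integral>z. u (y + z) * gk t z \<partial>lborel)" for y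
  define g where "g y = \<psi>b y - m" for y
  define V where "V y = (\<integral>z. (u (y + z))\<^sup>2 * gk t z \<partial>lborel)" for y
  have m': "m = (\<integral>y. \<psi>b y \<partial>\<nu>)" and i\<psi>b: "integrable \<nu> \<psi>b"
    unfolding m \<psi>b_def using wi[of \<psi> B] wo[of \<psi> B] B by auto
  have [measurable]: "ub \<in> borel_measurable borel" unfolding ub_def by measurable
  have \<psi>b_le: "\<bar>\<psi>b y\<bar> \<le> B" for y unfolding \<psi>b_def by (rule le1) (use B in auto)
  have ub_le: "\<bar>ub y\<bar> \<le> B'" for y unfolding ub_def by (rule le1) (use B' in auto)
  have d\<psi>b: "(\<psi>b has_real_derivative ub y) (at y)" for y
    unfolding \<psi>b_def[abs_def] ub_def
  proof (rule has_real_derivative_integral[where \<delta> = 1 and h = "\<lambda>z. B' * gk t z"])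
    fix v z :: real
    show "integrable lborel (\<lambda>z. \<psi> (v + z) * gk t z)" by (rule bi) (use B in auto)
    have "((\<lambda>v. \<psi> (v + z)) has_real_derivative u (v + z)) (at v)"
      using d[of "v + z"] by (simp add: DERIV_shift)
    from DERIV_cmult_right[OF this, of "gk t z"]
    show "((\<lambda>v. \<psi> (v + z) * gk t z) has_real_derivative u (v + z) * gk t z) (at v)" .
    show "\<bar>u (v + z) * gk t z\<bar> \<le> B' * gk t z"
      using B' t by (simp add: abs_mult gk_nonneg mult_right_mono)
  qed (use igk in auto)
  have dg: "(g has_real_derivative ub y) (at y)" for y
    unfolding g_def[abs_def] using d\<psi>b[of y] by (auto intro!: derivative_eq_intros)
  have sg: "smooth g"
  proof -
    have "g = gauss_smooth (\<lambda>x. \<psi> x - m) t 1"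
    proof
      fix y
      have "gauss_smooth (\<lambda>x. \<psi> x - m) t 1 y = (\<integral>w. (\<psi> (y + (w + - y)) - m) * gk t (w + - y) \<partial>lborel)"
        by (simp add: gauss_smooth_def)
      also have "\<dots> = (\<integral>z. (\<psi> (y + z) - m) * gk t z \<partial>lborel)"
        by (rule integral_lborel_translate) measurable
      also have "\<dots> = \<psi>b y - m"
      proof -
        have "integrable lborel (\<lambda>z. \<psi> (y + z) * gk t z)" by (rule bi) (use B in auto)
        then show ?thesis using igk gk1 by (simp add: \<psi>b_def left_diff_distrib)
      qed
      finally show "g y = gauss_smooth (\<lambda>x. \<psi> x - m) t 1 y" by (simp add: g_def)
    qed
    moreover have "\<bar>\<psi> x - m\<bar> \<le> B + \<bar>m\<bar>" for x using B[of x] by linarith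
    ultimately show ?thesis using smooth_gauss_smooth[OF t, of "\<lambda>x. \<psi> x - m" "B + \<bar>m\<bar>" 1] by simp
  qed
  have g_le: "\<bar>g y\<bar> \<le> B + \<bar>m\<bar>" for y unfolding g_def using \<psi>b_le[of y] by linarith
  have gm: "(\<integral>y. g y \<partial>\<nu>) = 0"
    using i\<psi>b by (simp add: g_def m'[symmetric])
  have G: "(\<integral>y. (g y)\<^sup>2 \<partial>\<nu>) \<le> 1 / c * (\<integral>y. (ub y)\<^sup>2 \<partial>\<nu>)"
    by (rule spectral_gap_bounded[OF sg dg _ g_le ub_le gm]) measurable
  have B0: "0 \<le> B'" using B'[of 0] by simp
  have u2: "\<bar>(u x)\<^sup>2\<bar> \<le> B'\<^sup>2" for x using B'[of x] B0 by (simp add: abs_le_square_iff[symmetric])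
  have p2: "\<bar>(\<psi> x - a)\<^sup>2\<bar> \<le> (B + \<bar>a\<bar>)\<^sup>2" for x a
    using B[of x] by (simp add: abs_le_square_iff[symmetric])
  have iV: "integrable \<nu> V" unfolding V_def using wo[of "\<lambda>x. (u x)\<^sup>2", OF _ u2] by simp
  have EV: "(\<integral>x. (u x)\<^sup>2 * conv (gk t) x \<partial>lborel) = (\<integral>y. V y \<partial>\<nu>)"
    unfolding V_def using wi[of "\<lambda>x. (u x)\<^sup>2", OF _ u2] by simp
  have var: "(\<integral>z. (h z - a)\<^sup>2 * gk t z \<partial>lborel) = (\<integral>z. (h z)\<^sup>2 * gk t z \<partial>lborel) - 2 * a * (\<integral>z. h z * gk t z \<partial>lborel) + a\<^sup>2"
    if "h \<in> borel_measurable borel" "\<And>x. \<bar>h x\<bar> \<le> D" for h :: "real \<Rightarrow> real" and a D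
  proof -
    have "0 \<le> D" using that(2)[of 0] by simp
    then have h2: "\<bar>(h x)\<^sup>2\<bar> \<le> D\<^sup>2" for x using that(2)[of x] by (simp add: abs_le_square_iff[symmetric])
    have i2: "integrable lborel (\<lambda>z. (h z)\<^sup>2 * gk t z)" by (rule bi[OF _ h2]) (use that in measurable)
    have "(\<integral>z. (h z - a)\<^sup>2 * gk t z \<partial>lborel) = (\<integral>z. (h z)\<^sup>2 * gk t z - 2 * a * (h z * gk t z) + a\<^sup>2 * gk t z \<partial>lborel)"
      by (rule Bochner_Integration.integral_cong) (auto simp: power2_eq_square algebra_simps)
    also have "\<dots> = (\<integral>z. (h z)\<^sup>2 * gk t z \<partial>lborel) - 2 * a * (\<integral>z. h z * gk t z \<partial>lborel) + a\<^sup>2"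
      using i2 bi[OF that] igk gk1 by simp
    finally show ?thesis .
  qed
  \<comment> \<open>Jensen's inequality, obtained from the nonnegative variance of
    \<open>u (y + z)\<close> around its mean \<open>ub y\<close>.\<close>
  have ubV: "(ub y)\<^sup>2 \<le> V y" for y
  proof -
    have "0 \<le> (\<integral>z. (u (y + z) - ub y)\<^sup>2 * gk t z \<partial>lborel)"
      using t by (intro integral_nonneg_AE AE_I2) (simp add: gk_nonneg)
    also have "\<dots> = V y - 2 * ub y * ub y + (ub y)\<^sup>2"
      unfolding V_def ub_def by (rule var) (use B' in auto)
    finally show ?thesis by (simp add: power2_eq_square)
  qed
  have iub: "integrable \<nu> (\<lambda>y. (ub y)\<^sup>2)"
    by (rule integrable_const_bound[where B = "B'\<^sup>2"]) (use ub_le B0 in \<open>auto simp: abs_le_square_iff[symmetric]\<close>)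
  have ig2: "integrable \<nu> (\<lambda>y. (g y)\<^sup>2)"
  proof (rule integrable_const_bound[where B = "(B + \<bar>m\<bar>)\<^sup>2"])
    have "(g y)\<^sup>2 \<le> (B + \<bar>m\<bar>)\<^sup>2" for y
      using power_mono[OF g_le[of y] abs_ge_zero, of 2] by simp
    then show "AE y in \<nu>. norm ((g y)\<^sup>2) \<le> (B + \<bar>m\<bar>)\<^sup>2" by simp
    show "(\<lambda>y. (g y)\<^sup>2) \<in> borel_measurable \<nu>" using i\<psi>b unfolding g_def by measurable
  qed
  \<comment> \<open>The mean square around \<open>m\<close> is the variance around
    \<open>\<psi>b y\<close> plus the squared distance of the two centres.\<close>
  have inner: "(\<integral>z. (\<psi> (y + z) - m)\<^sup>2 * gk t z \<partial>lborel) \<le> t * V y + (g y)\<^sup>2" for y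
  proof -
    have "(\<integral>z. (\<psi> (y + z) - \<psi>b y)\<^sup>2 * gk t z \<partial>lborel) \<le> t * V y"
      unfolding V_def
    proof (rule gaussian_poincare[OF t _ _ _ _ \<psi>b_def])
      show "((\<lambda>z. \<psi> (y + z)) has_real_derivative u (y + z)) (at z)" for z
        using d[of "y + z"] DERIV_shift[of \<psi> "u (y + z)" z y] by (simp add: add.commute)
      show "continuous_on UNIV (\<lambda>z. u (y + z))"
        by (rule continuous_on_compose2[OF cu]) (auto intro!: continuous_intros)
    qed (use B B' in auto)
    moreover define X where "X = (\<integral>z. (\<psi> (y + z))\<^sup>2 * gk t z \<partial>lborel)"
    have v: "(\<integral>z. (\<psi> (y + z) - a)\<^sup>2 * gk t z \<partial>lborel) = X - 2 * a * \<psi>b y + a\<^sup>2" for a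
      unfolding \<psi>b_def X_def by (rule var) (use B in auto)
    ultimately have "X - 2 * \<psi>b y * \<psi>b y + (\<psi>b y)\<^sup>2 \<le> t * V y" by (simp only:)
    then show ?thesis unfolding v g_def by (simp add: power2_eq_square algebra_simps)
  qed
  have "(\<integral>x. (\<psi> x - m)\<^sup>2 * conv (gk t) x \<partial>lborel) = (\<integral>y. (\<integral>z. (\<psi> (y + z) - m)\<^sup>2 * gk t z \<partial>lborel) \<partial>\<nu>)"
    by (rule wi[OF _ p2]) measurable
  also have "\<dots> \<le> (\<integral>y. t * V y + (g y)\<^sup>2 \<partial>\<nu>)"
    using wo[of "\<lambda>x. (\<psi> x - m)\<^sup>2", OF _ p2] iV ig2 inner by (intro integral_mono) auto
  also have "\<dots> = t * (\<integral>y. V y \<partial>\<nu>) + (\<integral>y. (g y)\<^sup>2 \<partial>\<nu>)" using iV ig2 by simp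
  also have "\<dots> \<le> t * (\<integral>y. V y \<partial>\<nu>) + 1 / c * (\<integral>y. (ub y)\<^sup>2 \<partial>\<nu>)" using G by simp
  also have "\<dots> \<le> t * (\<integral>y. V y \<partial>\<nu>) + 1 / c * (\<integral>y. V y \<partial>\<nu>)"
    using c_pos iub iV ubV by (intro add_left_mono mult_left_mono integral_mono) auto
  finally show ?thesis unfolding EV by (simp add: algebra_simps)
qed

end

section \<open>The Stein kernel along the heat flow\<close>

text \<open>Fatou's lemma, arranged so that integrability of the limit comes with the bound; it
  later removes cutoffs and truncations.\<close>

lemma integrable_limit_bounded:
  fixes h :: "nat \<Rightarrow> 'x \<Rightarrow> real"
  assumes i: "\<And>n. integrable M (h n)" and nn: "\<And>n x. 0 \<le> h n x" and B: "\<And>n. (\<integral>x. h n x \<partial>M) \<le> B"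
    and lim: "\<And>x. (\<lambda>n. h n x) \<longlonglongrightarrow> H x" and [measurable]: "H \<in> borel_measurable M"
  shows "integrable M H" and "(\<integral>x. H x \<partial>M) \<le> B"
proof -
  have H0: "0 \<le> H x" for x using lim[of x] nn by (intro LIMSEQ_le_const) auto
  have "0 \<le> (\<integral>x. h 0 x \<partial>M)" by (rule integral_nonneg_AE) (simp add: nn)
  then have B0: "0 \<le> B" using B[of 0] by simp
  have "(\<integral>\<^sup>+x. ennreal (H x) \<partial>M) = (\<integral>\<^sup>+x. liminf (\<lambda>n. ennreal (h n x)) \<partial>M)"
  proof (rule nn_integral_cong)
    fix x
    have "(\<lambda>n. ennreal (h n x)) \<longlonglongrightarrow> ennreal (H x)" by (intro tendsto_ennrealI lim)
    then show "ennreal (H x) = liminf (\<lambda>n. ennreal (h n x))"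
      by (simp add: lim_imp_Liminf)
  qed
  also have "\<dots> \<le> liminf (\<lambda>n. \<integral>\<^sup>+x. ennreal (h n x) \<partial>M)"
    using i by (intro nn_integral_liminf) auto
  also have "(\<lambda>n. \<integral>\<^sup>+x. ennreal (h n x) \<partial>M) = (\<lambda>n. ennreal (\<integral>x. h n x \<partial>M))"
    using i nn by (simp add: nn_integral_eq_integral)
  also have "liminf (\<lambda>n. ennreal (\<integral>x. h n x \<partial>M)) \<le> liminf (\<lambda>n. ennreal B)"
    by (intro Liminf_mono always_eventually allI ennreal_leI B)
  finally have le: "(\<integral>\<^sup>+x. ennreal (H x) \<partial>M) \<le> ennreal B" by (simp add: Liminf_const)
  show int: "integrable M H"
    using le H0 by (intro integrableI_nonneg) (auto intro: le_less_trans)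
  have "ennreal (\<integral>x. H x \<partial>M) \<le> ennreal B"
    using le nn_integral_eq_integral[OF int] H0 by simp
  then show "(\<integral>x. H x \<partial>M) \<le> B" using B0 by (simp add: ennreal_le_iff)
qed

lemma left_tail_tendsto:
  assumes h: "integrable lborel h"
  shows "(\<lambda>n. left_tail h (- real n)) \<longlonglongrightarrow> 0" and "(\<lambda>n. left_tail h (real n)) \<longlonglongrightarrow> (\<integral>x. h x \<partial>lborel)"
proof -
  have bnd: "AE x in lborel. norm (h x * indicator A x) \<le> \<bar>h x\<bar>" for A :: "real set"
    by (intro AE_I2) (auto simp: indicator_def)
  have "(\<lambda>n. left_tail h (- real n)) \<longlonglongrightarrow> (\<integral>x. (0::real) \<partial>(lborel :: real measure))"
    unfolding left_tail_def
  proof (rule integral_dominated_convergence[OF _ _ _ _ bnd])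
    show "AE x in lborel. (\<lambda>n. h x * indicator {..- real n} x) \<longlonglongrightarrow> 0"
    proof (rule AE_I2)
      fix x :: real
      obtain N where "- x < real N" using reals_Archimedean2 by blast
      then have "\<forall>n\<ge>N. h x * indicator {..- real n} x = 0" by (auto simp: indicator_def)
      then show "(\<lambda>n. h x * indicator {..- real n} x) \<longlonglongrightarrow> 0"
        by (intro tendsto_eventually) (auto simp: eventually_sequentially)
    qed
  qed (use h in auto)
  then show "(\<lambda>n. left_tail h (- real n)) \<longlonglongrightarrow> 0" by simp
  show "(\<lambda>n. left_tail h (real n)) \<longlonglongrightarrow> (\<integral>x. h x \<partial>lborel)"
    unfolding left_tail_def
  proof (rule integral_dominated_convergence[OF _ _ _ _ bnd])
    show "AE x in lborel. (\<lambda>n. h x * indicator {..real n} x) \<longlonglongrightarrow> h x"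
    proof (rule AE_I2)
      fix x :: real
      obtain N where "x < real N" using reals_Archimedean2 by blast
      then have "\<forall>n\<ge>N. h x * indicator {..real n} x = h x" by (auto simp: indicator_def)
      then show "(\<lambda>n. h x * indicator {..real n} x) \<longlonglongrightarrow> h x"
        by (intro tendsto_eventually) (auto simp: eventually_sequentially)
    qed
  qed (use h in auto)
qed

lemma left_tail_bound:
  assumes h: "integrable lborel h"
  shows "\<bar>left_tail h x\<bar> \<le> (\<integral>y. \<bar>h y\<bar> \<partial>lborel)"
proof -
  have "\<bar>left_tail h x\<bar> \<le> (\<integral>y. \<bar>h y * indicator {..x} y\<bar> \<partial>lborel)"
    unfolding left_tail_def by (rule integral_abs_bound)
  also have "\<dots> \<le> (\<integral>y. \<bar>h y\<bar> \<partial>lborel)"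
  proof (rule integral_mono)
    show "integrable lborel (\<lambda>y. \<bar>h y * indicator {..x} y\<bar>)"
      using integrable_mult_indicator[of "{..x}" lborel h] h by (simp add: mult.commute)
  qed (use h in \<open>auto simp: indicator_def\<close>)
  finally show ?thesis .
qed

lemma integrable_continuous_compact_support:
  fixes u :: "real \<Rightarrow> real"
  assumes c: "continuous_on UNIV u" and supp: "\<And>x. R < \<bar>x\<bar> \<Longrightarrow> u x = 0"
  shows "integrable lborel u"
proof -
  have "integrable lborel (\<lambda>x. indicator {-R..R} x *\<^sub>R u x)"
    using borel_integrable_atLeastAtMost'[OF continuous_on_subset[OF c], of "-R" R]
    by (simp add: set_integrable_def)
  moreover have "indicator {-R..R} x *\<^sub>R u x = u x" for x
  proof (cases "R < \<bar>x\<bar>")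
    case True
    then show ?thesis using supp by simp
  next
    case False
    then have "x \<in> {-R..R}" by (auto simp: not_less abs_le_iff)
    then show ?thesis by simp
  qed
  ultimately show ?thesis by (simp only:)
qed

text \<open>The boundary terms on \<open>[- n, n]\<close> vanish since \<open>K\<close> tends to 0
  and \<open>\<psi>\<close> is bounded. Compact support of \<open>u\<close> makes
  \<open>K * u\<close> integrable before anything is known about the tails of
  \<open>K\<close>.\<close>

lemma weak_by_parts:
  fixes K \<kappa> \<psi> u :: "real \<Rightarrow> real"
  assumes K: "\<And>x. (K has_real_derivative \<kappa> x) (at x)" and c\<kappa>: "continuous_on UNIV \<kappa>" and i\<kappa>: "integrable lborel \<kappa>"
    and lim: "(\<lambda>n. K (real n)) \<longlonglongrightarrow> 0" "(\<lambda>n. K (- real n)) \<longlonglongrightarrow> 0"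
    and \<psi>: "\<And>x. (\<psi> has_real_derivative u x) (at x)" and cu: "continuous_on UNIV u" and supp: "\<And>x. R < \<bar>x\<bar> \<Longrightarrow> u x = 0"
    and B: "\<And>x. \<bar>\<psi> x\<bar> \<le> B"
  shows "integrable lborel (\<lambda>x. \<kappa> x * \<psi> x)" "integrable lborel (\<lambda>x. K x * u x)"
    and "(\<integral>x. \<kappa> x * \<psi> x \<partial>lborel) = - (\<integral>x. K x * u x \<partial>lborel)"
proof -
  have cK: "continuous_on UNIV K" and c\<psi>: "continuous_on UNIV \<psi>"
    by (rule DERIV_imp_continuous_on[OF K], rule DERIV_imp_continuous_on[OF \<psi>])
  then have [measurable]: "\<psi> \<in> borel_measurable borel" "K \<in> borel_measurable borel" by (auto intro: borel_measurable_continuous_onI)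
  have [measurable]: "\<kappa> \<in> borel_measurable borel" using c\<kappa> by (rule borel_measurable_continuous_onI)
  show i1: "integrable lborel (\<lambda>x. \<kappa> x * \<psi> x)"
  proof (rule Bochner_Integration.integrable_bound[where f = "\<lambda>x. B * \<kappa> x"])
    have "\<bar>\<kappa> x * \<psi> x\<bar> \<le> \<bar>B * \<kappa> x\<bar>" for x
      using mult_right_mono[OF order_trans[OF B abs_ge_self], of "\<bar>\<kappa> x\<bar>" x] by (simp add: abs_mult mult.commute)
    then show "AE x in lborel. norm (\<kappa> x * \<psi> x) \<le> norm (B * \<kappa> x)" by simp
  qed (use i\<kappa> in auto)
  show i2: "integrable lborel (\<lambda>x. K x * u x)"
    by (rule integrable_continuous_compact_support[where R = R]) (use supp cK cu in \<open>auto intro: continuous_intros\<close>)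
  have ftc: "(\<integral>x. (\<kappa> x * \<psi> x + K x * u x) * indicator {- real n..real n} x \<partial>lborel) = K (real n) * \<psi> (real n) - K (- real n) * \<psi> (- real n)" for n
  proof (rule integral_FTC_Icc_real)
    show "((\<lambda>x. K x * \<psi> x) has_real_derivative \<kappa> x * \<psi> x + K x * u x) (at x)" for x
      using DERIV_mult[OF K \<psi>, of x] by (simp add: mult.commute add.commute)
    show "isCont (\<lambda>x. \<kappa> x * \<psi> x + K x * u x) x" for x
      using c\<kappa> c\<psi> cK cu by (auto intro!: continuous_intros simp: continuous_on_eq_continuous_at)
  qed simp
  have l1: "(\<lambda>n. \<integral>x. (\<kappa> x * \<psi> x + K x * u x) * indicator {- real n..real n} x \<partial>lborel) \<longlonglongrightarrow> (\<integral>x. \<kappa> x * \<psi> x + K x * u x \<partial>lborel)"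
  proof (rule integral_dominated_convergence[where w = "\<lambda>x. \<bar>\<kappa> x * \<psi> x + K x * u x\<bar>"])
    show "AE x in lborel. (\<lambda>n. (\<kappa> x * \<psi> x + K x * u x) * indicator {- real n..real n} x) \<longlonglongrightarrow> \<kappa> x * \<psi> x + K x * u x"
    proof (rule AE_I2)
      fix x :: real
      obtain N where "\<bar>x\<bar> < real N" using reals_Archimedean2 by blast
      then have "\<forall>n\<ge>N. (\<kappa> x * \<psi> x + K x * u x) * indicator {- real n..real n} x = \<kappa> x * \<psi> x + K x * u x"
        by (auto simp: indicator_def)
      then show "(\<lambda>n. (\<kappa> x * \<psi> x + K x * u x) * indicator {- real n..real n} x) \<longlonglongrightarrow> \<kappa> x * \<psi> x + K x * u x"
        by (intro tendsto_eventually) (auto simp: eventually_sequentially)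
    qed
  qed (use i1 i2 in \<open>auto simp: indicator_def\<close>)
  have z: "(\<lambda>n. K (X n) * \<psi> (X n)) \<longlonglongrightarrow> 0" if "(\<lambda>n. K (X n)) \<longlonglongrightarrow> 0" for X :: "nat \<Rightarrow> real"
  proof (rule Lim_null_comparison)
    show "\<forall>\<^sub>F n in sequentially. norm (K (X n) * \<psi> (X n)) \<le> \<bar>K (X n)\<bar> * B"
      using B by (intro always_eventually allI) (simp add: abs_mult mult_left_mono)
    show "(\<lambda>n. \<bar>K (X n)\<bar> * B) \<longlonglongrightarrow> 0"
      using tendsto_mult_left_zero[OF tendsto_rabs_zero[OF that], of B] by simp
  qed
  have "(\<lambda>n. K (real n) * \<psi> (real n) - K (- real n) * \<psi> (- real n)) \<longlonglongrightarrow> 0 - 0"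
    using lim by (intro tendsto_diff z)
  then have "(\<integral>x. \<kappa> x * \<psi> x + K x * u x \<partial>lborel) = 0"
    using LIMSEQ_unique[OF l1] unfolding ftc by simp
  then show "(\<integral>x. \<kappa> x * \<psi> x \<partial>lborel) = - (\<integral>x. K x * u x \<partial>lborel)"
    using i1 i2 by simp
qed

definition cutoff :: "nat \<Rightarrow> real \<Rightarrow> real" where
  "cutoff n x = max 0 (min 1 (real n + 1 - \<bar>x\<bar>))"

lemma cutoff_bounds: "0 \<le> cutoff n x" "cutoff n x \<le> 1"
  by (auto simp: cutoff_def)

lemma cutoff_supp: "real n + 1 < \<bar>x\<bar> \<Longrightarrow> cutoff n x = 0"
  by (auto simp: cutoff_def)

lemma continuous_on_cutoff: "continuous_on S (cutoff n)"
  unfolding cutoff_def by (intro continuous_intros)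

lemma cutoff_tendsto: "(\<lambda>n. cutoff n x) \<longlonglongrightarrow> 1"
proof -
  obtain N where "\<bar>x\<bar> < real N" using reals_Archimedean2 by blast
  then have "\<forall>n\<ge>N. cutoff n x = 1" by (auto simp: cutoff_def max_def min_def)
  then show ?thesis by (intro tendsto_eventually) (auto simp: eventually_sequentially)
qed

section \<open>Weighted bounds for antiderivatives, dual to the Poincare inequality\<close>

context gap_flow
begin

text \<open>The Poincare inequality is tested with a function whose derivative is the cut-off
  quotient of \<open>K\<close> by the density; integration by parts turns the integral of
  \<open>K * u\<close> into one of \<open>\<kappa>\<close> against \<open>m - \<psi>\<close>. The
  cutoff makes the test function admissible and the left-hand side finite, so that half of it can be
  absorbed; Fatou removes it.\<close>

lemma dual_poincare:
  fixes K \<kappa> :: "real \<Rightarrow> real"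
  assumes t: "0 < t"
    and K: "\<And>x. (K has_real_derivative \<kappa> x) (at x)" and c\<kappa>: "continuous_on UNIV \<kappa>" and i\<kappa>: "integrable lborel \<kappa>"
    and mean: "(\<integral>x. \<kappa> x \<partial>lborel) = 0"
    and lim: "(\<lambda>n. K (real n)) \<longlonglongrightarrow> 0" "(\<lambda>n. K (- real n)) \<longlonglongrightarrow> 0"
    and i2: "integrable lborel (\<lambda>x. (\<kappa> x)\<^sup>2 / conv (gk t) x)"
  shows "integrable lborel (\<lambda>x. (K x)\<^sup>2 / conv (gk t) x)"
    and "(\<integral>x. (K x)\<^sup>2 / conv (gk t) x \<partial>lborel) \<le> (1 / c + t) * (\<integral>x. (\<kappa> x)\<^sup>2 / conv (gk t) x \<partial>lborel)"
proof -
  define C where "C = 1 / c + t"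
  let ?f = "conv (gk t)"
  let ?A = "\<integral>x. (\<kappa> x)\<^sup>2 / ?f x \<partial>lborel"
  have C: "0 < C" using t c_pos by (simp add: C_def add_pos_pos)
  have pos: "0 < ?f x" for x by (rule conv_gk_pos[OF t])
  have cf: "continuous_on UNIV ?f" by (rule continuous_on_conv[OF gdom_gk[OF t]])
  have cK: "continuous_on UNIV K" by (rule DERIV_imp_continuous_on[OF K])
  have [measurable]: "K \<in> borel_measurable borel" "?f \<in> borel_measurable borel" "\<kappa> \<in> borel_measurable borel"
    using cK cf c\<kappa> by (auto intro: borel_measurable_continuous_onI)
  have key: "integrable lborel (\<lambda>x. cutoff n x * ((K x)\<^sup>2 / ?f x)) \<and> (\<integral>x. cutoff n x * ((K x)\<^sup>2 / ?f x) \<partial>lborel) \<le> C * ?A" for n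
  proof -
    define u where "u x = cutoff n x * (K x / ?f x)" for x
    define \<psi> where "\<psi> = left_tail u"
    define m where "m = (\<integral>x. \<psi> x * ?f x \<partial>lborel)"
    have cu: "continuous_on UNIV u"
      unfolding u_def using pos by (intro continuous_intros continuous_on_cutoff cK cf) (simp add: less_imp_neq[THEN not_sym])
    have supp: "u x = 0" if "real n + 1 < \<bar>x\<bar>" for x using that by (simp add: u_def cutoff_supp)
    have iu: "integrable lborel u"
      by (rule integrable_continuous_compact_support[OF cu, where R = "real n + 1"]) (rule supp)
    have d\<psi>: "(\<psi> has_real_derivative u x) (at x)" for x
      unfolding \<psi>_def by (rule left_tail_deriv[OF iu cu])
    define B where "B = (\<integral>y. \<bar>u y\<bar> \<partial>lborel)"
    have B: "\<bar>\<psi> x\<bar> \<le> B" for x unfolding \<psi>_def B_def by (rule left_tail_bound[OF iu])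
    obtain B' where B': "\<bar>u x\<bar> \<le> B'" for x
    proof -
      have "compact (u ` {- (real n + 1)..real n + 1})"
        by (intro compact_continuous_image continuous_on_subset[OF cu]) auto
      then obtain b where b: "\<forall>y\<in>u ` {- (real n + 1)..real n + 1}. norm y \<le> b"
        using compact_imp_bounded bounded_iff by blast
      have "\<bar>u x\<bar> \<le> \<bar>b\<bar>" for x
      proof (cases "\<bar>x\<bar> \<le> real n + 1")
        case True
        then have "x \<in> {- (real n + 1)..real n + 1}" by (auto simp: abs_le_iff)
        then have "norm (u x) \<le> b" using b by blast
        then show ?thesis by simp
      qed (use supp[of x] in auto)
      then show ?thesis by (rule that)
    qed
    have [measurable]: "\<psi> \<in> borel_measurable borel" "u \<in> borel_measurable borel"
      using DERIV_imp_continuous_on[OF d\<psi>] cu by (auto intro: borel_measurable_continuous_onI)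
    note w = weak_by_parts[where R = "real n + 1", OF K c\<kappa> i\<kappa> lim d\<psi> cu supp B]
    have Ku: "K x * u x = cutoff n x * ((K x)\<^sup>2 / ?f x)" for x by (simp add: u_def power2_eq_square)
    have bf: "integrable lborel (\<lambda>x. h x * ?f x)" if "h \<in> borel_measurable borel" "\<And>x. \<bar>h x\<bar> \<le> D" for h :: "real \<Rightarrow> real" and D
    proof (rule Bochner_Integration.integrable_bound[where f = "\<lambda>x. D * ?f x"])
      show "AE x in lborel. norm (h x * ?f x) \<le> norm (D * ?f x)"
        using that(2) pos by (intro AE_I2) (simp add: abs_mult mult_right_mono order_trans[OF _ abs_ge_self])
    qed (use that integrable_conv_gk[OF t] in auto)
    have sq: "\<bar>a\<^sup>2\<bar> \<le> b\<^sup>2" if "\<bar>a\<bar> \<le> b" for a b :: real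
      using power_mono[OF that abs_ge_zero, of 2] by simp
    have i\<psi>2: "integrable lborel (\<lambda>x. (\<psi> x - m)\<^sup>2 * ?f x)"
    proof (rule bf)
      have "\<bar>\<psi> x - m\<bar> \<le> B + \<bar>m\<bar>" for x using B[of x] by linarith
      then show "\<bar>(\<psi> x - m)\<^sup>2\<bar> \<le> (B + \<bar>m\<bar>)\<^sup>2" for x by (intro sq)
    qed measurable
    have iu2: "integrable lborel (\<lambda>x. (u x)\<^sup>2 * ?f x)" by (rule bf[OF _ sq[OF B']]) measurable
    let ?X = "\<integral>x. K x * u x \<partial>lborel"
    have P: "(\<integral>x. (\<psi> x - m)\<^sup>2 * ?f x \<partial>lborel) \<le> C * (\<integral>x. (u x)\<^sup>2 * ?f x \<partial>lborel)"
      unfolding C_def by (rule poincare_heat[OF t d\<psi> cu B B' m_def])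
    have uX: "(\<integral>x. (u x)\<^sup>2 * ?f x \<partial>lborel) \<le> ?X"
    proof (rule integral_mono[OF iu2 w(2)])
      fix x
      have "(u x)\<^sup>2 * ?f x = cutoff n x * (cutoff n x * ((K x)\<^sup>2 / ?f x))"
        using pos[of x] by (simp add: u_def power2_eq_square)
      also have "\<dots> \<le> 1 * (cutoff n x * ((K x)\<^sup>2 / ?f x))"
        using cutoff_bounds[of n x] pos[of x] by (intro mult_right_mono) auto
      finally show "(u x)\<^sup>2 * ?f x \<le> K x * u x" by (simp add: Ku)
    qed
    have "?X = (\<integral>x. m * \<kappa> x - \<kappa> x * \<psi> x \<partial>lborel)"
      using w(1,3) i\<kappa> mean by simp
    \<comment> \<open>Young's inequality with weight \<open>C\<close>, chosen so that the Poincare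
      constant cancels and the second term is at most \<open>?X / 2\<close>. The zero mean of
      \<open>\<kappa>\<close> has allowed the constant \<open>m\<close> to be subtracted.\<close>
    also have "\<dots> \<le> (\<integral>x. C / 2 * ((\<kappa> x)\<^sup>2 / ?f x) + 1 / (2 * C) * ((\<psi> x - m)\<^sup>2 * ?f x) \<partial>lborel)"
    proof (rule integral_mono)
      fix x
      have "0 \<le> (C * \<kappa> x + (\<psi> x - m) * ?f x)\<^sup>2 / (2 * C * ?f x)" using C pos[of x] by simp
      also have "\<dots> = C / 2 * ((\<kappa> x)\<^sup>2 / ?f x) + 1 / (2 * C) * ((\<psi> x - m)\<^sup>2 * ?f x) + \<kappa> x * (\<psi> x - m)"
        using C pos[of x] by (simp add: power2_eq_square field_simps)
      finally show "m * \<kappa> x - \<kappa> x * \<psi> x \<le> C / 2 * ((\<kappa> x)\<^sup>2 / ?f x) + 1 / (2 * C) * ((\<psi> x - m)\<^sup>2 * ?f x)"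
        by (simp add: algebra_simps)
    next
      show "integrable lborel (\<lambda>x. m * \<kappa> x - \<kappa> x * \<psi> x)" using w(1) i\<kappa> by simp
      show "integrable lborel (\<lambda>x. C / 2 * ((\<kappa> x)\<^sup>2 / ?f x) + 1 / (2 * C) * ((\<psi> x - m)\<^sup>2 * ?f x))"
        by (intro Bochner_Integration.integrable_add integrable_mult_right i2 i\<psi>2)
    qed
    also have "\<dots> = C / 2 * ?A + 1 / (2 * C) * (\<integral>x. (\<psi> x - m)\<^sup>2 * ?f x \<partial>lborel)"
      by (subst Bochner_Integration.integral_add, (intro integrable_mult_right i2 i\<psi>2)+, simp only: integral_mult_right_zero)
    also have "\<dots> \<le> C / 2 * ?A + 1 / (2 * C) * (C * ?X)"
      using C order_trans[OF P mult_left_mono[OF uX less_imp_le[OF C]]]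
      by (intro add_left_mono mult_left_mono) auto
    also have "\<dots> = C / 2 * ?A + ?X / 2" using C by simp
    finally have "?X \<le> C * ?A" by simp
    then show ?thesis using w(2) by (simp add: Ku)
  qed
  have lim': "(\<lambda>n. cutoff n x * ((K x)\<^sup>2 / ?f x)) \<longlonglongrightarrow> (K x)\<^sup>2 / ?f x" for x
    using tendsto_mult[OF cutoff_tendsto tendsto_const, of x "(K x)\<^sup>2 / ?f x"] by simp
  have nn: "0 \<le> cutoff n x * ((K x)\<^sup>2 / ?f x)" for n x
    using cutoff_bounds[of n x] pos[of x] by simp
  note L = integrable_limit_bounded[where M = lborel and h = "\<lambda>n x. cutoff n x * ((K x)\<^sup>2 / ?f x)"
      and H = "\<lambda>x. (K x)\<^sup>2 / ?f x" and B = "C * ?A"]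
  show "integrable lborel (\<lambda>x. (K x)\<^sup>2 / ?f x)"
    by (rule L(1)[OF key[THEN conjunct1] nn key[THEN conjunct2] lim']) measurable
  show "(\<integral>x. (K x)\<^sup>2 / ?f x \<partial>lborel) \<le> (1 / c + t) * ?A"
    unfolding C_def[symmetric] by (rule L(2)[OF key[THEN conjunct1] nn key[THEN conjunct2] lim']) measurable
qed

lemma conv_gk_tendsto_0:
  assumes t: "0 < t" and X: "filterlim (\<lambda>n. \<bar>X n\<bar>) at_top sequentially"
  shows "(\<lambda>n. conv (gk t) (X n)) \<longlonglongrightarrow> 0"
proof -
  have "(\<lambda>n. conv (gk t) (X n)) \<longlonglongrightarrow> (\<integral>y. 0 \<partial>\<nu>)"
    unfolding conv_def
  proof (rule integral_dominated_convergence[where w = "\<lambda>_. gk t (0::real)"])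
    show "AE y in \<nu>. (\<lambda>n. gk t (X n - y)) \<longlonglongrightarrow> 0"
    proof (rule AE_I2)
      fix y
      have "filterlim (\<lambda>n. - \<bar>y\<bar> + \<bar>X n\<bar>) at_top sequentially"
        by (rule filterlim_tendsto_add_at_top[OF tendsto_const X])
      then have "filterlim (\<lambda>n. \<bar>X n - y\<bar>) at_top sequentially"
        by (rule filterlim_at_top_mono) (auto intro!: always_eventually)
      moreover have "((\<lambda>z. exp (- z\<^sup>2 / (2 * t)) / sqrt (2 * pi * t)) \<longlongrightarrow> 0) at_top"
        using t by real_asymp
      ultimately have "((\<lambda>n. exp (- \<bar>X n - y\<bar>\<^sup>2 / (2 * t)) / sqrt (2 * pi * t)) \<longlonglongrightarrow> 0)"
        by (rule filterlim_compose[rotated])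
      then show "(\<lambda>n. gk t (X n - y)) \<longlonglongrightarrow> 0" by (simp add: gk_def)
    qed
    show "AE y in \<nu>. norm (gk t (X n - y)) \<le> gk t (0::real)" for n
      using t by (auto simp: gk_nonneg gk_le)
  qed auto
  then show ?thesis by simp
qed

end

section \<open>Score and Stein kernel of a centred law of unit variance\<close>

locale std_gap_flow = gap_flow +
  assumes c_le: "c \<le> 1" and mean_0: "(\<integral>y. y \<partial>\<nu>) = 0" and variance_1: "(\<integral>y. y\<^sup>2 \<partial>\<nu>) = 1"
begin

abbreviation (input) "f \<equiv> \<lambda>t. conv (gk t)"
abbreviation (input) "f1 \<equiv> \<lambda>t. conv (gk1 1 t)"

lemma f_deriv:
  assumes t: "0 < t" shows "(f t has_real_derivative f1 t x) (at x)"
  using conv_gk_deriv[OF t t t, where x = 0 and v = 1 and h = x] by simp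

lemma fisher_real: "fisher t = (\<integral>x. (f1 t x)\<^sup>2 / f t x \<partial>lborel)"
  by (simp add: fisher_def)

lemma f_moments:
  assumes t: "0 < t"
  shows "integrable lborel (\<lambda>x. x * f t x)" "(\<integral>x. x * f t x \<partial>lborel) = 0"
    "integrable lborel (\<lambda>x. x\<^sup>2 * f t x)" "(\<integral>x. x\<^sup>2 * f t x \<partial>lborel) = 1 + t"
    "integrable lborel (f1 t)" "(\<integral>x. f1 t x \<partial>lborel) = 0"
    "integrable lborel (\<lambda>x. x * f1 t x)" "(\<integral>x. x * f1 t x \<partial>lborel) = - 1"
proof -
  have x1: "\<bar>x\<bar> \<le> 1 * (1 + (norm x)\<^sup>2)" for x :: real
    using sum_squares_ge_zero[of "\<bar>x\<bar> - 1/2" 0] by (simp add: power2_eq_square algebra_simps)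
  have m0: "has_bochner_integral lborel (gk t :: real \<Rightarrow> real) 1"
    using integrable_gk[OF t] integral_gk[OF t] by (simp add: has_bochner_integral_iff)
  have m1: "has_bochner_integral lborel (\<lambda>z::real. gk t z * z) 0"
    using gk_first_moment[OF t, of "1::real"] by simp
  have m2: "has_bochner_integral lborel (\<lambda>z::real. gk t z * z\<^sup>2) t"
    using gk_norm_moment[OF t, where 'a = real] by simp
  note g = gdom_gk[OF t, where 'a = real] and g1 = gdom_gk1[OF t, where 'a = real, of 1]
  show "integrable lborel (\<lambda>x. x * f t x)" by (rule gdom_weighted_integrable[OF g _ x1]) measurable
  have "(\<integral>x. x * f t x \<partial>lborel) = (\<integral>y. (\<integral>z. (y + z) * gk t z \<partial>lborel) \<partial>\<nu>)"
    by (rule gdom_weighted_integral[OF g _ x1]) measurable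
  also have "(\<lambda>y. (\<integral>z. (y + z) * gk t z \<partial>lborel)) = (\<lambda>y. y)"
  proof
    fix y :: real
    have "has_bochner_integral lborel (\<lambda>z. y * gk t z + gk t z * z) (y * 1 + 0)"
      by (intro has_bochner_integral_add has_bochner_integral_mult_right m0 m1)
    then show "(\<integral>z. (y + z) * gk t z \<partial>lborel) = y"
      by (simp add: has_bochner_integral_iff algebra_simps)
  qed
  finally show "(\<integral>x. x * f t x \<partial>lborel) = 0" by (simp add: mean_0)
  show "integrable lborel (\<lambda>x. x\<^sup>2 * f t x)" "(\<integral>x. x\<^sup>2 * f t x \<partial>lborel) = 1 + t"
    using integrable_norm_conv_gk[OF t] integral_norm_conv_gk[OF t] variance_1 by simp_all
  show "integrable lborel (f1 t)"
    using gdom_weighted_integrable[OF g1, of "\<lambda>_. 1" 1] by simp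
  have "(\<integral>x. 1 * f1 t x \<partial>lborel) = (\<integral>y. (\<integral>z. 1 * gk1 (1::real) t z \<partial>lborel) \<partial>\<nu>)"
    by (rule gdom_weighted_integral[OF g1, of "\<lambda>_. 1" 1]) auto
  also have "(\<integral>z. 1 * gk1 (1::real) t z \<partial>lborel) = - (1 / t) * (\<integral>z. gk t z * (z::real) \<partial>lborel)"
    unfolding integral_mult_right_zero[symmetric] by (rule Bochner_Integration.integral_cong) (auto simp: gk1_def)
  finally show "(\<integral>x. f1 t x \<partial>lborel) = 0" using m1 by (simp add: has_bochner_integral_iff)
  show "integrable lborel (\<lambda>x. x * f1 t x)" by (rule gdom_weighted_integrable[OF g1 _ x1]) measurable
  have "(\<integral>x. x * f1 t x \<partial>lborel) = (\<integral>y. (\<integral>z. (y + z) * gk1 1 t z \<partial>lborel) \<partial>\<nu>)"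
    by (rule gdom_weighted_integral[OF g1 _ x1]) measurable
  also have "(\<lambda>y. (\<integral>z. (y + z) * gk1 1 t z \<partial>lborel)) = (\<lambda>y. - 1)"
  proof
    fix y :: real
    have "has_bochner_integral lborel (\<lambda>z. - (y / t) * (gk t z * z) + - (1 / t) * (gk t z * z\<^sup>2)) (- (y / t) * 0 + - (1 / t) * t)"
      by (intro has_bochner_integral_add has_bochner_integral_mult_right m1 m2)
    moreover have "- (y / t) * (gk t z * z) + - (1 / t) * (gk t z * z\<^sup>2) = (y + z) * gk1 1 t z" for z
      by (simp add: gk1_def power2_eq_square algebra_simps add_divide_distrib)
    ultimately show "(\<integral>z. (y + z) * gk1 1 t z \<partial>lborel) = - 1"
      using t by (simp add: has_bochner_integral_iff)
  qed
  finally show "(\<integral>x. x * f1 t x \<partial>lborel) = - 1" by simp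
qed

text \<open>The density times the difference between the score of the flow and the score
  \<open>- x / (1 + t)\<close> of the Gaussian with the same variance.\<close>

definition score_dev :: "real \<Rightarrow> real \<Rightarrow> real" where
  "score_dev t x = f1 t x + x * f t x / (1 + t)"

text \<open>For a centred law the negated left tail is the right tail of \<open>y * f t y\<close>,
  so this is the density times the Stein kernel, divided by the variance \<open>1 + t\<close>. So
  normalised, the Stein kernel has mean 1, and it is constant 1 for a Gaussian.\<close>

definition stein_dens :: "real \<Rightarrow> real \<Rightarrow> real" where
  "stein_dens t x = - left_tail (\<lambda>x. x * f t x / (1 + t)) x"

definition stein_dev :: "real \<Rightarrow> real \<Rightarrow> real" where
  "stein_dev t x = stein_dens t x - f t x"

lemma
  assumes t: "0 < t"
  shows score_dev_cont: "continuous_on UNIV (score_dev t)"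
    and score_dev_int: "integrable lborel (score_dev t)"
    and score_dev_mean: "(\<integral>x. score_dev t x \<partial>lborel) = 0"
    and score_dev_sq_int: "integrable lborel (\<lambda>x. (score_dev t x)\<^sup>2 / f t x)"
    and score_dev_sq: "(\<integral>x. (score_dev t x)\<^sup>2 / f t x \<partial>lborel) = fisher t - 1 / (1 + t)"
proof -
  note m = f_moments[OF t]
  show "continuous_on UNIV (score_dev t)"
    unfolding score_dev_def using t
    by (intro continuous_intros continuous_on_conv gdom_gk gdom_gk1) auto
  show "integrable lborel (score_dev t)" "(\<integral>x. score_dev t x \<partial>lborel) = 0"
    unfolding score_dev_def using m by simp_all
  have eq: "(score_dev t x)\<^sup>2 / f t x = (f1 t x)\<^sup>2 / f t x + 2 / (1 + t) * (x * f1 t x) + 1 / (1 + t)\<^sup>2 * (x\<^sup>2 * f t x)" for x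
  proof -
    define s where "s = 1 + t"
    have "s \<noteq> 0" using t by (simp add: s_def)
    then show ?thesis using conv_gk_pos[OF t, of x] unfolding score_dev_def s_def[symmetric]
      by (simp add: power2_eq_square field_simps)
  qed
  note i = integrable_score_sq[OF t, of 1]
  show "integrable lborel (\<lambda>x. (score_dev t x)\<^sup>2 / f t x)" unfolding eq using i m by simp
  \<comment> \<open>The cross term gives \<open>- 2 / (1 + t)\<close> since
    \<open>x * f1 t x\<close> has integral \<open>- 1\<close>, the last term
    \<open>1 / (1 + t)\<close> by the second moment; what remains is the excess over the Gaussian
    Fisher information.\<close>
  have "(\<integral>x. (score_dev t x)\<^sup>2 / f t x \<partial>lborel) = fisher t + 2 / (1 + t) * (- 1) + 1 / (1 + t)\<^sup>2 * (1 + t)"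
    unfolding eq using i m by (simp add: fisher_real)
  also have "\<dots> = fisher t - 1 / (1 + t)"
  proof -
    define s where "s = 1 + t"
    have "s \<noteq> 0" using t by (simp add: s_def)
    then show ?thesis unfolding s_def[symmetric] by (simp add: power2_eq_square field_simps)
  qed
  finally show "(\<integral>x. (score_dev t x)\<^sup>2 / f t x \<partial>lborel) = fisher t - 1 / (1 + t)" .
qed

lemma stein_dens_deriv:
  assumes t: "0 < t"
  shows "(stein_dens t has_real_derivative - (x * f t x / (1 + t))) (at x)"
  unfolding stein_dens_def[abs_def]
  by (rule DERIV_minus, rule left_tail_deriv)
    (use f_moments(1)[OF t] t in \<open>auto intro!: continuous_intros continuous_on_conv gdom_gk\<close>)

text \<open>This link makes \<open>dual_poincare\<close> applicable: up to sign the Stein kernel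
  deviation is an antiderivative of the score deviation.\<close>

lemma stein_dev_deriv:
  assumes t: "0 < t"
  shows "(stein_dev t has_real_derivative - score_dev t x) (at x)"
  unfolding stein_dev_def[abs_def] score_dev_def
  by (rule DERIV_cong[OF DERIV_diff[OF stein_dens_deriv[OF t] f_deriv[OF t]]]) simp

text \<open>Two uses of \<open>dual_poincare\<close>: for \<open>stein_dens\<close> the weighted
  squared norm of the derivative is \<open>1 / (1 + t)\<close>, for \<open>stein_dev\<close> it is
  the excess Fisher information. The zero mean of the law makes the antiderivatives vanish at both
  ends.\<close>

lemma
  assumes t: "0 < t"
  shows stein_dens_sq_int: "integrable lborel (\<lambda>x. (stein_dens t x)\<^sup>2 / f t x)"
    and stein_dens_sq: "(\<integral>x. (stein_dens t x)\<^sup>2 / f t x \<partial>lborel) \<le> (1 / c + t) / (1 + t)"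
    and stein_dev_sq_int: "integrable lborel (\<lambda>x. (stein_dev t x)\<^sup>2 / f t x)"
    and stein_dev_sq: "(\<integral>x. (stein_dev t x)\<^sup>2 / f t x \<partial>lborel) \<le> (1 / c + t) * (fisher t - 1 / (1 + t))"
proof -
  note m = f_moments[OF t]
  have i: "integrable lborel (\<lambda>x. x * f t x / (1 + t))" using m by simp
  have lim: "(\<lambda>n. stein_dens t (real n)) \<longlonglongrightarrow> 0" "(\<lambda>n. stein_dens t (- real n)) \<longlonglongrightarrow> 0"
    using tendsto_minus[OF left_tail_tendsto(1)[OF i]] tendsto_minus[OF left_tail_tendsto(2)[OF i]] m
    by (simp_all add: stein_dens_def)
  have fl: "(\<lambda>n. f t (real n)) \<longlonglongrightarrow> 0" "(\<lambda>n. f t (- real n)) \<longlonglongrightarrow> 0"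
    by (rule conv_gk_tendsto_0[OF t], simp add: filterlim_real_sequentially)+
  have lim': "(\<lambda>n. stein_dev t (real n)) \<longlonglongrightarrow> 0" "(\<lambda>n. stein_dev t (- real n)) \<longlonglongrightarrow> 0"
    using tendsto_diff[OF lim(1) fl(1)] tendsto_diff[OF lim(2) fl(2)] by (simp_all add: stein_dev_def)
  have eq: "(- (x * f t x / (1 + t)))\<^sup>2 / f t x = 1 / (1 + t)\<^sup>2 * (x\<^sup>2 * f t x)" for x
  proof -
    define s where "s = 1 + t"
    have "s \<noteq> 0" using t by (simp add: s_def)
    then show ?thesis using conv_gk_pos[OF t, of x] unfolding s_def[symmetric]
      by (simp add: power2_eq_square field_simps)
  qed
  have c1: "continuous_on UNIV (\<lambda>x. - (x * f t x / (1 + t)))"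
    using t by (intro continuous_intros continuous_on_conv gdom_gk) auto
  have c2: "integrable lborel (\<lambda>x. - (x * f t x / (1 + t)))" "(\<integral>x. - (x * f t x / (1 + t)) \<partial>lborel) = 0"
    using m by simp_all
  have c3: "integrable lborel (\<lambda>x. (- (x * f t x / (1 + t)))\<^sup>2 / f t x)"
    unfolding eq using m by simp
  note D = dual_poincare[OF t stein_dens_deriv[OF t] c1 c2 lim c3]
  have c1': "continuous_on UNIV (\<lambda>x. - score_dev t x)"
    by (intro continuous_intros score_dev_cont[OF t])
  have c2': "integrable lborel (\<lambda>x. - score_dev t x)" "(\<integral>x. - score_dev t x \<partial>lborel) = 0"
    using score_dev_int[OF t] score_dev_mean[OF t] by simp_all
  have c3': "integrable lborel (\<lambda>x. (- score_dev t x)\<^sup>2 / f t x)"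
    using score_dev_sq_int[OF t] by simp
  note E = dual_poincare[OF t stein_dev_deriv[OF t] c1' c2' lim' c3']
  show "integrable lborel (\<lambda>x. (stein_dens t x)\<^sup>2 / f t x)" by (rule D(1))
  have "(\<integral>x. (- (x * f t x / (1 + t)))\<^sup>2 / f t x \<partial>lborel) = 1 / (1 + t)"
    unfolding eq using m t by (simp add: power2_eq_square)
  then show "(\<integral>x. (stein_dens t x)\<^sup>2 / f t x \<partial>lborel) \<le> (1 / c + t) / (1 + t)" using D(2) by simp
  show "integrable lborel (\<lambda>x. (stein_dev t x)\<^sup>2 / f t x)" by (rule E(1))
  show "(\<integral>x. (stein_dev t x)\<^sup>2 / f t x \<partial>lborel) \<le> (1 / c + t) * (fisher t - 1 / (1 + t))"
    using E(2) by (simp add: score_dev_sq[OF t])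
qed

lemma
  assumes t: "0 < t"
  shows stein_dev_int: "integrable lborel (stein_dev t)"
    and stein_dev_mean: "(\<integral>x. stein_dev t x \<partial>lborel) = 0"
    and fisher_stein_dev_le: "fisher t * (\<integral>x. (stein_dev t x)\<^sup>2 / f t x \<partial>lborel) \<le> (2 / c - 1) * (fisher t - 1 / (1 + t))"
    and fisher_ge: "0 \<le> fisher t - 1 / (1 + t)"
proof -
  note m = f_moments[OF t]
  let ?Q = "stein_dens t" and ?f = "f t"
  have pos: "0 < ?f x" for x by (rule conv_gk_pos[OF t])
  have cQ: "continuous_on UNIV ?Q" by (rule DERIV_imp_continuous_on[OF stein_dens_deriv[OF t]])
  have cf: "continuous_on UNIV ?f" by (rule continuous_on_conv[OF gdom_gk[OF t]])
  have [measurable]: "?Q \<in> borel_measurable borel" "?f \<in> borel_measurable borel"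
    using cQ cf by (auto intro: borel_measurable_continuous_onI)
  \<comment> \<open>Arithmetic-geometric mean with the density as weight; \<open>a = 1\<close> gives
    integrability of \<open>?Q\<close>, \<open>a = x\<close> that of
    \<open>x * ?Q x\<close>.\<close>
  have am: "\<bar>a * ?Q x\<bar> \<le> ((?Q x)\<^sup>2 / ?f x + a\<^sup>2 * ?f x) / 2" for a x
  proof -
    have "0 \<le> (\<bar>?Q x\<bar> - \<bar>a\<bar> * ?f x)\<^sup>2 / (2 * ?f x)" using pos[of x] by simp
    also have "\<dots> = ((?Q x)\<^sup>2 / ?f x + a\<^sup>2 * ?f x) / 2 - \<bar>a * ?Q x\<bar>"
      using pos[of x] by (simp add: power2_eq_square abs_mult field_simps)
    finally show ?thesis by simp
  qed
  have iQ: "integrable lborel ?Q"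
  proof (rule Bochner_Integration.integrable_bound[where f = "\<lambda>x. ((?Q x)\<^sup>2 / ?f x + 1\<^sup>2 * ?f x) / 2"])
    show "AE x in lborel. norm (?Q x) \<le> norm (((?Q x)\<^sup>2 / ?f x + 1\<^sup>2 * ?f x) / 2)"
    proof (rule AE_I2)
      fix x show "norm (?Q x) \<le> norm (((?Q x)\<^sup>2 / ?f x + 1\<^sup>2 * ?f x) / 2)"
        using order_trans[OF am[of 1 x] abs_ge_self] by (simp only: mult_1 real_norm_def)
    qed
  qed (use stein_dens_sq_int[OF t] integrable_conv_gk[OF t] in auto)
  have ixQ: "integrable lborel (\<lambda>x. x * ?Q x)"
  proof (rule Bochner_Integration.integrable_bound[where f = "\<lambda>x. ((?Q x)\<^sup>2 / ?f x + x\<^sup>2 * ?f x) / 2"])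
    show "AE x in lborel. norm (x * ?Q x) \<le> norm (((?Q x)\<^sup>2 / ?f x + x\<^sup>2 * ?f x) / 2)"
    proof (rule AE_I2)
      fix x show "norm (x * ?Q x) \<le> norm (((?Q x)\<^sup>2 / ?f x + x\<^sup>2 * ?f x) / 2)"
        using order_trans[OF am[of x x] abs_ge_self] by (simp only: real_norm_def)
    qed
  qed (use stein_dens_sq_int[OF t] m in auto)
  \<comment> \<open>The derivative of \<open>x * ?Q x\<close> has integral 0, so the mass of
    \<open>?Q\<close> is the second moment \<open>1 + t\<close> divided by \<open>1 + t\<close>.
    This mean 1 is what subtracts 1 in \<open>e1\<close>.\<close>
  have "(\<integral>x. ?Q x - 1 / (1 + t) * (x\<^sup>2 * ?f x) \<partial>lborel) = 0"
  proof (rule integral_derivative_eq_0_real[where F = "\<lambda>x. x * ?Q x"])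
    show "((\<lambda>x. x * ?Q x) has_real_derivative ?Q x - 1 / (1 + t) * (x\<^sup>2 * ?f x)) (at x)" for x
      using DERIV_mult[OF DERIV_ident stein_dens_deriv[OF t], of x] by (simp add: power2_eq_square mult_ac)
    show "continuous_on UNIV (\<lambda>x. ?Q x - 1 / (1 + t) * (x\<^sup>2 * ?f x))"
      by (intro continuous_intros cQ cf)
  qed (use ixQ iQ m in auto)
  then have Q1: "(\<integral>x. ?Q x \<partial>lborel) = 1"
    using iQ m t by simp
  show iS: "integrable lborel (stein_dev t)" "(\<integral>x. stein_dev t x \<partial>lborel) = 0"
    unfolding stein_dev_def using iQ integrable_conv_gk[OF t] Q1 integral_conv_gk[OF t] by simp_all
  show F: "0 \<le> fisher t - 1 / (1 + t)"
    unfolding score_dev_sq[OF t, symmetric] using pos by (intro integral_nonneg_AE AE_I2) (simp add: less_imp_le)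
  define R where "R = (1 / c + t) / (1 + t)"
  let ?E = "\<integral>x. (stein_dev t x)\<^sup>2 / ?f x \<partial>lborel" and ?I = "fisher t - 1 / (1 + t)"
  have "(stein_dev t x)\<^sup>2 / ?f x = (?Q x)\<^sup>2 / ?f x - 2 * ?Q x + ?f x" for x
    using pos[of x] by (simp add: stein_dev_def power2_eq_square field_simps)
  then have "?E = (\<integral>x. (?Q x)\<^sup>2 / ?f x \<partial>lborel) - 1"
    using stein_dens_sq_int[OF t] iQ integrable_conv_gk[OF t] Q1 integral_conv_gk[OF t] by simp
  then have e1: "?E \<le> R - 1" using stein_dens_sq[OF t] by (simp add: R_def)
  have e2: "?E / (1 + t) \<le> R * ?I"
    using divide_right_mono[OF stein_dev_sq[OF t], of "1 + t"] t by (simp add: R_def)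
  \<comment> \<open>As \<open>c \<le> 1\<close>, the ratio is largest at
    \<open>t = 0\<close>.\<close>
  have R: "R \<le> 1 / c"
  proof -
    have "1 / c + t \<le> 1 / c + t * (1 / c)" using c_le c_pos t by (intro add_left_mono) (simp add: field_simps)
    then have "1 / c + t \<le> 1 / c * (1 + t)" by (simp add: add_divide_distrib)
    then show ?thesis using t unfolding R_def by (simp add: divide_le_eq)
  qed
  \<comment> \<open>The bound \<open>R - 1\<close> is spent on the excess and the bound by the
    excess on \<open>1 / (1 + t)\<close>, so that no square of the excess arises.\<close>
  have "fisher t * ?E = ?I * ?E + ?E / (1 + t)" by (simp add: algebra_simps)
  also have "\<dots> \<le> ?I * (R - 1) + R * ?I"
    using mult_left_mono[OF e1 F] e2 by (rule add_mono)
  also have "\<dots> = (2 * R - 1) * ?I" by (simp add: algebra_simps diff_divide_distrib)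
  also have "\<dots> \<le> (2 / c - 1) * ?I"
    using R F by (intro mult_right_mono) auto
  finally show "fisher t * ?E \<le> (2 / c - 1) * ?I" .
qed

end

section \<open>Linear images of product measures\<close>

lemma nn_integral_lborel_reflect:
  fixes f :: "'a::euclidean_space \<Rightarrow> ennreal"
  assumes [measurable]: "f \<in> borel_measurable borel"
  shows "(\<integral>\<^sup>+x. f (- x) \<partial>lborel) = (\<integral>\<^sup>+x. f x \<partial>lborel)"
proof -
  have "(lborel :: 'a measure) = distr lborel borel uminus"
    using lborel_affine[of "- 1" "0 :: 'a"] by (simp add: density_1)
  then have "(\<integral>\<^sup>+x. f x \<partial>lborel) = (\<integral>\<^sup>+x. f x \<partial>distr lborel borel uminus)" by simp
  then show ?thesis by (simp add: nn_integral_distr)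
qed

text \<open>Uniqueness of Haar measure, with the Gaussian kernel as the test function that fixes the constant.\<close>

lemma nn_integral_lborel_orthogonal:
  fixes f :: "'a::euclidean_space \<Rightarrow> ennreal"
  assumes U: "orthogonal_transformation (U :: 'a \<Rightarrow> 'a)" and [measurable]: "f \<in> borel_measurable borel"
  shows "(\<integral>\<^sup>+x. f (U x) \<partial>lborel) = (\<integral>\<^sup>+x. f x \<partial>lborel)"
proof -
  have lin: "linear U" using U by (rule orthogonal_transformation_linear)
  have [measurable]: "U \<in> borel_measurable borel"
    using lin by (intro borel_measurable_continuous_onI linear_continuous_on linear_conv_bounded_linear[THEN iffD1])
  have surj: "surj U" using U by (rule orthogonal_transformation_surj)
  define g :: "'a \<Rightarrow> ennreal" where "g z = ennreal (gk 1 z)" for z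
  have [measurable]: "g \<in> borel_measurable borel" unfolding g_def by measurable
  have g1: "(\<integral>\<^sup>+x. g x \<partial>lborel) = 1"
    unfolding g_def using integrable_gk[of 1, where 'a = 'a] integral_gk[of 1, where 'a = 'a]
    by (subst nn_integral_eq_integral) (auto simp: gk_nonneg)
  \<comment> \<open>Invariance and mass 1 of \<open>g\<close> are the pivot: \<open>g\<close> is
    inserted next to \<open>f\<close>, exchanging the integrals moves the rotation from
    \<open>g\<close> to \<open>f\<close>, and \<open>g\<close> is integrated out again.\<close>
  have gU: "g (U y) = g y" for y
    using orthogonal_transformation_norm[OF U] by (simp add: g_def gk_def)
  have tr: "(\<integral>\<^sup>+y. h (U y + a) \<partial>lborel) = (\<integral>\<^sup>+y. h (U y) \<partial>lborel)" if [measurable]: "h \<in> borel_measurable borel" for h :: "'a \<Rightarrow> ennreal" and a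
  proof -
    obtain b where "a = U b" using surj by (metis surjD)
    then have "U y + a = U (y + b)" for y using lin by (simp add: linear_add)
    then show ?thesis using nn_integral_lborel_translate[of "\<lambda>y. h (U y)" b] by simp
  qed
  have "(\<integral>\<^sup>+x. f x \<partial>lborel) = (\<integral>\<^sup>+y. g (U y) * (\<integral>\<^sup>+x. f x \<partial>lborel) \<partial>lborel)"
    by (simp add: nn_integral_multc gU g1)
  also have "\<dots> = (\<integral>\<^sup>+y. (\<integral>\<^sup>+x. g (U y) * f (x + U y) \<partial>lborel) \<partial>lborel)"
    by (simp add: nn_integral_cmult nn_integral_lborel_translate)
  also have "\<dots> = (\<integral>\<^sup>+x. (\<integral>\<^sup>+y. g (U y) * f (x + U y) \<partial>lborel) \<partial>lborel)"
    by (rule lborel_pair.Fubini') measurable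
  also have "\<dots> = (\<integral>\<^sup>+x. (\<integral>\<^sup>+y. g (U y + - x) * f (x + (U y + - x)) \<partial>lborel) \<partial>lborel)"
    by (rule nn_integral_cong, rule tr[symmetric]) measurable
  also have "\<dots> = (\<integral>\<^sup>+x. (\<integral>\<^sup>+y. g (U y + - x) * f (U y) \<partial>lborel) \<partial>lborel)" by simp
  also have "\<dots> = (\<integral>\<^sup>+y. (\<integral>\<^sup>+x. g (U y + - x) * f (U y) \<partial>lborel) \<partial>lborel)"
    by (rule lborel_pair.Fubini') measurable
  also have "\<dots> = (\<integral>\<^sup>+y. (\<integral>\<^sup>+x. g (U y + - x) \<partial>lborel) * f (U y) \<partial>lborel)"
    by (simp add: nn_integral_multc)
  also have "\<dots> = (\<integral>\<^sup>+y. f (U y) \<partial>lborel)"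
  proof (rule nn_integral_cong)
    fix y
    have "(\<integral>\<^sup>+x. g (U y + - x) \<partial>lborel) = (\<integral>\<^sup>+x. g (x + U y) \<partial>lborel)"
      using nn_integral_lborel_reflect[of "\<lambda>x. g (x + U y)"] by (simp add: add.commute)
    also have "\<dots> = 1" by (simp add: nn_integral_lborel_translate g1)
    finally show "(\<integral>\<^sup>+x. g (U y + - x) \<partial>lborel) * f (U y) = f (U y)" by simp
  qed
  finally show ?thesis by simp
qed

section \<open>Gaussian measures and their images under co-isometries\<close>

definition gauss :: "real \<Rightarrow> 'a::euclidean_space measure" where
  "gauss t = density lborel (\<lambda>x. ennreal (gk t x))"

lemma sets_gauss [measurable_cong, simp]: "sets (gauss t) = sets borel"
  by (simp add: gauss_def)

lemma space_gauss [simp]: "space (gauss t) = UNIV"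
  by (simp add: gauss_def)

lemma std_gaussian_eq_gauss: "std_gaussian = gauss 1"
  by (simp add: std_gaussian_def gauss_def gk_def)

lemma integral_gauss:
  fixes g :: "'a::euclidean_space \<Rightarrow> real"
  assumes "0 < t" "g \<in> borel_measurable borel"
  shows "(\<integral>x. g x \<partial>gauss t) = (\<integral>x. g x * gk t x \<partial>lborel)"
  unfolding gauss_def using assms by (subst integral_density) (auto simp: gk_nonneg mult.commute)

lemma gk_Pair:
  assumes "0 < t" shows "gk t (u, x) = gk t u * gk t x"
proof -
  have "(norm (u, x))\<^sup>2 = (norm u)\<^sup>2 + (norm x)\<^sup>2" by (simp add: norm_prod_def)
  then have "- (norm (u, x))\<^sup>2 / (2 * t) = - (norm u)\<^sup>2 / (2 * t) + - (norm x)\<^sup>2 / (2 * t)"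
    by (simp only: minus_add_distrib add_divide_distrib)
  then show ?thesis
    unfolding gk_def by (simp only: exp_add DIM_prod power_add real_sqrt_mult times_divide_times_eq)
qed

text \<open>The co-isometry \<open>A\<close> is the first component of the rotation \<open>(u, x) \<mapsto> (A x, A\<^sup>T u + (1 - A\<^sup>T A) x)\<close>.\<close>

lemma distr_gauss_coisometry:
  fixes A :: "real ^ 'd ^ 'n"
  assumes A: "A ** transpose A = mat 1" and t: "0 < t"
  shows "distr (gauss t) borel (\<lambda>x. A *v x) = gauss t"
proof -
  define T where "T = transpose A"
  define U :: "(real ^ 'n) \<times> (real ^ 'd) \<Rightarrow> (real ^ 'n) \<times> (real ^ 'd)"
    where "U = (\<lambda>w. (A *v snd w, T *v fst w + (snd w - T *v (A *v snd w))))"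
  have AT: "A *v (T *v u) = u" for u
    unfolding T_def matrix_vector_mul_assoc A by simp
  have adj: "(T *v u) \<bullet> x = u \<bullet> (A *v x)" for u x
    unfolding T_def by (metis dot_lmul_matrix inner_commute matrix_transpose_mul transpose_matrix_vector transpose_transpose)
  have lin: "linear U"
    unfolding U_def
    by (rule linearI) (auto simp: matrix_vector_right_distrib scaleR_matrix_vector_assoc[symmetric] algebra_simps
        matrix_vector_mult_scaleR)
  \<comment> \<open>\<open>x\<close> splits into a part in the range of \<open>T\<close> and
    \<open>q\<close> in the kernel of \<open>A\<close>, which are orthogonal. As \<open>T\<close> is
    an isometry, \<open>U\<close> merely exchanges \<open>u\<close> with \<open>A *v x\<close> and
    keeps \<open>q\<close>.\<close>
  have nrm: "norm (U w) = norm w" for w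
  proof -
    obtain u x where w: "w = (u, x)" by (cases w)
    define q where "q = x - T *v (A *v x)"
    have 1: "(T *v u) \<bullet> (T *v v) = u \<bullet> v" for u v by (simp add: adj AT)
    have Aq: "A *v q = 0" by (simp add: q_def matrix_vector_mult_diff_distrib AT)
    have 2: "(T *v u) \<bullet> q = 0" for u by (simp add: adj Aq)
    have "x \<bullet> x = (T *v (A *v x) + q) \<bullet> (T *v (A *v x) + q)" by (simp add: q_def)
    also have "\<dots> = (A *v x) \<bullet> (A *v x) + q \<bullet> q"
      using 1 2 by (simp add: inner_add_left inner_add_right inner_commute)
    finally have xx: "x \<bullet> x = (A *v x) \<bullet> (A *v x) + q \<bullet> q" .
    have "U w \<bullet> U w = (A *v x) \<bullet> (A *v x) + (T *v u + q) \<bullet> (T *v u + q)"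
      by (simp add: U_def w q_def)
    also have "\<dots> = u \<bullet> u + x \<bullet> x"
      using 1 2 xx by (simp add: inner_add_left inner_add_right inner_commute)
    finally have "U w \<bullet> U w = w \<bullet> w" by (simp add: w)
    then show ?thesis by (simp add: norm_eq_sqrt_inner)
  qed
  have U: "orthogonal_transformation U"
    using lin nrm by (simp add: orthogonal_transformation)
  have [measurable]: "U \<in> borel_measurable borel"
    using lin by (intro borel_measurable_continuous_onI linear_continuous_on linear_conv_bounded_linear[THEN iffD1])
  have mA [measurable]: "(\<lambda>x. A *v x) \<in> borel_measurable borel"
    by (intro borel_measurable_continuous_onI continuous_intros)
  have one1: "(\<integral>\<^sup>+x. ennreal (gk t (x::real ^ 'n)) \<partial>lborel) = 1"
    using integrable_gk[OF t, where 'a = "real ^ 'n"] integral_gk[OF t, where 'a = "real ^ 'n"] t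
    by (subst nn_integral_eq_integral) (auto simp: gk_nonneg)
  have one2: "(\<integral>\<^sup>+x. ennreal (gk t (x::real ^ 'd)) \<partial>lborel) = 1"
    using integrable_gk[OF t, where 'a = "real ^ 'd"] integral_gk[OF t, where 'a = "real ^ 'd"] t
    by (subst nn_integral_eq_integral) (auto simp: gk_nonneg)
  \<comment> \<open>An independent Gaussian \<open>u\<close> of mass 1 is adjoined, the rotation
    carries \<open>A *v x\<close> to the first component, and the second component is then
    integrated out.\<close>
  have key: "(\<integral>\<^sup>+x. g (A *v x) * ennreal (gk t x) \<partial>lborel) = (\<integral>\<^sup>+u. g u * ennreal (gk t u) \<partial>lborel)"
    if g [measurable]: "g \<in> borel_measurable borel" for g :: "real ^ 'n \<Rightarrow> ennreal"
  proof -
    have gp: "ennreal (gk t (w :: (real ^ 'n) \<times> (real ^ 'd))) = ennreal (gk t (fst w)) * ennreal (gk t (snd w))" for w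
      using gk_Pair[OF t, of "fst w" "snd w"] t by (simp add: ennreal_mult gk_nonneg)
    have gU: "gk t (U w) = gk t w" for w using nrm by (simp add: gk_def)
    have mgA: "(\<lambda>x. g (A *v x)) \<in> borel_measurable borel" by (rule measurable_compose[OF mA g])
    have mf: "(\<lambda>w :: (real ^ 'n) \<times> (real ^ 'd). \<phi> (fst w)) \<in> borel_measurable (lborel \<Otimes>\<^sub>M lborel)"
      if "\<phi> \<in> borel_measurable borel" for \<phi> :: "real ^ 'n \<Rightarrow> ennreal"
      by (rule measurable_compose[OF measurable_fst]) (simp add: that)
    have ms: "(\<lambda>w :: (real ^ 'n) \<times> (real ^ 'd). \<phi> (snd w)) \<in> borel_measurable (lborel \<Otimes>\<^sub>M lborel)"
      if "\<phi> \<in> borel_measurable borel" for \<phi> :: "real ^ 'd \<Rightarrow> ennreal"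
      by (rule measurable_compose[OF measurable_snd]) (simp add: that)
    have mk1: "(\<lambda>x. ennreal (gk t (x :: real ^ 'n))) \<in> borel_measurable borel"
      and mk2: "(\<lambda>x. ennreal (gk t (x :: real ^ 'd))) \<in> borel_measurable borel"
      and mk3: "(\<lambda>x. ennreal (gk t (x :: (real ^ 'n) \<times> (real ^ 'd)))) \<in> borel_measurable borel"
      by measurable
    have m3: "(\<lambda>w. g (fst (w :: (real ^ 'n) \<times> (real ^ 'd)))) \<in> borel_measurable borel"
      by (rule measurable_compose[OF _ g]) (intro borel_measurable_continuous_onI continuous_intros)
    have "(\<integral>\<^sup>+x. g (A *v x) * ennreal (gk t x) \<partial>lborel)
        = (\<integral>\<^sup>+u. (\<integral>\<^sup>+x. ennreal (gk t (u :: real ^ 'n)) * (g (A *v x) * ennreal (gk t x)) \<partial>lborel) \<partial>lborel)"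
      by (simp add: nn_integral_cmult nn_integral_multc one1)
    also have "\<dots> = (\<integral>\<^sup>+w. ennreal (gk t (fst (w :: (real ^ 'n) \<times> (real ^ 'd)))) * (g (A *v snd w) * ennreal (gk t (snd w))) \<partial>(lborel \<Otimes>\<^sub>M lborel))"
      by (subst lborel.nn_integral_fst[symmetric], intro borel_measurable_times_ennreal mf[OF mk1] ms[OF mgA] ms[OF mk2]) simp
    also have "\<dots> = (\<integral>\<^sup>+w. g (fst (U w)) * ennreal (gk t (U w)) \<partial>lborel)"
      unfolding lborel_prod gU gp by (simp add: U_def mult_ac)
    also have "\<dots> = (\<integral>\<^sup>+w. g (fst w) * ennreal (gk t (w :: (real ^ 'n) \<times> (real ^ 'd))) \<partial>lborel)"
      by (rule nn_integral_lborel_orthogonal[OF U], intro borel_measurable_times_ennreal m3 mk3)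
    also have "\<dots> = (\<integral>\<^sup>+w. (g (fst w) * ennreal (gk t (fst w))) * ennreal (gk t (snd (w :: (real ^ 'n) \<times> (real ^ 'd)))) \<partial>(lborel \<Otimes>\<^sub>M lborel))"
      unfolding lborel_prod gp by (simp add: mult_ac)
    also have "\<dots> = (\<integral>\<^sup>+u. (\<integral>\<^sup>+x. (g u * ennreal (gk t u)) * ennreal (gk t (x :: real ^ 'd)) \<partial>lborel) \<partial>lborel)"
      by (subst lborel.nn_integral_fst[symmetric], intro borel_measurable_times_ennreal mf[OF mk1] mf[OF g] ms[OF mk2]) simp
    also have "\<dots> = (\<integral>\<^sup>+u. g u * ennreal (gk t u) \<partial>lborel)"
      by (simp add: nn_integral_cmult one2)
    finally show ?thesis .
  qed
  show ?thesis
  proof (rule measure_eqI)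
    fix S assume "S \<in> sets (distr (gauss t) borel (\<lambda>x. A *v x))"
    then have S [measurable]: "S \<in> sets borel" by simp
    have "emeasure (distr (gauss t) borel (\<lambda>x. A *v x)) S = (\<integral>\<^sup>+x. indicator S (A *v x) * ennreal (gk t x) \<partial>lborel)"
      unfolding gauss_def
      using measurable_sets_borel[OF mA S]
      by (subst emeasure_distr) (auto simp: emeasure_density indicator_def mult.commute intro!: nn_integral_cong)
    also have "\<dots> = (\<integral>\<^sup>+u. indicator S u * ennreal (gk t u) \<partial>lborel)" by (rule key) measurable
    also have "\<dots> = emeasure (gauss t) S"
      unfolding gauss_def by (simp add: emeasure_density mult.commute)
    finally show "emeasure (distr (gauss t) borel (\<lambda>x. A *v x)) S = emeasure (gauss t) S" .
  qed simp
qed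

lemma gk_vec:
  assumes "0 < t" shows "gk t (z :: real ^ 'd) = (\<Prod>i\<in>UNIV. gk t (z $ i))"
proof -
  have "gk t z = (\<Prod>b\<in>range (\<lambda>i. axis i 1 :: real ^ 'd). normal_density 0 (sqrt t) (z \<bullet> b))"
    using gk_eq_prod[OF assms, of z] by (simp only: Basis_vec_eq_range_axis)
  also have "\<dots> = (\<Prod>i\<in>UNIV. gk t (z $ i))"
    using assms by (subst prod.reindex[OF inj_axis_1]) (simp add: gk_real inner_axis)
  finally show ?thesis .
qed

text \<open>Independence and the common law are encoded by factorising expectations of products of
  one-coordinate functions. Integrability is stated separately, since the value of a Bochner
  integral does not imply it.\<close>

locale iid_flow = std_gap_flow +
  fixes \<mu> :: "(real ^ 'd) measure"
  assumes prob_\<mu>: "prob_space \<mu>" and sets_\<mu>': "sets \<mu> = sets borel"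
    and indep_int: "\<And>h :: 'd \<Rightarrow> real \<Rightarrow> real. (\<And>i. integrable \<nu> (h i)) \<Longrightarrow> integrable \<mu> (\<lambda>y. \<Prod>i\<in>UNIV. h i (y $ i))"
    and indep: "\<And>h :: 'd \<Rightarrow> real \<Rightarrow> real. (\<And>i. integrable \<nu> (h i)) \<Longrightarrow> (\<integral>y. (\<Prod>i\<in>UNIV. h i (y $ i)) \<partial>\<mu>) = (\<Prod>i\<in>UNIV. \<integral>y. h i y \<partial>\<nu>)"
begin

lemma cross_moment:
  "integrable \<mu> (\<lambda>y. y $ i * y $ j) \<and> (\<integral>y. y $ i * y $ j \<partial>\<mu>) = (if i = j then 1 else 0)"
proof (cases "i = j")
  case True
  define h where "h k = (if k = i then \<lambda>y::real. y\<^sup>2 else (\<lambda>_. 1))" for k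
  have h: "integrable \<nu> (h k)" for k using second_moment by (simp add: h_def)
  have "(\<Prod>k\<in>UNIV. h k (y $ k)) = y $ i * y $ j" for y :: "real ^ 'd"
    using True by (simp add: h_def if_distrib[of "\<lambda>f. f _"] prod.delta power2_eq_square cong: if_cong)
  moreover have "(\<Prod>k\<in>UNIV. \<integral>y. h k y \<partial>\<nu>) = 1"
    by (intro prod.neutral) (auto simp: h_def variance_1)
  ultimately show ?thesis using indep_int[of h, OF h] indep[of h, OF h] True by simp
next
  case False
  define h where "h k = (if k = i then \<lambda>y::real. y else if k = j then \<lambda>y. y else (\<lambda>_. 1))" for k
  have i1: "integrable \<nu> (\<lambda>y. y)"
  proof (rule Bochner_Integration.integrable_bound[where f = "\<lambda>y. 1 + (norm y)\<^sup>2"])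
    have "\<bar>y\<bar> \<le> \<bar>1 + y\<^sup>2\<bar>" for y :: real
      using sum_squares_ge_zero[of "\<bar>y\<bar> - 1/2" 0] by (simp add: power2_eq_square algebra_simps)
    then show "AE y in \<nu>. norm y \<le> norm (1 + (norm y)\<^sup>2)" by simp
  qed (use second_moment in auto)
  have h: "integrable \<nu> (h k)" for k using i1 by (simp add: h_def)
  have "(\<Prod>k\<in>UNIV. h k (y $ k)) = y $ i * y $ j" for y :: "real ^ 'd"
  proof -
    have "(\<Prod>k\<in>UNIV. h k (y $ k)) = h i (y $ i) * (\<Prod>k\<in>UNIV - {i}. h k (y $ k))" by (rule prod.remove) auto
    also have "(\<Prod>k\<in>UNIV - {i}. h k (y $ k)) = h j (y $ j) * (\<Prod>k\<in>UNIV - {i} - {j}. h k (y $ k))"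
      using False by (intro prod.remove) auto
    also have "(\<Prod>k\<in>UNIV - {i} - {j}. h k (y $ k)) = 1" by (intro prod.neutral) (auto simp: h_def)
    finally show ?thesis using False by (simp add: h_def)
  qed
  moreover have "(\<Prod>k\<in>UNIV. \<integral>y. h k y \<partial>\<nu>) = 0"
    by (rule prod_zero[of UNIV]) (auto intro!: bexI[of _ i] simp: h_def mean_0)
  ultimately show ?thesis using indep_int[of h, OF h] indep[of h, OF h] False by simp
qed

lemma \<mu>_heat_flow: "heat_flow \<mu>"
proof -
  interpret M: prob_space \<mu> by (rule prob_\<mu>)
  show ?thesis
  proof
    show "sets \<mu> = sets borel" by (rule sets_\<mu>')
    have "(norm y)\<^sup>2 = (\<Sum>i\<in>UNIV. y $ i * y $ i)" for y :: "real ^ 'd"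
      by (simp add: power2_norm_eq_inner inner_vec_def)
    then show "integrable \<mu> (\<lambda>y. (norm y)\<^sup>2)"
      using cross_moment by simp
  qed
qed

sublocale Y: heat_flow \<mu> by (rule \<mu>_heat_flow)

lemma Y_conv_gk: 
  assumes t: "0 < t" shows "Y.conv (gk t) x = (\<Prod>i\<in>UNIV. f t (x $ i))"
proof -
  have "Y.conv (gk t) x = (\<integral>y. (\<Prod>i\<in>UNIV. gk t (x $ i - y $ i)) \<partial>\<mu>)"
    by (simp add: Y.conv_def gk_vec[OF t])
  also have "\<dots> = (\<Prod>i\<in>UNIV. \<integral>y. gk t (x $ i - y) \<partial>\<nu>)"
    by (rule indep[of "\<lambda>i y. gk t (x $ i - y)"]) (rule integrable_conv[OF gdom_gk[OF t]])
  finally show ?thesis by (simp add: conv_def)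
qed

text \<open>Boxes are an intersection-stable generator and their indicators are products, so the
  factorised expectations determine the law. The product density serves to show that the law of
  \<open>A Y\<close> has a density.\<close>

lemma Y_density:
  assumes \<nu>: "\<nu> = density lborel (\<lambda>x. ennreal (f0 x))" and [measurable]: "f0 \<in> borel_measurable borel"
    and f0: "\<And>x. 0 \<le> f0 x"
  shows "\<mu> = density lborel (\<lambda>x. ennreal (\<Prod>i\<in>UNIV. f0 (x $ i)))"
proof -
  have "(\<integral>\<^sup>+x. ennreal (f0 x) \<partial>lborel) = 1"
    using emeasure_space_1 unfolding \<nu> by (simp add: emeasure_density)
  then have i0: "integrable lborel f0"
    using f0 by (intro integrableI_nonneg) auto
  have pm [measurable]: "(\<lambda>x::real ^ 'd. \<Prod>i\<in>UNIV. f0 (x $ i)) \<in> borel_measurable borel" by measurable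
  have p0: "0 \<le> (\<Prod>i\<in>UNIV. f0 (x $ i))" for x :: "real ^ 'd" using f0 by (intro prod_nonneg) auto
  show ?thesis
  proof (rule measure_eqI_generator_eq)
    let ?E = "range (\<lambda>(a, b). box a b :: (real ^ 'd) set)"
    show "Int_stable ?E" by (auto simp: Int_stable_def box_Int_box)
    show "?E \<subseteq> Pow UNIV" "sets \<mu> = sigma_sets UNIV ?E"
      "sets (density lborel (\<lambda>x. ennreal (\<Prod>i\<in>UNIV. f0 (x $ i)))) = sigma_sets UNIV ?E"
      by (simp_all add: borel_eq_box sets_\<mu>')
    let ?A = "\<lambda>n::nat. box (- (real n *\<^sub>R One)) (real n *\<^sub>R One) :: (real ^ 'd) set"
    show "range ?A \<subseteq> ?E" "(\<Union>i. ?A i) = UNIV" unfolding UN_box_eq_UNIV by auto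
    show "emeasure \<mu> (?A i) \<noteq> \<infinity>" for i by (simp add: Y.emeasure_finite)
    fix X assume "X \<in> ?E"
    then obtain a b where X: "X = box a b" by auto
    have ind: "indicator X x = (\<Prod>i\<in>UNIV. indicator {a $ i<..<b $ i} (x $ i) :: real)" for x
    proof (cases "x \<in> X")
      case True
      then show ?thesis by (simp add: X mem_box_cart)
    next
      case False
      then obtain i where "x $ i \<notin> {a $ i<..<b $ i}" by (auto simp: X mem_box_cart)
      then have z: "(indicator {a $ i<..<b $ i} (x $ i) :: real) = 0" by (rule indicator_simps)
      have "(\<Prod>i\<in>UNIV. indicator {a $ i<..<b $ i} (x $ i) :: real) = 0"
        by (intro prod_zero bexI[of _ i] z) auto
      with False show ?thesis by simp
    qed
    let ?h = "\<lambda>i. indicator {a $ i<..<b $ i} :: real \<Rightarrow> real"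
    have hi: "integrable \<nu> (?h i)" for i by (rule integrable_const_bound[where B = 1]) auto
    have hi': "integrable lborel (\<lambda>x. ?h i x * f0 x)" for i
      using integrable_mult_indicator[OF _ i0, of "{a $ i<..<b $ i}"] by simp
    have e: "(\<integral>x. ?h i x \<partial>\<nu>) = (\<integral>x. ?h i x * f0 x \<partial>lborel)" for i
      unfolding \<nu> using f0 by (subst integral_density) (auto simp: mult.commute)
    have [measurable]: "X \<in> sets borel" by (simp add: X)
    have "emeasure \<mu> X = ennreal (\<integral>x. indicator X x \<partial>\<mu>)"
      by (simp add: Y.emeasure_eq_measure)
    also have "(\<integral>x. indicator X x \<partial>\<mu>) = (\<Prod>i\<in>UNIV. \<integral>x. ?h i x * f0 x \<partial>lborel)"
      unfolding ind e[symmetric] by (rule indep[OF hi])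
    also have "\<dots> = (\<integral>x. (\<Prod>i\<in>UNIV. ?h i (x $ i) * f0 (x $ i)) \<partial>(lborel :: (real ^ 'd) measure))"
      by (rule integral_lborel_prod_vec[of "\<lambda>i x. ?h i x * f0 x", OF hi', symmetric])
    also have "\<dots> = (\<integral>x. (\<Prod>i\<in>UNIV. f0 (x $ i)) * indicator X x \<partial>lborel)"
      by (simp add: ind prod.distrib mult.commute)
    also have "ennreal \<dots> = (\<integral>\<^sup>+x. ennreal ((\<Prod>i\<in>UNIV. f0 (x $ i)) * indicator X x) \<partial>lborel)"
    proof (rule nn_integral_eq_integral[symmetric])
      show "integrable lborel (\<lambda>x. (\<Prod>i\<in>UNIV. f0 (x $ i)) * indicator X x)"
        using integrable_lborel_prod_vec[of "\<lambda>i x. ?h i x * f0 x", OF hi'] by (simp add: ind prod.distrib mult.commute)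
    qed (use p0 in auto)
    also have "\<dots> = emeasure (density lborel (\<lambda>x. ennreal (\<Prod>i\<in>UNIV. f0 (x $ i)))) X"
      using p0 by (subst emeasure_density) (auto simp: indicator_def intro!: nn_integral_cong)
    finally show "emeasure \<mu> X = emeasure (density lborel (\<lambda>x. ennreal (\<Prod>i\<in>UNIV. f0 (x $ i)))) X" .
  qed
qed

end

section \<open>The law of the linear image\<close>

locale projection_flow = iid_flow \<nu> c \<mu> for \<nu> c and \<mu> :: "(real ^ 'd) measure" +
  fixes A :: "real ^ 'd ^ 'n"
  assumes A: "A ** transpose A = mat 1"
begin

definition \<omega> :: "(real ^ 'n) measure" where "\<omega> = distr \<mu> borel (\<lambda>y. A *v y)"

lemma measurable_A [measurable]: "(\<lambda>x. A *v x) \<in> borel_measurable borel"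
  by (intro borel_measurable_continuous_onI continuous_intros)

lemma sum_A: "(\<Sum>j\<in>UNIV. A $ k $ j * A $ l $ j) = (if k = l then 1 else 0)"
proof -
  have "(A ** transpose A) $ k $ l = (\<Sum>j\<in>UNIV. A $ k $ j * A $ l $ j)"
    by (simp add: matrix_matrix_mult_def transpose_def)
  then show ?thesis by (simp add: A mat_def)
qed

lemma A_second_moment:
  "integrable \<mu> (\<lambda>y. (norm (A *v y))\<^sup>2) \<and> (\<integral>y. (norm (A *v y))\<^sup>2 \<partial>\<mu>) = CARD('n)"
proof -
  have eq: "(norm (A *v y))\<^sup>2 = (\<Sum>k\<in>UNIV. \<Sum>i\<in>UNIV. \<Sum>j\<in>UNIV. (A $ k $ i * A $ k $ j) * (y $ i * y $ j))" for y
    by (simp add: power2_norm_eq_inner inner_vec_def matrix_vector_mult_def sum_product mult_ac)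
  have "(\<integral>y. (norm (A *v y))\<^sup>2 \<partial>\<mu>) = (\<Sum>k\<in>UNIV. \<Sum>i\<in>UNIV. \<Sum>j\<in>UNIV. (A $ k $ i * A $ k $ j) * (if i = j then 1 else 0))"
    unfolding eq using cross_moment by (simp add: Bochner_Integration.integral_sum)
  also have "\<dots> = (\<Sum>k\<in>UNIV. \<Sum>i\<in>UNIV. A $ k $ i * A $ k $ i)"
    by (simp add: if_distrib[of "\<lambda>x. _ * x"] cong: if_cong)
  also have "\<dots> = CARD('n)" unfolding sum_A by simp
  finally show ?thesis unfolding eq using cross_moment by simp
qed

sublocale W: heat_flow \<omega>
proof -
  interpret W: prob_space \<omega> unfolding \<omega>_def by (rule Y.prob_space_distr) (simp add: measurable_cong_sets[OF sets_\<mu>' refl])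
  show "heat_flow \<omega>"
  proof
    show "sets \<omega> = sets borel" by (simp add: \<omega>_def)
    show "integrable \<omega> (\<lambda>y. (norm y)\<^sup>2)"
      unfolding \<omega>_def using A_second_moment by (subst integrable_distr_eq) auto
  qed
qed

lemma W_second_moment: "(\<integral>y. (norm y)\<^sup>2 \<partial>\<omega>) = CARD('n)"
  unfolding \<omega>_def using A_second_moment by (subst integral_distr) auto

lemma integral_gk_coisometry:
  fixes h :: "real ^ 'n \<Rightarrow> real"
  assumes t: "0 < t" and [measurable]: "h \<in> borel_measurable borel"
  shows "(\<integral>x. h (A *v x) * gk t x \<partial>lborel) = (\<integral>w. h w * gk t w \<partial>lborel)"
proof -
  have "(\<integral>w. h w * gk t w \<partial>lborel) = (\<integral>w. h w \<partial>distr (gauss t) borel (\<lambda>x. A *v x))"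
    unfolding distr_gauss_coisometry[OF A t] by (simp add: integral_gauss[OF t])
  also have "\<dots> = (\<integral>x. h (A *v x) \<partial>gauss t)" by (rule integral_distr) measurable
  finally show ?thesis by (simp add: integral_gauss[OF t])
qed

text \<open>Adding Gaussian noise commutes with \<open>A\<close>, because a co-isometry maps the
  Gaussian to the Gaussian of the same time. The factor \<open>q\<close> lets one statement cover
  the density and its derivative; bounded functions \<open>h\<close> of the image stand in for
  disintegration along the fibres of \<open>A\<close>.\<close>

lemma W_conv_eq_kernel:
  fixes h q :: "real ^ 'n \<Rightarrow> real"
  assumes t: "0 < t" and [measurable]: "h \<in> borel_measurable borel" and B: "\<And>x. \<bar>h x\<bar> \<le> B"
    and k: "gdom k" and k': "gdom k'" and kq: "\<And>z. k z = q z * gk t z" and k'q: "\<And>z. k' z = q (A *v z) * gk t z"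
    and [measurable]: "q \<in> borel_measurable borel"
  shows "(\<integral>w. h w * W.conv k w \<partial>lborel) = (\<integral>x. h (A *v x) * Y.conv k' x \<partial>lborel)"
proof -
  have B0: "0 \<le> B" using B[of 0] by simp
  have b: "B \<le> B * (1 + r)" if "0 \<le> r" for r :: real using B0 that by (simp add: algebra_simps)
  have g: "\<bar>h x\<bar> \<le> B * (1 + (norm x)\<^sup>2)" for x
    by (rule order_trans[OF B b]) simp
  have g': "\<bar>h (A *v x)\<bar> \<le> B * (1 + (norm x)\<^sup>2)" for x
    by (rule order_trans[OF B b]) simp
  have [measurable]: "k \<in> borel_measurable borel" by (rule gdom_measurable[OF k])
  have mh [measurable]: "(\<lambda>x. h (A *v x)) \<in> borel_measurable borel"
    by (rule measurable_compose[OF measurable_A]) measurable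
  have "(\<integral>w. h w * W.conv k w \<partial>lborel) = (\<integral>y. (\<integral>z. h (y + z) * k z \<partial>lborel) \<partial>\<omega>)"
    by (rule W.gdom_weighted_integral[OF k _ g]) measurable
  also have "\<dots> = (\<integral>y. (\<integral>z. h (A *v y + z) * k z \<partial>lborel) \<partial>\<mu>)"
    unfolding \<omega>_def by (rule integral_distr) (auto simp: measurable_cong_sets[OF sets_\<mu>' refl])
  also have "\<dots> = (\<integral>y. (\<integral>z. h (A *v (y + z)) * k' z \<partial>lborel) \<partial>\<mu>)"
  proof (rule Bochner_Integration.integral_cong[OF refl])
    fix y
    show "(\<integral>z. h (A *v y + z) * k z \<partial>lborel) = (\<integral>z. h (A *v (y + z)) * k' z \<partial>lborel)"
      using integral_gk_coisometry[OF t, of "\<lambda>z. h (A *v y + z) * q z"]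
      by (simp add: kq k'q matrix_vector_right_distrib mult.assoc)
  qed
  also have "\<dots> = (\<integral>x. h (A *v x) * Y.conv k' x \<partial>lborel)"
    by (rule Y.gdom_weighted_integral[OF k' mh g', symmetric])
  finally show ?thesis .
qed

lemma W_conv_eq:
  fixes h :: "real ^ 'n \<Rightarrow> real"
  assumes t: "0 < t" and h: "h \<in> borel_measurable borel" and B: "\<And>x. \<bar>h x\<bar> \<le> B"
  shows "(\<integral>w. h w * W.conv (gk t) w \<partial>lborel) = (\<integral>x. h (A *v x) * Y.conv (gk t) x \<partial>lborel)"
    and "(\<integral>w. h w * W.conv (gk1 v t) w \<partial>lborel) = (\<integral>x. h (A *v x) * Y.conv (gk1 (transpose A *v v) t) x \<partial>lborel)"
proof -
  show "(\<integral>w. h w * W.conv (gk t) w \<partial>lborel) = (\<integral>x. h (A *v x) * Y.conv (gk t) x \<partial>lborel)"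
    by (rule W_conv_eq_kernel[where q = "\<lambda>_. 1", OF t h B]) (auto intro: gdom_gk t)
  show "(\<integral>w. h w * W.conv (gk1 v t) w \<partial>lborel) = (\<integral>x. h (A *v x) * Y.conv (gk1 (transpose A *v v) t) x \<partial>lborel)"
  proof (rule W_conv_eq_kernel[where q = "\<lambda>z. - (z \<bullet> v) / t", OF t h B])
    have "z \<bullet> (transpose A *v v) = (A *v z) \<bullet> v" for z
      by (metis dot_lmul_matrix inner_commute transpose_matrix_vector)
    then show "gk1 (transpose A *v v) t z = - ((A *v z) \<bullet> v) / t * gk t z" for z
      unfolding gk1_def by (simp only:)
  qed (auto intro: gdom_gk1 t simp: gk1_def)
qed

text \<open>A Lebesgue null set is null for the Gaussian, which is the image under \<open>A\<close>
  of a Gaussian; its preimage is hence Gaussian null, then Lebesgue null, then null for the law of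
  \<open>Y\<close>. Radon-Nikodym supplies the density.\<close>

lemma W_has_lebesgue_density:
  assumes "has_lebesgue_density \<nu>"
  shows "has_lebesgue_density \<omega>"
proof -
  from assms obtain f where [measurable]: "f \<in> borel_measurable borel" and \<nu>: "\<nu> = density lborel f"
    unfolding has_lebesgue_density_def by blast
  have "(\<integral>\<^sup>+x. f x \<partial>lborel) = 1"
    using emeasure_space_1 unfolding \<nu> by (simp add: emeasure_density)
  then have "AE x in lborel. f x \<noteq> \<infinity>" by (intro nn_integral_PInf_AE) auto
  then have "\<nu> = density lborel (\<lambda>x. ennreal (enn2real (f x)))"
    unfolding \<nu> by (intro density_cong) (auto simp: less_top)
  from Y_density[OF this]
  have \<mu>: "\<mu> = density lborel (\<lambda>x. ennreal (\<Prod>i\<in>UNIV. enn2real (f (x $ i))))" by simp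
  have "absolutely_continuous lborel \<omega>"
    unfolding absolutely_continuous_def
  proof
    fix N :: "(real ^ 'n) set" assume N: "N \<in> null_sets lborel"
    then have [measurable]: "N \<in> sets borel" by auto
    let ?P = "(\<lambda>y. A *v y) -` N"
    have P: "?P \<in> sets borel" using measurable_sets_borel[OF measurable_A] by simp
    have nn: "S \<in> null_sets lborel" if "emeasure (gauss 1) S = 0" "S \<in> sets borel" for S :: "(real ^ 'd) set"
    proof -
      have "S \<in> null_sets (gauss 1)" using that by (simp add: null_sets_def)
      then have "AE x in lborel. x \<in> S \<longrightarrow> ennreal (gk 1 x) = 0"
        unfolding gauss_def by (subst (asm) null_sets_density_iff) auto
      then have "AE x in lborel. x \<notin> S"
        by eventually_elim (metis ennreal_eq_0_iff gk_pos not_le zero_less_one)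
      then show ?thesis using that(2) by (subst AE_iff_null_sets) auto
    qed
    have "emeasure (gauss 1) N = 0"
    proof -
      have "AE x in lborel. x \<notin> N" using N by (rule AE_not_in)
      then have "(\<integral>\<^sup>+x. ennreal (gk 1 x) * indicator N x \<partial>lborel) = 0"
        by (subst nn_integral_0_iff_AE) (auto simp: indicator_def elim!: eventually_mono)
      then show ?thesis unfolding gauss_def by (simp add: emeasure_density)
    qed
    then have "emeasure (distr (gauss 1) borel (\<lambda>y. A *v y)) N = 0"
      using distr_gauss_coisometry[OF A, of 1] by simp
    then have "emeasure (gauss 1) ?P = 0" by (subst (asm) emeasure_distr) auto
    then have "?P \<in> null_sets lborel" using P by (rule nn)
    then have "AE x in lborel. x \<notin> ?P" by (rule AE_not_in)
    then have "emeasure \<mu> ?P = 0"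
      unfolding \<mu> using P
      by (subst emeasure_density) (auto simp: nn_integral_0_iff_AE indicator_def elim!: eventually_mono)
    then have "emeasure \<omega> N = 0"
      unfolding \<omega>_def by (subst emeasure_distr) (auto simp: measurable_cong_sets[OF sets_\<mu>' refl])
    then show "N \<in> null_sets \<omega>" by (simp add: null_sets_def)
  qed
  then obtain g where "g \<in> borel_measurable lborel" "density lborel g = \<omega>"
    using sigma_finite_measure.Radon_Nikodym[OF sigma_finite_lborel, of \<omega>] by auto
  then show ?thesis unfolding has_lebesgue_density_def by (intro bexI[of _ g]) auto
qed

end

section \<open>The Fisher information of a linear image\<close>

locale projection_flow_at = projection_flow \<nu> c \<mu> A
  for \<nu> c and \<mu> :: "(real ^ 'd) measure" and A :: "real ^ 'd ^ 'n" +
  fixes t :: real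
  assumes t: "0 < t"
begin

abbreviation "p1 \<equiv> conv (gk t)"
abbreviation "P \<equiv> Y.conv (gk t)"
abbreviation "p \<equiv> W.conv (gk t)"

lemma p1_pos: "0 < p1 x" and P_pos: "0 < P y" and p_pos: "0 < p w"
  using t by (simp_all add: conv_gk_pos Y.conv_gk_pos W.conv_gk_pos)

lemma p1_meas [measurable]: "p1 \<in> borel_measurable borel" and P_meas [measurable]: "P \<in> borel_measurable borel"
  and p_meas [measurable]: "p \<in> borel_measurable borel"
  using t by (auto intro!: borel_measurable_conv Y.borel_measurable_conv W.borel_measurable_conv gdom_gk)

text \<open>Relative to the density \<open>p1\<close>, \<open>\<rho>\<close> is the score of a
  coordinate, \<open>r\<close> its deviation from the Gaussian score, and \<open>s\<close> is 1
  minus the normalised Stein kernel. With this sign the derivative of \<open>s * p1\<close> is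
  \<open>r * p1\<close>.\<close>

definition r :: "real \<Rightarrow> real" where "r x = score_dev t x / p1 x"
definition s :: "real \<Rightarrow> real" where "s x = - stein_dev t x / p1 x"
definition \<rho> :: "real \<Rightarrow> real" where "\<rho> x = conv (gk1 1 t) x / p1 x"

lemma continuous_on_parts:
  "continuous_on UNIV p1" "continuous_on UNIV (conv (gk1 1 t))" "continuous_on UNIV (score_dev t)" "continuous_on UNIV (stein_dev t)"
  using t by (auto intro!: continuous_on_conv gdom_gk gdom_gk1 score_dev_cont DERIV_imp_continuous_on[OF stein_dev_deriv[OF t]])

lemma parts_measurable [measurable]: "r \<in> borel_measurable borel" "s \<in> borel_measurable borel" "\<rho> \<in> borel_measurable borel"
proof -
  have [measurable]: "conv (gk1 1 t) \<in> borel_measurable borel" "score_dev t \<in> borel_measurable borel" "stein_dev t \<in> borel_measurable borel"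
    using continuous_on_parts by (auto intro: borel_measurable_continuous_onI)
  show "r \<in> borel_measurable borel" "s \<in> borel_measurable borel" "\<rho> \<in> borel_measurable borel"
    unfolding r_def s_def \<rho>_def by measurable
qed

definition letters :: "(real \<Rightarrow> real) set" where "letters = {\<lambda>_. 1, r, s, \<rho>}"

lemma sq_eq:
  "(r x)\<^sup>2 * p1 x = (score_dev t x)\<^sup>2 / p1 x" "(s x)\<^sup>2 * p1 x = (stein_dev t x)\<^sup>2 / p1 x" "(\<rho> x)\<^sup>2 * p1 x = (conv (gk1 1 t) x)\<^sup>2 / p1 x"
  "r x * p1 x = score_dev t x" "s x * p1 x = - stein_dev t x" "\<rho> x * p1 x = conv (gk1 1 t) x"
  using p1_pos[of x] by (simp_all add: r_def s_def \<rho>_def power2_eq_square)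

lemma letters_sq_int:
  assumes "a \<in> letters" shows "integrable lborel (\<lambda>x. (a x)\<^sup>2 * p1 x)"
  using assms t score_dev_sq_int[OF t] stein_dev_sq_int[OF t] integrable_score_sq[OF t, of 1] integrable_conv_gk[OF t]
  by (auto simp: letters_def sq_eq)

lemma letters_measurable: "a \<in> letters \<Longrightarrow> a \<in> borel_measurable borel"
  by (auto simp: letters_def)

lemma letters_mult_int:
  assumes a: "a \<in> letters" and b: "b \<in> letters"
  shows "integrable lborel (\<lambda>x. a x * b x * p1 x)"
proof (rule Bochner_Integration.integrable_bound[where f = "\<lambda>x. (a x)\<^sup>2 * p1 x + (b x)\<^sup>2 * p1 x"])
  have [measurable]: "a \<in> borel_measurable borel" "b \<in> borel_measurable borel"
    using a b by (auto intro: letters_measurable)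
  show "(\<lambda>x. a x * b x * p1 x) \<in> borel_measurable lborel" by measurable
  show "integrable lborel (\<lambda>x. (a x)\<^sup>2 * p1 x + (b x)\<^sup>2 * p1 x)"
    using letters_sq_int a b by simp
  have "\<bar>a x * b x * p1 x\<bar> \<le> (a x)\<^sup>2 * p1 x + (b x)\<^sup>2 * p1 x" for x
  proof -
    have "2 * (\<bar>a x\<bar> * \<bar>b x\<bar>) \<le> (a x)\<^sup>2 + (b x)\<^sup>2"
      using zero_le_power2[of "\<bar>a x\<bar> - \<bar>b x\<bar>"] by (simp add: power2_diff)
    moreover have "0 \<le> \<bar>a x\<bar> * \<bar>b x\<bar>" by simp
    ultimately have "\<bar>a x * b x\<bar> \<le> (a x)\<^sup>2 + (b x)\<^sup>2"
      unfolding abs_mult by linarith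
    from mult_right_mono[OF this, of "p1 x"] show ?thesis
      using p1_pos[of x] by (simp add: abs_mult algebra_simps)
  qed
  then show "AE x in lborel. norm (a x * b x * p1 x) \<le> norm ((a x)\<^sup>2 * p1 x + (b x)\<^sup>2 * p1 x)"
    by (intro AE_I2) (simp add: order_trans[OF _ abs_ge_self])
qed

abbreviation "fi \<equiv> fisher t - 1 / (1 + t)"
definition "s2 = (\<integral>x. (s x)\<^sup>2 * p1 x \<partial>lborel)"
definition "cr = (\<integral>x. s x * \<rho> x * p1 x \<partial>lborel)"

lemma letter_integrals:
  "(\<integral>x. r x * p1 x \<partial>lborel) = 0" "(\<integral>x. s x * p1 x \<partial>lborel) = 0" "(\<integral>x. \<rho> x * p1 x \<partial>lborel) = 0"
  "(\<integral>x. r x * r x * p1 x \<partial>lborel) = fi" "(\<integral>x. s x * s x * p1 x \<partial>lborel) = s2" "(\<integral>x. \<rho> x * \<rho> x * p1 x \<partial>lborel) = fisher t"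
  "(\<integral>x. s x * \<rho> x * p1 x \<partial>lborel) = cr" "(\<integral>x. \<rho> x * s x * p1 x \<partial>lborel) = cr"
  using score_dev_mean[OF t] stein_dev_mean[OF t] f_moments(6)[OF t] score_dev_sq[OF t]
  by (simp_all add: sq_eq s2_def cr_def fisher_real power2_eq_square[symmetric] mult.commute[of "\<rho> _" "s _"])

lemma s2_bound: "fisher t * s2 \<le> (2 / c - 1) * fi"
  using fisher_stein_dev_le[OF t] by (simp add: s2_def sq_eq)

lemma s2_nonneg: "0 \<le> s2"
  unfolding s2_def using p1_pos by (intro integral_nonneg_AE AE_I2) (simp add: less_imp_le)

lemma fisher_pos: "0 < fisher t"
proof -
  have "0 < 1 / (1 + t)" using t by simp
  then show ?thesis using fisher_ge[OF t] by linarith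
qed

lemma cr_sq_le: "cr\<^sup>2 \<le> fisher t * s2"
proof -
  define l where "l = cr / fisher t"
  have i: "integrable lborel (\<lambda>x. (s x)\<^sup>2 * p1 x)" "integrable lborel (\<lambda>x. s x * \<rho> x * p1 x)" "integrable lborel (\<lambda>x. (\<rho> x)\<^sup>2 * p1 x)"
    using letters_sq_int letters_mult_int by (auto simp: letters_def)
  have "0 \<le> (\<integral>x. (s x - l * \<rho> x)\<^sup>2 * p1 x \<partial>lborel)"
    using p1_pos by (intro integral_nonneg_AE AE_I2) (simp add: less_imp_le)
  also have "\<dots> = (\<integral>x. (s x)\<^sup>2 * p1 x - 2 * l * (s x * \<rho> x * p1 x) + l\<^sup>2 * ((\<rho> x)\<^sup>2 * p1 x) \<partial>lborel)"
    by (rule Bochner_Integration.integral_cong) (auto simp: power2_eq_square algebra_simps)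
  also have "\<dots> = s2 - 2 * l * cr + l\<^sup>2 * fisher t"
    using i letter_integrals(6) by (simp add: s2_def cr_def power2_eq_square)
  also have "\<dots> = s2 - cr\<^sup>2 / fisher t"
    using fisher_pos by (simp add: l_def power2_eq_square)
  finally have "cr\<^sup>2 / fisher t \<le> s2" by simp
  then show ?thesis using fisher_pos by (simp add: divide_le_eq mult.commute)
qed

section \<open>Products of one-coordinate functions and their Gram matrix\<close>

lemma
  fixes h :: "'d \<Rightarrow> real \<Rightarrow> real"
  assumes h: "\<And>i. integrable lborel (\<lambda>x. h i x * p1 x)"
  shows tensor_int: "integrable lborel (\<lambda>x. (\<Prod>i\<in>UNIV. h i (x $ i)) * P x)"
    and tensor_integral: "(\<integral>x. (\<Prod>i\<in>UNIV. h i (x $ i)) * P x \<partial>lborel) = (\<Prod>i\<in>UNIV. \<integral>x. h i x * p1 x \<partial>lborel)"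
  using integrable_lborel_prod_vec[of "\<lambda>i x. h i x * p1 x", OF h] integral_lborel_prod_vec[of "\<lambda>i x. h i x * p1 x", OF h]
  by (simp_all add: Y_conv_gk[OF t] prod.distrib)

text \<open>For \<open>q = (i, j)\<close> these are the factors that arise when
  \<open>s (x $ j)\<close> times the density is differentiated in coordinate \<open>i\<close> and
  divided by the density: \<open>\<rho>\<close> at \<open>i\<close> and \<open>s\<close> at
  \<open>j\<close> if they differ, a single \<open>r\<close> if they coincide.\<close>

definition letter :: "'d \<times> 'd \<Rightarrow> 'd \<Rightarrow> real \<Rightarrow> real" where
  "letter q m = (if fst q = snd q then (if m = fst q then r else (\<lambda>_. 1))
     else if m = fst q then \<rho> else if m = snd q then s else (\<lambda>_. 1))"

definition \<tau> :: "'d \<times> 'd \<Rightarrow> real ^ 'd \<Rightarrow> real" where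
  "\<tau> q x = (\<Prod>m\<in>UNIV. letter q m (x $ m))"

lemma letter_in: "letter q m \<in> letters"
  by (simp add: letter_def letters_def)

lemma letter_mean_0: "m = fst q \<or> m = snd q \<Longrightarrow> (\<integral>x. letter q m x * p1 x \<partial>lborel) = 0"
  by (auto simp: letter_def letter_integrals)

lemma letter_1: "m \<noteq> fst q \<Longrightarrow> m \<noteq> snd q \<Longrightarrow> letter q m = (\<lambda>_. 1)"
  by (simp add: letter_def)

lemma \<tau>_measurable [measurable]: "\<tau> q \<in> borel_measurable borel"
proof -
  have [measurable]: "letter q m \<in> borel_measurable borel" for m by (rule letters_measurable[OF letter_in])
  show ?thesis unfolding \<tau>_def by measurable
qed

lemma \<tau>_int: "integrable lborel (\<lambda>x. \<tau> q x * P x)"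
  unfolding \<tau>_def using letters_mult_int[OF letter_in, of "\<lambda>_. 1" q] by (intro tensor_int) (simp add: letters_def)

lemma \<tau>_mult: "\<tau> q x * \<tau> q' x = (\<Prod>m\<in>UNIV. letter q m (x $ m) * letter q' m (x $ m))"
  by (simp add: \<tau>_def prod.distrib)

lemma \<tau>_mult_int: "integrable lborel (\<lambda>x. \<tau> q x * \<tau> q' x * P x)"
  unfolding \<tau>_mult by (rule tensor_int[of "\<lambda>m x. letter q m x * letter q' m x"]) (rule letters_mult_int[OF letter_in letter_in])

lemma \<tau>_mult_integral:
  "(\<integral>x. \<tau> q x * \<tau> q' x * P x \<partial>lborel) = (\<Prod>m\<in>UNIV. \<integral>x. letter q m x * letter q' m x * p1 x \<partial>lborel)"
  unfolding \<tau>_mult by (rule tensor_integral[of "\<lambda>m x. letter q m x * letter q' m x"]) (rule letters_mult_int[OF letter_in letter_in])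

lemma p1_one: "(\<integral>x. p1 x \<partial>lborel) = 1"
  using t by (simp add: integral_conv_gk)

text \<open>Since \<open>r\<close>, \<open>s\<close> and \<open>\<rho>\<close> have mean 0, a
  coordinate that occurs in only one of the pairs annihilates the product. There survive
  \<open>q' = q\<close> and the swapped pair, whose two coordinates each contribute the covariance
  \<open>cr\<close>; on the diagonal both cases coincide, and the inner condition avoids counting it
  twice.\<close>

lemma gram:
  "(\<integral>x. \<tau> q x * \<tau> q' x * P x \<partial>lborel) =
    (if q' = q then (if fst q = snd q then fi else fisher t * s2) else 0) +
    (if q' = prod.swap q then (if fst q = snd q then 0 else cr\<^sup>2) else 0)"
proof -
  obtain i j k l where q: "q = (i, j)" and q': "q' = (k, l)" by (metis surj_pair)
  let ?g = "\<lambda>m. \<integral>x. letter q m x * letter q' m x * p1 x \<partial>lborel"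
  have zero: "(\<Prod>m\<in>UNIV. ?g m) = 0" if "?g m = 0" for m
    using that by (intro prod_zero) auto
  have prod1: "(\<Prod>m\<in>UNIV. ?g m) = ?g i" if "\<And>m. m \<noteq> i \<Longrightarrow> ?g m = 1"
    using that prod.remove[of UNIV i ?g] by (simp add: prod.neutral)
  have prod2: "(\<Prod>m\<in>UNIV. ?g m) = ?g i * ?g j" if "i \<noteq> j" "\<And>m. m \<noteq> i \<Longrightarrow> m \<noteq> j \<Longrightarrow> ?g m = 1"
  proof -
    have "(\<Prod>m\<in>UNIV. ?g m) = ?g i * (?g j * (\<Prod>m\<in>UNIV - {i} - {j}. ?g m))"
      using that(1) prod.remove[of UNIV i ?g] prod.remove[of "UNIV - {i}" j ?g] by simp
    also have "(\<Prod>m\<in>UNIV - {i} - {j}. ?g m) = 1" using that(2) by (intro prod.neutral) auto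
    finally show ?thesis by simp
  qed
  have out: "?g m = 1" if "m \<notin> {i, j}" "m \<notin> {k, l}" for m
    using that by (simp add: q q' letter_1 p1_one)
  consider "\<exists>m\<in>{i, j}. m \<notin> {k, l}" | "\<exists>m\<in>{k, l}. m \<notin> {i, j}" | "{i, j} = {k, l}" by blast
  then show ?thesis
  proof cases
    case 1
    then obtain m where m: "m \<in> {i, j}" "m \<notin> {k, l}" by blast
    then have "?g m = 0" using letter_mean_0[of m q] by (auto simp: q q' letter_1)
    moreover have "q' \<noteq> q" "q' \<noteq> prod.swap q" using m by (auto simp: q q')
    ultimately show ?thesis using zero by (simp add: \<tau>_mult_integral)
  next
    case 2
    then obtain m where m: "m \<in> {k, l}" "m \<notin> {i, j}" by blast
    then have "?g m = 0" using letter_mean_0[of m q'] by (auto simp: q q' letter_1)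
    moreover have "q' \<noteq> q" "q' \<noteq> prod.swap q" using m by (auto simp: q q')
    ultimately show ?thesis using zero by (simp add: \<tau>_mult_integral)
  next
    case 3
    show ?thesis
    proof (cases "i = j")
      case True
      with 3 have "k = i" "l = i" by auto
      then have "(\<Prod>m\<in>UNIV. ?g m) = ?g i" using out True by (intro prod1) auto
      also have "?g i = fi" using True \<open>k = i\<close> \<open>l = i\<close> by (simp add: q q' letter_def letter_integrals)
      finally show ?thesis using True \<open>k = i\<close> \<open>l = i\<close> by (simp add: \<tau>_mult_integral q q')
    next
      case False
      have P2: "(\<Prod>m\<in>UNIV. ?g m) = ?g i * ?g j" using out False 3 by (intro prod2) auto
      from 3 False have "(k = i \<and> l = j) \<or> (k = j \<and> l = i)" by (auto simp: doubleton_eq_iff)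
      then show ?thesis
      proof
        assume kl: "k = i \<and> l = j"
        then have "?g i = fisher t" "?g j = s2" using False by (auto simp: q q' letter_def letter_integrals)
        then show ?thesis using kl False P2 by (simp add: \<tau>_mult_integral q q')
      next
        assume kl: "k = j \<and> l = i"
        then have "?g i = cr" "?g j = cr" using False by (auto simp: q q' letter_def letter_integrals)
        then show ?thesis using kl False P2 by (simp add: \<tau>_mult_integral q q' power2_eq_square)
      qed
    qed
  qed
qed

definition lin :: "('d \<times> 'd \<Rightarrow> real) \<Rightarrow> real ^ 'd \<Rightarrow> real" where
  "lin k x = (\<Sum>q\<in>UNIV. k q * \<tau> q x)"

lemma lin_measurable [measurable]: "lin k \<in> borel_measurable borel"
  unfolding lin_def by measurable

lemma lin_sq_eq: "(lin k x)\<^sup>2 * P x = (\<Sum>q\<in>UNIV. \<Sum>q'\<in>UNIV. k q * k q' * (\<tau> q x * \<tau> q' x * P x))"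
  unfolding lin_def power2_eq_square sum_product
  unfolding sum_distrib_right
  by (intro sum.cong refl) (simp add: mult_ac)

lemma lin_sq_int: "integrable lborel (\<lambda>x. (lin k x)\<^sup>2 * P x)"
  unfolding lin_sq_eq by (intro Bochner_Integration.integrable_sum integrable_mult_right \<tau>_mult_int)

lemma lin_sq_integral:
  "(\<integral>x. (lin k x)\<^sup>2 * P x \<partial>lborel) =
    (\<Sum>q\<in>UNIV. (k q)\<^sup>2 * (if fst q = snd q then fi else fisher t * s2)) +
    (\<Sum>q\<in>UNIV. k q * k (prod.swap q) * (if fst q = snd q then 0 else cr\<^sup>2))"
proof -
  have "(\<integral>x. (lin k x)\<^sup>2 * P x \<partial>lborel) = (\<Sum>q\<in>UNIV. \<Sum>q'\<in>UNIV. k q * k q' * (\<integral>x. \<tau> q x * \<tau> q' x * P x \<partial>lborel))"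
    unfolding lin_sq_eq using \<tau>_mult_int by (simp add: Bochner_Integration.integral_sum)
  also have "\<dots> = (\<Sum>q\<in>UNIV. (k q)\<^sup>2 * (if fst q = snd q then fi else fisher t * s2) + k q * k (prod.swap q) * (if fst q = snd q then 0 else cr\<^sup>2))"
  proof (rule sum.cong[OF refl])
    fix q
    have "(\<Sum>q'\<in>UNIV. k q * k q' * (\<integral>x. \<tau> q x * \<tau> q' x * P x \<partial>lborel))
        = (\<Sum>q'\<in>UNIV. (if q' = q then k q * k q' * (if fst q = snd q then fi else fisher t * s2) else 0)
            + (if q' = prod.swap q then k q * k q' * (if fst q = snd q then 0 else cr\<^sup>2) else 0))"
      unfolding gram by (rule sum.cong) (auto simp: distrib_left)
    also have "\<dots> = k q * k q * (if fst q = snd q then fi else fisher t * s2) + k q * k (prod.swap q) * (if fst q = snd q then 0 else cr\<^sup>2)"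
      unfolding sum.distrib by simp
    finally show "(\<Sum>q'\<in>UNIV. k q * k q' * (\<integral>x. \<tau> q x * \<tau> q' x * P x \<partial>lborel))
        = (k q)\<^sup>2 * (if fst q = snd q then fi else fisher t * s2) + k q * k (prod.swap q) * (if fst q = snd q then 0 else cr\<^sup>2)"
      by (simp add: power2_eq_square)
  qed
  finally show ?thesis by (simp only: sum.distrib)
qed

text \<open>Entries of B = A^T A, the orthogonal projection onto the row space of \<open>A\<close>;
  \<open>A_b\<close>, \<open>b_sq\<close> and \<open>b_trace\<close> express A B = A, the diagonal
  of B^2 = B, and that the trace is the rank.\<close>

definition b :: "'d \<Rightarrow> 'd \<Rightarrow> real" where "b i j = (\<Sum>k\<in>UNIV. A $ k $ i * A $ k $ j)"

lemma b_sym: "b i j = b j i"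
  by (simp add: b_def mult.commute)

lemma A_b: "(\<Sum>i\<in>UNIV. A $ k $ i * b i j) = A $ k $ j"
proof -
  have "(\<Sum>i\<in>UNIV. A $ k $ i * b i j) = (\<Sum>i\<in>UNIV. \<Sum>l\<in>UNIV. (A $ k $ i * A $ l $ i) * A $ l $ j)"
    by (simp add: b_def sum_distrib_left mult_ac)
  also have "\<dots> = (\<Sum>l\<in>UNIV. (\<Sum>i\<in>UNIV. A $ k $ i * A $ l $ i) * A $ l $ j)"
    by (subst sum.swap) (simp add: sum_distrib_right)
  also have "\<dots> = A $ k $ j" by (simp add: sum_A if_distrib[of "\<lambda>x. x * _"] cong: if_cong)
  finally show ?thesis .
qed

lemma b_sq: "(\<Sum>i\<in>UNIV. (b i j)\<^sup>2) = b j j"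
proof -
  have "(\<Sum>i\<in>UNIV. (b i j)\<^sup>2) = (\<Sum>i\<in>UNIV. \<Sum>k\<in>UNIV. A $ k $ j * (A $ k $ i * b i j))"
    by (simp add: power2_eq_square b_def[of _ j] sum_distrib_right mult_ac)
  also have "\<dots> = (\<Sum>k\<in>UNIV. A $ k $ j * (\<Sum>i\<in>UNIV. A $ k $ i * b i j))"
    by (subst sum.swap) (simp add: sum_distrib_left)
  finally show ?thesis by (simp add: A_b b_def[of j j])
qed

lemma b_trace: "(\<Sum>j\<in>UNIV. b j j) = CARD('n)"
proof -
  have "(\<Sum>j\<in>UNIV. b j j) = (\<Sum>k\<in>UNIV. \<Sum>j\<in>UNIV. A $ k $ j * A $ k $ j)"
    unfolding b_def by (rule sum.swap)
  then show ?thesis unfolding sum_A by simp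
qed

lemma b_nonneg: "0 \<le> b j j"
  by (simp add: b_def sum_nonneg)

text \<open>The field of directions is \<open>(1 - A\<^sup>T A) e\<^sub>j\<close>, which lies in the kernel of \<open>A\<close>.\<close>

lemma integrate_along_kernel:
  fixes h :: "real ^ 'n \<Rightarrow> real"
  assumes h [measurable]: "h \<in> borel_measurable borel" and B: "\<And>w. \<bar>h w\<bar> \<le> B"
  shows "(\<integral>x. h (A *v x) * (\<Sum>i\<in>UNIV. ((if i = j then 1 else 0) - b i j) * (\<tau> (i, j) x * P x)) \<partial>lborel) = 0"
proof -
  define v :: "real ^ 'd" where "v = (\<chi> i. (if i = j then 1 else 0) - b i j)"
  have Av: "A *v v = 0"
  proof (rule vec_eq_iff[THEN iffD2], rule allI)
    fix k
    have "(A *v v) $ k = (\<Sum>i\<in>UNIV. A $ k $ i * (if i = j then 1 else 0)) - (\<Sum>i\<in>UNIV. A $ k $ i * b i j)"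
      by (simp add: matrix_vector_mult_def v_def right_diff_distrib sum_subtractf)
    then show "(A *v v) $ k = 0 $ k" by (simp add: A_b if_distrib[of "\<lambda>x. _ * x"] cong: if_cong)
  qed
  \<comment> \<open>\<open>K\<close> factorises \<open>s (x $ j)\<close> times the density and
    \<open>L i\<close> differentiates it in coordinate \<open>i\<close>; by \<open>LP\<close> the
    result is \<open>\<tau> (i, j)\<close> times the density.\<close>
  define K where "K l = (if l = j then \<lambda>x. - stein_dev t x else p1)" for l
  define K' where "K' l = (if l = j then score_dev t else conv (gk1 1 t))" for l
  define L where "L i l = (if l = i then K' l else K l)" for i l
  have L: "L i l x = letter (i, j) l x * p1 x" for i l x
    using sq_eq[of x] by (auto simp: L_def K_def K'_def letter_def)
  have LP: "(\<Prod>l\<in>UNIV. L i l (x $ l)) = \<tau> (i, j) x * P x" for i x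
    by (simp add: L \<tau>_def Y_conv_gk[OF t] prod.distrib)
  have cL: "continuous_on UNIV (L i l)" for i l
    using continuous_on_parts by (auto simp: L_def K_def K'_def intro!: continuous_intros)
  have dK: "(K l has_real_derivative K' l x) (at x)" for l x
    using DERIV_minus[OF stein_dev_deriv[OF t], of x] f_deriv[OF t, of x] by (simp add: K_def K'_def)
  have iK: "integrable lborel (K l)" for l
    using stein_dev_int[OF t] integrable_conv_gk[OF t] by (simp add: K_def)
  have hA: "(\<lambda>x. h (A *v x)) \<in> borel_measurable borel" by (rule measurable_compose[OF measurable_A h])
  have "(\<integral>x. h (A *v x) * (\<Sum>i\<in>UNIV. v $ i * (\<Prod>l\<in>UNIV. L i l (x $ l))) \<partial>lborel) = 0"
  proof (rule integral_directional_derivative_eq_0[where v = v and \<Phi> = "\<lambda>x. \<Prod>l\<in>UNIV. K l (x $ l)"])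
    fix x
    have "((\<lambda>u. \<Prod>l\<in>UNIV. K l (x $ l + u * v $ l)) has_real_derivative
        (\<Sum>l\<in>UNIV. (K' l (x $ l + 0 * v $ l) * v $ l) * (\<Prod>m\<in>UNIV - {l}. K m (x $ m + 0 * v $ m)))) (at 0)"
    proof (rule has_field_derivative_prod)
      fix l
      have "((\<lambda>u. x $ l + u * v $ l) has_real_derivative v $ l) (at 0)" by (auto intro!: derivative_eq_intros)
      from DERIV_chain2[OF dK this]
      show "((\<lambda>u. K l (x $ l + u * v $ l)) has_real_derivative K' l (x $ l + 0 * v $ l) * v $ l) (at 0)" .
    qed
    moreover have "(\<Sum>l\<in>UNIV. (K' l (x $ l + 0 * v $ l) * v $ l) * (\<Prod>m\<in>UNIV - {l}. K m (x $ m + 0 * v $ m)))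
        = (\<Sum>i\<in>UNIV. v $ i * (\<Prod>l\<in>UNIV. L i l (x $ l)))"
    proof (rule sum.cong[OF refl])
      fix i
      have "(\<Prod>l\<in>UNIV. L i l (x $ l)) = L i i (x $ i) * (\<Prod>l\<in>UNIV - {i}. L i l (x $ l))"
        by (rule prod.remove) auto
      also have "(\<Prod>l\<in>UNIV - {i}. L i l (x $ l)) = (\<Prod>l\<in>UNIV - {i}. K l (x $ l))"
        by (rule prod.cong) (auto simp: L_def)
      finally show "(K' i (x $ i + 0 * v $ i) * v $ i) * (\<Prod>m\<in>UNIV - {i}. K m (x $ m + 0 * v $ m)) = v $ i * (\<Prod>l\<in>UNIV. L i l (x $ l))"
        by (simp add: L_def)
    qed
    ultimately show "((\<lambda>u. \<Prod>l\<in>UNIV. K l ((x + u *\<^sub>R v) $ l)) has_real_derivative (\<Sum>i\<in>UNIV. v $ i * (\<Prod>l\<in>UNIV. L i l (x $ l)))) (at 0)"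
      by simp
    show "continuous_on UNIV (\<lambda>u. \<Sum>i\<in>UNIV. v $ i * (\<Prod>l\<in>UNIV. L i l ((x + u *\<^sub>R v) $ l)))"
      by (intro continuous_intros continuous_on_compose2[OF cL]) auto
    show "h (A *v (x + u *\<^sub>R v)) = h (A *v x)" for u
      by (simp add: matrix_vector_right_distrib matrix_vector_mult_scaleR Av)
    show "\<bar>h (A *v x)\<bar> \<le> B" by (rule B)
  next
    show "integrable lborel (\<lambda>x::real ^ 'd. \<Prod>l\<in>UNIV. K l (x $ l))" by (rule integrable_lborel_prod_vec[OF iK])
    show "integrable lborel (\<lambda>x. \<Sum>i\<in>UNIV. v $ i * (\<Prod>l\<in>UNIV. L i l (x $ l)))"
      unfolding LP by (intro Bochner_Integration.integrable_sum integrable_mult_right \<tau>_int)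
  qed (rule hA)
  then show ?thesis by (simp add: LP v_def)
qed

text \<open>Pairs with equal entries carry \<open>r\<close>, so \<open>lin (full k)\<close> is
  component \<open>k\<close> of \<open>A\<close> applied to the vector of coordinate score
  deviations.\<close>

definition full :: "'n \<Rightarrow> 'd \<times> 'd \<Rightarrow> real" where
  "full k q = (if fst q = snd q then A $ k $ snd q else 0)"

text \<open>What is left of \<open>full k\<close> after subtracting, for every \<open>j\<close>,
  \<open>A $ k $ j\<close> times the divergence along the \<open>j\<close>-th kernel direction,
  whose coefficients are the entries of the identity minus \<open>b\<close>.\<close>

definition reduced :: "'n \<Rightarrow> 'd \<times> 'd \<Rightarrow> real" where
  "reduced k q = A $ k $ snd q * b (fst q) (snd q)"

lemma sum_pairs: "(\<Sum>q\<in>UNIV. g q) = (\<Sum>j\<in>UNIV. \<Sum>i\<in>UNIV. g (i, j))" for g :: "'d \<times> 'd \<Rightarrow> real"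
proof -
  have "(\<Sum>q\<in>UNIV. g q) = (\<Sum>i\<in>UNIV. \<Sum>j\<in>UNIV. g (i, j))"
    by (simp add: sum.cartesian_product)
  also have "\<dots> = (\<Sum>j\<in>UNIV. \<Sum>i\<in>UNIV. g (i, j))" by (rule sum.swap)
  finally show ?thesis .
qed

lemma lin_bounded_int:
  fixes h :: "real ^ 'n \<Rightarrow> real"
  assumes h: "h \<in> borel_measurable borel" and B: "\<And>w. \<bar>h w\<bar> \<le> B"
  shows "integrable lborel (\<lambda>x. h (A *v x) * (\<tau> q x * P x))"
proof (rule Bochner_Integration.integrable_bound[where f = "\<lambda>x. B * (\<tau> q x * P x)"])
  have [measurable]: "(\<lambda>x. h (A *v x)) \<in> borel_measurable borel" by (rule measurable_compose[OF measurable_A h])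
  show "(\<lambda>x. h (A *v x) * (\<tau> q x * P x)) \<in> borel_measurable lborel" by measurable
  have "0 \<le> B" using B[of 0] by simp
  then have "\<bar>h (A *v x) * (\<tau> q x * P x)\<bar> \<le> \<bar>B * (\<tau> q x * P x)\<bar>" for x
    using B[of "A *v x"] unfolding abs_mult by (intro mult_right_mono) auto
  then show "AE x in lborel. norm (h (A *v x) * (\<tau> q x * P x)) \<le> norm (B * (\<tau> q x * P x))" by simp
  show "integrable lborel (\<lambda>x. B * (\<tau> q x * P x))" by (intro integrable_mult_right \<tau>_int)
qed

lemma lin_eq: "h (A *v x) * lin k x * P x = (\<Sum>q\<in>UNIV. k q * (h (A *v x) * (\<tau> q x * P x)))"
  by (simp add: lin_def sum_distrib_left sum_distrib_right mult_ac)

text \<open>The difference is a combination of the fields in \<open>integrate_along_kernel\<close>.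
  Equality against all bounded functions of \<open>A *v x\<close> means equal conditional
  expectations, so either field may be used to bound the score of the image.\<close>

lemma full_eq_reduced:
  fixes h :: "real ^ 'n \<Rightarrow> real"
  assumes h: "h \<in> borel_measurable borel" and B: "\<And>w. \<bar>h w\<bar> \<le> B"
  shows "(\<integral>x. h (A *v x) * lin (full k) x * P x \<partial>lborel) = (\<integral>x. h (A *v x) * lin (reduced k) x * P x \<partial>lborel)"
proof -
  let ?e = "\<lambda>i j. \<integral>x. h (A *v x) * (\<tau> (i, j) x * P x) \<partial>lborel"
  note i = lin_bounded_int[OF h B]
  have lin_int: "(\<integral>x. h (A *v x) * lin k x * P x \<partial>lborel) = (\<Sum>j\<in>UNIV. \<Sum>i\<in>UNIV. k (i, j) * ?e i j)" for k
    unfolding lin_eq sum_pairs[symmetric] using i by (simp add: Bochner_Integration.integral_sum sum_pairs)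
  have z: "(\<Sum>i\<in>UNIV. ((if i = j then 1 else 0) - b i j) * ?e i j) = 0" for j
  proof -
    have "(\<integral>x. h (A *v x) * (\<Sum>i\<in>UNIV. ((if i = j then 1 else 0) - b i j) * (\<tau> (i, j) x * P x)) \<partial>lborel)
        = (\<integral>x. (\<Sum>i\<in>UNIV. ((if i = j then 1 else 0) - b i j) * (h (A *v x) * (\<tau> (i, j) x * P x))) \<partial>lborel)"
      by (simp add: sum_distrib_left mult_ac)
    also have "\<dots> = (\<Sum>i\<in>UNIV. ((if i = j then 1 else 0) - b i j) * ?e i j)"
      using i by (simp add: Bochner_Integration.integral_sum)
    finally show ?thesis using integrate_along_kernel[OF h B, of j] by simp
  qed
  have "(\<Sum>i\<in>UNIV. full k (i, j) * ?e i j) - (\<Sum>i\<in>UNIV. reduced k (i, j) * ?e i j) = 0" for j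
  proof -
    have "(\<Sum>i\<in>UNIV. full k (i, j) * ?e i j) - (\<Sum>i\<in>UNIV. reduced k (i, j) * ?e i j)
      = (\<Sum>i\<in>UNIV. A $ k $ j * (((if i = j then 1 else 0) - b i j) * ?e i j))"
      unfolding sum_subtractf[symmetric] by (rule sum.cong) (auto simp: full_def reduced_def algebra_simps)
    then show ?thesis unfolding sum_distrib_left[symmetric] z by simp
  qed
  then show ?thesis unfolding lin_int by (simp only: right_minus_eq)
qed

text \<open>Both sides are the derivative at 0 of the product density along
  \<open>x + u *\<^sub>R v\<close>, once from the flow and once by the product rule.\<close>

lemma Y_conv_gk1: "Y.conv (gk1 v t) x = (\<Sum>i\<in>UNIV. v $ i * (conv (gk1 1 t) (x $ i) * (\<Prod>l\<in>UNIV - {i}. p1 (x $ l))))"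
proof (rule DERIV_unique)
  show "((\<lambda>u. Y.conv (gk t) (x + u *\<^sub>R v)) has_real_derivative Y.conv (gk1 v t) x) (at 0)"
    using Y.conv_gk_deriv[OF t t t, where h = 0 and x = x and v = v] by simp
  have "((\<lambda>u. \<Prod>l\<in>UNIV. p1 (x $ l + u * v $ l)) has_real_derivative
      (\<Sum>l\<in>UNIV. (conv (gk1 1 t) (x $ l + 0 * v $ l) * v $ l) * (\<Prod>m\<in>UNIV - {l}. p1 (x $ m + 0 * v $ m)))) (at 0)"
  proof (rule has_field_derivative_prod)
    fix l
    have "((\<lambda>u. x $ l + u * v $ l) has_real_derivative v $ l) (at 0)" by (auto intro!: derivative_eq_intros)
    from DERIV_chain2[OF f_deriv[OF t] this]
    show "((\<lambda>u. p1 (x $ l + u * v $ l)) has_real_derivative conv (gk1 1 t) (x $ l + 0 * v $ l) * v $ l) (at 0)" .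
  qed
  then show "((\<lambda>u. Y.conv (gk t) (x + u *\<^sub>R v)) has_real_derivative
      (\<Sum>i\<in>UNIV. v $ i * (conv (gk1 1 t) (x $ i) * (\<Prod>l\<in>UNIV - {i}. p1 (x $ l))))) (at 0)"
    by (simp add: Y_conv_gk[OF t] mult_ac)
qed

lemma \<tau>_diag: "\<tau> (j, j) x * P x = conv (gk1 1 t) (x $ j) * (\<Prod>l\<in>UNIV - {j}. p1 (x $ l)) + x $ j / (1 + t) * P x"
proof -
  have "\<tau> (j, j) x = letter (j, j) j (x $ j) * (\<Prod>l\<in>UNIV - {j}. letter (j, j) l (x $ l))"
    unfolding \<tau>_def by (rule prod.remove) auto
  also have "(\<Prod>l\<in>UNIV - {j}. letter (j, j) l (x $ l)) = 1" by (intro prod.neutral) (auto simp: letter_def)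
  finally have 1: "\<tau> (j, j) x = r (x $ j)" by (simp add: letter_def)
  have 2: "P x = p1 (x $ j) * (\<Prod>l\<in>UNIV - {j}. p1 (x $ l))"
    unfolding Y_conv_gk[OF t] by (rule prod.remove) auto
  have "r (x $ j) * p1 (x $ j) = conv (gk1 1 t) (x $ j) + x $ j / (1 + t) * p1 (x $ j)"
    unfolding sq_eq score_dev_def by simp
  then show ?thesis unfolding 1 2 mult.assoc[symmetric] by (simp add: distrib_right)
qed

text \<open>Component \<open>k\<close> of the score of the image flow, minus the Gaussian score
  \<open>- w $ k / (1 + t)\<close>.\<close>

definition sc :: "'n \<Rightarrow> real ^ 'n \<Rightarrow> real" where
  "sc k w = W.conv (gk1 (axis k 1) t) w / p w + w $ k / (1 + t)"

lemma q_meas [measurable]: "W.conv (gk1 v t) \<in> borel_measurable borel"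
  by (rule W.borel_measurable_conv[OF gdom_gk1[OF t]])

lemma sc_meas [measurable]: "sc k \<in> borel_measurable borel"
  unfolding sc_def by measurable

text \<open>Weak form of the statement that the score of the image is the conditional expectation of
  the transported coordinate scores; the direction \<open>axis k 1\<close> pulls back to row
  \<open>k\<close> of \<open>A\<close>. The bound \<open>B'\<close> lets the linear part be treated
  by a bounded test function as well.\<close>

lemma score_projection:
  fixes h :: "real ^ 'n \<Rightarrow> real"
  assumes h [measurable]: "h \<in> borel_measurable borel" and B: "\<And>w. \<bar>h w\<bar> \<le> B" and B': "\<And>w. \<bar>h w * w $ k\<bar> \<le> B'"
  shows "(\<integral>w. h w * sc k w * p w \<partial>lborel) = (\<integral>x. h (A *v x) * lin (full k) x * P x \<partial>lborel)"
proof -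
  let ?u = "transpose A *v axis k 1"
  have u: "?u $ j = A $ k $ j" for j
    by (simp add: matrix_vector_mult_def transpose_def axis_def if_distrib[of "\<lambda>x. _ * x"] cong: if_cong)
  have grow: "\<bar>a w\<bar> \<le> D * (1 + (norm w)\<^sup>2)" if "\<And>w. \<bar>a w\<bar> \<le> D" for a :: "'z::real_normed_vector \<Rightarrow> real" and D w
  proof -
    have "0 \<le> D" using that[of 0] by simp
    then have "D \<le> D * (1 + (norm w)\<^sup>2)" by (simp add: algebra_simps)
    then show ?thesis using that[of w] by linarith
  qed
  have hA [measurable]: "(\<lambda>x. h (A *v x)) \<in> borel_measurable borel" by (rule measurable_compose[OF measurable_A h])
  have hA' [measurable]: "(\<lambda>x. h (A *v x) * (A *v x) $ k) \<in> borel_measurable borel"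
    by (rule measurable_compose[OF measurable_A, of "\<lambda>w. h w * w $ k"]) measurable
  have i1: "integrable lborel (\<lambda>w. h w * W.conv (gk1 (axis k 1) t) w)"
    by (rule W.gdom_weighted_integrable[OF gdom_gk1[OF t] h]) (rule grow[of h, OF B])
  have i2: "integrable lborel (\<lambda>w. (h w * w $ k) * p w)"
    by (rule W.gdom_weighted_integrable[OF gdom_gk[OF t] _ grow[of "\<lambda>w. h w * w $ k", OF B']]) measurable
  have j1: "integrable lborel (\<lambda>x. h (A *v x) * Y.conv (gk1 ?u t) x)"
    by (rule Y.gdom_weighted_integrable[OF gdom_gk1[OF t] hA]) (rule grow[of "\<lambda>x. h (A *v x)", OF B])
  have j2: "integrable lborel (\<lambda>x. (h (A *v x) * (A *v x) $ k) * P x)"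
    by (rule Y.gdom_weighted_integrable[OF gdom_gk[OF t] hA']) (rule grow[of "\<lambda>x. h (A *v x) * (A *v x) $ k", OF B'])
  have "(\<integral>w. h w * sc k w * p w \<partial>lborel) = (\<integral>w. h w * W.conv (gk1 (axis k 1) t) w + 1 / (1 + t) * ((h w * w $ k) * p w) \<partial>lborel)"
    using p_pos by (intro Bochner_Integration.integral_cong) (auto simp: sc_def field_simps less_imp_neq[THEN not_sym])
  also have "\<dots> = (\<integral>w. h w * W.conv (gk1 (axis k 1) t) w \<partial>lborel) + 1 / (1 + t) * (\<integral>w. (h w * w $ k) * p w \<partial>lborel)"
    using i1 i2 by simp
  also have "\<dots> = (\<integral>x. h (A *v x) * Y.conv (gk1 ?u t) x \<partial>lborel) + 1 / (1 + t) * (\<integral>x. (h (A *v x) * (A *v x) $ k) * P x \<partial>lborel)"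
    using W_conv_eq(2)[OF t h B] W_conv_eq(1)[OF t _ B'] by simp
  also have "\<dots> = (\<integral>x. h (A *v x) * Y.conv (gk1 ?u t) x + 1 / (1 + t) * ((h (A *v x) * (A *v x) $ k) * P x) \<partial>lborel)"
    using j1 j2 by simp
  also have "\<dots> = (\<integral>x. h (A *v x) * lin (full k) x * P x \<partial>lborel)"
  proof (rule Bochner_Integration.integral_cong[OF refl])
    fix x
    have "lin (full k) x = (\<Sum>j\<in>UNIV. A $ k $ j * \<tau> (j, j) x)"
      unfolding lin_def sum_pairs by (simp add: full_def if_distrib[of "\<lambda>x. x * _"] cong: if_cong)
    then have "lin (full k) x * P x = (\<Sum>j\<in>UNIV. A $ k $ j * (\<tau> (j, j) x * P x))"
      by (simp add: sum_distrib_right mult.assoc)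
    also have "\<dots> = Y.conv (gk1 ?u t) x + 1 / (1 + t) * ((A *v x) $ k * P x)"
      unfolding \<tau>_diag Y_conv_gk1 u
      by (simp add: distrib_left sum.distrib matrix_vector_mult_def sum_distrib_left sum_distrib_right sum_divide_distrib mult_ac)
    finally show "h (A *v x) * Y.conv (gk1 ?u t) x + 1 / (1 + t) * ((h (A *v x) * (A *v x) $ k) * P x) = h (A *v x) * lin (full k) x * P x"
      by (simp add: algebra_simps)
  qed
  finally show ?thesis .
qed

text \<open>Conditional expectation contracts the norm; this is proved by testing with the truncated
  score itself, using 2 a b \<le> a^2 + b^2 and absorbing half. Fatou removes the
  truncation.\<close>

lemma score_dominated:
  assumes U: "\<And>h B. h \<in> borel_measurable borel \<Longrightarrow> (\<And>w. \<bar>h w\<bar> \<le> B) \<Longrightarrow>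
    (\<integral>x. h (A *v x) * lin (full k) x * P x \<partial>lborel) = (\<integral>x. h (A *v x) * lin u x * P x \<partial>lborel)"
  shows "(\<integral>w. (sc k w)\<^sup>2 * p w \<partial>lborel) \<le> (\<integral>x. (lin u x)\<^sup>2 * P x \<partial>lborel)"
proof -
  \<comment> \<open>The bound on the score makes the test function bounded, the bound on
    \<open>w\<close> its product with \<open>w $ k\<close>; \<open>score_projection\<close> asks for
    both.\<close>
  define T where "T m = {w. norm w \<le> real m \<and> \<bar>sc k w\<bar> \<le> real m}" for m :: nat
  have [measurable]: "T m \<in> sets borel" for m unfolding T_def by measurable
  have key: "integrable lborel (\<lambda>w. indicator (T m) w * ((sc k w)\<^sup>2 * p w)) \<and>
      (\<integral>w. indicator (T m) w * ((sc k w)\<^sup>2 * p w) \<partial>lborel) \<le> (\<integral>x. (lin u x)\<^sup>2 * P x \<partial>lborel)" for m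
  proof -
    define h where "h w = indicator (T m) w * sc k w" for w
    have mh [measurable]: "h \<in> borel_measurable borel" unfolding h_def by measurable
    have B: "\<bar>h w\<bar> \<le> real m" for w by (auto simp: h_def T_def indicator_def)
    have h2: "(h w)\<^sup>2 = indicator (T m) w * (sc k w)\<^sup>2" for w by (auto simp: h_def indicator_def)
    have B2: "\<bar>(h w)\<^sup>2\<bar> \<le> (real m)\<^sup>2" for w using power_mono[OF B[of w] abs_ge_zero, of 2] by simp
    have B': "\<bar>h w * w $ k\<bar> \<le> real m * real m" for w
    proof (cases "w \<in> T m")
      case True
      then have "\<bar>w $ k\<bar> \<le> real m" using component_le_norm_cart[of w k] by (auto simp: T_def)
      then show ?thesis unfolding abs_mult using B[of w] by (intro mult_mono) auto
    qed (simp add: h_def)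
    have hA [measurable]: "(\<lambda>x. h (A *v x)) \<in> borel_measurable borel" by (rule measurable_compose[OF measurable_A mh])
    have bi: "integrable lborel (\<lambda>x. a x * q x)" if "a \<in> borel_measurable borel" "\<And>x. \<bar>a x\<bar> \<le> D" "integrable lborel q"
      for a q :: "'z::euclidean_space \<Rightarrow> real" and D
    proof (rule Bochner_Integration.integrable_bound[where f = "\<lambda>x. D * q x"])
      have "0 \<le> D" using that(2)[of 0] by simp
      then have "\<bar>a x * q x\<bar> \<le> \<bar>D * q x\<bar>" for x unfolding abs_mult using that(2)[of x] by (intro mult_right_mono) auto
      then show "AE x in lborel. norm (a x * q x) \<le> norm (D * q x)" by simp
    qed (use that in auto)
    have ip: "integrable lborel (\<lambda>w. (h w)\<^sup>2 * p w)"
      by (rule bi[OF _ B2 W.integrable_conv_gk[OF t]]) measurable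
    have iP: "integrable lborel (\<lambda>x. (h (A *v x))\<^sup>2 * P x)"
    proof (rule bi[OF _ B2 Y.integrable_conv_gk[OF t]])
      show "(\<lambda>x. (h (A *v x))\<^sup>2) \<in> borel_measurable borel" by measurable
    qed
    have iU: "integrable lborel (\<lambda>x. h (A *v x) * lin u x * P x)"
      unfolding lin_eq by (intro Bochner_Integration.integrable_sum integrable_mult_right lin_bounded_int[OF mh B])
    have "(\<integral>w. (h w)\<^sup>2 * p w \<partial>lborel) = (\<integral>w. h w * sc k w * p w \<partial>lborel)"
      by (rule Bochner_Integration.integral_cong) (auto simp: h_def indicator_def power2_eq_square)
    also have "\<dots> = (\<integral>x. h (A *v x) * lin u x * P x \<partial>lborel)"
      unfolding score_projection[OF mh B B'] by (rule U[OF mh B])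
    also have "\<dots> \<le> (\<integral>x. 1 / 2 * ((h (A *v x))\<^sup>2 * P x) + 1 / 2 * ((lin u x)\<^sup>2 * P x) \<partial>lborel)"
    proof (rule integral_mono[OF iU])
      show "integrable lborel (\<lambda>x. 1 / 2 * ((h (A *v x))\<^sup>2 * P x) + 1 / 2 * ((lin u x)\<^sup>2 * P x))"
        by (intro Bochner_Integration.integrable_add integrable_mult_right iP lin_sq_int)
      fix x
      have "0 \<le> (h (A *v x) - lin u x)\<^sup>2" by simp
      then have "h (A *v x) * lin u x \<le> 1 / 2 * (h (A *v x))\<^sup>2 + 1 / 2 * (lin u x)\<^sup>2"
        by (simp add: power2_diff)
      from mult_right_mono[OF this less_imp_le[OF P_pos], of x]
      show "h (A *v x) * lin u x * P x \<le> 1 / 2 * ((h (A *v x))\<^sup>2 * P x) + 1 / 2 * ((lin u x)\<^sup>2 * P x)"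
        by (simp add: distrib_right)
    qed
    also have "\<dots> = 1 / 2 * (\<integral>x. (h (A *v x))\<^sup>2 * P x \<partial>lborel) + 1 / 2 * (\<integral>x. (lin u x)\<^sup>2 * P x \<partial>lborel)"
      using iP lin_sq_int by simp
    also have "(\<integral>x. (h (A *v x))\<^sup>2 * P x \<partial>lborel) = (\<integral>w. (h w)\<^sup>2 * p w \<partial>lborel)"
      by (rule W_conv_eq(1)[OF t _ B2, symmetric]) measurable
    finally have "(\<integral>w. (h w)\<^sup>2 * p w \<partial>lborel) \<le> (\<integral>x. (lin u x)\<^sup>2 * P x \<partial>lborel)" by simp
    then show ?thesis using ip unfolding h2 by (simp add: mult.assoc)
  qed
  have lim: "(\<lambda>m. indicator (T m) w * ((sc k w)\<^sup>2 * p w)) \<longlonglongrightarrow> (sc k w)\<^sup>2 * p w" for w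
  proof -
    obtain N where "max (norm w) \<bar>sc k w\<bar> \<le> real N" using real_arch_simple by blast
    then have "\<forall>m\<ge>N. indicator (T m) w * ((sc k w)\<^sup>2 * p w) = (sc k w)\<^sup>2 * p w" by (auto simp: T_def)
    then show ?thesis by (intro tendsto_eventually) (auto simp: eventually_sequentially)
  qed
  show ?thesis
    by (rule integrable_limit_bounded(2)[where h = "\<lambda>m w. indicator (T m) w * ((sc k w)\<^sup>2 * p w)",
          OF key[THEN conjunct1] _ key[THEN conjunct2] lim])
      (use p_pos in \<open>auto simp: less_imp_le\<close>)
qed

text \<open>In the expanded square each \<open>w $ k * ?q k w\<close> integrates to
  \<open>- 1\<close>, and the second moment of the image flow is \<open>(1 + t) * CARD('n)\<close>;
  the outcome is the excess Fisher information of the image.\<close>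

lemma sc_sq_sum: "(\<Sum>k\<in>UNIV. \<integral>w. (sc k w)\<^sup>2 * p w \<partial>lborel) = W.fisher t - CARD('n) / (1 + t)"
proof -
  let ?q = "\<lambda>k. W.conv (gk1 (axis k 1) t)"
  have eq: "(sc k w)\<^sup>2 * p w = (?q k w)\<^sup>2 / p w + 2 / (1 + t) * (w $ k * ?q k w) + 1 / (1 + t)\<^sup>2 * ((w $ k)\<^sup>2 * p w)" for k w
  proof -
    define a where "a = 1 + t"
    have "a \<noteq> 0" using t by (simp add: a_def)
    then show ?thesis using p_pos[of w] unfolding sc_def a_def[symmetric] by (simp add: power2_eq_square field_simps)
  qed
  have i1: "integrable lborel (\<lambda>w. (?q k w)\<^sup>2 / p w)" for k by (rule W.integrable_score_sq[OF t])
  have w1: "\<bar>w $ k\<bar> \<le> 1 * (1 + (norm w)\<^sup>2)" for w :: "real ^ 'n" and k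
    using inner_abs_le[of w "axis k 1 :: real ^ 'n"] by (simp add: inner_axis)
  have w2: "\<bar>(w $ k)\<^sup>2\<bar> \<le> 1 * (1 + (norm w)\<^sup>2)" for w :: "real ^ 'n" and k
    using power_mono[OF component_le_norm_cart[of w k] abs_ge_zero, of 2] by simp
  have i2: "integrable lborel (\<lambda>w. w $ k * ?q k w)" for k
    by (rule W.gdom_weighted_integrable[OF gdom_gk1[OF t] _ w1]) measurable
  have i3: "integrable lborel (\<lambda>w. (w $ k)\<^sup>2 * p w)" for k
    by (rule W.gdom_weighted_integrable[OF gdom_gk[OF t] _ w2]) measurable
  have e2: "(\<integral>w. w $ k * ?q k w \<partial>lborel) = - 1" for k
  proof -
    have "(\<integral>w. w $ k * ?q k w \<partial>lborel) = (\<integral>y. (\<integral>z. (y + z) $ k * gk1 (axis k 1) t z \<partial>lborel) \<partial>\<omega>)"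
      by (rule W.gdom_weighted_integral[OF gdom_gk1[OF t] _ w1]) measurable
    also have "(\<lambda>y::real ^ 'n. (\<integral>z. (y + z) $ k * gk1 (axis k 1) t z \<partial>lborel)) = (\<lambda>y. - 1)"
    proof
      fix y :: "real ^ 'n"
      let ?e = "axis k 1 :: real ^ 'n"
      have "?e \<in> Basis" by (auto simp: Basis_vec_def)
      then have "has_bochner_integral lborel (\<lambda>z. - (y $ k / t) * (gk t z * (z \<bullet> ?e)) + - (1 / t) * (gk t z * (z \<bullet> ?e)\<^sup>2)) (- (y $ k / t) * 0 + - (1 / t) * t)"
        by (intro has_bochner_integral_add has_bochner_integral_mult_right gk_first_moment gk_second_moment_Basis t)
      moreover have "- (y $ k / t) * (gk t z * (z \<bullet> ?e)) + - (1 / t) * (gk t z * (z \<bullet> ?e)\<^sup>2) = (y + z) $ k * gk1 ?e t z" for z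
        by (simp add: gk1_def inner_axis power2_eq_square algebra_simps add_divide_distrib)
      ultimately show "(\<integral>z. (y + z) $ k * gk1 ?e t z \<partial>lborel) = - 1"
        using t by (simp add: has_bochner_integral_iff)
    qed
    finally show ?thesis by simp
  qed
  have "(\<Sum>k\<in>UNIV. \<integral>w. (sc k w)\<^sup>2 * p w \<partial>lborel)
      = (\<Sum>k\<in>UNIV. (\<integral>w. (?q k w)\<^sup>2 / p w \<partial>lborel) + 2 / (1 + t) * (- 1) + 1 / (1 + t)\<^sup>2 * (\<integral>w. (w $ k)\<^sup>2 * p w \<partial>lborel))"
    unfolding eq using i1 i2 i3 by (simp add: e2)
  also have "\<dots> = (\<Sum>k\<in>UNIV. \<integral>w. (?q k w)\<^sup>2 / p w \<partial>lborel) - 2 / (1 + t) * CARD('n) + 1 / (1 + t)\<^sup>2 * (\<Sum>k\<in>UNIV. \<integral>w. (w $ k)\<^sup>2 * p w \<partial>lborel)"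
    by (simp add: sum.distrib sum_subtractf sum_distrib_left sum_negf)
  also have "(\<Sum>k\<in>UNIV. \<integral>w. (w $ k)\<^sup>2 * p w \<partial>lborel) = (\<integral>w. (norm w)\<^sup>2 * p w \<partial>lborel)"
  proof -
    have "(norm w)\<^sup>2 * p w = (\<Sum>k\<in>UNIV. (w $ k)\<^sup>2 * p w)" for w
      unfolding power2_norm_eq_inner inner_vec_def sum_distrib_right by (simp add: power2_eq_square)
    then show ?thesis using i3 by (simp add: Bochner_Integration.integral_sum)
  qed
  also have "(\<integral>w. (norm w)\<^sup>2 * p w \<partial>lborel) = (1 + t) * CARD('n)"
    using W.integral_norm_conv_gk[OF t] by (simp add: W_second_moment algebra_simps)
  also have "(\<Sum>k\<in>UNIV. \<integral>w. (?q k w)\<^sup>2 / p w \<partial>lborel) = W.fisher t"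
    unfolding W.fisher_def Basis_vec_eq_range_axis by (subst sum.reindex[OF inj_axis_1]) simp
  also have "W.fisher t - 2 / (1 + t) * CARD('n) + 1 / (1 + t)\<^sup>2 * ((1 + t) * CARD('n)) = W.fisher t - CARD('n) / (1 + t)"
  proof -
    define a where "a = 1 + t"
    have "a \<noteq> 0" using t by (simp add: a_def)
    then show ?thesis unfolding a_def[symmetric] by (simp add: power2_eq_square field_simps)
  qed
  finally show ?thesis .
qed

text \<open>Scores of different coordinates are orthogonal, so the norm is governed by the sum of
  the squared entries of \<open>A\<close>, which is \<open>CARD('n)\<close>. This is the 1 in the
  minimum.\<close>

lemma fisher_le_full: "W.fisher t - CARD('n) / (1 + t) \<le> CARD('n) * fi"
proof -
  have "(\<integral>x. (lin (full k) x)\<^sup>2 * P x \<partial>lborel) = (\<Sum>j\<in>UNIV. (A $ k $ j)\<^sup>2 * fi)" for k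
  proof -
    have "(\<Sum>q\<in>UNIV. (full k q)\<^sup>2 * (if fst q = snd q then fi else fisher t * s2)) = (\<Sum>j\<in>UNIV. (A $ k $ j)\<^sup>2 * fi)"
      unfolding sum_pairs by (rule sum.cong[OF refl]) (simp add: full_def if_distrib[of "\<lambda>x. x\<^sup>2"] if_distrib[of "\<lambda>x. x * _"] cong: if_cong)
    moreover have "(\<Sum>q\<in>UNIV. full k q * full k (prod.swap q) * (if fst q = snd q then 0 else cr\<^sup>2)) = 0"
      by (rule sum.neutral) (auto simp: full_def)
    ultimately show ?thesis unfolding lin_sq_integral by simp
  qed
  then have "(\<integral>w. (sc k w)\<^sup>2 * p w \<partial>lborel) \<le> (\<Sum>j\<in>UNIV. (A $ k $ j)\<^sup>2 * fi)" for k
    using score_dominated[of k "full k"] by simp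
  then have "W.fisher t - CARD('n) / (1 + t) \<le> (\<Sum>k\<in>UNIV. \<Sum>j\<in>UNIV. (A $ k $ j)\<^sup>2 * fi)"
    unfolding sc_sq_sum[symmetric] by (rule sum_mono)
  also have "\<dots> = (\<Sum>k\<in>UNIV. \<Sum>j\<in>UNIV. A $ k $ j * A $ k $ j) * fi"
    by (simp add: sum_distrib_right power2_eq_square)
  finally show ?thesis unfolding sum_A by simp
qed

text \<open>Summing the Gram form over the rows turns products of entries of \<open>A\<close> into
  entries of \<open>b\<close>. The cost is at most \<open>S3 * fi + (V + X) * ?D\<close>, where
  \<open>X\<close> comes from the swapped pairs; then \<open>X \<le> V\<close>, \<open>?D\<close> is
  at most \<open>(2 / c - 1) * fi\<close>, and \<open>S3 + 2 * V = S2 + V\<close>.\<close>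

lemma fisher_le_reduced:
  fixes \<epsilon> \<zeta> :: real
  assumes \<epsilon>: "\<And>j. b j j \<le> \<epsilon>" and \<zeta>: "\<And>i j. i \<noteq> j \<Longrightarrow> \<bar>b i j\<bar> \<le> \<zeta>"
  shows "W.fisher t - CARD('n) / (1 + t) \<le> CARD('n) * (2 * (\<epsilon> + \<zeta>\<^sup>2 * CARD('d)) / c) * fi"
proof -
  let ?\<kappa> = "2 / c - 1" and ?D = "fisher t * s2"
  have \<kappa>: "1 \<le> ?\<kappa>" using c_le c_pos by (simp add: field_simps)
  have fi: "0 \<le> fi" using fisher_ge[OF t] .
  have D: "0 \<le> ?D" "?D \<le> ?\<kappa> * fi" "cr\<^sup>2 \<le> ?D"
    using fisher_pos s2_nonneg s2_bound cr_sq_le by (auto intro: mult_nonneg_nonneg less_imp_le)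
  \<comment> \<open>Arithmetic-geometric mean in each term of the sum defining \<open>b\<close>; it
    trades one factor of \<open>\<bar>b i j\<bar> ^ 3\<close> for diagonal entries.\<close>
  have b3: "\<bar>b i j\<bar> \<le> (b i i + b j j) / 2" for i j
  proof -
    have "\<bar>b i j\<bar> \<le> (\<Sum>k\<in>UNIV. \<bar>A $ k $ i * A $ k $ j\<bar>)" unfolding b_def by (rule sum_abs)
    also have "\<dots> \<le> (\<Sum>k\<in>UNIV. (A $ k $ i * A $ k $ i + A $ k $ j * A $ k $ j) / 2)"
    proof (rule sum_mono)
      fix k
      have "0 \<le> (\<bar>A $ k $ i\<bar> - \<bar>A $ k $ j\<bar>)\<^sup>2" by simp
      then show "\<bar>A $ k $ i * A $ k $ j\<bar> \<le> (A $ k $ i * A $ k $ i + A $ k $ j * A $ k $ j) / 2"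
        by (simp add: power2_diff abs_mult) (simp add: power2_eq_square)
    qed
    also have "\<dots> = (b i i + b j j) / 2" by (simp add: b_def sum.distrib sum_divide_distrib[symmetric])
    finally show ?thesis .
  qed
  let ?o = "\<lambda>i j x. if i = j then 0 else (x::real)"
  have o_sum: "(\<Sum>i\<in>UNIV. ?o i j ((b i j)\<^sup>2)) = b j j - (b j j)\<^sup>2" for j
  proof -
    have "(\<Sum>i\<in>UNIV. ?o i j ((b i j)\<^sup>2)) = (\<Sum>i\<in>UNIV. (b i j)\<^sup>2 - (if i = j then (b j j)\<^sup>2 else 0))"
      by (rule sum.cong) auto
    then show ?thesis by (simp add: sum_subtractf b_sq)
  qed
  define S3 where "S3 = (\<Sum>j\<in>UNIV. (b j j) ^ 3)"
  define S2 where "S2 = (\<Sum>j\<in>UNIV. (b j j)\<^sup>2)"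
  define V where "V = (\<Sum>j\<in>UNIV. \<Sum>i\<in>UNIV. ?o i j (b j j * (b i j)\<^sup>2))"
  define X where "X = (\<Sum>j\<in>UNIV. \<Sum>i\<in>UNIV. ?o i j (\<bar>b i j\<bar> ^ 3))"
  \<comment> \<open>The off-diagonal squares in column \<open>j\<close> sum to
    \<open>b j j - (b j j)\<^sup>2\<close> because \<open>b\<close> is a projection.\<close>
  have V_eq: "V = S2 - S3"
  proof -
    have "V = (\<Sum>j\<in>UNIV. b j j * (\<Sum>i\<in>UNIV. ?o i j ((b i j)\<^sup>2)))"
      unfolding V_def sum_distrib_left by (intro sum.cong) auto
    then show ?thesis unfolding o_sum S2_def S3_def sum_subtractf[symmetric]
      by (simp add: right_diff_distrib power2_eq_square power3_eq_cube mult.assoc)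
  qed
  \<comment> \<open>\<open>b3\<close> bounds \<open>X\<close> by two half sums that differ by
    exchanging \<open>i\<close> and \<open>j\<close>; as \<open>b\<close> is symmetric, each equals
    \<open>V / 2\<close>.\<close>
  have X_le: "X \<le> V"
  proof -
    have "X \<le> (\<Sum>j\<in>UNIV. \<Sum>i\<in>UNIV. ?o i j (b i i * (b i j)\<^sup>2) / 2 + ?o i j (b j j * (b i j)\<^sup>2) / 2)"
      unfolding X_def
    proof (intro sum_mono)
      fix i j
      have "\<bar>b i j\<bar> ^ 3 = \<bar>b i j\<bar> * (b i j)\<^sup>2" by (simp add: power3_eq_cube power2_eq_square)
      also have "\<dots> \<le> (b i i + b j j) / 2 * (b i j)\<^sup>2" by (rule mult_right_mono[OF b3]) simp
      finally show "?o i j (\<bar>b i j\<bar> ^ 3) \<le> ?o i j (b i i * (b i j)\<^sup>2) / 2 + ?o i j (b j j * (b i j)\<^sup>2) / 2"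
        by (simp add: algebra_simps add_divide_distrib)
    qed
    also have "\<dots> = (\<Sum>j\<in>UNIV. \<Sum>i\<in>UNIV. ?o i j (b i i * (b i j)\<^sup>2)) / 2 + V / 2"
      unfolding V_def by (simp add: sum.distrib sum_divide_distrib)
    also have "(\<Sum>j\<in>UNIV. \<Sum>i\<in>UNIV. ?o i j (b i i * (b i j)\<^sup>2)) = V"
      unfolding V_def by (subst sum.swap) (auto intro!: sum.cong simp: b_sym)
    finally show ?thesis by simp
  qed
  have V_le: "V \<le> CARD('n) * (\<zeta>\<^sup>2 * CARD('d))"
  proof -
    have "V \<le> (\<Sum>j\<in>UNIV. \<Sum>i\<in>(UNIV::'d set). b j j * \<zeta>\<^sup>2)"
      unfolding V_def
    proof (intro sum_mono)
      fix i j
      show "?o i j (b j j * (b i j)\<^sup>2) \<le> b j j * \<zeta>\<^sup>2"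
        using power_mono[OF \<zeta>[of i j] abs_ge_zero, of 2] b_nonneg[of j] by (auto intro!: mult_left_mono)
    qed
    also have "\<dots> = (\<Sum>j\<in>UNIV. b j j) * (\<zeta>\<^sup>2 * CARD('d))"
      unfolding sum_distrib_right by (intro sum.cong refl) simp
    finally show ?thesis unfolding b_trace .
  qed
  have S2_le: "S2 \<le> CARD('n) * \<epsilon>"
  proof -
    have "S2 \<le> (\<Sum>j\<in>UNIV. b j j * \<epsilon>)"
      unfolding S2_def power2_eq_square using \<epsilon> b_nonneg by (intro sum_mono mult_left_mono) auto
    then show ?thesis by (simp add: sum_distrib_right[symmetric] b_trace)
  qed
  have red: "(\<integral>w. (sc k w)\<^sup>2 * p w \<partial>lborel) \<le> (\<Sum>j\<in>UNIV. \<Sum>i\<in>UNIV. (A $ k $ j * A $ k $ j) * ((b i j)\<^sup>2 * (if i = j then fi else ?D))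
      + (A $ k $ j * A $ k $ i) * ?o i j (b i j * b j i * cr\<^sup>2))" for k
  proof -
    have "(\<integral>w. (sc k w)\<^sup>2 * p w \<partial>lborel) \<le> (\<integral>x. (lin (reduced k) x)\<^sup>2 * P x \<partial>lborel)"
      by (rule score_dominated) (rule full_eq_reduced)
    also have "\<dots> = (\<Sum>j\<in>UNIV. \<Sum>i\<in>UNIV. (A $ k $ j * A $ k $ j) * ((b i j)\<^sup>2 * (if i = j then fi else ?D))
      + (A $ k $ j * A $ k $ i) * ?o i j (b i j * b j i * cr\<^sup>2))"
      unfolding lin_sq_integral sum_pairs sum.distrib[symmetric]
      by (intro sum.cong refl) (simp add: reduced_def power2_eq_square mult_ac)
    finally show ?thesis .
  qed
  have "W.fisher t - CARD('n) / (1 + t) \<le> (\<Sum>k\<in>UNIV. \<Sum>j\<in>UNIV. \<Sum>i\<in>UNIV. (A $ k $ j * A $ k $ j) * ((b i j)\<^sup>2 * (if i = j then fi else ?D))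
      + (A $ k $ j * A $ k $ i) * ?o i j (b i j * b j i * cr\<^sup>2))"
    unfolding sc_sq_sum[symmetric] using red by (rule sum_mono)
  also have "\<dots> = (\<Sum>j\<in>UNIV. \<Sum>i\<in>UNIV. \<Sum>k\<in>UNIV. (A $ k $ j * A $ k $ j) * ((b i j)\<^sup>2 * (if i = j then fi else ?D))
      + (A $ k $ j * A $ k $ i) * ?o i j (b i j * b j i * cr\<^sup>2))"
    by (subst sum.swap, rule sum.cong[OF refl], subst sum.swap, rule refl)
  also have "\<dots> = (\<Sum>j\<in>UNIV. \<Sum>i\<in>UNIV. b j j * ((b i j)\<^sup>2 * (if i = j then fi else ?D)) + b j i * ?o i j (b i j * b j i * cr\<^sup>2))"
    by (simp add: sum.distrib sum_distrib_right[symmetric] b_def[symmetric])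
  also have "\<dots> \<le> (\<Sum>j\<in>UNIV. \<Sum>i\<in>UNIV. (if i = j then (b j j) ^ 3 * fi else 0) + (?o i j (b j j * (b i j)\<^sup>2) * ?D + ?o i j (\<bar>b i j\<bar> ^ 3) * ?D))"
  proof (intro sum_mono)
    fix i j
    show "b j j * ((b i j)\<^sup>2 * (if i = j then fi else ?D)) + b j i * ?o i j (b i j * b j i * cr\<^sup>2)
        \<le> (if i = j then (b j j) ^ 3 * fi else 0) + (?o i j (b j j * (b i j)\<^sup>2) * ?D + ?o i j (\<bar>b i j\<bar> ^ 3) * ?D)"
    proof (cases "i = j")
      case True
      then show ?thesis by (simp add: power2_eq_square power3_eq_cube)
    next
      case False
      have "b j i * (b i j * b j i * cr\<^sup>2) = (b i j) ^ 3 * cr\<^sup>2"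
        by (simp add: b_sym[of j i] power3_eq_cube)
      also have "\<dots> \<le> \<bar>b i j\<bar> ^ 3 * cr\<^sup>2"
        unfolding power_abs[symmetric] by (intro mult_right_mono) auto
      also have "\<dots> \<le> \<bar>b i j\<bar> ^ 3 * ?D" using D(3) by (intro mult_left_mono) auto
      finally show ?thesis using False by simp
    qed
  qed
  also have "\<dots> = S3 * fi + (V * ?D + X * ?D)"
    unfolding sum.distrib by (simp add: S3_def V_def X_def sum_distrib_right)
  \<comment> \<open>The factor \<open>?\<kappa>\<close> is at least 1 as \<open>c \<le> 1\<close>;
    granting it to the diagonal part too lets \<open>S3\<close> combine with
    \<open>V\<close>.\<close>
  also have "\<dots> \<le> S3 * (?\<kappa> * fi) + (V * (?\<kappa> * fi) + V * (?\<kappa> * fi))"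
  proof (intro add_mono mult_left_mono)
    show "0 \<le> S3" unfolding S3_def using b_nonneg by (intro sum_nonneg zero_le_power)
    have V0: "0 \<le> V" unfolding V_def using b_nonneg by (intro sum_nonneg) auto
    then show "0 \<le> V" .
    show "fi \<le> ?\<kappa> * fi" using mult_right_mono[OF \<kappa> fi] by simp
    show "?D \<le> ?\<kappa> * fi" by (rule D(2))
    have "X * ?D \<le> V * ?D" using X_le D(1) by (rule mult_right_mono)
    also have "\<dots> \<le> V * (?\<kappa> * fi)" using D(2) V0 by (rule mult_left_mono)
    finally show "X * ?D \<le> V * (?\<kappa> * fi)" .
  qed
  also have "\<dots> = (S2 + V) * (?\<kappa> * fi)"
  proof -
    have "S3 * y + (V * y + V * y) = (S2 + V) * y" for y :: real
      unfolding V_eq by (simp add: algebra_simps)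
    then show ?thesis .
  qed
  also have "\<dots> \<le> (CARD('n) * \<epsilon> + CARD('n) * (\<zeta>\<^sup>2 * CARD('d))) * (?\<kappa> * fi)"
    using S2_le V_le \<kappa> fi by (intro mult_right_mono add_mono mult_nonneg_nonneg) auto
  also have "\<dots> \<le> (CARD('n) * \<epsilon> + CARD('n) * (\<zeta>\<^sup>2 * CARD('d))) * (2 / c * fi)"
  proof (intro mult_left_mono mult_right_mono fi)
    have "0 \<le> \<epsilon>" using b_nonneg \<epsilon> order_trans by blast
    then show "0 \<le> CARD('n) * \<epsilon> + CARD('n) * (\<zeta>\<^sup>2 * CARD('d))" by simp
  qed simp
  also have "\<dots> = CARD('n) * (2 * (\<epsilon> + \<zeta>\<^sup>2 * CARD('d)) / c) * fi"
  proof -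
    have "(m * \<epsilon> + m * (\<zeta>\<^sup>2 * CARD('d))) * (2 / c * y) = m * (2 * (\<epsilon> + \<zeta>\<^sup>2 * CARD('d)) / c) * y" for m y :: real
      by (simp add: algebra_simps add_divide_distrib)
    then show ?thesis .
  qed
  finally show ?thesis .
qed

end

section \<open>Relative entropy\<close>

text \<open>The inequality \<open>ln y \<le> y - 1\<close> at \<open>y = b / a\<close>. Integrated
  over two densities of equal mass the left-hand side vanishes; the variational bounds on entropy
  below arise in this way.\<close>

lemma gibbs_pointwise:
  fixes a b :: real
  assumes "0 \<le> a" "0 < b"
  shows "a - b \<le> a * ln (a / b)"
proof (cases "a = 0")
  case False
  then have a: "0 < a" using assms by simp
  have "ln (b / a) \<le> b / a - 1" using a assms by (intro ln_le_minus_one) simp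
  then have "a * ln (b / a) \<le> a * (b / a - 1)" using a by (intro mult_left_mono) auto
  also have "\<dots> = b - a" using a by (simp add: field_simps)
  finally show ?thesis using a assms by (simp add: ln_div algebra_simps)
qed (use assms in simp)

lemma ln_gk: "0 < t \<Longrightarrow> ln (gk t (z :: 'a::euclidean_space)) = - (norm z)\<^sup>2 / (2 * t) + ln (gk t (0 :: 'a))"
proof -
  assume t: "0 < t"
  have "gk t z = exp (- (norm z)\<^sup>2 / (2 * t)) * gk t (0::'a)" by (simp add: gk_def)
  then show ?thesis using gk_pos[OF t, of "0::'a"] by (simp add: ln_mult)
qed

lemma integral_gk_scale:
  fixes h :: "'a::euclidean_space \<Rightarrow> real"
  assumes t: "0 < t" and [measurable]: "h \<in> borel_measurable borel"
  shows "(\<integral>z. h z * gk t z \<partial>lborel) = (\<integral>z. h (sqrt t *\<^sub>R z) * gk 1 z \<partial>lborel)"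
proof -
  let ?n = "DIM('a)"
  have gk: "\<bar>sqrt t\<bar> ^ ?n * gk t (sqrt t *\<^sub>R z) = gk 1 z" for z :: 'a
  proof -
    define K where "K = sqrt t ^ ?n"
    have K: "K \<noteq> 0" using t by (simp add: K_def)
    have "sqrt ((2 * pi * t) ^ ?n) = sqrt ((2 * pi) ^ ?n) * K"
      by (simp add: power_mult_distrib real_sqrt_mult real_sqrt_power K_def)
    moreover have "(norm (sqrt t *\<^sub>R z))\<^sup>2 / (2 * t) = (norm z)\<^sup>2 / 2"
      using t by (simp add: power_mult_distrib)
    ultimately show ?thesis using K t unfolding gk_def by (simp add: K_def[symmetric])
  qed
  have "(\<integral>z. h z * gk t z \<partial>lborel) = (\<integral>z. h z * gk t z \<partial>density (distr lborel borel (\<lambda>x. 0 + sqrt t *\<^sub>R x)) (\<lambda>_. ennreal (\<bar>sqrt t\<bar> ^ ?n)))"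
    using lborel_affine[of "sqrt t" "0 :: 'a"] t by simp
  also have "\<dots> = (\<integral>z. \<bar>sqrt t\<bar> ^ ?n *\<^sub>R (h z * gk t z) \<partial>distr lborel borel (\<lambda>x. 0 + sqrt t *\<^sub>R x))"
    by (rule integral_density) auto
  also have "\<dots> = (\<integral>z. \<bar>sqrt t\<bar> ^ ?n *\<^sub>R (h (sqrt t *\<^sub>R z) * gk t (sqrt t *\<^sub>R z)) \<partial>lborel)"
    by (subst integral_distr) auto
  also have "\<dots> = (\<integral>z. h (sqrt t *\<^sub>R z) * gk 1 z \<partial>lborel)"
    by (simp add: gk[symmetric] mult_ac)
  finally show ?thesis .
qed

text \<open>Rescaling moves the time from the kernel into the argument of \<open>h\<close>, where
  continuity and dominated convergence act. The limit \<open>s\<close> may be 0, and the right-hand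
  side is then \<open>h y\<close>; both \<open>s = 0\<close> and \<open>s = 1\<close> occur.\<close>

lemma integral_gk_tendsto:
  fixes h :: "'a::euclidean_space \<Rightarrow> real"
  assumes c: "continuous_on UNIV h" and B: "\<And>z. \<bar>h z\<bar> \<le> B" and T: "T \<longlonglongrightarrow> s" "\<And>n. 0 < T n"
  shows "(\<lambda>n. \<integral>z. h (y + z) * gk (T n) z \<partial>lborel) \<longlonglongrightarrow> (\<integral>z. h (y + sqrt s *\<^sub>R z) * gk 1 z \<partial>lborel)"
proof -
  have [measurable]: "h \<in> borel_measurable borel" using c by (rule borel_measurable_continuous_onI)
  have ic: "isCont h z" for z using c by (simp add: continuous_on_eq_continuous_at)
  have "(\<lambda>n. \<integral>z. h (y + sqrt (T n) *\<^sub>R z) * gk 1 z \<partial>lborel) \<longlonglongrightarrow> (\<integral>z. h (y + sqrt s *\<^sub>R z) * gk 1 z \<partial>lborel)"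
  proof (rule integral_dominated_convergence[where w = "\<lambda>z. B * gk 1 z"])
    show "integrable lborel (\<lambda>z::'a. B * gk 1 z)" by (intro integrable_mult_right integrable_gk) simp
    show "AE z in lborel. (\<lambda>n. h (y + sqrt (T n) *\<^sub>R z) * gk 1 z) \<longlonglongrightarrow> h (y + sqrt s *\<^sub>R z) * gk 1 z"
      by (intro AE_I2 tendsto_mult tendsto_const isCont_tendsto_compose[OF ic] tendsto_add tendsto_scaleR tendsto_real_sqrt T)
    show "AE z in lborel. norm (h (y + sqrt (T n) *\<^sub>R z) * gk 1 z) \<le> B * gk 1 z" for n
      using B by (intro AE_I2) (simp add: abs_mult gk_nonneg mult_right_mono)
  qed measurable
  moreover have "(\<integral>z. h (y + z) * gk (T n) z \<partial>lborel) = (\<integral>z. h (y + sqrt (T n) *\<^sub>R z) * gk 1 z \<partial>lborel)" for n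
    by (rule integral_gk_scale[OF T(2)]) measurable
  ultimately show ?thesis by simp
qed

section \<open>Entropy along the flow and its variational bounds\<close>

context heat_flow
begin

lemma neg_entropy_eq: "neg_entropy t = (\<integral>x. ln (conv (gk t) x) * conv (gk t) x \<partial>lborel)"
  by (simp add: neg_entropy_def mult.commute)

text \<open>Conditioning on the initial point does not increase the entropy.\<close>

lemma neg_entropy_le:
  assumes t: "0 < t"
  shows "neg_entropy t \<le> - (DIM('a) / 2) + ln (gk t (0::'a))"
proof -
  let ?p = "conv (gk t)"
  obtain L where L: "\<And>x. \<bar>ln (?p x)\<bar> \<le> L * (1 + (norm x)\<^sup>2)"
    by (rule ln_conv_gk_bound[OF t, of t]) auto
  have [measurable]: "?p \<in> borel_measurable borel" by (rule borel_measurable_conv[OF gdom_gk[OF t]])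
  have pos: "0 < ?p x" for x by (rule conv_gk_pos[OF t])
  let ?c = "- (DIM('a) / 2) + ln (gk t (0::'a))"
  have cz: "has_bochner_integral lborel (\<lambda>z::'a. - (1 / (2 * t)) * (gk t z * (norm z)\<^sup>2) + ln (gk t (0::'a)) * gk t z) ?c"
  proof -
    have "has_bochner_integral lborel (\<lambda>z::'a. - (1 / (2 * t)) * (gk t z * (norm z)\<^sup>2) + ln (gk t (0::'a)) * gk t z)
        (- (1 / (2 * t)) * (t * DIM('a)) + ln (gk t (0::'a)) * 1)"
      using integrable_gk[OF t, where 'a = 'a] integral_gk[OF t, where 'a = 'a]
      by (intro has_bochner_integral_add has_bochner_integral_mult_right gk_norm_moment t) (auto simp: has_bochner_integral_iff)
    then show ?thesis using t by simp
  qed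
  have cz': "- (1 / (2 * t)) * (gk t z * (norm z)\<^sup>2) + ln (gk t (0::'a)) * gk t z = ln (gk t z) * gk t z" for z :: 'a
    unfolding ln_gk[OF t, of z] by (simp add: algebra_simps)
  \<comment> \<open>For fixed \<open>y\<close>, Gibbs' inequality compares the kernel centred at
    \<open>y\<close> with the flow density; \<open>?c\<close> is the negative entropy of the kernel,
    the same for all \<open>y\<close>.\<close>
  have inner: "(\<integral>z. ln (?p (y + z)) * gk t z \<partial>lborel) \<le> ?c" for y
  proof -
    have i1: "integrable lborel (\<lambda>z. ln (?p (y + z)) * gk t z)"
      by (rule conv_inner_integrable[OF _ _ gdom_integrable[OF gdom_gk[OF t]] L]) measurable
    have i2: "integrable lborel (\<lambda>z. ln (gk t z) * gk t (z::'a))"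
      using cz unfolding cz' by (simp add: has_bochner_integral_iff)
    have i3: "integrable lborel (\<lambda>z. ?p (y + z))"
      using integrable_lborel_translate[OF integrable_conv_gk[OF t], of y] by (simp add: add.commute)
    have e3: "(\<integral>z. ?p (y + z) \<partial>lborel) = 1"
      using integral_lborel_translate[of ?p y] integral_conv_gk[OF t] by (simp add: add.commute)
    have "(\<integral>z. ln (?p (y + z)) * gk t z \<partial>lborel) \<le> (\<integral>z. ln (gk t z) * gk t z - (gk t z - ?p (y + z)) \<partial>lborel)"
    proof (rule integral_mono[OF i1])
      show "integrable lborel (\<lambda>z. ln (gk t z) * gk t z - (gk t z - ?p (y + z)))"
        using i2 i3 integrable_gk[OF t, where 'a = 'a] by simp
      fix z
      show "ln (?p (y + z)) * gk t z \<le> ln (gk t z) * gk t z - (gk t z - ?p (y + z))"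
        using gibbs_pointwise[OF gk_nonneg[OF t] pos, of z "y + z"] gk_pos[OF t, of z] pos[of "y + z"]
        by (simp add: ln_div algebra_simps)
    qed
    also have "\<dots> = (\<integral>z. ln (gk t z) * gk t (z::'a) \<partial>lborel)"
      using i2 i3 e3 integrable_gk[OF t, where 'a = 'a] integral_gk[OF t, where 'a = 'a] by simp
    also have "\<dots> = ?c" using cz unfolding cz' by (simp add: has_bochner_integral_iff)
    finally show ?thesis .
  qed
  have "neg_entropy t = (\<integral>y. (\<integral>z. ln (?p (y + z)) * gk t z \<partial>lborel) \<partial>\<mu>)"
    unfolding neg_entropy_eq by (rule gdom_weighted_integral[OF gdom_gk[OF t] _ L]) measurable
  also have "\<dots> \<le> (\<integral>y. ?c \<partial>\<mu>)"
  proof (rule integral_mono)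
    show "integrable \<mu> (\<lambda>y. \<integral>z. ln (?p (y + z)) * gk t z \<partial>lborel)"
      by (rule conv_outer_integrable[OF _ _ gdom_integrable[OF gdom_gk[OF t]] L]) measurable
  qed (use inner in auto)
  finally show ?thesis by simp
qed

text \<open>For a law with second moment \<open>DIM('a)\<close> this is the relative entropy of the
  flow to the Gaussian of variance \<open>1 + t\<close>: the quadratic term of the Gaussian
  logarithm averages to \<open>DIM('a) / 2\<close>, see \<open>ent_eq\<close>. In this form the time
  derivative follows at once from \<open>de_Bruijn\<close>.\<close>

definition ent :: "real \<Rightarrow> real" where
  "ent t = neg_entropy t + DIM('a) / 2 - ln (gk (1 + t) (0::'a))"

lemma ent_deriv:
  assumes t: "0 < t"
  shows "(ent has_real_derivative - (1 / 2) * fisher t + DIM('a) / (2 * (1 + t))) (at t)"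
proof -
  define q where "q = 2 * pi"
  have q: "0 < q" by (simp add: q_def)
  have "((\<lambda>t. ln (q * (1 + t))) has_real_derivative 1 / (q * (1 + t)) * q) (at t)"
    using t q by (auto intro!: derivative_eq_intros)
  then have "((\<lambda>t. ln (q * (1 + t))) has_real_derivative 1 / (1 + t)) (at t)"
    using q by simp
  from DERIV_add[OF DERIV_add[OF de_Bruijn[OF t] DERIV_const] DERIV_cmult[OF this]]
  have "((\<lambda>t. neg_entropy t + DIM('a) / 2 + DIM('a) / 2 * ln (2 * pi * (1 + t))) has_real_derivative
      - (1 / 2) * fisher t + DIM('a) / (2 * (1 + t))) (at t)"
    unfolding q_def by (rule DERIV_cong) simp
  then show ?thesis
    by (rule has_field_derivative_transform_within_open[where S = "{0<..}"])
      (use t in \<open>auto simp: ent_def ln_gk_0\<close>)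
qed

text \<open>The bound tends to 0 as \<open>t\<close> grows and so provides the boundary condition at
  infinity for comparing two flows.\<close>

lemma ent_le:
  assumes t: "0 < t" shows "ent t \<le> DIM('a) / 2 * ln ((1 + t) / t)"
proof -
  have "ent t \<le> ln (gk t (0::'a)) - ln (gk (1 + t) (0::'a))"
    using neg_entropy_le[OF t] by (simp add: ent_def)
  also have "\<dots> = DIM('a) / 2 * (ln (2 * pi * (1 + t)) - ln (2 * pi * t))"
    using t by (simp add: ln_gk_0 algebra_simps)
  also have "ln (2 * pi * (1 + t)) - ln (2 * pi * t) = ln ((1 + t) / t)"
    using t by (simp add: ln_div ln_mult)
  finally show ?thesis .
qed

lemma ent_eq:
  assumes t: "0 < t" and m: "(\<integral>y. (norm y)\<^sup>2 \<partial>\<mu>) = DIM('a)"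
  shows "integrable lborel (\<lambda>x. (ln (conv (gk t) x) - ln (gk (1 + t) x)) * conv (gk t) x)"
    and "(\<integral>x. (ln (conv (gk t) x) - ln (gk (1 + t) x)) * conv (gk t) x \<partial>lborel) = ent t"
proof -
  let ?p = "conv (gk t)" and ?s = "1 + t"
  have s: "0 < ?s" using t by simp
  note i = integrable_ln_conv_gk[OF t gdom_gk[OF t]] integrable_conv_gk[OF t] integrable_norm_conv_gk[OF t]
  have eq: "(ln (?p x) - ln (gk ?s x)) * ?p x = ln (?p x) * ?p x + 1 / (2 * ?s) * ((norm x)\<^sup>2 * ?p x) - ln (gk ?s (0::'a)) * ?p x" for x
    unfolding ln_gk[OF s, of x] by (simp add: algebra_simps)
  show "integrable lborel (\<lambda>x. (ln (?p x) - ln (gk ?s x)) * ?p x)"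
    unfolding eq using i by simp
  have "(\<integral>x. (ln (?p x) - ln (gk ?s x)) * ?p x \<partial>lborel)
      = neg_entropy t + 1 / (2 * ?s) * (t * DIM('a) + DIM('a)) - ln (gk ?s (0::'a))"
    unfolding eq using i by (simp add: neg_entropy_eq integral_norm_conv_gk[OF t] m integral_conv_gk[OF t])
  also have "1 / (2 * ?s) * (t * DIM('a) + DIM('a)) = DIM('a) / 2"
    using s by (simp add: field_simps)
  finally show "(\<integral>x. (ln (?p x) - ln (gk ?s x)) * ?p x \<partial>lborel) = ent t" by (simp add: ent_def)
qed

text \<open>Gibbs' inequality between the flow density and the Gaussian of variance
  \<open>1 + t\<close>, tilted by \<open>exp (\<phi> x)\<close> and normalised by
  \<open>?Z\<close>.\<close>

lemma donsker_varadhan_le: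
  fixes \<phi> :: "'a \<Rightarrow> real"
  assumes t: "0 < t" and m: "(\<integral>y. (norm y)\<^sup>2 \<partial>\<mu>) = DIM('a)"
    and [measurable]: "\<phi> \<in> borel_measurable borel" and B: "\<And>x. \<bar>\<phi> x\<bar> \<le> B"
  shows "(\<integral>x. \<phi> x * conv (gk t) x \<partial>lborel) \<le> ent t + ln (\<integral>x. exp (\<phi> x) * gk (1 + t) x \<partial>lborel)"
proof -
  let ?p = "conv (gk t)" and ?s = "1 + t" and ?Z = "\<integral>x. exp (\<phi> x) * gk (1 + t) x \<partial>lborel"
  have s: "0 < ?s" using t by simp
  have pos: "0 < ?p x" for x by (rule conv_gk_pos[OF t])
  have [measurable]: "?p \<in> borel_measurable borel" by (rule borel_measurable_conv[OF gdom_gk[OF t]])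
  have bi: "integrable lborel (\<lambda>x. a x * q x)" if "a \<in> borel_measurable borel" "\<And>x. \<bar>a x\<bar> \<le> D" "integrable lborel q"
    for a q :: "'a \<Rightarrow> real" and D
  proof (rule Bochner_Integration.integrable_bound[where f = "\<lambda>x. D * q x"])
    have "0 \<le> D" using that(2)[of 0] by simp
    then have "\<bar>a x * q x\<bar> \<le> \<bar>D * q x\<bar>" for x unfolding abs_mult using that(2)[of x] by (intro mult_right_mono) auto
    then show "AE x in lborel. norm (a x * q x) \<le> norm (D * q x)" by simp
  qed (use that in auto)
  have i1: "integrable lborel (\<lambda>x. \<phi> x * ?p x)" by (rule bi[OF _ B integrable_conv_gk[OF t]]) measurable
  have eB: "\<bar>exp (\<phi> x)\<bar> \<le> exp B" for x using B[of x] by simp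
  have iZ: "integrable lborel (\<lambda>x. exp (\<phi> x) * gk ?s x)" by (rule bi[OF _ eB integrable_gk[OF s]]) measurable
  have Z: "exp (- B) \<le> ?Z"
  proof -
    have "exp (- B) = (\<integral>x. exp (- B) * gk ?s (x::'a) \<partial>lborel)" using integral_gk[OF s, where 'a = 'a] by simp
    also have "\<dots> \<le> ?Z"
    proof (rule integral_mono[OF _ iZ])
      show "exp (- B) * gk ?s x \<le> exp (\<phi> x) * gk ?s x" for x
        using B[of x] gk_nonneg[OF s] by (intro mult_right_mono) auto
    qed (use integrable_gk[OF s, where 'a = 'a] in simp)
    finally show ?thesis .
  qed
  then have Z0: "0 < ?Z" by (meson exp_gt_zero less_le_trans)
  note e = ent_eq[OF t m]
  have "0 = (\<integral>x. ?p x - exp (\<phi> x) * gk ?s x / ?Z \<partial>lborel)"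
    using integrable_conv_gk[OF t] iZ Z0 integral_conv_gk[OF t] by simp
  also have "\<dots> \<le> (\<integral>x. (ln (?p x) - ln (gk ?s x)) * ?p x - \<phi> x * ?p x + ln ?Z * ?p x \<partial>lborel)"
  proof (rule integral_mono)
    show "integrable lborel (\<lambda>x. ?p x - exp (\<phi> x) * gk ?s x / ?Z)"
      using integrable_conv_gk[OF t] iZ by simp
    show "integrable lborel (\<lambda>x. (ln (?p x) - ln (gk ?s x)) * ?p x - \<phi> x * ?p x + ln ?Z * ?p x)"
      using e(1) i1 integrable_conv_gk[OF t] by simp
    fix x :: 'a
    have g: "0 < gk ?s x" by (rule gk_pos[OF s])
    have "?p x - exp (\<phi> x) * gk ?s x / ?Z \<le> ?p x * ln (?p x / (exp (\<phi> x) * gk ?s x / ?Z))"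
      using pos[of x] g Z0 by (intro gibbs_pointwise) auto
    also have "ln (?p x / (exp (\<phi> x) * gk ?s x / ?Z)) = ln (?p x) - (\<phi> x + ln (gk ?s x) - ln ?Z)"
      using pos[of x] g Z0 by (simp add: ln_div ln_mult)
    finally show "?p x - exp (\<phi> x) * gk ?s x / ?Z \<le> (ln (?p x) - ln (gk ?s x)) * ?p x - \<phi> x * ?p x + ln ?Z * ?p x"
      by (simp add: algebra_simps)
  qed
  also have "\<dots> = ent t - (\<integral>x. \<phi> x * ?p x \<partial>lborel) + ln ?Z"
    using e i1 integrable_conv_gk[OF t] integral_conv_gk[OF t] by simp
  finally show ?thesis by simp
qed

lemma ent_nonneg:
  assumes t: "0 < t" and m: "(\<integral>y. (norm y)\<^sup>2 \<partial>\<mu>) = DIM('a)"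
  shows "0 \<le> ent t"
  using donsker_varadhan_le[OF t m, of "\<lambda>_. 0" 0] integral_gk[of "1 + t", where 'a = 'a] t by simp

text \<open>For bounded continuous \<open>\<phi>\<close> the linear term and the logarithm of the
  partition function converge as the time tends to 0, while the entropy enters only through its
  upper bound \<open>K\<close>: lower semicontinuity in dual form.\<close>

lemma donsker_varadhan_limit:
  fixes \<phi> :: "'a \<Rightarrow> real"
  assumes m: "(\<integral>y. (norm y)\<^sup>2 \<partial>\<mu>) = DIM('a)" and K: "\<And>t. 0 < t \<Longrightarrow> ent t \<le> K"
    and c: "continuous_on UNIV \<phi>" and B: "\<And>x. \<bar>\<phi> x\<bar> \<le> B"
  shows "(\<integral>x. \<phi> x \<partial>\<mu>) \<le> K + ln (\<integral>x. exp (\<phi> x) * gk 1 x \<partial>lborel)"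
proof -
  define T where "T n = 1 / real (Suc n)" for n
  have T: "T \<longlonglongrightarrow> 0" "0 < T n" for n
    unfolding T_def using LIMSEQ_inverse_real_of_nat by (auto simp: inverse_eq_divide)
  have [measurable]: "\<phi> \<in> borel_measurable borel" using c by (rule borel_measurable_continuous_onI)
  have B0: "0 \<le> B" using B[of 0] by simp
  have g: "\<bar>\<phi> x\<bar> \<le> B * (1 + (norm x)\<^sup>2)" for x
    using order_trans[OF B[of x], of "B * (1 + (norm x)\<^sup>2)"] B0 by (simp add: algebra_simps)
  have eB: "\<bar>exp (\<phi> x)\<bar> \<le> exp B" for x using B[of x] by simp
  have ce: "continuous_on UNIV (\<lambda>x. exp (\<phi> x))" by (intro continuous_intros c)
  have l1: "(\<lambda>n. \<integral>x. \<phi> x * conv (gk (T n)) x \<partial>lborel) \<longlonglongrightarrow> (\<integral>y. \<phi> y \<partial>\<mu>)"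
  proof -
    have e: "(\<integral>x. \<phi> x * conv (gk (T n)) x \<partial>lborel) = (\<integral>y. (\<integral>z. \<phi> (y + z) * gk (T n) z \<partial>lborel) \<partial>\<mu>)" for n
      by (rule gdom_weighted_integral[OF gdom_gk[OF T(2)] _ g]) measurable
    have "(\<lambda>n. \<integral>y. (\<integral>z. \<phi> (y + z) * gk (T n) z \<partial>lborel) \<partial>\<mu>) \<longlonglongrightarrow> (\<integral>y. \<phi> y \<partial>\<mu>)"
    proof (rule integral_dominated_convergence[where w = "\<lambda>_. B"])
      show "AE y in \<mu>. (\<lambda>n. \<integral>z. \<phi> (y + z) * gk (T n) z \<partial>lborel) \<longlonglongrightarrow> \<phi> y"
      proof (rule AE_I2)
        fix y
        have "(\<integral>z. \<phi> (y + sqrt 0 *\<^sub>R z) * gk 1 z \<partial>lborel) = \<phi> y"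
          using integral_gk[of 1, where 'a = 'a] by simp
        then show "(\<lambda>n. \<integral>z. \<phi> (y + z) * gk (T n) z \<partial>lborel) \<longlonglongrightarrow> \<phi> y"
          using integral_gk_tendsto[OF c B T, of y] by (simp only:)
      qed
      show "AE y in \<mu>. norm (\<integral>z. \<phi> (y + z) * gk (T n) z \<partial>lborel) \<le> B" for n
      proof (rule AE_I2)
        fix y
        have i: "integrable lborel (\<lambda>z. \<phi> (y + z) * gk (T n) z)"
          by (rule conv_inner_integrable[OF _ _ gdom_integrable[OF gdom_gk[OF T(2)]] g]) measurable
        have "norm (\<integral>z. \<phi> (y + z) * gk (T n) z \<partial>lborel) \<le> (\<integral>z. norm (\<phi> (y + z) * gk (T n) z) \<partial>lborel)"
          by (rule integral_norm_bound)
        also have "\<dots> \<le> (\<integral>z. B * gk (T n) (z::'a) \<partial>lborel)"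
          using i integrable_gk[OF T(2), where 'a = 'a] B gk_nonneg[OF T(2), where 'a = 'a]
          by (intro integral_mono integrable_norm) (auto simp: abs_mult mult_right_mono)
        finally show "norm (\<integral>z. \<phi> (y + z) * gk (T n) z \<partial>lborel) \<le> B"
          using integral_gk[OF T(2), where 'a = 'a] by simp
      qed
    qed measurable
    then show ?thesis by (simp add: e)
  qed
  have T1: "(\<lambda>n. 1 + T n) \<longlonglongrightarrow> 1" "0 < 1 + T n" for n
    using tendsto_add[OF tendsto_const T(1), of 1] T(2)[of n] by (auto simp: add_pos_pos)
  have l2: "(\<lambda>n. \<integral>x. exp (\<phi> x) * gk (1 + T n) x \<partial>lborel) \<longlonglongrightarrow> (\<integral>x. exp (\<phi> x) * gk 1 x \<partial>lborel)"
    using integral_gk_tendsto[OF ce eB T1, of 0] by simp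
  have iZ: "integrable lborel (\<lambda>x. exp (\<phi> x) * gk 1 x)"
  proof (rule Bochner_Integration.integrable_bound[where f = "\<lambda>x. exp B * gk 1 x"])
    show "AE x in lborel. norm (exp (\<phi> x) * gk 1 x) \<le> norm (exp B * gk 1 x)"
      using eB by (intro AE_I2) (simp add: abs_mult gk_nonneg mult_right_mono)
  qed (use integrable_gk[of 1, where 'a = 'a] in auto)
  have "exp (- B) = (\<integral>x. exp (- B) * gk 1 (x::'a) \<partial>lborel)" using integral_gk[of 1, where 'a = 'a] by simp
  also have "\<dots> \<le> (\<integral>x. exp (\<phi> x) * gk 1 x \<partial>lborel)"
  proof (rule integral_mono[OF _ iZ])
    show "exp (- B) * gk 1 x \<le> exp (\<phi> x) * gk 1 x" for x
      using B[of x] gk_nonneg[of 1 x] by (intro mult_right_mono) auto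
  qed (use integrable_gk[of 1, where 'a = 'a] in simp)
  finally have Z: "(\<integral>x. exp (\<phi> x) * gk 1 x \<partial>lborel) \<noteq> 0" using exp_gt_zero[of "- B"] by linarith
  show ?thesis
  proof (rule LIMSEQ_le[OF l1 tendsto_add[OF tendsto_const tendsto_ln[OF l2 Z]]])
    have "(\<integral>x. \<phi> x * conv (gk (T n)) x \<partial>lborel) \<le> K + ln (\<integral>x. exp (\<phi> x) * gk (1 + T n) x \<partial>lborel)" for n
      using donsker_varadhan_le[OF T(2)[of n] m \<open>\<phi> \<in> borel_measurable borel\<close> B] K[OF T(2)[of n]] by simp
    then show "\<exists>N. \<forall>n\<ge>N. (\<integral>x. \<phi> x * conv (gk (T n)) x \<partial>lborel) \<le> K + ln (\<integral>x. exp (\<phi> x) * gk (1 + T n) x \<partial>lborel)"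
      by blast
  qed
qed

end

text \<open>By the hypothesis on Fisher information \<open>W.ent - \<kappa> * ent\<close> is
  nondecreasing in time, and at large times it is at most \<open>W.ent\<close>, which tends to
  0.\<close>

lemma (in projection_flow) ent_projection_le:
  assumes t: "0 < t" and \<kappa>: "0 \<le> \<kappa>"
    and F: "\<And>s. 0 < s \<Longrightarrow> W.fisher s - CARD('n) / (1 + s) \<le> \<kappa> * (fisher s - 1 / (1 + s))"
  shows "W.ent t \<le> \<kappa> * ent t"
proof -
  have mono: "W.ent t - \<kappa> * ent t \<le> CARD('n) / 2 * ln ((1 + T) / T)" if T: "t < T" for T
  proof -
    have "W.ent t - \<kappa> * ent t \<le> W.ent T - \<kappa> * ent T"
    proof (rule DERIV_nonneg_imp_nondecreasing[where f = "\<lambda>t. W.ent t - \<kappa> * ent t"])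
      show "t \<le> T" using T by simp
      fix x assume "t \<le> x" "x \<le> T"
      then have x: "0 < x" using t by simp
      have "((\<lambda>t. W.ent t - \<kappa> * ent t) has_real_derivative
          (- (1 / 2) * W.fisher x + CARD('n) / (2 * (1 + x))) - \<kappa> * (- (1 / 2) * fisher x + 1 / (2 * (1 + x)))) (at x)"
        using DERIV_diff[OF W.ent_deriv[OF x] DERIV_cmult[OF ent_deriv[OF x], of \<kappa>]] by simp
      moreover have "0 \<le> (- (1 / 2) * W.fisher x + CARD('n) / (2 * (1 + x))) - \<kappa> * (- (1 / 2) * fisher x + 1 / (2 * (1 + x)))"
      proof -
        have eq: "(- (1 / 2) * W.fisher x + CARD('n) / (2 * (1 + x))) - \<kappa> * (- (1 / 2) * fisher x + 1 / (2 * (1 + x)))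
            = (\<kappa> * (fisher x - 1 / (1 + x)) - (W.fisher x - CARD('n) / (1 + x))) / 2"
        proof -
          define a where "a = 1 + x"
          have "a \<noteq> 0" using x by (simp add: a_def)
          then show ?thesis unfolding a_def[symmetric] by (simp add: field_simps)
        qed
        show ?thesis unfolding eq using F[OF x] by simp
      qed
      ultimately show "\<exists>y. ((\<lambda>t. W.ent t - \<kappa> * ent t) has_real_derivative y) (at x) \<and> 0 \<le> y" by blast
    qed
    moreover have "0 \<le> \<kappa> * ent T"
      using \<kappa> ent_nonneg[of T] variance_1 t T by (intro mult_nonneg_nonneg) auto
    moreover have "W.ent T \<le> CARD('n) / 2 * ln ((1 + T) / T)"
      using W.ent_le[of T] t T by simp
    ultimately show ?thesis by linarith
  qed
  have "((\<lambda>T::real. CARD('n) / 2 * ln ((1 + T) / T)) \<longlongrightarrow> 0) at_top" by real_asymp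
  moreover have "\<forall>\<^sub>F T in at_top. W.ent t - \<kappa> * ent t \<le> CARD('n) / 2 * ln ((1 + T) / T)"
    using eventually_gt_at_top[of t] by eventually_elim (rule mono)
  ultimately have "W.ent t - \<kappa> * ent t \<le> 0"
    by (rule tendsto_lowerbound) simp
  then show ?thesis by simp
qed

text \<open>Gibbs' inequality gives \<open>- u \<le> gk 1 - f \<le> gk 1\<close>, so the negative
  part is finite and the difference is never infinity minus infinity. Positivity of the Gaussian
  excludes the infinite branch of \<open>entropy_integrand\<close>.\<close>

lemma relative_entropy_std_gaussian:
  fixes f :: "'a::euclidean_space \<Rightarrow> real"
  assumes [measurable]: "f \<in> borel_measurable borel" and f0: "\<And>x. 0 \<le> f x"
  defines "u \<equiv> \<lambda>x. f x * ln (f x / gk 1 x)"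
  shows "relative_entropy (density lborel f) std_gaussian =
      enn2ereal (\<integral>\<^sup>+x. ennreal (u x) \<partial>lborel) - enn2ereal (\<integral>\<^sup>+x. ennreal (- u x) \<partial>lborel)"
    and "(\<integral>\<^sup>+x. ennreal (- u x) \<partial>lborel) < \<infinity>"
proof -
  have g: "0 < gk 1 (x::'a)" for x by (rule gk_pos) simp
  have eq: "entropy_integrand (f x) (gk 1 x) = ereal (u x)" for x
    using g[of x] by (simp add: entropy_integrand_def u_def)
  have "std_gaussian = density lborel (\<lambda>x::'a. ennreal (gk 1 x))"
    by (simp add: std_gaussian_eq_gauss gauss_def)
  then have "relative_entropy (density lborel f) std_gaussian = ereal_integral lborel (\<lambda>x. ereal (u x))"
    using relative_entropy_density[of f "gk 1"] f0 g by (simp add: eq less_imp_le)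
  then show "relative_entropy (density lborel f) std_gaussian =
      enn2ereal (\<integral>\<^sup>+x. ennreal (u x) \<partial>lborel) - enn2ereal (\<integral>\<^sup>+x. ennreal (- u x) \<partial>lborel)"
    by (simp add: ereal_integral_def)
  have "(\<integral>\<^sup>+x. ennreal (- u x) \<partial>lborel) \<le> (\<integral>\<^sup>+x. ennreal (gk 1 (x::'a)) \<partial>lborel)"
  proof (intro nn_integral_mono ennreal_leI)
    show "- u x \<le> gk 1 x" for x
      using gibbs_pointwise[OF f0 g, of x x] f0[of x] by (simp add: u_def)
  qed
  also have "\<dots> = 1"
    using integrable_gk[of 1, where 'a = 'a] integral_gk[of 1, where 'a = 'a]
    by (subst nn_integral_eq_integral) (auto simp: gk_nonneg)
  finally show "(\<integral>\<^sup>+x. ennreal (- u x) \<partial>lborel) < \<infinity>"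
    by (rule le_less_trans) simp
qed

lemma relative_entropy_std_gaussian_cases:
  fixes f :: "'a::euclidean_space \<Rightarrow> real"
  assumes m [measurable]: "f \<in> borel_measurable borel" and f0: "\<And>x. 0 \<le> f x"
  defines "u \<equiv> \<lambda>x. f x * ln (f x / gk 1 x)"
  shows "relative_entropy (density lborel f) std_gaussian = \<infinity> \<or>
    (integrable lborel u \<and> relative_entropy (density lborel f) std_gaussian = ereal (\<integral>x. u x \<partial>lborel))"
    and "integrable lborel u \<Longrightarrow> relative_entropy (density lborel f) std_gaussian = ereal (\<integral>x. u x \<partial>lborel)"
proof -
  have uu: "u x = f x * ln (f x / gk 1 x)" for x by (simp add: u_def)
  note r = relative_entropy_std_gaussian[OF m f0, folded uu]
  have [measurable]: "u \<in> borel_measurable borel" unfolding u_def by measurable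
  obtain b where b: "(\<integral>\<^sup>+x. ennreal (- u x) \<partial>lborel) = ennreal b" "0 \<le> b"
    using r(2) by (cases "\<integral>\<^sup>+x. ennreal (- u x) \<partial>lborel") auto
  show int: "integrable lborel u \<Longrightarrow> relative_entropy (density lborel f) std_gaussian = ereal (\<integral>x. u x \<partial>lborel)"
  proof -
    assume i: "integrable lborel u"
    then have "(\<integral>\<^sup>+x. ennreal (u x) \<partial>lborel) < \<infinity>" 
      unfolding real_integrable_def by (simp add: less_top)
    then obtain a where a: "(\<integral>\<^sup>+x. ennreal (u x) \<partial>lborel) = ennreal a" "0 \<le> a"
      by (cases "\<integral>\<^sup>+x. ennreal (u x) \<partial>lborel") auto
    show "relative_entropy (density lborel f) std_gaussian = ereal (\<integral>x. u x \<partial>lborel)"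
      unfolding r(1) real_lebesgue_integral_def[OF i] a(1) b(1) using a(2) b(2) by simp
  qed
  show "relative_entropy (density lborel f) std_gaussian = \<infinity> \<or>
    (integrable lborel u \<and> relative_entropy (density lborel f) std_gaussian = ereal (\<integral>x. u x \<partial>lborel))"
  proof (cases "(\<integral>\<^sup>+x. ennreal (u x) \<partial>lborel) = \<infinity>")
    case True
    then show ?thesis unfolding r(1) b(1) using b(2) by simp
  next
    case False
    then have "integrable lborel u" unfolding real_integrable_def using r(2) by auto
    then show ?thesis using int by simp
  qed
qed

text \<open>The optimal test function is the logarithm of the density ratio. It is truncated at
  \<open>m\<close>, approximated almost everywhere by bounded continuous functions to which the
  hypothesis applies, and the truncation is removed by Fatou on the positive part.\<close>

lemma relative_entropy_le_of_donsker_varadhan: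
  fixes \<mu> :: "'a::euclidean_space measure"
  assumes "prob_space \<mu>" and dens: "has_lebesgue_density \<mu>"
    and DV: "\<And>\<phi> B. continuous_on UNIV \<phi> \<Longrightarrow> (\<And>x. \<bar>\<phi> x\<bar> \<le> B) \<Longrightarrow>
      (\<integral>x. \<phi> x \<partial>\<mu>) \<le> K + ln (\<integral>x. exp (\<phi> x) * gk 1 x \<partial>lborel)"
  shows "relative_entropy \<mu> std_gaussian \<le> ereal K"
proof -
  interpret prob_space \<mu> by fact
  obtain f' where [measurable]: "f' \<in> borel_measurable borel" and \<mu>': "\<mu> = density lborel f'"
    using dens unfolding has_lebesgue_density_def by blast
  define f where "f x = enn2real (f' x)" for x
  have mf [measurable]: "f \<in> borel_measurable borel" unfolding f_def by measurable
  have f0: "0 \<le> f x" for x by (simp add: f_def)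
  have f'1: "(\<integral>\<^sup>+x. f' x \<partial>lborel) = 1"
    using emeasure_space_1 unfolding \<mu>' by (simp add: emeasure_density)
  then have "AE x in lborel. f' x \<noteq> \<infinity>" by (intro nn_integral_PInf_AE) auto
  then have ff': "AE x in lborel. f' x = ennreal (f x)" by eventually_elim (simp add: f_def less_top)
  have \<mu>: "\<mu> = density lborel f" unfolding \<mu>' using ff' by (intro density_cong) auto
  have "(\<integral>\<^sup>+x. ennreal (f x) \<partial>lborel) = 1"
    using f'1 nn_integral_cong_AE[OF ff'] by simp
  then have fi: "integrable lborel f" and f1: "(\<integral>x. f x \<partial>lborel) = 1"
    using f0 by (auto intro!: integrableI_nonneg simp: integral_eq_nn_integral)
  have g: "0 < gk 1 (x::'a)" for x by (rule gk_pos) simp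
  have gi: "integrable lborel (gk 1 :: 'a \<Rightarrow> real)" and g1: "(\<integral>x. gk 1 (x::'a) \<partial>lborel) = 1"
    by (auto intro: integrable_gk integral_gk)
  define u where "u x = f x * ln (f x / gk 1 x)" for x
  \<comment> \<open>Where \<open>f\<close> vanishes the logarithm stands for minus infinity, hence
    \<open>- real m\<close>; the default \<open>ln 0 = 0\<close> would spoil the bound on the
    partition function.\<close>
  define \<phi> where "\<phi> m x = (if f x = 0 then - real m else max (- real m) (min (real m) (ln (f x / gk 1 x))))" for m :: nat and x
  have [measurable]: "u \<in> borel_measurable borel" "\<phi> m \<in> borel_measurable borel" for m
    unfolding u_def \<phi>_def by measurable
  have \<phi>B: "\<bar>\<phi> m x\<bar> \<le> real m" for m x by (auto simp: \<phi>_def)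
  have bi: "integrable lborel (\<lambda>x. a x * q x)" if "a \<in> borel_measurable borel" "\<And>x. \<bar>a x\<bar> \<le> D" "integrable lborel q"
    for a q :: "'a \<Rightarrow> real" and D
  proof (rule Bochner_Integration.integrable_bound[where f = "\<lambda>x. D * q x"])
    have "0 \<le> D" using that(2)[of 0] by simp
    then have "\<bar>a x * q x\<bar> \<le> \<bar>D * q x\<bar>" for x unfolding abs_mult using that(2)[of x] by (intro mult_right_mono) auto
    then show "AE x in lborel. norm (a x * q x) \<le> norm (D * q x)" by simp
  qed (use that in auto)
  have DV\<phi>: "(\<integral>x. \<phi> m x * f x \<partial>lborel) \<le> K + exp (- real m)" for m
  proof -
    \<comment> \<open>Lebesgue measurability provides continuous functions converging to
      \<open>\<phi> m\<close> off a negligible set; clipping them at \<open>m\<close> gives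
      domination and keeps the limit.\<close>
    have "\<phi> m \<in> borel_measurable lebesgue" by (rule measurable_completion) simp
    then have "\<phi> m measurable_on UNIV"
      by (simp add: measurable_on_iff_borel_measurable)
    then obtain N h where N: "negligible N" and h: "\<And>n. continuous_on UNIV (h n)"
      and lim: "\<And>x. x \<notin> N \<Longrightarrow> (\<lambda>n. h n x) \<longlonglongrightarrow> \<phi> m x"
      unfolding measurable_on_def by auto
    define k where "k n x = max (- real m) (min (real m) (h n x))" for n :: nat and x
    have ck: "continuous_on UNIV (k n)" for n unfolding k_def by (intro continuous_intros h)
    have [measurable]: "k n \<in> borel_measurable borel" for n using ck by (rule borel_measurable_continuous_onI)
    have kB: "\<bar>k n x\<bar> \<le> real m" for n x by (auto simp: k_def)
    have klim: "(\<lambda>n. k n x) \<longlonglongrightarrow> \<phi> m x" if "x \<notin> N" for x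
    proof -
      have "(\<lambda>n. k n x) \<longlonglongrightarrow> max (- real m) (min (real m) (\<phi> m x))"
        unfolding k_def by (intro tendsto_intros lim that)
      moreover have "max (- real m) (min (real m) (\<phi> m x)) = \<phi> m x" using \<phi>B[of m x] by (auto simp: abs_le_iff)
      ultimately show ?thesis by simp
    qed
    have AEN: "AE x in lborel. x \<notin> N"
    proof -
      have "AE x in lebesgue. x \<notin> N" using N by (simp add: negligible_iff_null_sets AE_not_in)
      then show ?thesis by (simp add: AE_completion_iff)
    qed
    have l1: "(\<lambda>n. \<integral>x. k n x * f x \<partial>lborel) \<longlonglongrightarrow> (\<integral>x. \<phi> m x * f x \<partial>lborel)"
    proof (rule integral_dominated_convergence[where w = "\<lambda>x. real m * f x"])
      show "AE x in lborel. (\<lambda>n. k n x * f x) \<longlonglongrightarrow> \<phi> m x * f x"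
        using AEN by eventually_elim (intro tendsto_mult klim tendsto_const)
      show "AE x in lborel. norm (k n x * f x) \<le> real m * f x" for n
        using kB f0 by (intro AE_I2) (simp add: abs_mult mult_right_mono)
    qed (use fi in auto)
    have l2: "(\<lambda>n. \<integral>x. exp (k n x) * gk 1 x \<partial>lborel) \<longlonglongrightarrow> (\<integral>x. exp (\<phi> m x) * gk 1 x \<partial>lborel)"
    proof (rule integral_dominated_convergence[where w = "\<lambda>x. exp (real m) * gk 1 x"])
      show "AE x in lborel. (\<lambda>n. exp (k n x) * gk 1 x) \<longlonglongrightarrow> exp (\<phi> m x) * gk 1 x"
        using AEN by eventually_elim (intro tendsto_mult tendsto_exp klim tendsto_const)
      show "AE x in lborel. norm (exp (k n x) * gk 1 x) \<le> exp (real m) * gk 1 x" for n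
      proof (rule AE_I2)
        fix x
        have "exp (k n x) \<le> exp (real m)" using kB[of n x] by simp
        then show "norm (exp (k n x) * gk 1 x) \<le> exp (real m) * gk 1 x"
          using g[of x] by (simp add: abs_mult)
      qed
    qed (use gi in auto)
    have eB: "\<bar>exp (\<phi> m x)\<bar> \<le> exp (real m)" for x using \<phi>B[of m x] by simp
    have iZ: "integrable lborel (\<lambda>x. exp (\<phi> m x) * gk 1 x)" by (rule bi[OF _ eB gi]) measurable
    have "exp (- real m) = (\<integral>x. exp (- real m) * gk 1 (x::'a) \<partial>lborel)" using g1 by simp
    also have "\<dots> \<le> (\<integral>x. exp (\<phi> m x) * gk 1 x \<partial>lborel)"
    proof (rule integral_mono[OF _ iZ])
      show "exp (- real m) * gk 1 x \<le> exp (\<phi> m x) * gk 1 x" for x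
        using \<phi>B[of m x] g[of x] by (intro mult_right_mono) auto
    qed (use gi in simp)
    finally have Z: "0 < (\<integral>x. exp (\<phi> m x) * gk 1 x \<partial>lborel)"
      using exp_gt_zero[of "- real m"] by linarith
    \<comment> \<open>\<open>exp (\<phi> m x)\<close> is at most the density ratio, except where the
      truncation from below makes it \<open>exp (- real m)\<close>. The partition function is thus
      at most \<open>1 + exp (- real m)\<close>, and its logarithm at most
      \<open>exp (- real m)\<close>.\<close>
    have "(\<integral>x. exp (\<phi> m x) * gk 1 x \<partial>lborel) \<le> (\<integral>x. f x + exp (- real m) * gk 1 x \<partial>lborel)"
    proof (rule integral_mono[OF iZ])
      show "integrable lborel (\<lambda>x. f x + exp (- real m) * gk 1 x)" using fi gi by simp
      fix x
      show "exp (\<phi> m x) * gk 1 x \<le> f x + exp (- real m) * gk 1 x"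
      proof (cases "f x = 0")
        case True
        then show ?thesis by (simp add: \<phi>_def)
      next
        case False
        then have fx: "0 < f x" using f0[of x] by simp
        define l where "l = ln (f x / gk 1 x)"
        have el: "exp l = f x / gk 1 x" using fx g[of x] by (simp add: l_def)
        have "\<phi> m x \<le> l \<or> \<phi> m x = - real m" using False by (auto simp: \<phi>_def l_def)
        then have "exp (\<phi> m x) \<le> exp l + exp (- real m)"
        proof
          assume "\<phi> m x \<le> l"
          then have "exp (\<phi> m x) \<le> exp l" by simp
          then show ?thesis using exp_gt_zero[of "- real m"] by linarith
        qed simp
        then have "exp (\<phi> m x) * gk 1 x \<le> (exp l + exp (- real m)) * gk 1 x"
          using g[of x] by (intro mult_right_mono) auto
        also have "\<dots> = f x + exp (- real m) * gk 1 x" using g[of x] by (simp add: el distrib_right)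
        finally show ?thesis .
      qed
    qed
    also have "\<dots> = 1 + exp (- real m)" using fi gi f1 g1 by simp
    finally have Zle: "(\<integral>x. exp (\<phi> m x) * gk 1 x \<partial>lborel) \<le> 1 + exp (- real m)" .
    have "(\<integral>x. k n x * f x \<partial>lborel) \<le> K + ln (\<integral>x. exp (k n x) * gk 1 x \<partial>lborel)" for n
    proof -
      have "(\<integral>x. k n x \<partial>\<mu>) = (\<integral>x. k n x * f x \<partial>lborel)"
        unfolding \<mu> using f0 by (subst integral_density) (auto simp: mult.commute)
      then show ?thesis using DV[OF ck kB, of n] by simp
    qed
    then have "(\<integral>x. \<phi> m x * f x \<partial>lborel) \<le> K + ln (\<integral>x. exp (\<phi> m x) * gk 1 x \<partial>lborel)"
      using Z by (intro LIMSEQ_le[OF l1 tendsto_add[OF tendsto_const tendsto_ln[OF l2]]]) auto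
    also have "ln (\<integral>x. exp (\<phi> m x) * gk 1 x \<partial>lborel) \<le> ln (1 + exp (- real m))"
      using Z Zle by (subst ln_le_cancel_iff) (auto intro: add_pos_pos)
    also have "\<dots> \<le> exp (- real m)" by (rule ln_add_one_self_le_self) simp
    finally show ?thesis by simp
  qed
  have un: "- u x \<le> gk 1 x" for x
    using gibbs_pointwise[OF f0 g, of x x] f0[of x] by (simp add: u_def)
  define un where "un x = max 0 (- u x)" for x
  define up where "up x = max 0 (u x)" for x
  have [measurable]: "un \<in> borel_measurable borel" "up \<in> borel_measurable borel" unfolding un_def up_def by measurable
  have iun: "integrable lborel un"
  proof (rule Bochner_Integration.integrable_bound[OF gi])
    show "AE x in lborel. norm (un x) \<le> norm (gk 1 x)"
      using un g by (intro AE_I2) (auto simp: un_def less_imp_le)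
  qed measurable
  \<comment> \<open>Unlike \<open>\<phi> m x * f x\<close>, the positive part cut at height
    \<open>real m * f x\<close> is nonnegative, so that Fatou applies; \<open>vle\<close> pays for
    the difference with \<open>un\<close>.\<close>
  define v where "v m x = min (up x) (real m * f x)" for m :: nat and x
  have iv: "integrable lborel (v m)" for m
  proof (rule Bochner_Integration.integrable_bound[where f = "\<lambda>x. real m * f x"])
    show "v m \<in> borel_measurable lborel" unfolding v_def by measurable
    show "AE x in lborel. norm (v m x) \<le> norm (real m * f x)"
      using f0 by (intro AE_I2) (auto simp: v_def up_def)
  qed (use fi in simp)
  have vle: "v m x \<le> \<phi> m x * f x + un x" for m x
  proof (cases "f x = 0")
    case True
    then show ?thesis by (simp add: v_def up_def un_def u_def)
  next
    case False
    then have fx: "0 < f x" using f0[of x] by simp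
    define l where "l = ln (f x / gk 1 x)"
    have ux: "u x = f x * l" by (simp add: u_def l_def)
    have ph: "\<phi> m x = max (- real m) (min (real m) l)" using False by (simp add: \<phi>_def l_def)
    show ?thesis
    proof (cases "0 \<le> l")
      case True
      then have "\<phi> m x = min (real m) l" by (simp add: ph)
      moreover have "v m x = min (f x * l) (real m * f x)" using True fx by (simp add: v_def up_def ux)
      moreover have "min (f x * l) (real m * f x) = min (real m) l * f x"
        using fx by (simp add: min_def mult.commute)
      moreover have "0 \<le> un x" by (simp add: un_def)
      ultimately show ?thesis by simp
    next
      case F: False
      then have "up x = 0" using fx by (simp add: up_def ux mult_le_0_iff)
      then have "v m x = 0" using fx by (simp add: v_def)
      moreover have "l \<le> \<phi> m x" using F by (auto simp: ph)
      then have "f x * l \<le> \<phi> m x * f x" using fx by (simp add: mult.commute)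
      then have "0 \<le> \<phi> m x * f x + un x" by (simp add: un_def ux)
      ultimately show ?thesis by simp
    qed
  qed
  have iph: "integrable lborel (\<lambda>x. \<phi> m x * f x)" for m by (rule bi[OF _ \<phi>B fi]) measurable
  have vint: "(\<integral>x. v m x \<partial>lborel) \<le> K + exp (- real m) + (\<integral>x. un x \<partial>lborel)" for m
  proof -
    have "(\<integral>x. v m x \<partial>lborel) \<le> (\<integral>x. \<phi> m x * f x + un x \<partial>lborel)"
      using iv iph iun vle by (intro integral_mono) auto
    also have "\<dots> = (\<integral>x. \<phi> m x * f x \<partial>lborel) + (\<integral>x. un x \<partial>lborel)" using iph iun by simp
    finally show ?thesis using DV\<phi>[of m] by simp
  qed
  \<comment> \<open>Starting the sequence at \<open>m0\<close> bounds all its terms with the error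
    \<open>exp (- real m0)\<close>, which disappears when \<open>m0\<close> grows.\<close>
  have up: "integrable lborel up \<and> (\<integral>x. up x \<partial>lborel) \<le> K + exp (- real m0) + (\<integral>x. un x \<partial>lborel)" for m0
  proof -
    have nn: "0 \<le> v (m + m0) x" for m x using f0[of x] by (simp add: v_def up_def)
    have bd: "(\<integral>x. v (m + m0) x \<partial>lborel) \<le> K + exp (- real m0) + (\<integral>x. un x \<partial>lborel)" for m
      using order_trans[OF vint[of "m + m0"], of "K + exp (- real m0) + (\<integral>x. un x \<partial>lborel)"] by simp
    have lim: "(\<lambda>m. v (m + m0) x) \<longlonglongrightarrow> up x" for x
    proof (cases "f x = 0")
      case True
      then show ?thesis by (simp add: v_def up_def u_def)
    next
      case False
      then have fx: "0 < f x" using f0[of x] by simp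
      obtain M where M: "up x / f x \<le> real M" using real_arch_simple by blast
      have "v (m + m0) x = up x" if "m \<ge> M" for m
      proof -
        have "up x / f x \<le> real (m + m0)" using M that by simp
        then have "up x \<le> real (m + m0) * f x" using fx by (simp add: divide_le_eq)
        then show ?thesis by (simp add: v_def)
      qed
      then show ?thesis by (intro tendsto_eventually) (auto simp: eventually_sequentially)
    qed
    show ?thesis
      using integrable_limit_bounded[where h = "\<lambda>m. v (m + m0)" and M = lborel and H = up, OF iv nn bd lim] by simp
  qed
  have "(\<integral>x. up x \<partial>lborel) \<le> K + 0 + (\<integral>x. un x \<partial>lborel)"
  proof (rule LIMSEQ_le_const)
    have "(\<lambda>m. exp (- real m)) \<longlonglongrightarrow> 0" by real_asymp
    then show "(\<lambda>m. K + exp (- real m) + (\<integral>x. un x \<partial>lborel)) \<longlonglongrightarrow> K + 0 + (\<integral>x. un x \<partial>lborel)"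
      by (intro tendsto_intros)
  qed (use up in auto)
  moreover have ue: "u = (\<lambda>x. up x - un x)" by (auto simp: up_def un_def)
  ultimately have "integrable lborel u" "(\<integral>x. u x \<partial>lborel) \<le> K"
    unfolding ue using up iun by simp_all
  then show ?thesis
    using relative_entropy_std_gaussian_cases(2)[OF mf f0] unfolding \<mu> u_def by simp
qed

section \<open>Data processing at the initial time\<close>

context std_gap_flow
begin

lemma gk_semigroup:
  assumes t: "0 < t"
  shows "(\<integral>\<^sup>+y. ennreal (gk t (x - y) * gk 1 y) \<partial>lborel) = ennreal (gk (1 + t) (x::real))"
proof -
  have "(\<lambda>x. \<integral>\<^sup>+y. ennreal (normal_density 0 (sqrt t) (x - y) * normal_density 0 1 y) \<partial>lborel) = normal_density 0 (sqrt ((sqrt t)\<^sup>2 + 1\<^sup>2))"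
    using t by (intro conv_normal_density_zero_mean) auto
  from fun_cong[OF this, of x] show ?thesis using t by (simp add: gk_real add.commute)
qed

text \<open>Data processing for the Gaussian channel. Gibbs' inequality is applied to
  \<open>f0 y\<close> and \<open>gk 1 y * exp (\<phi> x)\<close>, with \<open>\<phi>\<close> the
  logarithmic density ratio at time \<open>t\<close>, and averaged over \<open>x\<close> by the
  kernel at \<open>x - y\<close>; by the semigroup property the second density has total mass
  1.\<close>

lemma ent_le_initial:
  assumes t: "0 < t" and \<nu>: "\<nu> = density lborel (\<lambda>x. ennreal (f0 x))" and [measurable]: "f0 \<in> borel_measurable borel"
    and f0: "\<And>x. 0 \<le> f0 x" and iu: "integrable lborel (\<lambda>x. f0 x * ln (f0 x / gk 1 x))"
  shows "ent t \<le> (\<integral>x. f0 x * ln (f0 x / gk 1 x) \<partial>lborel)"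
proof -
  let ?p = "f t" and ?s = "1 + t"
  have s: "0 < ?s" using t by simp
  have pos: "0 < ?p x" for x by (rule conv_gk_pos[OF t])
  have g1: "0 < gk 1 (x::real)" and gt: "0 < gk t (x::real)" and gs: "0 < gk ?s (x::real)" for x
    using t s by (simp_all add: gk_pos)
  have [measurable]: "?p \<in> borel_measurable borel" by (rule borel_measurable_conv[OF gdom_gk[OF t]])
  have "(\<integral>\<^sup>+x. ennreal (f0 x) \<partial>lborel) = 1"
    using emeasure_space_1 unfolding \<nu> by (simp add: emeasure_density)
  then have fi: "integrable lborel f0" and f1: "(\<integral>x. f0 x \<partial>lborel) = 1"
    using f0 by (auto intro!: integrableI_nonneg simp: integral_eq_nn_integral)
  define \<phi> where "\<phi> x = ln (?p x) - ln (gk ?s x)" for x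
  have [measurable]: "\<phi> \<in> borel_measurable borel" unfolding \<phi>_def by measurable
  have e\<phi>: "exp (\<phi> x) = ?p x / gk ?s x" for x using pos[of x] gs[of x] by (simp add: \<phi>_def exp_diff)
  obtain L where L: "0 \<le> L" "\<And>x. \<bar>ln (?p x)\<bar> \<le> L * (1 + (norm x)\<^sup>2)"
    by (rule ln_conv_gk_bound[OF t, of t]) auto
  define L' where "L' = L + 1 / (2 * ?s) + \<bar>ln (gk ?s (0::real))\<bar>"
  have \<phi>L: "\<bar>\<phi> x\<bar> \<le> L' * (1 + (norm x)\<^sup>2)" for x
  proof -
    have "\<bar>\<phi> x\<bar> \<le> \<bar>ln (?p x)\<bar> + \<bar>ln (gk ?s x)\<bar>" unfolding \<phi>_def by (rule abs_triangle_ineq4)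
    also have "\<bar>ln (gk ?s x)\<bar> \<le> 1 / (2 * ?s) * (norm x)\<^sup>2 + \<bar>ln (gk ?s (0::real))\<bar>"
      unfolding ln_gk[OF s, of x] using s by (intro order_trans[OF abs_triangle_ineq]) (simp add: abs_mult)
    also have "\<bar>ln (?p x)\<bar> \<le> L * (1 + (norm x)\<^sup>2)" by (rule L(2))
    also have "L * (1 + (norm x)\<^sup>2) + (1 / (2 * ?s) * (norm x)\<^sup>2 + \<bar>ln (gk ?s (0::real))\<bar>) \<le> L' * (1 + (norm x)\<^sup>2)"
    proof -
      define a where "a = 1 / (2 * ?s)"
      have "0 \<le> a" using s by (simp add: a_def)
      then show ?thesis unfolding L'_def a_def[symmetric] by (simp add: algebra_simps)
    qed
    finally show ?thesis by simp
  qed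
  define \<psi> where "\<psi> y = (\<integral>z. \<phi> (y + z) * gk t z \<partial>lborel)" for y
  have ent1: "ent t = (\<integral>y. \<psi> y \<partial>\<nu>)"
  proof -
    have "ent t = (\<integral>x. \<phi> x * ?p x \<partial>lborel)"
      unfolding \<phi>_def by (rule ent_eq(2)[OF t, symmetric]) (simp add: variance_1)
    also have "\<dots> = (\<integral>y. \<psi> y \<partial>\<nu>)"
      unfolding \<psi>_def by (rule gdom_weighted_integral[OF gdom_gk[OF t] _ \<phi>L]) measurable
    finally show ?thesis .
  qed
  have i\<psi>': "integrable \<nu> \<psi>"
    unfolding \<psi>_def by (rule conv_outer_integrable[OF _ _ gdom_integrable[OF gdom_gk[OF t]] \<phi>L]) measurable
  have m\<psi> [measurable]: "\<psi> \<in> borel_measurable borel" unfolding \<psi>_def by measurable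
  have i\<psi>: "integrable lborel (\<lambda>y. f0 y * \<psi> y)"
    using i\<psi>' f0 unfolding \<nu> by (subst (asm) integrable_density) auto
  have e\<psi>: "(\<integral>y. \<psi> y \<partial>\<nu>) = (\<integral>y. f0 y * \<psi> y \<partial>lborel)"
    unfolding \<nu> using f0 by (subst integral_density) auto
  \<comment> \<open>Kept extended-valued for Fubini; finiteness for almost every \<open>y\<close> is
    then deduced from \<open>total\<close>.\<close>
  define \<Theta> where "\<Theta> y = (\<integral>\<^sup>+x. ennreal (exp (\<phi> x) * gk t (x - y)) \<partial>lborel)" for y
  have [measurable]: "\<Theta> \<in> borel_measurable borel" unfolding \<Theta>_def by measurable
  have total: "(\<integral>\<^sup>+y. ennreal (gk 1 y) * \<Theta> y \<partial>lborel) = 1"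
  proof -
    have "(\<integral>\<^sup>+y. ennreal (gk 1 y) * \<Theta> y \<partial>lborel) = (\<integral>\<^sup>+y. (\<integral>\<^sup>+x. ennreal (exp (\<phi> x)) * ennreal (gk t (x - y) * gk 1 y) \<partial>lborel) \<partial>lborel)"
      unfolding \<Theta>_def using g1 gt
      by (subst nn_integral_cmult[symmetric]) (auto intro!: nn_integral_cong simp: ennreal_mult less_imp_le mult_ac)
    also have "\<dots> = (\<integral>\<^sup>+x. (\<integral>\<^sup>+y. ennreal (exp (\<phi> x)) * ennreal (gk t (x - y) * gk 1 y) \<partial>lborel) \<partial>lborel)"
      by (rule lborel_pair.Fubini') measurable
    also have "\<dots> = (\<integral>\<^sup>+x. ennreal (exp (\<phi> x)) * ennreal (gk ?s x) \<partial>lborel)"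
      by (simp add: nn_integral_cmult gk_semigroup[OF t])
    also have "\<dots> = (\<integral>\<^sup>+x. ennreal (?p x) \<partial>lborel)"
    proof (rule nn_integral_cong)
      fix x
      have "exp (\<phi> x) * gk ?s x = ?p x" using gs[of x] by (simp add: e\<phi>)
      then show "ennreal (exp (\<phi> x)) * ennreal (gk ?s x) = ennreal (?p x)"
        using gs[of x] by (simp add: ennreal_mult[symmetric] less_imp_le)
    qed
    also have "\<dots> = 1"
      using integrable_conv_gk[OF t] integral_conv_gk[OF t] pos by (subst nn_integral_eq_integral) (auto simp: less_imp_le)
    finally show ?thesis .
  qed
  then have "AE y in lborel. ennreal (gk 1 y) * \<Theta> y \<noteq> \<infinity>" by (intro nn_integral_PInf_AE) auto
  then have fin: "AE y in lborel. \<Theta> y \<noteq> \<infinity>"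
  proof eventually_elim
    case (elim y)
    show ?case
    proof
      assume "\<Theta> y = \<infinity>"
      then have "ennreal (gk 1 y) * \<Theta> y = \<infinity>" using g1[of y] by (simp add: ennreal_mult_top ennreal_top_mult)
      with elim show False by simp
    qed
  qed
  define \<theta> where "\<theta> y = enn2real (\<Theta> y)" for y
  have [measurable]: "\<theta> \<in> borel_measurable borel" unfolding \<theta>_def by measurable
  have tot: "(\<integral>\<^sup>+y. ennreal (gk 1 y * \<theta> y) \<partial>lborel) = 1"
  proof -
    have "AE y in lborel. ennreal (gk 1 y * \<theta> y) = ennreal (gk 1 y) * \<Theta> y"
      using fin by eventually_elim (simp add: ennreal_mult g1 less_imp_le \<theta>_def less_top)
    from nn_integral_cong_AE[OF this] show ?thesis using total by simp
  qed
  have th0: "0 \<le> gk 1 y * \<theta> y" for y using g1[of y] by (simp add: \<theta>_def)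
  have i\<theta>: "integrable lborel (\<lambda>y. gk 1 y * \<theta> y)" and e\<theta>: "(\<integral>y. gk 1 y * \<theta> y \<partial>lborel) = 1"
    using tot th0 by (auto intro!: integrableI_nonneg simp: integral_eq_nn_integral)
  have "0 = (\<integral>y. f0 y - gk 1 y * \<theta> y \<partial>lborel)" using fi f1 i\<theta> e\<theta> by simp
  also have "\<dots> \<le> (\<integral>y. f0 y * ln (f0 y / gk 1 y) - f0 y * \<psi> y \<partial>lborel)"
  proof (rule integral_mono_AE)
    show "AE y in lborel. f0 y - gk 1 y * \<theta> y \<le> f0 y * ln (f0 y / gk 1 y) - f0 y * \<psi> y"
      using fin
    proof eventually_elim
      case (elim y)
      have nn: "(\<integral>\<^sup>+x. ennreal (exp (\<phi> x) * gk t (x - y)) \<partial>lborel) = ennreal (\<theta> y)"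
        using elim by (simp add: \<Theta>_def[symmetric] \<theta>_def less_top)
      have ie: "integrable lborel (\<lambda>x. exp (\<phi> x) * gk t (x - y))"
        by (rule integrableI_nonneg) (use gt nn in \<open>auto simp: less_imp_le\<close>)
      have ee: "(\<integral>x. exp (\<phi> x) * gk t (x - y) \<partial>lborel) = \<theta> y"
        using nn gt by (subst integral_eq_nn_integral) (auto simp: less_imp_le \<theta>_def)
      have ig: "integrable lborel (\<lambda>x. gk t (x - y))" and eg: "(\<integral>x. gk t (x - y) \<partial>lborel) = 1"
        using integrable_lborel_translate[OF integrable_gk[OF t, where 'a = real], of "- y"]
          integral_lborel_translate[of "gk t" "- y"] integral_gk[OF t, where 'a = real] by auto
      have ip0: "integrable lborel (\<lambda>z. \<phi> (y + z) * gk t z)"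
        by (rule conv_inner_integrable[OF _ _ gdom_integrable[OF gdom_gk[OF t]] \<phi>L]) measurable
      have ip: "integrable lborel (\<lambda>x. \<phi> x * gk t (x - y))" and ep: "(\<integral>x. \<phi> x * gk t (x - y) \<partial>lborel) = \<psi> y"
        using integrable_lborel_translate[OF ip0, of "- y"] integral_lborel_translate[of "\<lambda>z. \<phi> (y + z) * gk t z" "- y"]
        by (auto simp: \<psi>_def)
      have "f0 y - gk 1 y * \<theta> y = (\<integral>x. f0 y * gk t (x - y) - gk 1 y * (exp (\<phi> x) * gk t (x - y)) \<partial>lborel)"
        using ig eg ie ee by simp
      also have "\<dots> \<le> (\<integral>x. f0 y * ln (f0 y / gk 1 y) * gk t (x - y) - f0 y * (\<phi> x * gk t (x - y)) \<partial>lborel)"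
      proof (rule integral_mono)
        show "integrable lborel (\<lambda>x. f0 y * gk t (x - y) - gk 1 y * (exp (\<phi> x) * gk t (x - y)))"
          using ig ie by simp
        show "integrable lborel (\<lambda>x. f0 y * ln (f0 y / gk 1 y) * gk t (x - y) - f0 y * (\<phi> x * gk t (x - y)))"
          using ig ip by simp
        fix x
        have "f0 y - gk 1 y * exp (\<phi> x) \<le> f0 y * ln (f0 y / (gk 1 y * exp (\<phi> x)))"
          using g1[of y] by (intro gibbs_pointwise f0) simp
        also have "f0 y * ln (f0 y / (gk 1 y * exp (\<phi> x))) = f0 y * ln (f0 y / gk 1 y) - f0 y * \<phi> x"
        proof (cases "f0 y = 0")
          case False
          then have "0 < f0 y" using f0[of y] by simp
          then show ?thesis using g1[of y] by (simp add: ln_div ln_mult algebra_simps)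
        qed simp
        finally have "(f0 y - gk 1 y * exp (\<phi> x)) * gk t (x - y) \<le> (f0 y * ln (f0 y / gk 1 y) - f0 y * \<phi> x) * gk t (x - y)"
          using gt[of "x - y"] by (intro mult_right_mono) auto
        then show "f0 y * gk t (x - y) - gk 1 y * (exp (\<phi> x) * gk t (x - y)) \<le> f0 y * ln (f0 y / gk 1 y) * gk t (x - y) - f0 y * (\<phi> x * gk t (x - y))"
          by (simp add: left_diff_distrib mult.assoc)
      qed
      also have "\<dots> = f0 y * ln (f0 y / gk 1 y) - f0 y * \<psi> y"
        using ig eg ip ep by simp
      finally show ?case .
    qed
    show "integrable lborel (\<lambda>y. f0 y - gk 1 y * \<theta> y)" using fi i\<theta> by simp
    show "integrable lborel (\<lambda>y. f0 y * ln (f0 y / gk 1 y) - f0 y * \<psi> y)" using iu i\<psi> by simp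
  qed
  also have "\<dots> = (\<integral>x. f0 x * ln (f0 x / gk 1 x) \<partial>lborel) - ent t"
    using iu i\<psi> by (simp add: ent1 e\<psi>)
  finally show ?thesis by simp
qed

end

text \<open>If the initial entropy is infinite, \<open>0 < \<kappa>\<close> makes the right-hand
  side infinite, whereas 0 times infinity is 0 in \<open>ereal\<close>. Otherwise
  \<open>ent_le_initial\<close> bounds the entropies at positive times uniformly, and the
  variational formula passes to time 0 on the left.\<close>

lemma (in projection_flow) relative_entropy_projection_le:
  assumes dens: "has_lebesgue_density \<nu>" and \<kappa>: "0 < \<kappa>"
    and F: "\<And>s. 0 < s \<Longrightarrow> W.fisher s - CARD('n) / (1 + s) \<le> \<kappa> * (fisher s - 1 / (1 + s))"
  shows "relative_entropy \<omega> std_gaussian \<le> ereal \<kappa> * relative_entropy \<nu> std_gaussian"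
proof -
  obtain f' where [measurable]: "f' \<in> borel_measurable borel" and \<nu>': "\<nu> = density lborel f'"
    using dens unfolding has_lebesgue_density_def by blast
  define f0 where "f0 x = enn2real (f' x)" for x
  have m0 [measurable]: "f0 \<in> borel_measurable borel" unfolding f0_def by measurable
  have f0: "0 \<le> f0 x" for x by (simp add: f0_def)
  have "(\<integral>\<^sup>+x. f' x \<partial>lborel) = 1"
    using emeasure_space_1 unfolding \<nu>' by (simp add: emeasure_density)
  then have "AE x in lborel. f' x \<noteq> \<infinity>" by (intro nn_integral_PInf_AE) auto
  then have ff': "AE x in lborel. f' x = ennreal (f0 x)" by eventually_elim (simp add: f0_def less_top)
  have \<nu>: "\<nu> = density lborel (\<lambda>x. ennreal (f0 x))" unfolding \<nu>' using ff' by (intro density_cong) auto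
  consider "relative_entropy \<nu> std_gaussian = \<infinity>"
    | "integrable lborel (\<lambda>x. f0 x * ln (f0 x / gk 1 x))"
      "relative_entropy \<nu> std_gaussian = ereal (\<integral>x. f0 x * ln (f0 x / gk 1 x) \<partial>lborel)"
    using relative_entropy_std_gaussian_cases(1)[OF m0 f0] unfolding \<nu>[symmetric] by blast
  then show ?thesis
  proof cases
    case 1
    then show ?thesis using \<kappa> by simp
  next
    case 2
    let ?R = "\<integral>x. f0 x * ln (f0 x / gk 1 x) \<partial>lborel"
    have "relative_entropy \<omega> std_gaussian \<le> ereal (\<kappa> * ?R)"
    proof (rule relative_entropy_le_of_donsker_varadhan)
      show "prob_space \<omega>" by (rule W.prob_space_axioms)
      show "has_lebesgue_density \<omega>" by (rule W_has_lebesgue_density[OF dens])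
      fix \<phi> :: "real ^ 'n \<Rightarrow> real" and B assume "continuous_on UNIV \<phi>" "\<And>x. \<bar>\<phi> x\<bar> \<le> B"
      then show "(\<integral>x. \<phi> x \<partial>\<omega>) \<le> \<kappa> * ?R + ln (\<integral>x. exp (\<phi> x) * gk 1 x \<partial>lborel)"
      proof (rule W.donsker_varadhan_limit[rotated 2])
        show "(\<integral>y. (norm y)\<^sup>2 \<partial>\<omega>) = DIM(real ^ 'n)" by (simp add: W_second_moment)
        fix t :: real assume t: "0 < t"
        have "W.ent t \<le> \<kappa> * ent t" using \<kappa> by (intro ent_projection_le[OF t _ F]) auto
        also have "\<dots> \<le> \<kappa> * ?R"
          using \<kappa> ent_le_initial[OF t \<nu> m0 f0 2(1)] by (intro mult_left_mono) auto
        finally show "W.ent t \<le> \<kappa> * ?R" .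
      qed
    qed
    then show ?thesis using 2(2) by simp
  qed
qed

theorem theorem3:
  fixes M :: "'w measure"
    and Y :: "'w \<Rightarrow> real ^ 'd"
    and \<nu> :: "real measure"
    and A :: "real ^ 'd ^ 'n"
    and c \<epsilon> \<zeta> :: real
  assumes "prob_space M"
    and "prob_space \<nu>"
    and "has_lebesgue_density \<nu>"
    and "integrable \<nu> (\<lambda>x. x)"
    and "prob_space.expectation \<nu> (\<lambda>x. x) = 0"
    and "prob_space.variance \<nu> (\<lambda>x. x) = 1"
    and "0 < c" and "c \<le> 1"
    and "has_spectral_gap \<nu> c"
    and "Y \<in> borel_measurable M"
    and "prob_space.indep_vars M (\<lambda>_. borel) (\<lambda>i \<omega>. Y \<omega> $ i) UNIV"
    and "\<And>i. distr M borel (\<lambda>\<omega>. Y \<omega> $ i) = \<nu>"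
    and "A ** transpose A = mat 1"
    and "\<epsilon> = max_diagonal (transpose A ** A)"
    and "\<zeta> = max_off_diagonal (transpose A ** A)"
  shows "relative_entropy (distr M borel (\<lambda>\<omega>. A *v Y \<omega>)) std_gaussian
    \<le> ereal (real CARD('n) * min (2 * (\<epsilon> + \<zeta>\<^sup>2 * real CARD('d)) / c) 1)
        * relative_entropy \<nu> std_gaussian"
proof -
  interpret M: prob_space M by fact
  interpret N: prob_space \<nu> by fact
  have [measurable]: "Y \<in> borel_measurable M" by fact
  have sets_\<nu>: "sets \<nu> = sets borel"
    using assms(3) unfolding has_lebesgue_density_def by auto
  have var: "(\<integral>x. x\<^sup>2 \<partial>\<nu>) = 1" using assms(5,6) by simp
  \<comment> \<open>A nonintegrable function has Bochner integral 0, so the value 1 forces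
    integrability.\<close>
  then have i2: "integrable \<nu> (\<lambda>x. x\<^sup>2)" using not_integrable_integral_eq by fastforce
  have borel_measurable_vec_nth: "(\<lambda>y::real ^ 'd. y $ i) \<in> borel_measurable borel" for i
    by (intro borel_measurable_continuous_onI continuous_intros)
  have Yi [measurable]: "(\<lambda>\<omega>. Y \<omega> $ i) \<in> borel_measurable M" for i
    by (rule measurable_compose[OF \<open>Y \<in> borel_measurable M\<close> borel_measurable_vec_nth])
  define \<mu> where "\<mu> = distr M borel Y"
  have ind: "integrable M (\<lambda>\<omega>. \<Prod>i\<in>UNIV. h i (Y \<omega> $ i)) \<and> (\<integral>\<omega>. (\<Prod>i\<in>UNIV. h i (Y \<omega> $ i)) \<partial>M) = (\<Prod>i\<in>UNIV. \<integral>y. h i y \<partial>\<nu>)"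
    and mh: "h i \<in> borel_measurable borel"
    if h: "\<And>i. integrable \<nu> (h i)" for h :: "'d \<Rightarrow> real \<Rightarrow> real" and i
  proof -
    have mh: "h i \<in> borel_measurable borel" for i
      using borel_measurable_integrable[OF h[of i]] by (simp add: measurable_cong_sets[OF sets_\<nu> refl])
    then show "h i \<in> borel_measurable borel" .
    have v: "M.indep_vars (\<lambda>_. borel) (\<lambda>i \<omega>. h i (Y \<omega> $ i)) UNIV"
      by (rule M.indep_vars_compose2[OF assms(11)]) (rule mh)
    have hi: "integrable M (\<lambda>\<omega>. h i (Y \<omega> $ i))" for i
      using h[of i] unfolding assms(12)[of i, symmetric] by (subst (asm) integrable_distr_eq) (auto intro: mh)
    have he: "(\<integral>\<omega>. h i (Y \<omega> $ i) \<partial>M) = (\<integral>y. h i y \<partial>\<nu>)" for i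
      unfolding assms(12)[of i, symmetric] by (subst integral_distr) (auto intro: mh)
    show "integrable M (\<lambda>\<omega>. \<Prod>i\<in>UNIV. h i (Y \<omega> $ i)) \<and> (\<integral>\<omega>. (\<Prod>i\<in>UNIV. h i (Y \<omega> $ i)) \<partial>M) = (\<Prod>i\<in>UNIV. \<integral>y. h i y \<partial>\<nu>)"
      using M.indep_vars_integrable[OF finite v hi] M.indep_vars_lebesgue_integral[OF finite v hi] by (simp add: he)
  qed
  have mprod: "(\<lambda>y::real ^ 'd. \<Prod>i\<in>UNIV. h i (y $ i)) \<in> borel_measurable borel"
    if "\<And>i. integrable \<nu> (h i)" for h :: "'d \<Rightarrow> real \<Rightarrow> real"
    by (intro borel_measurable_prod measurable_compose[OF borel_measurable_vec_nth mh[OF that]])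
  interpret P: prob_space \<mu> unfolding \<mu>_def by (rule M.prob_space_distr) measurable
  interpret projection_flow \<nu> c \<mu> A
  proof
    show "sets \<nu> = sets borel" by fact
    show "integrable \<nu> (\<lambda>y. (norm y)\<^sup>2)" using i2 by simp
    show "0 < c" "c \<le> 1" "has_spectral_gap \<nu> c" "N.expectation (\<lambda>y. y) = 0" by fact+
    show "N.expectation (\<lambda>y. y\<^sup>2) = 1" by (rule var)
    show "sets \<mu> = sets borel" by (simp add: \<mu>_def)
    show "A ** transpose A = mat 1" by fact
    fix h :: "'d \<Rightarrow> real \<Rightarrow> real" assume h: "\<And>i. integrable \<nu> (h i)"
    show "integrable \<mu> (\<lambda>y. \<Prod>i\<in>UNIV. h i (y $ i))"
      unfolding \<mu>_def using ind[OF h] mprod[OF h] by (subst integrable_distr_eq) auto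
    show "(\<integral>y. (\<Prod>i\<in>UNIV. h i (y $ i)) \<partial>\<mu>) = (\<Prod>i\<in>UNIV. \<integral>y. h i y \<partial>\<nu>)"
      unfolding \<mu>_def using ind[OF h] mprod[OF h] by (subst integral_distr) auto
  qed
  have \<omega>: "\<omega> = distr M borel (\<lambda>\<omega>. A *v Y \<omega>)"
    unfolding \<omega>_def unfolding \<mu>_def by (subst distr_distr) (auto simp: comp_def)
  define B where "B = transpose A ** A"
  have Bij: "B $ i $ j = (\<Sum>k\<in>UNIV. A $ k $ i * A $ k $ j)" for i j
    by (simp add: B_def matrix_matrix_mult_def transpose_def)
  have \<epsilon>: "B $ j $ j \<le> \<epsilon>" for j
    unfolding assms(14) B_def[symmetric] max_diagonal_def by (rule Max_ge) auto
  have \<zeta>: "\<bar>B $ i $ j\<bar> \<le> \<zeta>" if "i \<noteq> j" for i j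
    unfolding assms(15) B_def[symmetric] max_off_diagonal_def
  proof (rule Max_ge)
    have "{\<bar>B $ i $ j\<bar> |i j. i \<noteq> j} \<subseteq> (\<lambda>(i, j). \<bar>B $ i $ j\<bar>) ` UNIV" by auto
    then show "finite (insert 0 {\<bar>B $ i $ j\<bar> |i j. i \<noteq> j})" by (simp add: finite_subset)
  qed (use that in auto)
  have tr: "(\<Sum>j\<in>UNIV. B $ j $ j) = CARD('n)"
  proof -
    have "(\<Sum>j\<in>UNIV. B $ j $ j) = (\<Sum>k\<in>UNIV. \<Sum>j\<in>UNIV. A $ k $ j * A $ k $ j)"
      unfolding Bij by (rule sum.swap)
    then show ?thesis unfolding sum_A by simp
  qed
  \<comment> \<open>The diagonal entries sum to \<open>CARD('n)\<close>, so the largest is positive;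
    this yields the strict positivity that \<open>relative_entropy_projection_le\<close>
    demands.\<close>
  have \<epsilon>0: "0 < \<epsilon>"
  proof (rule ccontr)
    assume "\<not> 0 < \<epsilon>"
    then have "B $ j $ j \<le> 0" for j using \<epsilon>[of j] by simp
    then have "(\<Sum>j\<in>UNIV. B $ j $ j) \<le> 0" by (intro sum_nonpos) auto
    with tr show False by simp
  qed
  define m where "m = 2 * (\<epsilon> + \<zeta>\<^sup>2 * CARD('d)) / c"
  have m0: "0 < m" unfolding m_def using \<epsilon>0 \<open>0 < c\<close> by (simp add: add_pos_nonneg)
  have "relative_entropy \<omega> std_gaussian \<le> ereal (CARD('n) * min m 1) * relative_entropy \<nu> std_gaussian"
  proof (rule relative_entropy_projection_le)
    show "has_lebesgue_density \<nu>" by fact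
    show "0 < CARD('n) * min m 1" using m0 by simp
    fix s :: real assume "0 < s"
    then interpret F: projection_flow_at \<nu> c \<mu> A s by unfold_locales
    have "F.b i j = B $ i $ j" for i j by (simp add: F.b_def Bij)
    then have 1: "W.fisher s - CARD('n) / (1 + s) \<le> CARD('n) * m * (fisher s - 1 / (1 + s))"
      unfolding m_def using \<epsilon> \<zeta> by (intro F.fisher_le_reduced) auto
    show "W.fisher s - CARD('n) / (1 + s) \<le> CARD('n) * min m 1 * (fisher s - 1 / (1 + s))"
      using 1 F.fisher_le_full by (cases "m \<le> 1") (simp_all add: min_def)
  qed
  then show ?thesis by (simp add: \<omega> m_def)
qed

end
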